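(* Let $T$ be a base ring, $\mathbf P=\mathbf P_T$, and let $s\in\widehat{\mathcal S}$. The functor $\vartheta_s\colon\mathbf P\to\mathbf P$, $\vartheta_s\mathcal M=(\epsilon_s\mathcal M)^+$, is the up to isomorphism unique functor $\mathbf P\to\mathbf P$ that admits a natural transformation $\rho_s\colon\epsilon_s\to\vartheta_s$ such that for every object $\mathcal M$ of $\mathbf P$ and every $s$-invariant open subset $\mathcal J$ of $\mathcal A_T$ (i.e. $\mathcal J=\mathcal Js$) the homomorphism $\rho_s^{\mathcal M}(\mathcal J)\colon\epsilon_s\mathcal M(\mathcal J)\to\vartheta_s\mathcal M(\mathcal J)$ is an isomorphism of $\mathcal Z$-modules.
   Context: ALCOVES. $R$ is a finite irreducible (reduced) root system in a finite-dimensional real vector space $V$, with coroots $\alpha^\vee\in V^*$, pairing $\langle\cdot,\cdot\rangle$, and a fixed positive system $R^+$. $X^\vee=\{v\in V^*\mid\langle\alpha,v\rangle\in\mathbb Z\ \forall\alpha\in R\}$. For $\alpha\in R^+$, $n\in\mathbb Z$: $H_{\alpha,n}=\{\mu\in V\mid\langle\mu,\alpha^\vee\rangle=n\}$, $H_{\alpha,n}^-=\{\mu\mid\langle\mu,\alpha^\vee\rangle<n\}$, $s_{\alpha,n}(\lambda)=\lambda-(\langle\lambda,\alpha^\vee\rangle-n)\alpha$; $t_\gamma$ is translation by $\gamma$. $\mathcal A$ is the set of alcoves, i.e. connected components of $V\setminus\bigcup_{\alpha\in R^+,n\in\mathbb Z}H_{\alpha,n}$. $\widehat{\mathcal W}$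 is the affine Weyl group generated by all $s_{\alpha,n}$; it contains $t_\gamma$ for $\gamma\in\mathbb ZR$ and acts simply transitively on $\mathcal A$. $\mathcal V=\mathcal A/\mathbb ZR$ is the set of orbits under translation by $\mathbb ZR$ (an element $x\in\mathcal V$ is also regarded as a subset of $\mathcal A$). $\widehat{\mathcal W}$ acts on $\mathcal V$, with $s_{\alpha,n}$ acting as $s_\alpha:=s_{\alpha,0}$. Let $A_e$ be the alcove in the dominant chamber having $0$ in its closure and $A_w=w(A_e)$. The right action of $\widehat{\mathcal W}$ on $\mathcal A$ is $A_xw:=A_{xw}$; it commutes with the left action and induces a right action on $\mathcal V$. $\widehat{\mathcal S}\subset\widehat{\mathcal W}$ (simple affine reflections) is the set of reflections at hyperplanes having codimension 1 intersection with the closure of $A_e$. BASE RINGS. $k$ is a field satisfying the GKM condition: $\operatorname{char}k\neq2$ and $\alpha^\vee\notin k\beta^\vee$ in $X^\vee_k=X^\vee\otimes_{\mathbb Z}k$ for $\alpha\ne\beta$ in $R^+$. $S$ is the symmetric algebra of $X_k^\vee$, graded with $X_k^\vee$ in degree 2. For a commutative unital flat $S$-algebra $T$ (optionally $\mathbb Z$-graded, in which case modules are graded and homomorphisms have degree 0): $I_T$ is the set of $\alpha\in R^+$ with $\alpha^\vee$ not invertible in $T$; $\widehat{\mathcal W}_T\subset\widehat{\mathcal W}$ is generated by $t_\gamma$ ($\gamma\in\mathbb ZR$) and $s_{\alpha,m}$ ($\alpha\in I_T$, $m\in\mathbb Z$); $R_T^+$ is the set of $\alpha\in R^+$ with $s_{\alpha,m}\in\widehat{\mathcal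 W}_T$ for some $m$. $T$ is a base ring if it is a commutative unital flat $S$-algebra with $I_T=R_T^+$ such that every projective $T$-module is free. $T^\emptyset=T[\beta^{\vee-1}\mid\beta\in R^+]$. TOPOLOGY. $\preceq_T$ is the partial order on $\mathcal A$ generated by $A\preceq_TB$ if $B=t_\gamma(A)$ with $\gamma\in\mathbb Z_{\ge0}R^+$, or $B=s_{\alpha,n}(A)$ with $\alpha\in R_T^+$, $n\in\mathbb Z$, $A\subset H_{\alpha,n}^-$. $\mathcal A_T$ is $\mathcal A$ with the topology whose open sets are the sets closed under passing to $\preceq_T$-smaller elements. $\mathcal T_{\preceq_T}$ denotes the smallest open set containing $\mathcal T\subset\mathcal A$. STRUCTURE ALGEBRA. $\mathcal Z_S=\{(z_x)\in\bigoplus_{x\in\mathcal V}S\mid z_x\equiv z_{s_\alpha x}\bmod\alpha^\vee\ \forall x\in\mathcal V,\alpha\in R^+\}$ and $\mathcal Z=\mathcal Z_T=\mathcal Z_S\otimes_ST\subset\bigoplus_{x\in\mathcal V}T$. A $\mathcal Z$-module $M$ is root torsion free if each $\alpha^\vee$, $\alpha\in R^+$, acts injectively on it. Since $\mathcal Z\otimes_TT^\emptyset=\bigoplus_{x\in\mathcal V}T^\emptyset$, one has $M\otimes_TT^\emptyset=\bigoplus_{x\in\mathcal V}(M\otimes_TT^\emptyset)^x$, where $(z_y)$ acts on the $x$-summand by $z_x$. For root torsion free $M$, $M^x$ is the image of $M\to(M\otimes_TT^\emptyset)^x$. For $s\in\widehat{\mathcal S}$, $\mathcal Z^s\subset\mathcal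 Z$ is the subalgebra of all $(z_x)$ with $z_x=z_{xs}$ for all $x$. PRESHEAVES. Consider presheaves $\mathcal M$ of $\mathcal Z$-modules on $\mathcal A_T$. $\mathcal M$ is root torsion free if all $\mathcal M(\mathcal J)$ are; flabby if all restrictions are surjective; finitary if $\mathcal M(\emptyset)=0$ and there is a finite $\mathcal T\subset\mathcal A$ such that $\mathcal M(\mathcal J)\to\mathcal M((\mathcal J\cap\mathcal T)_{\preceq_T})$ is an isomorphism for all open $\mathcal J$. $\mathcal M$ satisfies the support condition if it is root torsion free and $\mathcal M(\mathcal J)^x\to\mathcal M((\mathcal J\cap x)_{\preceq_T})^x$ is an isomorphism for all open $\mathcal J$ and all $x\in\mathcal V$. $\mathbf P_T$ is the full subcategory of flabby, finitary, root torsion free presheaves satisfying the support condition. For flabby root torsion free $\mathcal M$, $\mathcal M^+$ is the presheaf for which $\mathcal M^+(\mathcal J)$ is the image of the natural map $\mathcal M(\mathcal J)\to\bigoplus_{x\in\mathcal V}\mathcal M((\mathcal J\cap x)_{\preceq_T})^x$; it is flabby, root torsion free and satisfies the support condition. WALL CROSSING. For open $\mathcal J$, $\mathcal J^\sharp:=\mathcal J\cup\mathcal Js$ is again open. For $\mathcal M$ in $\mathbf P_T$, $\epsilon_s\mathcal M$ is the presheaf $(\epsilon_s\mathcal M)(\mathcal J):=\mathcal Z\otimes_{\mathcal Z^s}\mathcal M(\mathcal J^\sharp)$ with restrictions $\mathrm{id}_{\mathcal Z}\otimes$(restriction of $\mathcal M$); it is flabby, finitary and root torsion free. $\vartheta_s\mathcal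 M:=(\epsilon_s\mathcal M)^+$ is an object of $\mathbf P_T$; the natural transformation $\mathrm{id}\to(\cdot)^+$ induces the natural transformation $\rho_s\colon\epsilon_s\to\vartheta_s$. *)

theory Defs
  imports
    "HOL-Analysis.Analysis"
    "HOL-Algebra.Module"
    "HOL-Algebra.QuotRing"
    "HOL-Algebra.IntRing"
    "HOL-Algebra.Bij"
    "HOL-Algebra.Generated_Groups"
    "HOL-Algebra.Free_Abelian_Groups"
begin

section \<open>Algebraic preliminaries\<close>

subsection \<open>Graded and ungraded modules\<close>

text \<open>
  The ungraded and the \<open>\<int>\<close>-graded theory are treated together. A ring \<open>R\<close> is accompanied by
  \<open>G :: (int \<Rightarrow> 'r set) option\<close>: for \<open>G = None\<close> the component \<open>homog\<close> of a module is ignored, for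
  \<open>G = Some h\<close> the ring is graded by \<open>h\<close>, modules are graded and homomorphisms have degree 0.
  The fields \<open>mult\<close> and \<open>one\<close> inherited from the library record for modules are never used.
\<close>

record ('r, 'm) gmodule = "('r, 'm) module" +
  homog :: "int \<Rightarrow> 'm set"

definition grading :: "('a, 'x) ring_scheme \<Rightarrow> (int \<Rightarrow> 'a set) \<Rightarrow> bool" where
  "grading M h \<longleftrightarrow>
     (\<forall>n. subgroup (h n) (add_monoid M)) \<and>
     (\<forall>m\<in>carrier M. \<exists>!c. (\<forall>n. c n \<in> h n) \<and> finite {n. c n \<noteq> \<zero>\<^bsub>M\<^esub>} \<and>
        m = gfinprod (add_monoid M) c UNIV)"

definition graded_ring :: "('a, 'x) ring_scheme \<Rightarrow> (int \<Rightarrow> 'a set) \<Rightarrow> bool" where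
  "graded_ring R h \<longleftrightarrow> grading R h \<and> \<one>\<^bsub>R\<^esub> \<in> h 0 \<and>
     (\<forall>i j. \<forall>a\<in>h i. \<forall>b\<in>h j. a \<otimes>\<^bsub>R\<^esub> b \<in> h (i + j))"

definition is_module ::
  "(int \<Rightarrow> 'r set) option \<Rightarrow> ('r, 'x) ring_scheme \<Rightarrow> ('r, 'm) gmodule \<Rightarrow> bool" where
  "is_module G R M \<longleftrightarrow> Module.module R M \<and>
     (\<forall>h. G = Some h \<longrightarrow> grading M (homog M) \<and>
        (\<forall>i j. \<forall>r\<in>h i. \<forall>m\<in>homog M j. r \<odot>\<^bsub>M\<^esub> m \<in> homog M (i + j)))"

definition module_hom ::
  "(int \<Rightarrow> 'r set) option \<Rightarrow> ('r, 'x) ring_scheme \<Rightarrow> ('r, 'm) gmodule \<Rightarrow> ('r, 'n) gmodule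
    \<Rightarrow> ('m \<Rightarrow> 'n) set" where
  "module_hom G R M N = {f \<in> carrier M \<rightarrow>\<^sub>E carrier N.
     (\<forall>a\<in>carrier M. \<forall>b\<in>carrier M. f (a \<oplus>\<^bsub>M\<^esub> b) = f a \<oplus>\<^bsub>N\<^esub> f b) \<and>
     (\<forall>r\<in>carrier R. \<forall>a\<in>carrier M. f (r \<odot>\<^bsub>M\<^esub> a) = r \<odot>\<^bsub>N\<^esub> f a) \<and>
     (G \<noteq> None \<longrightarrow> (\<forall>n. f ` homog M n \<subseteq> homog N n))}"

text \<open>In the graded case the inverse of a bijective homomorphism of degree 0 has degree 0 as well.\<close>

definition module_iso ::
  "(int \<Rightarrow> 'r set) option \<Rightarrow> ('r, 'x) ring_scheme \<Rightarrow> ('r, 'm) gmodule \<Rightarrow> ('r, 'n) gmodule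
    \<Rightarrow> ('m \<Rightarrow> 'n) set" where
  "module_iso G R M N = {f \<in> module_hom G R M N. bij_betw f (carrier M) (carrier N)}"

text \<open>
  Projectivity refers to modules with carriers in the type of \<open>P\<close>, cf. the remarks on the
  universe below. A graded module is (graded) free if it has a homogeneous basis.
\<close>

definition projective ::
  "(int \<Rightarrow> 'r set) option \<Rightarrow> ('r, 'x) ring_scheme \<Rightarrow> ('r, 'm) gmodule \<Rightarrow> bool" where
  "projective G R P \<longleftrightarrow> is_module G R P \<and>
     (\<forall>(N :: ('r, 'm) gmodule) (L :: ('r, 'm) gmodule).
        is_module G R N \<and> is_module G R L \<longrightarrow>
        (\<forall>f\<in>module_hom G R N L. \<forall>g\<in>module_hom G R P L.
           f ` carrier N = carrier L \<longrightarrow>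
           (\<exists>h\<in>module_hom G R P N. \<forall>p\<in>carrier P. f (h p) = g p)))"

definition free ::
  "(int \<Rightarrow> 'r set) option \<Rightarrow> ('r, 'x) ring_scheme \<Rightarrow> ('r, 'm) gmodule \<Rightarrow> bool" where
  "free G R P \<longleftrightarrow> (\<exists>B\<subseteq>carrier P.
     (G \<noteq> None \<longrightarrow> (\<forall>b\<in>B. \<exists>n. b \<in> homog P n)) \<and>
     (\<forall>p\<in>carrier P. \<exists>!c. c \<in> B \<rightarrow>\<^sub>E carrier R \<and> finite {b\<in>B. c b \<noteq> \<zero>\<^bsub>R\<^esub>} \<and>
        p = gfinprod (add_monoid P) (\<lambda>b. c b \<odot>\<^bsub>P\<^esub> b) B))"

definition regular_module :: "('r, 'x) ring_scheme \<Rightarrow> ('r, 'r) module" where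
  "regular_module R = \<lparr>carrier = carrier R, mult = mult R, one = one R, ring.zero = ring.zero R,
     ring.add = ring.add R, smult = mult R\<rparr>"

definition restrict_scalars ::
  "('q \<Rightarrow> 'r) \<Rightarrow> ('r, 'm, 'x) module_scheme \<Rightarrow> ('q, 'm) module" where
  "restrict_scalars \<phi> M = \<lparr>carrier = carrier M, mult = mult M, one = one M, ring.zero = ring.zero M,
     ring.add = ring.add M, smult = (\<lambda>q m. \<phi> q \<odot>\<^bsub>M\<^esub> m)\<rparr>"


subsection \<open>Tensor products\<close>

text \<open>
  \<open>A \<otimes>\<^sub>R B\<close> is the quotient of the free abelian group on \<open>A \<times> B\<close> by the subgroup generated by the
  usual relations; it is written multiplicatively, as the library does for groups.
\<close>

definition tensor_free ::
  "('r, 'a, 'x) module_scheme \<Rightarrow> ('r, 'b, 'y) module_scheme \<Rightarrow> ('a \<times> 'b \<Rightarrow>\<^sub>0 int) monoid" where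
  "tensor_free A B = free_Abelian_group (carrier A \<times> carrier B)"

definition tensor_rel ::
  "('r, 'z) ring_scheme \<Rightarrow> ('r, 'a, 'x) module_scheme \<Rightarrow> ('r, 'b, 'y) module_scheme
    \<Rightarrow> ('a \<times> 'b \<Rightarrow>\<^sub>0 int) set" where
  "tensor_rel R A B = generate (tensor_free A B)
     ({frag_of (a \<oplus>\<^bsub>A\<^esub> a', b) - frag_of (a, b) - frag_of (a', b) | a a' b.
         a \<in> carrier A \<and> a' \<in> carrier A \<and> b \<in> carrier B} \<union>
      {frag_of (a, b \<oplus>\<^bsub>B\<^esub> b') - frag_of (a, b) - frag_of (a, b') | a b b'.
         a \<in> carrier A \<and> b \<in> carrier B \<and> b' \<in> carrier B} \<union>
      {frag_of (r \<odot>\<^bsub>A\<^esub> a, b) - frag_of (a, r \<odot>\<^bsub>B\<^esub> b) | r a b.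
         r \<in> carrier R \<and> a \<in> carrier A \<and> b \<in> carrier B})"

definition tensor ::
  "('r, 'z) ring_scheme \<Rightarrow> ('r, 'a, 'x) module_scheme \<Rightarrow> ('r, 'b, 'y) module_scheme
    \<Rightarrow> ('a \<times> 'b \<Rightarrow>\<^sub>0 int) set monoid" where
  "tensor R A B = tensor_free A B Mod tensor_rel R A B"

definition tensor_elt ::
  "('r, 'z) ring_scheme \<Rightarrow> ('r, 'a, 'x) module_scheme \<Rightarrow> ('r, 'b, 'y) module_scheme
    \<Rightarrow> 'a \<Rightarrow> 'b \<Rightarrow> ('a \<times> 'b \<Rightarrow>\<^sub>0 int) set" where
  "tensor_elt R A B a b = tensor_rel R A B #>\<^bsub>tensor_free A B\<^esub> frag_of (a, b)"

text \<open>
  The map \<open>f \<otimes> g\<close> into \<open>C \<otimes>\<^sub>R D\<close>. All representatives \<open>h\<close> of a tensor \<open>X\<close> have the same image, so the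
  union is over equal cosets.
\<close>

definition tensor_map ::
  "('r, 'z) ring_scheme \<Rightarrow> ('r, 'c, 'x) module_scheme \<Rightarrow> ('r, 'd, 'y) module_scheme
    \<Rightarrow> ('a \<Rightarrow> 'c) \<Rightarrow> ('b \<Rightarrow> 'd) \<Rightarrow> ('a \<times> 'b \<Rightarrow>\<^sub>0 int) set \<Rightarrow> ('c \<times> 'd \<Rightarrow>\<^sub>0 int) set" where
  "tensor_map R C D f g X =
     (\<Union>h\<in>X. tensor_rel R C D #>\<^bsub>tensor_free C D\<^esub> frag_extend (\<lambda>(a, b). frag_of (f a, g b)) h)"

definition flat :: "'m itself \<Rightarrow> ('r, 'x) ring_scheme \<Rightarrow> ('r, 'a, 'y) module_scheme \<Rightarrow> bool" where
  "flat U R A \<longleftrightarrow> (\<forall>(M :: ('r, 'm) gmodule) (N :: ('r, 'm) gmodule).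
     is_module None R M \<and> is_module None R N \<longrightarrow>
     (\<forall>f\<in>module_hom None R M N. inj_on f (carrier M) \<longrightarrow>
        inj_on (tensor_map R N A f (\<lambda>a. a)) (carrier (tensor R M A))))"


subsection \<open>Symmetric algebras\<close>

definition mpoly_ring :: "('k, 'x) ring_scheme \<Rightarrow> 'e set \<Rightarrow> ('e multiset \<Rightarrow> 'k) ring" where
  "mpoly_ring k I =
     \<lparr>carrier = {p. (\<forall>m. p m \<in> carrier k) \<and> finite {m. p m \<noteq> \<zero>\<^bsub>k\<^esub>} \<and>
                    (\<forall>m. p m \<noteq> \<zero>\<^bsub>k\<^esub> \<longrightarrow> set_mset m \<subseteq> I)},
      mult = (\<lambda>p q m. finsum k (\<lambda>a. p a \<otimes>\<^bsub>k\<^esub> q (m - a)) {a. a \<subseteq># m}),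
      one = (\<lambda>m. if m = {#} then \<one>\<^bsub>k\<^esub> else \<zero>\<^bsub>k\<^esub>),
      ring.zero = (\<lambda>m. \<zero>\<^bsub>k\<^esub>),
      ring.add = (\<lambda>p q m. p m \<oplus>\<^bsub>k\<^esub> q m)\<rparr>"

definition mpoly_monom :: "('k, 'x) ring_scheme \<Rightarrow> 'k \<Rightarrow> 'e multiset \<Rightarrow> 'e multiset \<Rightarrow> 'k" where
  "mpoly_monom k c m = (\<lambda>m'. if m' = m then c else \<zero>\<^bsub>k\<^esub>)"

text \<open>
  The symmetric algebra of a \<open>k\<close>-module \<open>E\<close>: the polynomial ring with one variable for each element
  of \<open>E\<close>, modulo the linear relations that hold in \<open>E\<close>.
\<close>

definition sym_ideal ::
  "('k, 'x) ring_scheme \<Rightarrow> ('k, 'e, 'y) module_scheme \<Rightarrow> ('e multiset \<Rightarrow> 'k) set" where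
  "sym_ideal k E = (let P = mpoly_ring k (carrier E) in genideal P
     ({mpoly_monom k \<one>\<^bsub>k\<^esub> {#e \<oplus>\<^bsub>E\<^esub> f#} \<ominus>\<^bsub>P\<^esub>
         (mpoly_monom k \<one>\<^bsub>k\<^esub> {#e#} \<oplus>\<^bsub>P\<^esub> mpoly_monom k \<one>\<^bsub>k\<^esub> {#f#}) | e f.
         e \<in> carrier E \<and> f \<in> carrier E} \<union>
      {mpoly_monom k \<one>\<^bsub>k\<^esub> {#c \<odot>\<^bsub>E\<^esub> e#} \<ominus>\<^bsub>P\<^esub> mpoly_monom k c {#e#} | c e.
         c \<in> carrier k \<and> e \<in> carrier E}))"

definition sym_algebra ::
  "('k, 'x) ring_scheme \<Rightarrow> ('k, 'e, 'y) module_scheme \<Rightarrow> ('e multiset \<Rightarrow> 'k) set ring" where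
  "sym_algebra k E = mpoly_ring k (carrier E) Quot sym_ideal k E"

definition sym_elt ::
  "('k, 'x) ring_scheme \<Rightarrow> ('k, 'e, 'y) module_scheme \<Rightarrow> 'e \<Rightarrow> ('e multiset \<Rightarrow> 'k) set" where
  "sym_elt k E e =
     sym_ideal k E +>\<^bsub>mpoly_ring k (carrier E)\<^esub> mpoly_monom k \<one>\<^bsub>k\<^esub> {#e#}"

text \<open>The grading in which \<open>E\<close> has degree 2.\<close>

definition sym_homog ::
  "('k, 'x) ring_scheme \<Rightarrow> ('k, 'e, 'y) module_scheme \<Rightarrow> int \<Rightarrow> ('e multiset \<Rightarrow> 'k) set set" where
  "sym_homog k E n =
     {sym_ideal k E +>\<^bsub>mpoly_ring k (carrier E)\<^esub> p | p.
        p \<in> carrier (mpoly_ring k (carrier E)) \<and>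
        (\<forall>m. p m \<noteq> \<zero>\<^bsub>k\<^esub> \<longrightarrow> 2 * int (size m) = n)}"


subsection \<open>Localizations\<close>

definition fraction ::
  "('t, 'x) ring_scheme \<Rightarrow> 't set \<Rightarrow> 't \<Rightarrow> 't \<Rightarrow> ('t \<times> 't) set" where
  "fraction T \<Delta> a d = {(a', d') \<in> carrier T \<times> \<Delta>.
     \<exists>u\<in>\<Delta>. u \<otimes>\<^bsub>T\<^esub> (a \<otimes>\<^bsub>T\<^esub> d') = u \<otimes>\<^bsub>T\<^esub> (a' \<otimes>\<^bsub>T\<^esub> d)}"

definition localization ::
  "('t, 'x) ring_scheme \<Rightarrow> 't set \<Rightarrow> ('t, ('t \<times> 't) set) module" where
  "localization T \<Delta> =
     \<lparr>carrier = {fraction T \<Delta> a d | a d. a \<in> carrier T \<and> d \<in> \<Delta>},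
      mult = (\<lambda>X Y. \<Union>(a, d)\<in>X. \<Union>(b, e)\<in>Y. fraction T \<Delta> (a \<otimes>\<^bsub>T\<^esub> b) (d \<otimes>\<^bsub>T\<^esub> e)),
      one = fraction T \<Delta> \<one>\<^bsub>T\<^esub> \<one>\<^bsub>T\<^esub>,
      ring.zero = fraction T \<Delta> \<zero>\<^bsub>T\<^esub> \<one>\<^bsub>T\<^esub>,
      ring.add = (\<lambda>X Y. \<Union>(a, d)\<in>X. \<Union>(b, e)\<in>Y.
                    fraction T \<Delta> (a \<otimes>\<^bsub>T\<^esub> e \<oplus>\<^bsub>T\<^esub> b \<otimes>\<^bsub>T\<^esub> d) (d \<otimes>\<^bsub>T\<^esub> e)),
      smult = (\<lambda>t X. \<Union>(a, d)\<in>X. fraction T \<Delta> (t \<otimes>\<^bsub>T\<^esub> a) d)\<rparr>"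


section \<open>Roots and alcoves\<close>

text \<open>
  The real vector space \<open>V\<close> is a type \<open>'v::euclidean_space\<close>; the inner product of that class plays no
  role. Elements of \<open>V\<^sup>*\<close> are linear functions \<open>'v \<Rightarrow> real\<close>, so that the pairing of \<open>v\<close> with
  \<open>coroot D \<alpha>\<close> is \<open>coroot D \<alpha> v\<close>.
\<close>

record 'v root_data =
  roots :: "'v set"
  coroot :: "'v \<Rightarrow> 'v \<Rightarrow> real"
  pos_roots :: "'v set"

definition aff_refl :: "('v::euclidean_space, 'x) root_data_scheme \<Rightarrow> 'v \<Rightarrow> int \<Rightarrow> 'v \<Rightarrow> 'v" where
  "aff_refl D \<alpha> n v = v - (coroot D \<alpha> v - of_int n) *\<^sub>R \<alpha>"

definition root_system :: "('v::euclidean_space, 'x) root_data_scheme \<Rightarrow> bool" where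
  "root_system D \<longleftrightarrow> finite (roots D) \<and> 0 \<notin> roots D \<and> span (roots D) = UNIV \<and>
     (\<forall>\<alpha>\<in>roots D. linear (coroot D \<alpha>) \<and> coroot D \<alpha> \<alpha> = 2 \<and>
        aff_refl D \<alpha> 0 ` roots D = roots D \<and>
        (\<forall>\<beta>\<in>roots D. coroot D \<alpha> \<beta> \<in> \<int>))"

definition reduced_root_system :: "('v::euclidean_space, 'x) root_data_scheme \<Rightarrow> bool" where
  "reduced_root_system D \<longleftrightarrow> (\<forall>\<alpha>\<in>roots D. \<forall>c. c *\<^sub>R \<alpha> \<in> roots D \<longrightarrow> c = 1 \<or> c = -1)"

definition irreducible_root_system :: "('v::euclidean_space, 'x) root_data_scheme \<Rightarrow> bool" where
  "irreducible_root_system D \<longleftrightarrow> roots D \<noteq> {} \<and>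
     \<not> (\<exists>R1 R2. R1 \<noteq> {} \<and> R2 \<noteq> {} \<and> R1 \<inter> R2 = {} \<and> R1 \<union> R2 = roots D \<and>
          (\<forall>\<alpha>\<in>R1. \<forall>\<beta>\<in>R2. coroot D \<beta> \<alpha> = 0 \<and> coroot D \<alpha> \<beta> = 0))"

definition positive_system :: "('v::euclidean_space, 'x) root_data_scheme \<Rightarrow> bool" where
  "positive_system D \<longleftrightarrow> (\<exists>f :: 'v \<Rightarrow> real. linear f \<and> (\<forall>\<alpha>\<in>roots D. f \<alpha> \<noteq> 0) \<and>
     pos_roots D = {\<alpha>\<in>roots D. f \<alpha> > 0})"

definition root_lattice :: "('v::euclidean_space, 'x) root_data_scheme \<Rightarrow> 'v set" where
  "root_lattice D = {\<Sum>\<alpha>\<in>roots D. of_int (c \<alpha>) *\<^sub>R \<alpha> | c :: 'v \<Rightarrow> int. True}"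

definition pos_root_cone :: "('v::euclidean_space, 'x) root_data_scheme \<Rightarrow> 'v set" where
  "pos_root_cone D = {\<Sum>\<alpha>\<in>pos_roots D. of_nat (c \<alpha>) *\<^sub>R \<alpha> | c :: 'v \<Rightarrow> nat. True}"

definition hyperplane :: "('v::euclidean_space, 'x) root_data_scheme \<Rightarrow> 'v \<Rightarrow> int \<Rightarrow> 'v set" where
  "hyperplane D \<alpha> n = {\<mu>. coroot D \<alpha> \<mu> = of_int n}"

definition neg_halfspace :: "('v::euclidean_space, 'x) root_data_scheme \<Rightarrow> 'v \<Rightarrow> int \<Rightarrow> 'v set" where
  "neg_halfspace D \<alpha> n = {\<mu>. coroot D \<alpha> \<mu> < of_int n}"

definition alcoves :: "('v::euclidean_space, 'x) root_data_scheme \<Rightarrow> 'v set set" where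
  "alcoves D = components (UNIV - (\<Union>\<alpha>\<in>pos_roots D. \<Union>n. hyperplane D \<alpha> n))"

definition affine_weyl :: "('v::euclidean_space, 'x) root_data_scheme \<Rightarrow> ('v \<Rightarrow> 'v) set" where
  "affine_weyl D = generate (BijGroup UNIV) {aff_refl D \<alpha> n | \<alpha> n. \<alpha> \<in> pos_roots D}"

definition orbits :: "('v::euclidean_space, 'x) root_data_scheme \<Rightarrow> 'v set set set" where
  "orbits D = {{(+) \<gamma> ` A | \<gamma>. \<gamma> \<in> root_lattice D} | A. A \<in> alcoves D}"

definition refl_orbit ::
  "('v::euclidean_space, 'x) root_data_scheme \<Rightarrow> 'v \<Rightarrow> 'v set set \<Rightarrow> 'v set set" where
  "refl_orbit D \<alpha> x = (\<lambda>A. aff_refl D \<alpha> 0 ` A) ` x"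

definition base_alcove :: "('v::euclidean_space, 'x) root_data_scheme \<Rightarrow> 'v set" where
  "base_alcove D = (THE A. A \<in> alcoves D \<and>
     A \<subseteq> {v. \<forall>\<alpha>\<in>pos_roots D. coroot D \<alpha> v > 0} \<and> 0 \<in> closure A)"

definition right_act ::
  "('v::euclidean_space, 'x) root_data_scheme \<Rightarrow> ('v \<Rightarrow> 'v) \<Rightarrow> 'v set \<Rightarrow> 'v set" where
  "right_act D w A = (THE B. \<exists>x\<in>affine_weyl D.
     A = x ` base_alcove D \<and> B = (x \<circ> w) ` base_alcove D)"

definition right_act_orbit ::
  "('v::euclidean_space, 'x) root_data_scheme \<Rightarrow> ('v \<Rightarrow> 'v) \<Rightarrow> 'v set set \<Rightarrow> 'v set set" where
  "right_act_orbit D w x = right_act D w ` x"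

definition simple_affine_refls ::
  "('v::euclidean_space, 'x) root_data_scheme \<Rightarrow> ('v \<Rightarrow> 'v) set" where
  "simple_affine_refls D = {aff_refl D \<alpha> n | \<alpha> n. \<alpha> \<in> pos_roots D \<and>
     aff_dim (hyperplane D \<alpha> n \<inter> closure (base_alcove D)) = int DIM('v) - 1}"

definition coweights :: "('v::euclidean_space, 'x) root_data_scheme \<Rightarrow> (int, 'v \<Rightarrow> real) module" where
  "coweights D = \<lparr>carrier = {f. linear f \<and> (\<forall>\<alpha>\<in>roots D. f \<alpha> \<in> \<int>)},
     mult = undefined, one = undefined, ring.zero = (\<lambda>x. 0), ring.add = (\<lambda>f g x. f x + g x),
     smult = (\<lambda>n f x. of_int n * f x)\<rparr>"


section \<open>Base rings\<close>

type_synonym ('v, 'k) coweight_k = "(('v \<Rightarrow> real) \<times> 'k \<Rightarrow>\<^sub>0 int) set"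
type_synonym ('v, 'k) sym = "(('v, 'k) coweight_k multiset \<Rightarrow> 'k) set"

text \<open>
  \<open>struct_map\<close> is the structure homomorphism \<open>S \<rightarrow> T\<close>. The base ring is ungraded if \<open>base_grading\<close> is
  \<open>None\<close>, and graded by \<open>h\<close> if it is \<open>Some h\<close>.
\<close>

record ('v, 'k, 't) base_data = "'v root_data" +
  ground :: "'k ring"
  base :: "'t ring"
  struct_map :: "('v, 'k) sym \<Rightarrow> 't"
  base_grading :: "(int \<Rightarrow> 't set) option"

definition ground_int_module :: "('v, 'k, 't) base_data \<Rightarrow> (int, 'k) module" where
  "ground_int_module D = \<lparr>carrier = carrier (ground D), mult = mult (ground D),
     one = one (ground D), ring.zero = ring.zero (ground D), ring.add = ring.add (ground D),
     smult = (\<lambda>n c. [n] \<cdot>\<^bsub>ground D\<^esub> c)\<rparr>"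

definition coweights_k ::
  "('v::euclidean_space, 'k, 't) base_data \<Rightarrow> ('k, ('v, 'k) coweight_k) module" where
  "coweights_k D = (let X = coweights D; K = ground_int_module D; G = tensor \<Z> X K in
     \<lparr>carrier = carrier G, mult = undefined, one = undefined, ring.zero = \<one>\<^bsub>G\<^esub>,
      ring.add = monoid.mult G,
      smult = (\<lambda>c. tensor_map \<Z> X K (\<lambda>f. f) (\<lambda>d. c \<otimes>\<^bsub>ground D\<^esub> d))\<rparr>)"

definition coweight_in_k ::
  "('v::euclidean_space, 'k, 't) base_data \<Rightarrow> ('v \<Rightarrow> real) \<Rightarrow> ('v, 'k) coweight_k" where
  "coweight_in_k D f = tensor_elt \<Z> (coweights D) (ground_int_module D) f \<one>\<^bsub>ground D\<^esub>"

definition gkm :: "('v::euclidean_space, 'k, 't) base_data \<Rightarrow> bool" where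
  "gkm D \<longleftrightarrow> \<one>\<^bsub>ground D\<^esub> \<oplus>\<^bsub>ground D\<^esub> \<one>\<^bsub>ground D\<^esub> \<noteq> \<zero>\<^bsub>ground D\<^esub> \<and>
     (\<forall>\<alpha>\<in>pos_roots D. \<forall>\<beta>\<in>pos_roots D. \<alpha> \<noteq> \<beta> \<longrightarrow>
        coweight_in_k D (coroot D \<alpha>) \<notin>
          {c \<odot>\<^bsub>coweights_k D\<^esub> coweight_in_k D (coroot D \<beta>) | c. c \<in> carrier (ground D)})"

definition sym_ring :: "('v::euclidean_space, 'k, 't) base_data \<Rightarrow> ('v, 'k) sym ring" where
  "sym_ring D = sym_algebra (ground D) (coweights_k D)"

definition coroot_S :: "('v::euclidean_space, 'k, 't) base_data \<Rightarrow> 'v \<Rightarrow> ('v, 'k) sym" where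
  "coroot_S D \<alpha> = sym_elt (ground D) (coweights_k D) (coweight_in_k D (coroot D \<alpha>))"

definition coroot_T :: "('v::euclidean_space, 'k, 't) base_data \<Rightarrow> 'v \<Rightarrow> 't" where
  "coroot_T D \<alpha> = struct_map D (coroot_S D \<alpha>)"

definition I_T :: "('v::euclidean_space, 'k, 't) base_data \<Rightarrow> 'v set" where
  "I_T D = {\<alpha>\<in>pos_roots D. coroot_T D \<alpha> \<notin> Units (base D)}"

definition affine_weyl_T :: "('v::euclidean_space, 'k, 't) base_data \<Rightarrow> ('v \<Rightarrow> 'v) set" where
  "affine_weyl_T D = generate (BijGroup UNIV)
     ({(+) \<gamma> | \<gamma>. \<gamma> \<in> root_lattice D} \<union> {aff_refl D \<alpha> m | \<alpha> m. \<alpha> \<in> I_T D})"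

definition R_T :: "('v::euclidean_space, 'k, 't) base_data \<Rightarrow> 'v set" where
  "R_T D = {\<alpha>\<in>pos_roots D. \<exists>m. aff_refl D \<alpha> m \<in> affine_weyl_T D}"

text \<open>
  HOL cannot quantify over all modules at once, so a type \<open>'m\<close> serves as a universe: "module" means
  "module with carrier in \<open>'m\<close>". The universe is required to be infinite and at least as large as \<open>T\<close>.
  Up to isomorphism it then contains all countably generated modules over \<open>T\<close> (and over \<open>S\<close>, unless
  \<open>T = 0\<close>), so that neither flatness nor the condition on projective modules depends on it, and it is
  closed under the constructions of this theory.
\<close>

definition universe :: "'m itself \<Rightarrow> ('t, 'x) ring_scheme \<Rightarrow> bool" where
  "universe U T \<longleftrightarrow> infinite (UNIV :: 'm set) \<and> (\<exists>f :: 't \<Rightarrow> 'm. inj_on f (carrier T))"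

definition base_ring :: "'m itself \<Rightarrow> ('v::euclidean_space, 'k, 't) base_data \<Rightarrow> bool" where
  "base_ring U D \<longleftrightarrow>
     cring (base D) \<and> struct_map D \<in> ring_hom (sym_ring D) (base D) \<and>
     (\<forall>h. base_grading D = Some h \<longrightarrow> graded_ring (base D) h \<and>
        (\<forall>n. struct_map D ` sym_homog (ground D) (coweights_k D) n \<subseteq> h n)) \<and>
     flat U (sym_ring D) (restrict_scalars (struct_map D) (regular_module (base D))) \<and>
     I_T D = R_T D \<and>
     (\<forall>P :: ('t, 'm) gmodule.
        projective (base_grading D) (base D) P \<longrightarrow> free (base_grading D) (base D) P)"

text \<open>The localization \<open>T[\<beta>\<^sup>\<or>\<^sup>-\<^sup>1 | \<beta> \<in> R\<^sup>+]\<close> as a \<open>T\<close>-module.\<close>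

definition T_gen :: "('v::euclidean_space, 'k, 't) base_data \<Rightarrow> ('t, ('t \<times> 't) set) module" where
  "T_gen D = localization (base D)
     {finprod (base D) (\<lambda>\<beta>. coroot_T D \<beta> [^]\<^bsub>base D\<^esub> n \<beta>) (pos_roots D) | n :: 'v \<Rightarrow> nat. True}"


section \<open>The topology on the set of alcoves\<close>

definition alcove_order :: "('v::euclidean_space, 'k, 't) base_data \<Rightarrow> ('v set \<times> 'v set) set" where
  "alcove_order D = {(A, B). A \<in> alcoves D \<and> B \<in> alcoves D \<and>
     ((\<exists>\<gamma>\<in>pos_root_cone D. B = (+) \<gamma> ` A) \<or>
      (\<exists>\<alpha>\<in>R_T D. \<exists>n. B = aff_refl D \<alpha> n ` A \<and> A \<subseteq> neg_halfspace D \<alpha> n))}\<^sup>*"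

definition opens :: "('v::euclidean_space, 'k, 't) base_data \<Rightarrow> 'v set set set" where
  "opens D = {J. J \<subseteq> alcoves D \<and> (\<forall>B\<in>J. \<forall>A. (A, B) \<in> alcove_order D \<longrightarrow> A \<in> J)}"

definition open_hull :: "('v::euclidean_space, 'k, 't) base_data \<Rightarrow> 'v set set \<Rightarrow> 'v set set" where
  "open_hull D \<T> = \<Inter>{J\<in>opens D. \<T> \<subseteq> J}"

definition sharp ::
  "('v::euclidean_space, 'k, 't) base_data \<Rightarrow> ('v \<Rightarrow> 'v) \<Rightarrow> 'v set set \<Rightarrow> 'v set set" where
  "sharp D s J = J \<union> right_act D s ` J"


section \<open>The structure algebra\<close>

type_synonym ('v, 't) struct_elt = "'v set set \<Rightarrow> 't"

definition struct_alg_S :: "('v::euclidean_space, 'k, 't) base_data \<Rightarrow> ('v set set \<Rightarrow> ('v, 'k) sym) set" where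
  "struct_alg_S D = {z \<in> orbits D \<rightarrow>\<^sub>E carrier (sym_ring D).
     \<forall>x\<in>orbits D. \<forall>\<alpha>\<in>pos_roots D.
       z x \<ominus>\<^bsub>sym_ring D\<^esub> z (refl_orbit D \<alpha> x) \<in> PIdl\<^bsub>sym_ring D\<^esub> (coroot_S D \<alpha>)}"

definition orbit_functions :: "('v::euclidean_space, 'k, 't) base_data \<Rightarrow> ('v, 't) struct_elt ring" where
  "orbit_functions D =
     \<lparr>carrier = orbits D \<rightarrow>\<^sub>E carrier (base D),
      mult = (\<lambda>y z. \<lambda>x\<in>orbits D. y x \<otimes>\<^bsub>base D\<^esub> z x),
      one = (\<lambda>x\<in>orbits D. \<one>\<^bsub>base D\<^esub>),
      ring.zero = (\<lambda>x\<in>orbits D. \<zero>\<^bsub>base D\<^esub>),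
      ring.add = (\<lambda>y z. \<lambda>x\<in>orbits D. y x \<oplus>\<^bsub>base D\<^esub> z x)\<rparr>"

text \<open>
  \<open>\<Z>\<^sub>S \<otimes>\<^sub>S T\<close>, identified with its image in the ring of \<open>T\<close>-valued functions on the set of orbits:
  the additive subgroup generated by the images of the pure tensors. As \<open>T\<close> is flat over \<open>S\<close>, the
  map from the tensor product to this ring is injective.
\<close>

definition struct_alg :: "('v::euclidean_space, 'k, 't) base_data \<Rightarrow> ('v, 't) struct_elt ring" where
  "struct_alg D = orbit_functions D \<lparr>carrier := generate (add_monoid (orbit_functions D))
     {\<lambda>x\<in>orbits D. struct_map D (z x) \<otimes>\<^bsub>base D\<^esub> t | z t.
        z \<in> struct_alg_S D \<and> t \<in> carrier (base D)}\<rparr>"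

definition struct_grading ::
  "('v::euclidean_space, 'k, 't) base_data \<Rightarrow> (int \<Rightarrow> ('v, 't) struct_elt set) option" where
  "struct_grading D = map_option
     (\<lambda>h n. {z \<in> carrier (struct_alg D). \<forall>x\<in>orbits D. z x \<in> h n}) (base_grading D)"

definition struct_inv ::
  "('v::euclidean_space, 'k, 't) base_data \<Rightarrow> ('v \<Rightarrow> 'v) \<Rightarrow> ('v, 't) struct_elt ring" where
  "struct_inv D s = struct_alg D \<lparr>carrier :=
     {z \<in> carrier (struct_alg D). \<forall>x\<in>orbits D. z x = z (right_act_orbit D s x)}\<rparr>"

definition diag :: "('v::euclidean_space, 'k, 't) base_data \<Rightarrow> 't \<Rightarrow> ('v, 't) struct_elt" where
  "diag D t = (\<lambda>x\<in>orbits D. t)"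

type_synonym ('v, 't, 'm) zmodule = "(('v, 't) struct_elt, 'm) gmodule"

definition is_zmodule ::
  "('v::euclidean_space, 'k, 't) base_data \<Rightarrow> ('v, 't, 'm) zmodule \<Rightarrow> bool" where
  "is_zmodule D = is_module (struct_grading D) (struct_alg D)"

definition zhom :: "('v::euclidean_space, 'k, 't) base_data \<Rightarrow> ('v, 't, 'm) zmodule
    \<Rightarrow> ('v, 't, 'n) zmodule \<Rightarrow> ('m \<Rightarrow> 'n) set" where
  "zhom D = module_hom (struct_grading D) (struct_alg D)"

definition ziso :: "('v::euclidean_space, 'k, 't) base_data \<Rightarrow> ('v, 't, 'm) zmodule
    \<Rightarrow> ('v, 't, 'n) zmodule \<Rightarrow> ('m \<Rightarrow> 'n) set" where
  "ziso D = module_iso (struct_grading D) (struct_alg D)"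

definition root_torsion_free ::
  "('v::euclidean_space, 'k, 't) base_data \<Rightarrow> ('v, 't, 'm) zmodule \<Rightarrow> bool" where
  "root_torsion_free D M \<longleftrightarrow>
     (\<forall>\<alpha>\<in>pos_roots D. inj_on (\<lambda>m. diag D (coroot_T D \<alpha>) \<odot>\<^bsub>M\<^esub> m) (carrier M))"


subsection \<open>Decomposition over the localized base ring\<close>

type_synonym ('m, 't) gen = "('m \<times> ('t \<times> 't) set \<Rightarrow>\<^sub>0 int) set"

text \<open>\<open>M \<otimes>\<^sub>T T\<^sup>\<emptyset>\<close>, the map \<open>f \<otimes> id\<close> into \<open>N \<otimes>\<^sub>T T\<^sup>\<emptyset>\<close>, and the action of \<open>\<Z>\<close> on \<open>M \<otimes>\<^sub>T T\<^sup>\<emptyset>\<close>.\<close>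

definition gen_group ::
  "('v::euclidean_space, 'k, 't) base_data \<Rightarrow> ('v, 't, 'm) zmodule \<Rightarrow> ('m, 't) gen monoid" where
  "gen_group D M = tensor (base D) (restrict_scalars (diag D) M) (T_gen D)"

definition gen_map ::
  "('v::euclidean_space, 'k, 't) base_data \<Rightarrow> ('v, 't, 'n) zmodule \<Rightarrow> ('m \<Rightarrow> 'n)
    \<Rightarrow> ('m, 't) gen \<Rightarrow> ('n, 't) gen" where
  "gen_map D N f = tensor_map (base D) (restrict_scalars (diag D) N) (T_gen D) f (\<lambda>t. t)"

definition gen_act ::
  "('v::euclidean_space, 'k, 't) base_data \<Rightarrow> ('v, 't, 'm) zmodule \<Rightarrow> ('v, 't) struct_elt
    \<Rightarrow> ('m, 't) gen \<Rightarrow> ('m, 't) gen" where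
  "gen_act D M z = gen_map D M (\<lambda>m. z \<odot>\<^bsub>M\<^esub> m)"

text \<open>
  The summand on which \<open>z\<close> acts as \<open>z x\<close>. Since \<open>\<Z> \<otimes>\<^sub>T T\<^sup>\<emptyset>\<close> is generated by \<open>\<Z>\<close> as a \<open>T\<^sup>\<emptyset>\<close>-module,
  it suffices to require this for \<open>z \<in> \<Z>\<close>.
\<close>

definition gen_summand ::
  "('v::euclidean_space, 'k, 't) base_data \<Rightarrow> ('v, 't, 'm) zmodule \<Rightarrow> 'v set set
    \<Rightarrow> ('m, 't) gen set" where
  "gen_summand D M x = {n \<in> carrier (gen_group D M).
     \<forall>z\<in>carrier (struct_alg D). gen_act D M z n = gen_act D M (diag D (z x)) n}"

definition gen_proj ::
  "('v::euclidean_space, 'k, 't) base_data \<Rightarrow> ('v, 't, 'm) zmodule \<Rightarrow> 'v set set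
    \<Rightarrow> ('m, 't) gen \<Rightarrow> ('m, 't) gen" where
  "gen_proj D M x n = (THE c. c \<in> (\<Pi>\<^sub>E y\<in>orbits D. gen_summand D M y) \<and>
     finprod (gen_group D M) c (orbits D) = n) x"

definition to_stalk ::
  "('v::euclidean_space, 'k, 't) base_data \<Rightarrow> ('v, 't, 'm) zmodule \<Rightarrow> 'v set set
    \<Rightarrow> 'm \<Rightarrow> ('m, 't) gen" where
  "to_stalk D M x m = gen_proj D M x
     (tensor_elt (base D) (restrict_scalars (diag D) M) (T_gen D) m \<one>\<^bsub>T_gen D\<^esub>)"

definition stalk ::
  "('v::euclidean_space, 'k, 't) base_data \<Rightarrow> ('v, 't, 'm) zmodule \<Rightarrow> 'v set set
    \<Rightarrow> ('m, 't) gen set" where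
  "stalk D M x = to_stalk D M x ` carrier M"


section \<open>Presheaves\<close>

text \<open>\<open>res M J J'\<close> is the restriction from \<open>J\<close> to \<open>J' \<subseteq> J\<close>.\<close>

record ('v, 't, 'm) presheaf =
  sec :: "'v set set \<Rightarrow> ('v, 't, 'm) zmodule"
  res :: "'v set set \<Rightarrow> 'v set set \<Rightarrow> 'm \<Rightarrow> 'm"

type_synonym ('v, 'm, 'n) presheaf_map = "'v set set \<Rightarrow> 'm \<Rightarrow> 'n"

definition presheaves :: "('v::euclidean_space, 'k, 't) base_data \<Rightarrow> ('v, 't, 'm) presheaf set" where
  "presheaves D = {M.
     (\<forall>J\<in>opens D. is_zmodule D (sec M J)) \<and>
     (\<forall>J\<in>opens D. \<forall>J'\<in>opens D. J' \<subseteq> J \<longrightarrow> res M J J' \<in> zhom D (sec M J) (sec M J')) \<and>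
     (\<forall>J\<in>opens D. \<forall>m\<in>carrier (sec M J). res M J J m = m) \<and>
     (\<forall>J\<in>opens D. \<forall>J'\<in>opens D. \<forall>J''\<in>opens D. J'' \<subseteq> J' \<and> J' \<subseteq> J \<longrightarrow>
        (\<forall>m\<in>carrier (sec M J). res M J' J'' (res M J J' m) = res M J J'' m))}"

definition presheaf_hom :: "('v::euclidean_space, 'k, 't) base_data
    \<Rightarrow> ('v, 't, 'm) presheaf \<Rightarrow> ('v, 't, 'n) presheaf \<Rightarrow> ('v, 'm, 'n) presheaf_map set" where
  "presheaf_hom D M N = {f \<in> extensional (opens D).
     (\<forall>J\<in>opens D. f J \<in> zhom D (sec M J) (sec N J)) \<and>
     (\<forall>J\<in>opens D. \<forall>J'\<in>opens D. J' \<subseteq> J \<longrightarrow>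
        (\<forall>m\<in>carrier (sec M J). res N J J' (f J m) = f J' (res M J J' m)))}"

definition presheaf_id :: "('v::euclidean_space, 'k, 't) base_data \<Rightarrow> ('v, 't, 'm) presheaf
    \<Rightarrow> ('v, 'm, 'm) presheaf_map" where
  "presheaf_id D M = (\<lambda>J\<in>opens D. \<lambda>m\<in>carrier (sec M J). m)"

text \<open>The composite of \<open>f : M \<rightarrow> N\<close> and \<open>g : N \<rightarrow> L\<close>.\<close>

definition presheaf_comp :: "('v::euclidean_space, 'k, 't) base_data \<Rightarrow> ('v, 't, 'm) presheaf
    \<Rightarrow> ('v, 'n, 'l) presheaf_map \<Rightarrow> ('v, 'm, 'n) presheaf_map \<Rightarrow> ('v, 'm, 'l) presheaf_map" where
  "presheaf_comp D M g f = (\<lambda>J\<in>opens D. \<lambda>m\<in>carrier (sec M J). g J (f J m))"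

definition torsion_free_presheaf ::
  "('v::euclidean_space, 'k, 't) base_data \<Rightarrow> ('v, 't, 'm) presheaf \<Rightarrow> bool" where
  "torsion_free_presheaf D M \<longleftrightarrow> (\<forall>J\<in>opens D. root_torsion_free D (sec M J))"

definition flabby ::
  "('v::euclidean_space, 'k, 't) base_data \<Rightarrow> ('v, 't, 'm) presheaf \<Rightarrow> bool" where
  "flabby D M \<longleftrightarrow> (\<forall>J\<in>opens D. \<forall>J'\<in>opens D. J' \<subseteq> J \<longrightarrow>
     res M J J' ` carrier (sec M J) = carrier (sec M J'))"

definition finitary ::
  "('v::euclidean_space, 'k, 't) base_data \<Rightarrow> ('v, 't, 'm) presheaf \<Rightarrow> bool" where
  "finitary D M \<longleftrightarrow> carrier (sec M {}) = {\<zero>\<^bsub>sec M {}\<^esub>} \<and>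
     (\<exists>\<T>\<subseteq>alcoves D. finite \<T> \<and>
        (\<forall>J\<in>opens D. res M J (open_hull D (J \<inter> \<T>)) \<in>
           ziso D (sec M J) (sec M (open_hull D (J \<inter> \<T>)))))"

definition support_condition ::
  "('v::euclidean_space, 'k, 't) base_data \<Rightarrow> ('v, 't, 'm) presheaf \<Rightarrow> bool" where
  "support_condition D M \<longleftrightarrow> torsion_free_presheaf D M \<and>
     (\<forall>J\<in>opens D. \<forall>x\<in>orbits D. let J' = open_hull D (J \<inter> x) in
        bij_betw (gen_map D (sec M J') (res M J J')) (stalk D (sec M J) x) (stalk D (sec M J') x))"

definition P_T :: "('v::euclidean_space, 'k, 't) base_data \<Rightarrow> ('v, 't, 'm) presheaf set" where
  "P_T D = {M \<in> presheaves D.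
     flabby D M \<and> finitary D M \<and> torsion_free_presheaf D M \<and> support_condition D M}"


subsection \<open>The presheaf \<open>M\<^sup>+\<close>\<close>

type_synonym ('v, 't, 'm) plus_elt = "'v set set \<Rightarrow> ('m, 't) gen"

definition to_plus :: "('v::euclidean_space, 'k, 't) base_data \<Rightarrow> ('v, 't, 'm) presheaf
    \<Rightarrow> 'v set set \<Rightarrow> 'm \<Rightarrow> ('v, 't, 'm) plus_elt" where
  "to_plus D M J m = (\<lambda>x\<in>orbits D. let J' = open_hull D (J \<inter> x) in
     to_stalk D (sec M J') x (res M J J' m))"

definition plus_sec :: "('v::euclidean_space, 'k, 't) base_data \<Rightarrow> ('v, 't, 'm) presheaf
    \<Rightarrow> 'v set set \<Rightarrow> ('v, 't, ('v, 't, 'm) plus_elt) zmodule" where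
  "plus_sec D M J =
     \<lparr>carrier = to_plus D M J ` carrier (sec M J),
      mult = undefined, one = undefined,
      ring.zero = (\<lambda>x\<in>orbits D. \<one>\<^bsub>gen_group D (sec M (open_hull D (J \<inter> x)))\<^esub>),
      ring.add = (\<lambda>u v. \<lambda>x\<in>orbits D. u x \<otimes>\<^bsub>gen_group D (sec M (open_hull D (J \<inter> x)))\<^esub> v x),
      smult = (\<lambda>z u. \<lambda>x\<in>orbits D. gen_act D (sec M (open_hull D (J \<inter> x))) z (u x)),
      homog = (\<lambda>n. to_plus D M J ` homog (sec M J) n)\<rparr>"

definition plus_presheaf :: "('v::euclidean_space, 'k, 't) base_data \<Rightarrow> ('v, 't, 'm) presheaf
    \<Rightarrow> ('v, 't, ('v, 't, 'm) plus_elt) presheaf" where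
  "plus_presheaf D M =
     \<lparr>sec = plus_sec D M,
      res = (\<lambda>J J'. \<lambda>u\<in>carrier (plus_sec D M J). \<lambda>x\<in>orbits D.
        gen_map D (sec M (open_hull D (J' \<inter> x)))
          (res M (open_hull D (J \<inter> x)) (open_hull D (J' \<inter> x))) (u x))\<rparr>"

definition plus_map :: "('v::euclidean_space, 'k, 't) base_data
    \<Rightarrow> ('v, 't, 'm) presheaf \<Rightarrow> ('v, 't, 'n) presheaf \<Rightarrow> ('v, 'm, 'n) presheaf_map
    \<Rightarrow> ('v, ('v, 't, 'm) plus_elt, ('v, 't, 'n) plus_elt) presheaf_map" where
  "plus_map D M N f = (\<lambda>J\<in>opens D. \<lambda>u\<in>carrier (plus_sec D M J). \<lambda>x\<in>orbits D.
     gen_map D (sec N (open_hull D (J \<inter> x))) (f (open_hull D (J \<inter> x))) (u x))"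

definition plus_unit :: "('v::euclidean_space, 'k, 't) base_data \<Rightarrow> ('v, 't, 'm) presheaf
    \<Rightarrow> ('v, 'm, ('v, 't, 'm) plus_elt) presheaf_map" where
  "plus_unit D M = (\<lambda>J\<in>opens D. restrict (to_plus D M J) (carrier (sec M J)))"


subsection \<open>Isomorphic copies in the universe\<close>

text \<open>
  The sections of \<open>M\<^sup>+\<close> and of \<open>\<epsilon>\<^sub>s M\<close> are modules whose carriers do not lie in the type used for \<open>M\<close>.
  To obtain presheaves with sections in a given type \<open>'n\<close> again, each carrier is replaced by its image
  under some injection into \<open>'n\<close>.
\<close>

definition copy_fun :: "('r, 'm, 'x) module_scheme \<Rightarrow> 'm \<Rightarrow> 'n" where
  "copy_fun M = restrict (SOME f. inj_on f (carrier M)) (carrier M)"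

definition copy_inv :: "('r, 'm, 'x) module_scheme \<Rightarrow> 'n \<Rightarrow> 'm" where
  "copy_inv M = inv_into (carrier M) (copy_fun M)"

definition copy_module :: "('r, 'm) gmodule \<Rightarrow> ('r, 'n) gmodule" where
  "copy_module M =
     \<lparr>carrier = copy_fun M ` carrier M,
      mult = undefined, one = undefined,
      ring.zero = copy_fun M \<zero>\<^bsub>M\<^esub>,
      ring.add = (\<lambda>a b. copy_fun M (copy_inv M a \<oplus>\<^bsub>M\<^esub> copy_inv M b)),
      smult = (\<lambda>r a. copy_fun M (r \<odot>\<^bsub>M\<^esub> copy_inv M a)),
      homog = (\<lambda>n. copy_fun M ` homog M n)\<rparr>"

definition copy_hom :: "('r, 'm) gmodule \<Rightarrow> ('r, 'l) gmodule \<Rightarrow> ('m \<Rightarrow> 'l) \<Rightarrow> 'n \<Rightarrow> 'p" where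
  "copy_hom M N f = (\<lambda>a\<in>copy_fun M ` carrier M. copy_fun N (f (copy_inv M a)))"

definition copy_presheaf :: "('v, 't, 'm) presheaf \<Rightarrow> ('v, 't, 'n) presheaf" where
  "copy_presheaf M =
     \<lparr>sec = (\<lambda>J. copy_module (sec M J)),
      res = (\<lambda>J J'. copy_hom (sec M J) (sec M J') (res M J J'))\<rparr>"


section \<open>Functors on the category \<open>P\<^sub>T\<close>\<close>

text \<open>
  Functors from presheaves with sections in \<open>'m\<close> to presheaves with sections in \<open>'n\<close>;
  \<open>fmor F M N f\<close> is the image of the morphism \<open>f : M \<rightarrow> N\<close>.
\<close>

record ('v, 't, 'm, 'n) presheaf_functor =
  fob :: "('v, 't, 'm) presheaf \<Rightarrow> ('v, 't, 'n) presheaf"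
  fmor :: "('v, 't, 'm) presheaf \<Rightarrow> ('v, 't, 'm) presheaf \<Rightarrow> ('v, 'm, 'm) presheaf_map
             \<Rightarrow> ('v, 'n, 'n) presheaf_map"

text \<open>\<open>F\<close> is a functor from \<open>P\<^sub>T\<close> to the full subcategory of the category of presheaves with objects \<open>\<Q>\<close>.\<close>

definition is_functor :: "('v::euclidean_space, 'k, 't) base_data \<Rightarrow> ('v, 't, 'n) presheaf set
    \<Rightarrow> ('v, 't, 'm, 'n) presheaf_functor \<Rightarrow> bool" where
  "is_functor D \<Q> F \<longleftrightarrow>
     (\<forall>M\<in>P_T D. fob F M \<in> \<Q>) \<and>
     (\<forall>M\<in>P_T D. \<forall>N\<in>P_T D. \<forall>f\<in>presheaf_hom D M N.
        fmor F M N f \<in> presheaf_hom D (fob F M) (fob F N)) \<and>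
     (\<forall>M\<in>P_T D. fmor F M M (presheaf_id D M) = presheaf_id D (fob F M)) \<and>
     (\<forall>M\<in>P_T D. \<forall>N\<in>P_T D. \<forall>L\<in>P_T D. \<forall>f\<in>presheaf_hom D M N. \<forall>g\<in>presheaf_hom D N L.
        fmor F M L (presheaf_comp D M g f) =
          presheaf_comp D (fob F M) (fmor F N L g) (fmor F M N f))"

type_synonym ('v, 't, 'm, 'a, 'b) transformation =
  "('v, 't, 'm) presheaf \<Rightarrow> ('v, 'a, 'b) presheaf_map"

definition natural_transformation :: "('v::euclidean_space, 'k, 't) base_data
    \<Rightarrow> ('v, 't, 'm, 'a) presheaf_functor \<Rightarrow> ('v, 't, 'm, 'b) presheaf_functor
    \<Rightarrow> ('v, 't, 'm, 'a, 'b) transformation \<Rightarrow> bool" where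
  "natural_transformation D F G \<rho> \<longleftrightarrow>
     is_functor D (presheaves D) F \<and> is_functor D (presheaves D) G \<and>
     (\<forall>M\<in>P_T D. \<rho> M \<in> presheaf_hom D (fob F M) (fob G M)) \<and>
     (\<forall>M\<in>P_T D. \<forall>N\<in>P_T D. \<forall>f\<in>presheaf_hom D M N.
        presheaf_comp D (fob F M) (fmor G M N f) (\<rho> M) =
          presheaf_comp D (fob F M) (\<rho> N) (fmor F M N f))"

definition isomorphic_functors :: "('v::euclidean_space, 'k, 't) base_data
    \<Rightarrow> ('v, 't, 'm, 'a) presheaf_functor \<Rightarrow> ('v, 't, 'm, 'b) presheaf_functor \<Rightarrow> bool" where
  "isomorphic_functors D F G \<longleftrightarrow> (\<exists>\<eta>. natural_transformation D F G \<eta> \<and>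
     (\<forall>M\<in>P_T D. \<forall>J\<in>opens D. \<eta> M J \<in> ziso D (sec (fob F M) J) (sec (fob G M) J)))"


section \<open>Wall crossing\<close>

type_synonym ('v, 't, 'm) eps_elt = "(('v, 't) struct_elt \<times> 'm \<Rightarrow>\<^sub>0 int) set"

text \<open>
  \<open>\<Z> \<otimes> M\<close> over the ring of \<open>s\<close>-invariants of \<open>\<Z>\<close>; the homogeneous part of degree \<open>n\<close> is generated by
  the tensors of homogeneous elements whose degrees add up to \<open>n\<close>.
\<close>

definition eps_module :: "('v::euclidean_space, 'k, 't) base_data \<Rightarrow> ('v \<Rightarrow> 'v)
    \<Rightarrow> ('v, 't, 'm) zmodule \<Rightarrow> ('v, 't, ('v, 't, 'm) eps_elt) zmodule" where
  "eps_module D s M =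
     (let R = struct_inv D s; Z = regular_module (struct_alg D); G = tensor R Z M in
     \<lparr>carrier = carrier G, mult = undefined, one = undefined,
      ring.zero = \<one>\<^bsub>G\<^esub>, ring.add = monoid.mult G,
      smult = (\<lambda>z. tensor_map R Z M (\<lambda>y. z \<otimes>\<^bsub>struct_alg D\<^esub> y) (\<lambda>m. m)),
      homog = (\<lambda>n. generate G {tensor_elt R Z M z m | z m.
        \<exists>h i. struct_grading D = Some h \<and> z \<in> h i \<and> m \<in> homog M (n - i)})\<rparr>)"

definition eps_hom :: "('v::euclidean_space, 'k, 't) base_data \<Rightarrow> ('v \<Rightarrow> 'v)
    \<Rightarrow> ('v, 't, 'm) zmodule \<Rightarrow> ('v, 't, 'n) zmodule \<Rightarrow> ('m \<Rightarrow> 'n)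
    \<Rightarrow> ('v, 't, 'm) eps_elt \<Rightarrow> ('v, 't, 'n) eps_elt" where
  "eps_hom D s M N f = restrict
     (tensor_map (struct_inv D s) (regular_module (struct_alg D)) N (\<lambda>z. z) f)
     (carrier (eps_module D s M))"

definition eps :: "('v::euclidean_space, 'k, 't) base_data \<Rightarrow> ('v \<Rightarrow> 'v)
    \<Rightarrow> ('v, 't, 'm, ('v, 't, 'm) eps_elt) presheaf_functor" where
  "eps D s =
     \<lparr>fob = (\<lambda>M. \<lparr>sec = (\<lambda>J. eps_module D s (sec M (sharp D s J))),
                  res = (\<lambda>J J'. eps_hom D s (sec M (sharp D s J)) (sec M (sharp D s J'))
                                  (res M (sharp D s J) (sharp D s J')))\<rparr>),
      fmor = (\<lambda>M N f. \<lambda>J\<in>opens D.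
        eps_hom D s (sec M (sharp D s J)) (sec N (sharp D s J)) (f (sharp D s J)))\<rparr>"

definition theta :: "('v::euclidean_space, 'k, 't) base_data \<Rightarrow> ('v \<Rightarrow> 'v)
    \<Rightarrow> ('v, 't, 'm, 'm) presheaf_functor" where
  "theta D s =
     \<lparr>fob = (\<lambda>M. copy_presheaf (plus_presheaf D (fob (eps D s) M))),
      fmor = (\<lambda>M N f. \<lambda>J\<in>opens D.
        copy_hom (plus_sec D (fob (eps D s) M) J) (plus_sec D (fob (eps D s) N) J)
          (plus_map D (fob (eps D s) M) (fob (eps D s) N) (fmor (eps D s) M N f) J))\<rparr>"

definition rho :: "('v::euclidean_space, 'k, 't) base_data \<Rightarrow> ('v \<Rightarrow> 'v)
    \<Rightarrow> ('v, 't, 'm, ('v, 't, 'm) eps_elt, 'm) transformation" where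
  "rho D s M = (\<lambda>J\<in>opens D. \<lambda>e\<in>carrier (sec (fob (eps D s) M) J).
     copy_fun (plus_sec D (fob (eps D s) M) J) (plus_unit D (fob (eps D s) M) J e))"

definition iso_on_invariants :: "('v::euclidean_space, 'k, 't) base_data \<Rightarrow> ('v \<Rightarrow> 'v)
    \<Rightarrow> ('v, 't, 'm, 'm) presheaf_functor
    \<Rightarrow> ('v, 't, 'm, ('v, 't, 'm) eps_elt, 'm) transformation \<Rightarrow> bool" where
  "iso_on_invariants D s F \<rho> \<longleftrightarrow>
     (\<forall>M\<in>P_T D. \<forall>J\<in>opens D. right_act D s ` J = J \<longrightarrow>
        \<rho> M J \<in> ziso D (sec (fob (eps D s) M) J) (sec (fob F M) J))"

end

theory Submission
 imports Defs "HOL-Algebra.Subrings"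
begin

text \<open>
 Write \<open>e\<^sub>x \<in> \<Z>\<close> for the function with value \<open>\<delta>\<close>, the product of the positive coroots, at \<open>x\<close> and \<open>0\<close>
 elsewhere. For torsion free modules all statements about the stalk at \<open>x\<close> become statements about
 multiplication by \<open>e\<^sub>x\<close>. The algebra satisfies \<open>\<Z> = \<Z>\<^sup>s + c \<Z>\<^sup>s\<close> with \<open>c\<close> antisymmetric under \<open>s\<close>, so that \<open>e\<^sub>x\<close>
 kills an element of \<open>\<Z> \<otimes> M\<close> if and only if its evaluation at \<open>x\<close>, which lies in the parts of \<open>M\<close> at \<open>x\<close> and
 \<open>xs\<close>, vanishes. On an \<open>s\<close>-invariant set the support condition for \<open>M\<close> therefore makes \<open>\<rho>\<close> injective.
 Conversely, let \<open>\<rho>'\<close> be bijective on invariant sets. As \<open>\<epsilon>\<^sub>s M(J) = \<epsilon>\<^sub>s M(J\<^sup>\<sharp>)\<close>, it is surjective, and since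
 \<open>J'\<^sup>\<sharp> \<inter> x = J \<inter> x\<close> for the hull \<open>J'\<close> of \<open>J \<inter> x\<close>, its kernel is forced by the support condition.
\<close>

section \<open>Affine reflections and alcoves\<close>

text \<open>The right action is meaningful only because the affine Weyl group acts simply
  transitively on the alcoves, and it does not respect the order: a step across the wall between an
  alcove and its neighbour is reversed. Two weak forms of monotonicity take the place of
  monotonicity, together with a trichotomy of orbits: the crossing goes up everywhere, goes down
  everywhere, or the orbit and its neighbour are incomparable. The factor \<delta> stands for
  denominators: the idempotents of the orbits exist only after inverting the coroots, but their
  multiples by \<delta> lie in the algebra, and torsion freeness cancels \<delta>. Existence and
  uniqueness share one notion, the locale \<open>plus_quotient\<close>: a presheaf with a surjection
  from a given one and with kernel \<open>vanish\<close>. The constructed functor and any competing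
  one give such quotients of the same presheaf, so they are compared on representatives. In the
  graded case the kernel must be spanned by homogeneous elements; it is, being cut out by maps of a
  fixed degree.\<close>

lemma BijGroup_UNIV:
 assumes "bij f" "bij g" shows "f \<otimes>\<^bsub>BijGroup UNIV\<^esub> g = f \<circ> g"
 using assms by (simp add: BijGroup_def Bij_def compose_def fun_eq_iff)

lemma carrier_BijGroup_UNIV: "carrier (BijGroup UNIV) = {f. bij f}"
 by (auto simp: BijGroup_def Bij_def)

lemma inv_BijGroup_UNIV: assumes "bij f" shows "inv\<^bsub>BijGroup UNIV\<^esub> f = Hilbert_Choice.inv f"
 using assms by (simp add: inv_BijGroup Bij_def restrict_def)

context
 fixes H :: "('a \<Rightarrow> 'a) set"
 assumes bij: "\<And>h. h \<in> H ==> bij h"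
begin

lemma generate_Bij_bij: "w \<in> generate (BijGroup UNIV) H ==> bij w"
 using group.generate_in_carrier[OF group_BijGroup, of H UNIV w] bij
 by (auto simp: carrier_BijGroup_UNIV)

lemma generate_Bij_id: "id \<in> generate (BijGroup UNIV) H"
 using generate.one[of "BijGroup UNIV" H] by (simp add: BijGroup_def id_def restrict_def)

lemma generate_Bij_comp:
 assumes "v \<in> generate (BijGroup UNIV) H" "w \<in> generate (BijGroup UNIV) H"
 shows "v \<circ> w \<in> generate (BijGroup UNIV) H"
 using generate.eng[OF assms] BijGroup_UNIV[OF generate_Bij_bij[OF assms(1)] generate_Bij_bij[OF assms(2)]]
 by simp

lemma generate_Bij_induct [consumes 1, case_names id gen inv comp]:
 assumes "w \<in> generate (BijGroup UNIV) H" and "P id" and "\<And>h. h \<in> H ==> P h"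
  and "\<And>h. h \<in> H ==> P (Hilbert_Choice.inv h)"
  and c: "\<And>u v. u \<in> generate (BijGroup UNIV) H ==> v \<in> generate (BijGroup UNIV) H ==>
   P u ==> P v ==> P (u \<circ> v)"
 shows "P w"
 using assms(1)
proof (induction rule: generate.induct)
 case one
 thus ?case using assms(2) by (simp add: BijGroup_def id_def restrict_def)
next
 case (incl h)
 thus ?case using assms(3) by simp
next
 case (inv h)
 thus ?case using assms(4) inv_BijGroup_UNIV[OF bij] by simp
next
 case (eng u v)
 thus ?case
  using c[OF eng(1,2)] BijGroup_UNIV[OF generate_Bij_bij[OF eng(1)] generate_Bij_bij[OF eng(2)]] by metis
qed

end

section \<open>Root data and an invariant inner product\<close>

locale root_datum =
 fixes D :: "('v::euclidean_space, 'x) root_data_scheme"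
 assumes root_system: "root_system D"
  and reduced: "reduced_root_system D"
  and positive: "positive_system D"
begin

abbreviation "R \<equiv> roots D"
abbreviation "Rp \<equiv> pos_roots D"
abbreviation "co \<equiv> coroot D"

lemma finite_R: "finite R" and zero_notin_R: "0 \<notin> R" and span_R: "span R = UNIV"
 using root_system unfolding root_system_def by auto

lemma
 assumes "\<alpha> \<in> R"
 shows linear_co: "linear (co \<alpha>)" and co_self: "co \<alpha> \<alpha> = 2"
  and refl_R: "aff_refl D \<alpha> 0 ` R = R" and co_int: "\<beta> \<in> R ==> co \<alpha> \<beta> \<in> \<int>"
 using root_system assms unfolding root_system_def by auto

lemma co_simps:
 assumes "\<alpha> \<in> R"
 shows "co \<alpha> (x + y) = co \<alpha> x + co \<alpha> y" "co \<alpha> (x - y) = co \<alpha> x - co \<alpha> y"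
  "co \<alpha> (c *\<^sub>R x) = c * co \<alpha> x" "co \<alpha> (- x) = - co \<alpha> x" "co \<alpha> 0 = 0"
 using linear_co[OF assms] by (auto simp: linear_add linear_diff linear_scale linear_neg linear_0)

lemma Rp_subset: "Rp \<subseteq> R"
 using positive unfolding positive_system_def by auto

lemma finite_Rp: "finite Rp"
 using finite_R Rp_subset finite_subset by blast

text \<open>The automorphism group of the root system, used in place of the finite Weyl group: it
  contains the linear part of every element of the affine Weyl group, and its finiteness needs no
  words in reflections.\<close>

definition sym_grp :: "('v \<Rightarrow> 'v) set" where
 "sym_grp = {g. linear g \<and> g ` R = R}"

lemma sym_grp_comp: "g \<in> sym_grp ==> h \<in> sym_grp ==> g \<circ> h \<in> sym_grp"
 unfolding sym_grp_def mem_Collect_eq by (metis image_comp linear_compose)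

lemma id_sym_grp: "id \<in> sym_grp"
 unfolding sym_grp_def by (auto simp: linear_id)

lemma linear_eqI_R:
 assumes "linear g" "linear h" "\<And>x. x \<in> R ==> g x = h x" shows "g = h"
proof
 fix x show "g x = h x" using linear_eq_on_span[OF assms(1,2,3), of R x] span_R by auto
qed

text \<open>A linear map is determined by its values on the finite spanning set
  \<open>R\<close>.\<close>

lemma finite_sym_grp: "finite sym_grp"
proof -
 have "inj_on (\<lambda>g. restrict g R) sym_grp"
 proof (rule inj_onI)
  fix g h assume gh: "g \<in> sym_grp" "h \<in> sym_grp" "restrict g R = restrict h R"
  hence "\<And>x. x \<in> R ==> g x = h x" by (metis restrict_apply')
  thus "g = h" using gh by (intro linear_eqI_R) (auto simp: sym_grp_def)
 qed
 moreover have "(\<lambda>g. restrict g R) ` sym_grp \<subseteq> R \<rightarrow>\<^sub>E R"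
  unfolding sym_grp_def by auto
 ultimately show ?thesis
  by (meson finite_PiE finite_R finite_imageD finite_subset)
qed

lemma refl0: "aff_refl D \<alpha> 0 v = v - co \<alpha> v *\<^sub>R \<alpha>"
 by (simp add: aff_refl_def)

lemma aff_refl_invol:
 assumes "\<alpha> \<in> R" shows "aff_refl D \<alpha> n (aff_refl D \<alpha> n v) = v"
 using assms by (simp add: aff_refl_def co_simps co_self algebra_simps)

lemma refl_sym_grp: assumes "\<alpha> \<in> R" shows "aff_refl D \<alpha> 0 \<in> sym_grp"
 unfolding sym_grp_def using refl_R[OF assms]
 by (auto intro!: linearI simp: refl0 co_simps assms algebra_simps)

text \<open>The inner product of the type class is unrelated to the root system; summing its
  translates over the finite group \<open>sym_grp\<close> makes it invariant.\<close>

definition form :: "'v \<Rightarrow> 'v \<Rightarrow> real" where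
 "form x y = (\<Sum>g\<in>sym_grp. g x \<bullet> g y)"

lemma sym_grp_linear: "g \<in> sym_grp ==> linear g"
 by (simp add: sym_grp_def)

lemma form_simps:
 "form (x + y) z = form x z + form y z" "form z (x + y) = form z x + form z y"
 "form (x - y) z = form x z - form y z" "form z (x - y) = form z x - form z y"
 "form (c *\<^sub>R x) z = c * form x z" "form z (c *\<^sub>R x) = c * form z x"
 "form (- x) z = - form x z" "form z (- x) = - form z x"
 by (auto simp: form_def linear_add[OF sym_grp_linear] linear_diff[OF sym_grp_linear]
   linear_scale[OF sym_grp_linear] linear_neg[OF sym_grp_linear] algebra_simps sum.distrib
   sum_subtractf sum_distrib_left sum_negf intro!: sum.cong)

lemma form_sym: "form x y = form y x"
 unfolding form_def by (simp add: inner_commute)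

text \<open>The summand of the identity is already positive, and the other summands are
  nonnegative.\<close>

lemma form_pos: assumes "x \<noteq> 0" shows "form x x > 0"
proof -
 have "id x \<bullet> id x \<le> form x x"
  unfolding form_def
  using sum_mono2[OF finite_sym_grp, of "{id}" "\<lambda>g. g x \<bullet> g x"] id_sym_grp by auto
 thus ?thesis using assms by (smt (verit) id_apply inner_gt_zero_iff)
qed

lemma form_refl:
 assumes "\<alpha> \<in> R" shows "form (aff_refl D \<alpha> 0 x) (aff_refl D \<alpha> 0 y) = form x y"
proof -
 let ?s = "aff_refl D \<alpha> 0"
 have ss: "?s \<circ> ?s = id" using aff_refl_invol[OF assms] by auto
 show ?thesis unfolding form_def
 proof (rule sum.reindex_bij_witness[where i="\<lambda>g. g \<circ> ?s" and j="\<lambda>g. g \<circ> ?s"])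
  fix g assume "g \<in> sym_grp"
  thus "g \<circ> ?s \<circ> ?s = g" "g \<circ> ?s \<in> sym_grp" "g \<circ> ?s \<circ> ?s = g" "g \<circ> ?s \<in> sym_grp"
   using sym_grp_comp refl_sym_grp[OF assms] ss by (auto simp: comp_assoc)
  show "(g \<circ> ?s) x \<bullet> (g \<circ> ?s) y = g (?s x) \<bullet> g (?s y)" by simp
 qed
qed

lemma root_nonzero: "\<alpha> \<in> R ==> \<alpha> \<noteq> 0" using zero_notin_R by auto

text \<open>Invariance under the reflection, applied to \<open>x\<close> and \<alpha> with \<alpha>
  sent to its negative, forces this expression. Hence a coroot is determined by its root, and every
  automorphism of the root system respects coroots.\<close>

lemma co_form: assumes "\<alpha> \<in> R" shows "co \<alpha> x = 2 * form x \<alpha> / form \<alpha> \<alpha>"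
proof -
 have "aff_refl D \<alpha> 0 \<alpha> = - \<alpha>" using assms by (simp add: refl0 co_self scaleR_2)
 hence "form (x - co \<alpha> x *\<^sub>R \<alpha>) (- \<alpha>) = form x \<alpha>"
  using form_refl[OF assms, of x \<alpha>] by (simp add: refl0)
 hence "co \<alpha> x * form \<alpha> \<alpha> = 2 * form x \<alpha>" by (simp add: form_simps)
 thus ?thesis using form_pos[OF root_nonzero[OF assms]] by (simp add: field_simps)
qed

lemma neg_root: assumes "\<alpha> \<in> R" shows "- \<alpha> \<in> R"
proof -
 have "aff_refl D \<alpha> 0 \<alpha> = - \<alpha>" using assms by (simp add: refl0 co_self scaleR_2)
 thus ?thesis using refl_R[OF assms] assms by (metis imageI)
qed

lemma co_neg: assumes "\<alpha> \<in> R" shows "co (- \<alpha>) x = - co \<alpha> x"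
 using co_form[OF assms] co_form[OF neg_root[OF assms]] by (simp add: form_simps)

lemma aff_refl_neg: assumes "\<alpha> \<in> R" shows "aff_refl D (- \<alpha>) (- n) = aff_refl D \<alpha> n"
 using co_neg[OF assms] by (auto simp: aff_refl_def fun_eq_iff algebra_simps)

text \<open>Right translation by \<open>g\<close> is an injective self-map of the finite set
  \<open>sym_grp\<close>, hence a permutation of the summands.\<close>

lemma form_sym_grp: assumes "g \<in> sym_grp" shows "form (g x) (g y) = form x y"
proof -
 have inj: "inj_on (\<lambda>h. h \<circ> g) sym_grp"
 proof (rule inj_onI)
  fix h k assume hk: "h \<in> sym_grp" "k \<in> sym_grp" "h \<circ> g = k \<circ> g"
  have "\<And>x. x \<in> R ==> h x = k x"
  proof -
   fix x assume "x \<in> R"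
   then obtain y where "x = g y" using assms unfolding sym_grp_def by auto
   thus "h x = k x" using hk(3) by (metis comp_apply)
  qed
  thus "h = k" using hk by (intro linear_eqI_R) (auto simp: sym_grp_def)
 qed
 have img: "(\<lambda>h. h \<circ> g) ` sym_grp = sym_grp"
  by (rule endo_inj_surj[OF finite_sym_grp _ inj]) (use assms sym_grp_comp in auto)
 have "form x y = (\<Sum>h\<in>(\<lambda>h. h \<circ> g) ` sym_grp. h x \<bullet> h y)" unfolding form_def img ..
 also have "\<dots> = form (g x) (g y)" unfolding form_def by (simp add: sum.reindex[OF inj])
 finally show ?thesis by simp
qed

lemma co_sym_grp:
 assumes "g \<in> sym_grp" "\<alpha> \<in> R" shows "g \<alpha> \<in> R" "co (g \<alpha>) (g x) = co \<alpha> x"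
proof -
 show "g \<alpha> \<in> R" using assms unfolding sym_grp_def by auto
 thus "co (g \<alpha>) (g x) = co \<alpha> x" using assms by (simp add: co_form form_sym_grp)
qed

lemma Rp_cases: assumes "\<alpha> \<in> R" shows "\<alpha> \<in> Rp \<or> - \<alpha> \<in> Rp"
proof -
 obtain f where f: "linear f" "\<forall>\<alpha>\<in>R. f \<alpha> \<noteq> (0::real)" "Rp = {\<alpha>\<in>R. f \<alpha> > 0}"
  using positive unfolding positive_system_def by blast
 have "f (- \<alpha>) = - f \<alpha>" using f(1) linear_neg by blast
 thus ?thesis using f(2,3) assms neg_root[OF assms] by force
qed

text \<open>Riesz representation for \<open>form\<close>: the Gram operator \<open>M\<close> with
  respect to the class inner product is injective by positivity, hence surjective in finite
  dimension.\<close>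

lemma form_represents:
 fixes f :: "'v \<Rightarrow> real" assumes f: "linear f" obtains v where "\<And>y. f y = form v y"
proof -
 define M where "M v = (\<Sum>b\<in>Basis. form v b *\<^sub>R b)" for v
 have M: "M v \<bullet> y = form v y" for v y
 proof -
  have "form v y = form v (\<Sum>b\<in>Basis. (y \<bullet> b) *\<^sub>R b)" by (simp add: euclidean_representation)
  also have "\<dots> = (\<Sum>b\<in>Basis. (y \<bullet> b) * form v b)"
  proof -
   have "linear (form v)" by (rule linearI) (auto simp: form_simps)
   thus ?thesis by (simp add: linear_sum form_simps)
  qed
  finally show ?thesis unfolding M_def by (simp add: inner_sum_left inner_sum_right inner_commute[of y] mult.commute)
 qed
 have "linear M" unfolding M_def
  by (rule linearI) (auto simp: form_simps algebra_simps sum.distrib scaleR_sum_right)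
 moreover have "inj M"
 proof -
  have "M v = 0 ==> v = 0" for v using M[of v v] form_pos[of v] by (metis inner_zero_left less_irrefl)
  thus ?thesis using \<open>linear M\<close> by (simp add: linear_injective_0)
 qed
 ultimately have "surj M" using linear_injective_imp_surjective by blast
 then obtain v where v: "M v = (\<Sum>b\<in>Basis. f b *\<^sub>R b)" by (metis surjD)
 have "f y = form v y" for y
 proof -
  have "f y = f (\<Sum>b\<in>Basis. (y \<bullet> b) *\<^sub>R b)" by (simp add: euclidean_representation)
  also have "\<dots> = (\<Sum>b\<in>Basis. f b * (b \<bullet> y))"
   using f by (simp add: linear_sum linear_scale inner_commute mult.commute)
  also have "\<dots> = M v \<bullet> y" unfolding v by (simp add: inner_sum_left)
  finally show ?thesis using M by simp
 qed
 thus ?thesis using that by blast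
qed

text \<open>The functional that cuts out the positive system is represented by a vector through
  \<open>form\<close>. Coroots are positive multiples of pairings with roots, so this vector is
  dominant; scaling moves it into the base alcove.\<close>

lemma dominant_exists: obtains v where "\<And>\<alpha>. \<alpha> \<in> Rp ==> 0 < co \<alpha> v \<and> co \<alpha> v < 1"
proof -
 obtain f where f: "linear f" "Rp = {\<alpha>\<in>R. f \<alpha> > (0::real)}"
  using positive unfolding positive_system_def by blast
 obtain v where v: "\<And>y. f y = form v y" using form_represents[OF f(1)] by blast
 have pos: "co \<alpha> v > 0" if "\<alpha> \<in> Rp" for \<alpha>
 proof -
  have "\<alpha> \<in> R" "form v \<alpha> > 0" using that f(2) v by auto
  thus ?thesis using co_form form_pos root_nonzero by simp
 qed
 \<comment> \<open>Exceeds every single value, all summands being positive.\<close>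
 define C where "C = 1 + (\<Sum>\<alpha>\<in>Rp. co \<alpha> v)"
 have C: "co \<alpha> v < C" if "\<alpha> \<in> Rp" for \<alpha>
  unfolding C_def using member_le_sum[OF that, of "\<lambda>\<alpha>. co \<alpha> v"] pos finite_Rp
  by (smt (verit, best) DiffD1)
 have "C > 0" unfolding C_def using sum_nonneg[of Rp "\<lambda>\<alpha>. co \<alpha> v"] pos by (smt (verit))
 have "0 < co \<alpha> ((1/C) *\<^sub>R v) \<and> co \<alpha> ((1/C) *\<^sub>R v) < 1" if "\<alpha> \<in> Rp" for \<alpha>
  using pos[OF that] C[OF that] \<open>C > 0\<close> Rp_subset that by (auto simp: co_simps subset_iff)
 thus ?thesis using that by blast
qed

end

section \<open>The root lattice, the affine Weyl group and affine roots\<close>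

context root_datum
begin

abbreviation "Q \<equiv> root_lattice D"
abbreviation "affW \<equiv> affine_weyl D"

lemma Q_def: "Q = {\<Sum>\<alpha>\<in>R. of_int (c \<alpha>) *\<^sub>R \<alpha> | c :: 'v \<Rightarrow> int. True}"
 by (simp add: root_lattice_def)

lemma Q_0: "0 \<in> Q"
 unfolding Q_def by (rule CollectI) (rule exI[of _ "\<lambda>_. 0"], simp)

lemma Q_add: "x \<in> Q ==> y \<in> Q ==> x + y \<in> Q"
 unfolding Q_def
proof clarsimp
 fix c d :: "'v \<Rightarrow> int"
 show "\<exists>e. (\<Sum>\<alpha>\<in>R. of_int (c \<alpha>) *\<^sub>R \<alpha>) + (\<Sum>\<alpha>\<in>R. of_int (d \<alpha>) *\<^sub>R \<alpha>) = (\<Sum>\<alpha>\<in>R. of_int (e \<alpha>) *\<^sub>R \<alpha>)"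
  by (rule exI[of _ "\<lambda>\<alpha>. c \<alpha> + d \<alpha>"]) (simp add: sum.distrib algebra_simps)
qed

lemma Q_int: "x \<in> Q ==> of_int n *\<^sub>R x \<in> Q"
 unfolding Q_def
proof clarsimp
 fix c :: "'v \<Rightarrow> int"
 show "\<exists>e. of_int n *\<^sub>R (\<Sum>\<alpha>\<in>R. of_int (c \<alpha>) *\<^sub>R \<alpha>) = (\<Sum>\<alpha>\<in>R. of_int (e \<alpha>) *\<^sub>R \<alpha>)"
  by (rule exI[of _ "\<lambda>\<alpha>. n * c \<alpha>"]) (simp add: scaleR_sum_right)
qed

lemma Q_neg: "x \<in> Q ==> - x \<in> Q"
 using Q_int[of x "-1"] by simp

lemma Q_root: assumes "\<alpha> \<in> R" shows "\<alpha> \<in> Q"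
proof -
 have "(\<Sum>\<beta>\<in>R. of_int (if \<beta> = \<alpha> then 1 else 0) *\<^sub>R \<beta>) = (\<Sum>\<beta>\<in>R. if \<beta> = \<alpha> then \<beta> else 0)"
  by (rule sum.cong) auto
 also have "\<dots> = \<alpha>" using assms finite_R by simp
 finally have "\<alpha> = (\<Sum>\<beta>\<in>R. of_int (if \<beta> = \<alpha> then 1 else 0) *\<^sub>R \<beta>)" ..
 thus ?thesis unfolding Q_def by (intro CollectI exI[of _ "\<lambda>\<beta>. if \<beta> = \<alpha> then 1 else 0"]) simp
qed

lemma Q_induct [consumes 1, case_names zero root add neg]:
 assumes "x \<in> Q" "P 0" "\<And>\<alpha>. \<alpha> \<in> R ==> P \<alpha>" "\<And>x y. x \<in> Q ==> y \<in> Q ==> P x ==> P y ==> P (x + y)"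
  "\<And>x. x \<in> Q ==> P x ==> P (- x)"
 shows "P x"
proof -
 have nat: "P (of_int (int n) *\<^sub>R \<alpha>)" if "\<alpha> \<in> R" for n \<alpha>
 proof (induction n)
  case (Suc n)
  have "of_int (int (Suc n)) *\<^sub>R \<alpha> = of_int (int n) *\<^sub>R \<alpha> + \<alpha>" by (simp add: algebra_simps)
  thus ?case using assms(4)[OF Q_int[OF Q_root[OF that]] Q_root[OF that] Suc assms(3)[OF that]] by metis
 qed (use assms(2) in simp)
 have int: "P (of_int n *\<^sub>R \<alpha>)" if "\<alpha> \<in> R" for n \<alpha>
 proof (cases "n \<ge> 0")
  case True
  thus ?thesis using nat[OF that, of "nat n"] by simp
 next
  case False
  hence "of_int n *\<^sub>R \<alpha> = - (of_int (int (nat (- n))) *\<^sub>R \<alpha>)" by simp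
  thus ?thesis using assms(5)[OF Q_int[OF Q_root[OF that]] nat[OF that]] by metis
 qed
 obtain c where c: "x = (\<Sum>\<alpha>\<in>R. of_int (c \<alpha>) *\<^sub>R \<alpha>)" using assms(1) unfolding Q_def by blast
 have "(\<Sum>\<alpha>\<in>S. of_int (c \<alpha>) *\<^sub>R \<alpha>) \<in> Q \<and> P (\<Sum>\<alpha>\<in>S. of_int (c \<alpha>) *\<^sub>R \<alpha>)" if "finite S" "S \<subseteq> R" for S
  using that
 proof (induction S rule: finite_induct)
  case (insert \<alpha> S)
  thus ?case using Q_add Q_int[OF Q_root] assms(4)[OF Q_int[OF Q_root]] int by simp
 qed (use Q_0 assms(2) in simp)
 thus ?thesis using c finite_R by simp
qed

lemma co_Q: "x \<in> Q ==> \<alpha> \<in> R ==> co \<alpha> x \<in> \<int>"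
 by (induction rule: Q_induct) (auto simp: co_simps co_int)

lemma sym_grp_Q: "x \<in> Q ==> g \<in> sym_grp ==> g x \<in> Q"
proof (induction rule: Q_induct)
 case (root \<alpha>)
 thus ?case using Q_root co_sym_grp by blast
qed (auto simp: linear_0[OF sym_grp_linear] linear_add[OF sym_grp_linear] linear_neg[OF sym_grp_linear]
 Q_0 Q_add Q_neg)

lemma bij_aff_refl: "\<alpha> \<in> R ==> bij (aff_refl D \<alpha> n)"
 using aff_refl_invol by (intro involuntory_imp_bij) auto

lemma inv_aff_refl: "\<alpha> \<in> R ==> Hilbert_Choice.inv (aff_refl D \<alpha> n) = aff_refl D \<alpha> n"
 using aff_refl_invol by (intro inv_unique_comp) auto

lemma affW_gen_bij: "h \<in> {aff_refl D \<alpha> n | \<alpha> n. \<alpha> \<in> Rp} ==> bij h"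
 using bij_aff_refl Rp_subset by auto

lemma affW_id: "id \<in> affW"
 unfolding affine_weyl_def by (rule generate_Bij_id[OF affW_gen_bij])

lemma affW_comp: "v \<in> affW ==> w \<in> affW ==> v \<circ> w \<in> affW"
 unfolding affine_weyl_def by (rule generate_Bij_comp[OF affW_gen_bij])

lemma affW_bij: "w \<in> affW ==> bij w"
 unfolding affine_weyl_def by (rule generate_Bij_bij[OF affW_gen_bij])

lemma affW_refl: assumes "\<alpha> \<in> R" shows "aff_refl D \<alpha> n \<in> affW"
proof -
 have *: "\<beta> \<in> Rp ==> aff_refl D \<beta> m \<in> affW" for \<beta> m
  unfolding affine_weyl_def by (rule generate.incl) blast
 show ?thesis using Rp_cases[OF assms] * aff_refl_neg[OF assms] by metis
qed

lemma affW_induct [consumes 1, case_names id refl comp]: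
 assumes "w \<in> affW" "P id" "\<And>\<alpha> n. \<alpha> \<in> R ==> P (aff_refl D \<alpha> n)"
  "\<And>u v. u \<in> affW ==> v \<in> affW ==> P u ==> P v ==> P (u \<circ> v)"
 shows "P w"
proof (rule generate_Bij_induct[of "{aff_refl D \<alpha> n | \<alpha> n. \<alpha> \<in> Rp}" w P, OF affW_gen_bij])
 show "w \<in> generate (BijGroup UNIV) {aff_refl D \<alpha> n |\<alpha> n. \<alpha> \<in> Rp}"
  using assms(1) by (simp add: affine_weyl_def)
qed (use assms inv_aff_refl Rp_subset in \<open>auto simp: affine_weyl_def\<close>)

lemma affW_inv: "w \<in> affW ==> Hilbert_Choice.inv w \<in> affW"
proof (induction rule: affW_induct)
 case (comp u v)
 hence "Hilbert_Choice.inv (u \<circ> v) = Hilbert_Choice.inv v \<circ> Hilbert_Choice.inv u"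
  using affW_bij by (intro o_inv_distrib)
 thus ?case using comp affW_comp by metis
qed (simp_all only: inv_id affW_id inv_aff_refl affW_refl)

lemma affW_transl: "\<gamma> \<in> Q ==> (+) \<gamma> \<in> affW"
proof (induction rule: Q_induct)
 case zero
 have "(+) (0::'v) = id" by auto
 thus ?case using affW_id by metis
next
 case (root \<alpha>)
 \<comment> \<open>Translation by a root is the product of the reflections in two adjacent parallel
   hyperplanes.\<close>
 have "(+) \<alpha> = aff_refl D \<alpha> 1 \<circ> aff_refl D \<alpha> 0"
  using root by (auto simp: aff_refl_def fun_eq_iff co_simps co_self algebra_simps scaleR_2)
 thus ?case using affW_comp affW_refl root by metis
next
 case (add x y)
 have "(+) (x + y) = (+) x \<circ> (+) y" by (auto simp: fun_eq_iff add.assoc)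
 thus ?case using affW_comp add by metis
next
 case (neg x)
 have "Hilbert_Choice.inv ((+) x) = (+) (- x)" by (rule inv_unique_comp) (auto simp: fun_eq_iff)
 thus ?case using affW_inv neg by metis
qed

text \<open>Reflections have this shape, and it is stable under composition because
  \<open>sym_grp\<close> preserves the root lattice.\<close>

lemma affW_decomp:
 assumes "w \<in> affW" obtains g \<gamma> where "g \<in> sym_grp" "\<gamma> \<in> Q" "w = (\<lambda>v. g v + \<gamma>)"
proof -
 have "\<exists>g\<in>sym_grp. \<exists>\<gamma>\<in>Q. w = (\<lambda>v. g v + \<gamma>)" using assms
 proof (induction rule: affW_induct)
  case id
  show ?case by (rule bexI[OF _ id_sym_grp], rule bexI[OF _ Q_0]) auto
 next
  case (refl \<alpha> n)
  show ?case
   by (rule bexI[OF _ refl_sym_grp[OF refl]], rule bexI[OF _ Q_int[OF Q_root[OF refl]]])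
    (auto simp: aff_refl_def algebra_simps)
 next
  case (comp u v)
  then obtain g \<gamma> h \<delta> where *: "g \<in> sym_grp" "\<gamma> \<in> Q" "u = (\<lambda>v. g v + \<gamma>)"
   "h \<in> sym_grp" "\<delta> \<in> Q" "v = (\<lambda>v. h v + \<delta>)" by blast
  thus ?case
   by (intro bexI[OF _ sym_grp_comp[of g h]] bexI[OF _ Q_add[OF sym_grp_Q[of \<delta> g] *(2)]])
    (auto simp: linear_add[OF sym_grp_linear])
 qed
 thus ?thesis using that by blast
qed

text \<open>Affine roots: a root of either sign and an integer. Every hyperplane thus occurs for two
  affine roots, \<open>a\<close> and \<open>ng a\<close>, one for each side.\<close>

definition AR :: "('v \<times> int) set" where "AR = R \<times> UNIV"
definition ev :: "'v \<times> int \<Rightarrow> 'v \<Rightarrow> real" where "ev a v = co (fst a) v - of_int (snd a)"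
definition rf :: "'v \<times> int \<Rightarrow> 'v \<Rightarrow> 'v" where "rf a = aff_refl D (fst a) (snd a)"
definition ng :: "'v \<times> int \<Rightarrow> 'v \<times> int" where "ng a = (- fst a, - snd a)"

lemma rf_ev: "rf a v = v - ev a v *\<^sub>R fst a"
 by (simp add: rf_def ev_def aff_refl_def)

lemma ng: assumes "a \<in> AR" shows "ng a \<in> AR" "ev (ng a) v = - ev a v" "rf (ng a) = rf a" "ng (ng a) = a"
 using assms neg_root co_neg aff_refl_neg by (auto simp: AR_def ng_def ev_def rf_def)

lemma rf_affW: "a \<in> AR ==> rf a \<in> affW"
 by (auto simp: AR_def rf_def affW_refl)

lemma rf_rf: "a \<in> AR ==> rf a (rf a v) = v"
 by (auto simp: AR_def rf_def aff_refl_invol)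

lemma ev_rf: "a \<in> AR ==> ev a (rf a v) = - ev a v"
 by (auto simp: AR_def rf_def ev_def aff_refl_def co_simps co_self algebra_simps)

text \<open>This is where reducedness enters: proportional affine functions come from proportional
  roots, and these agree up to sign.\<close>

lemma ev_prop:
 assumes "a \<in> AR" "b \<in> AR" "\<And>v. ev a v = c * ev b v"
 shows "a = b \<and> c = 1 \<or> a = ng b \<and> c = -1"
proof -
 have R: "fst a \<in> R" "fst b \<in> R" using assms by (auto simp: AR_def)
 have c0: "of_int (snd a) = c * of_int (snd b)"
  using assms(3)[of 0] R by (simp add: ev_def co_simps)
 have cc: "co (fst a) v = c * co (fst b) v" for v
  using assms(3)[of v] c0 by (simp add: ev_def algebra_simps)
 \<comment> \<open>Proportionality passes from coroots to roots through \<open>form\<close>, whose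
   nondegeneracy then gives an identity of vectors.\<close>
 define d where "d = c * form (fst a) (fst a) / form (fst b) (fst b)"
 have pos: "form (fst a) (fst a) > 0" "form (fst b) (fst b) > 0" using R root_nonzero form_pos by auto
 have "form v (fst a) = d * form v (fst b)" for v
  using cc[of v] pos R unfolding d_def by (simp add: co_form field_simps)
 hence "form v (fst a - d *\<^sub>R fst b) = 0" for v by (simp add: form_simps)
 hence eq: "fst a = d *\<^sub>R fst b" using form_pos by (metis eq_iff_diff_eq_0 less_irrefl)
 hence d: "d = 1 \<or> d = -1" using reduced R unfolding reduced_root_system_def by metis
 hence fs: "fst a = fst b \<or> fst a = - fst b" using eq by auto
 hence ca: "co (fst a) (fst b) = 2 \<or> co (fst a) (fst b) = -2"
  using R co_self co_neg by auto
 from fs show ?thesis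
 proof
  assume "fst a = fst b"
  hence "c = 1" using cc[of "fst b"] R by (simp add: co_self)
  thus ?thesis using \<open>fst a = fst b\<close> c0 by (auto simp: prod_eq_iff)
 next
  assume f: "fst a = - fst b"
  hence "c = -1" using cc[of "fst b"] R co_neg[of "fst b"] by (simp add: co_self)
  thus ?thesis using f c0 by (auto simp: prod_eq_iff ng_def)
 qed
qed

lemma ev_inj: "a \<in> AR ==> b \<in> AR ==> (\<And>v. ev a v = ev b v) ==> a = b"
 using ev_prop[of a b 1] by force

text \<open>The linear part of \<open>w\<close> permutes the roots, and coroots are integral on the
  root lattice, so the composite of an affine root with \<open>w\<close> has again an integral
  constant term.\<close>

lemma pullback_ex:
 assumes w: "w \<in> affW" and a: "a \<in> AR"
 obtains b where "b \<in> AR" "\<And>v. ev b v = ev a (w v)" "\<And>v. w (rf b v) = rf a (w v)"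
proof -
 obtain g \<gamma> where g: "g \<in> sym_grp" "\<gamma> \<in> Q" "w = (\<lambda>v. g v + \<gamma>)" using affW_decomp[OF w] .
 have aR: "fst a \<in> R" using a by (auto simp: AR_def)
 then obtain \<beta> where \<beta>: "\<beta> \<in> R" "g \<beta> = fst a" using g(1) unfolding sym_grp_def by (metis (mono_tags, lifting) imageE mem_Collect_eq)
 obtain m where m: "co (fst a) \<gamma> = of_int m" using co_Q[OF g(2) aR] by (auto elim: Ints_cases)
 define b where "b = (\<beta>, snd a - m)"
 have b: "b \<in> AR" using \<beta> by (auto simp: b_def AR_def)
 have e: "ev b v = ev a (w v)" for v
  using co_sym_grp(2)[OF g(1) \<beta>(1), of v] \<beta>(2) m aR unfolding g(3) b_def ev_def by (simp add: co_simps)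
 have "w (rf b v) = rf a (w v)" for v
  unfolding rf_ev e using \<beta> linear_diff[OF sym_grp_linear[OF g(1)]] linear_scale[OF sym_grp_linear[OF g(1)]]
  unfolding g(3) b_def by simp
 thus ?thesis using that b e by blast
qed

text \<open>The pullback of an affine root along \<open>w\<close>; by \<open>ev_inj\<close> there is
  only one candidate for this choice.\<close>

definition pb :: "('v \<Rightarrow> 'v) \<Rightarrow> 'v \<times> int \<Rightarrow> 'v \<times> int" where
 "pb w a = (SOME b. b \<in> AR \<and> (\<forall>v. ev b v = ev a (w v)) \<and> (\<forall>v. w (rf b v) = rf a (w v)))"

lemma pb:
 assumes "w \<in> affW" "a \<in> AR"
 shows "pb w a \<in> AR" "ev (pb w a) v = ev a (w v)" "w (rf (pb w a) v) = rf a (w v)"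
proof -
 have "\<exists>b. b \<in> AR \<and> (\<forall>v. ev b v = ev a (w v)) \<and> (\<forall>v. w (rf b v) = rf a (w v))"
  using pullback_ex[OF assms] by metis
 from someI_ex[OF this] show "pb w a \<in> AR" "ev (pb w a) v = ev a (w v)" "w (rf (pb w a) v) = rf a (w v)"
  unfolding pb_def by auto
qed

definition Reg :: "'v \<Rightarrow> bool" where "Reg p \<longleftrightarrow> (\<forall>a\<in>AR. ev a p \<noteq> 0)"
text \<open>Asking for positivity alone is enough: with \<open>a\<close> also \<open>ng a\<close> is
  an affine root, so for a regular point the sign of every affine root is fixed.\<close>

definition alc :: "'v \<Rightarrow> 'v set" where "alc p = {q. \<forall>a\<in>AR. ev a p > 0 --> ev a q > 0}"

lemma alc_self: "p \<in> alc p" by (simp add: alc_def)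

lemma alc_sgn:
 assumes "Reg p" "q \<in> alc p" "a \<in> AR" shows "ev a q > 0 \<longleftrightarrow> ev a p > 0" "ev a q < 0 \<longleftrightarrow> ev a p < 0"
proof -
 have 1: "ev a p > 0 ==> ev a q > 0" using assms by (auto simp: alc_def)
 have "ev (ng a) p > 0 ==> ev (ng a) q > 0" using assms ng(1) by (auto simp: alc_def)
 hence 2: "ev a p < 0 ==> ev a q < 0" using ng(2)[OF assms(3)] by auto
 have "ev a p \<noteq> 0" using assms by (auto simp: Reg_def)
 thus "ev a q > 0 \<longleftrightarrow> ev a p > 0" "ev a q < 0 \<longleftrightarrow> ev a p < 0" using 1 2 by linarith+
qed

lemma alc_Reg: "Reg p ==> q \<in> alc p ==> Reg q"
 unfolding Reg_def using alc_sgn[of p q] by (force simp: Reg_def)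

lemma alc_eq: "Reg p ==> q \<in> alc p ==> alc q = alc p"
 using alc_sgn(1)[of p q] unfolding alc_def[of p] alc_def[of q] by (intro Collect_cong ball_cong) auto

lemma affW_Reg: assumes "w \<in> affW" "Reg p" shows "Reg (w p)"
 using pb[OF assms(1)] assms(2) unfolding Reg_def by metis

lemma affW_alc: assumes w: "w \<in> affW" shows "w ` alc p = alc (w p)"
proof -
 have 1: "u ` alc q \<subseteq> alc (u q)" if "u \<in> affW" for u q
  using pb[OF that] unfolding alc_def by auto metis
 show ?thesis
 proof
  show "w ` alc p \<subseteq> alc (w p)" using 1 w .
  let ?u = "Hilbert_Choice.inv w"
  have b: "bij w" using affW_bij w .
  have "?u ` alc (w p) \<subseteq> alc (?u (w p))" using 1[OF affW_inv[OF w]] .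
  hence "?u ` alc (w p) \<subseteq> alc p" using b by (simp add: bij_is_inj)
  hence "w ` ?u ` alc (w p) \<subseteq> w ` alc p" by (rule image_mono)
  thus "alc (w p) \<subseteq> w ` alc p" using b by (simp add: image_image surj_f_inv_f bij_is_surj)
 qed
qed

lemma continuous_ev: "a \<in> AR ==> continuous_on S (ev a)"
 unfolding ev_def using linear_continuous_on[OF linear_conv_bounded_linear[THEN iffD1, OF linear_co]]
 by (auto intro!: continuous_intros simp: AR_def)

lemma convex_alc: "convex (alc p)"
proof (rule convexI)
 fix x y :: 'v and u v :: real
 assume xy: "x \<in> alc p" "y \<in> alc p" and uv: "0 \<le> u" "0 \<le> v" "u + v = 1"
 show "u *\<^sub>R x + v *\<^sub>R y \<in> alc p" unfolding alc_def
 proof clarify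
  fix \<alpha> n assume a: "(\<alpha>, n) \<in> AR" "0 < ev (\<alpha>, n) p"
  hence \<alpha>: "\<alpha> \<in> R" by (auto simp: AR_def)
  have pos: "ev (\<alpha>, n) x > 0" "ev (\<alpha>, n) y > 0" using a xy by (auto simp: alc_def)
  have "ev (\<alpha>, n) (u *\<^sub>R x + v *\<^sub>R y) = u * ev (\<alpha>, n) x + v * ev (\<alpha>, n) y"
   using uv(3) \<alpha> by (simp add: ev_def co_simps algebra_simps) (metis distrib_right mult.commute mult_1)
  also have "\<dots> > 0" using pos uv
   by (metis add.commute add_0 add_strict_increasing le_less mult_eq_0_iff mult_pos_pos zero_neq_one)
  finally show "0 < ev (\<alpha>, n) (u *\<^sub>R x + v *\<^sub>R y)" .
 qed
qed

lemma Reg_set: "{p. Reg p} = UNIV - (\<Union>\<alpha>\<in>Rp. \<Union>n. hyperplane D \<alpha> n)"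
proof -
 have "Reg p \<longleftrightarrow> (\<forall>\<alpha>\<in>Rp. \<forall>n. co \<alpha> p \<noteq> of_int n)" for p
 proof
  show "Reg p ==> \<forall>\<alpha>\<in>Rp. \<forall>n. co \<alpha> p \<noteq> of_int n"
   using Rp_subset by (force simp: Reg_def AR_def ev_def)
  assume *: "\<forall>\<alpha>\<in>Rp. \<forall>n. co \<alpha> p \<noteq> of_int n"
  show "Reg p" unfolding Reg_def
  proof
   fix a assume a: "a \<in> AR"
   then consider "fst a \<in> Rp" | "fst (ng a) \<in> Rp" using Rp_cases by (fastforce simp: AR_def ng_def)
   thus "ev a p \<noteq> 0"
   proof cases
    case 1 thus ?thesis using * by (simp add: ev_def)
   next
    case 2 hence "ev (ng a) p \<noteq> 0" using * by (simp add: ev_def)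
    thus ?thesis using ng(2)[OF a] by simp
   qed
  qed
 qed
 thus ?thesis by (auto simp: hyperplane_def)
qed

text \<open>Sign regions are convex, hence connected. Conversely an affine root cannot change sign
  on a connected set of regular points, by the intermediate value theorem. Alcoves can therefore be
  handled through signs.\<close>

lemma alcoves_eq: "alcoves D = {alc p | p. Reg p}"
proof -
 have cc: "connected_component_set {p. Reg p} p = alc p" if p: "Reg p" for p
 proof
  show "alc p \<subseteq> connected_component_set {p. Reg p} p"
   using alc_self alc_Reg[OF p] by (intro connected_component_maximal convex_connected convex_alc) auto
  show "connected_component_set {p. Reg p} p \<subseteq> alc p"
  proof
   fix q assume q: "q \<in> connected_component_set {p. Reg p} p"
   let ?C = "connected_component_set {p. Reg p} p"
   have pC: "p \<in> ?C" using p by (simp add: connected_component_refl)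
   have sub: "?C \<subseteq> {p. Reg p}" by (rule connected_component_subset)
   show "q \<in> alc p" unfolding alc_def
   proof clarify
    fix \<alpha> n assume a: "(\<alpha>, n) \<in> AR" "0 < ev (\<alpha>, n) p"
    show "0 < ev (\<alpha>, n) q"
    proof (rule ccontr)
     assume n: "\<not> 0 < ev (\<alpha>, n) q"
     have "connected (ev (\<alpha>, n) ` ?C)"
      by (intro connected_continuous_image continuous_ev a(1)) simp
     hence "0 \<in> ev (\<alpha>, n) ` ?C"
      using a(2) n imageI[OF pC, of "ev (\<alpha>, n)"] imageI[OF q, of "ev (\<alpha>, n)"]
      unfolding connected_iff_interval by (meson less_imp_le not_less)
     thus False using sub a(1) by (auto simp: Reg_def)
    qed
   qed
  qed
 qed
 show ?thesis unfolding alcoves_def components_def Reg_set[symmetric] using cc by auto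
qed

end

section \<open>The base alcove, separating hyperplanes and walls\<close>

context root_datum
begin

definition p0 :: 'v where "p0 = (SOME v. \<forall>\<alpha>\<in>Rp. 0 < co \<alpha> v \<and> co \<alpha> v < 1)"

lemma p0: "\<alpha> \<in> Rp ==> 0 < co \<alpha> p0" "\<alpha> \<in> Rp ==> co \<alpha> p0 < 1"
proof -
 have "\<exists>v. \<forall>\<alpha>\<in>Rp. 0 < co \<alpha> v \<and> co \<alpha> v < 1" using dominant_exists by metis
 from someI_ex[OF this] show "\<alpha> \<in> Rp ==> 0 < co \<alpha> p0" "\<alpha> \<in> Rp ==> co \<alpha> p0 < 1"
  unfolding p0_def by auto
qed

text \<open>No integer lies strictly between 0 and 1, so these inequalities decide the sign of every
  affine root.\<close>

lemma alc_p0I: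
 assumes q: "\<And>\<alpha>. \<alpha> \<in> Rp ==> 0 < co \<alpha> q" "\<And>\<alpha>. \<alpha> \<in> Rp ==> co \<alpha> q < 1"
 shows "q \<in> alc p0"
 unfolding alc_def
proof clarify
 fix \<alpha> n assume a: "(\<alpha>, n) \<in> AR" "0 < ev (\<alpha>, n) p0"
 hence R: "\<alpha> \<in> R" by (auto simp: AR_def)
 show "0 < ev (\<alpha>, n) q"
 proof (cases "\<alpha> \<in> Rp")
  case True
  hence "real_of_int n < 1" using a(2) p0(2)[OF True] by (simp add: ev_def)
  thus ?thesis using q(1)[OF True] by (simp add: ev_def)
 next
  case False
  hence m: "- \<alpha> \<in> Rp" using Rp_cases R by blast
  have "co \<alpha> p0 = - co (- \<alpha>) p0" "co \<alpha> q = - co (- \<alpha>) q" using co_neg[OF R] by auto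
  hence "real_of_int n < 0" "- 1 < co \<alpha> q" using a(2) p0(1)[OF m] q(2)[OF m] by (auto simp: ev_def)
  hence "n \<le> -1" by simp
  hence "real_of_int n \<le> -1" by linarith
  thus ?thesis using \<open>- 1 < co \<alpha> q\<close> by (simp add: ev_def)
 qed
qed

lemma Reg_p0: "Reg p0"
proof -
 have "p0 \<notin> hyperplane D \<alpha> n" if "\<alpha> \<in> Rp" for \<alpha> n
 proof
  assume "p0 \<in> hyperplane D \<alpha> n"
  hence "0 < real_of_int n" "real_of_int n < 1" using p0[OF that] by (auto simp: hyperplane_def)
  thus False by simp
 qed
 thus ?thesis using Reg_set by blast
qed

lemma base_alcove_eq: "base_alcove D = alc p0"
 unfolding base_alcove_def
proof (rule the_equality)
 have dom: "alc p0 \<subseteq> {v. \<forall>\<alpha>\<in>Rp. coroot D \<alpha> v > 0}"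
 proof clarify
  fix v \<alpha> assume "v \<in> alc p0" "\<alpha> \<in> Rp"
  thus "0 < co \<alpha> v" using alc_sgn(1)[OF Reg_p0, of v "(\<alpha>, 0)"] Rp_subset p0(1)
   by (auto simp: AR_def ev_def)
 qed
 have "0 \<in> closure (alc p0)"
  unfolding closure_approachable
 proof clarify
  fix e :: real assume e: "0 < e"
  \<comment> \<open>At most 1, so that the coroots stay below 1; the second bound makes the norm of
    \<open>t *\<^sub>R p0\<close> smaller than \<open>e\<close>.\<close>
  define t where "t = min 1 (e / (norm p0 + 1))"
  have np: "norm p0 + 1 > 0" by (simp add: add_nonneg_pos)
  have t: "0 < t" "t \<le> 1" using e np by (auto simp: t_def)
  have "t *\<^sub>R p0 \<in> alc p0"
  proof (rule alc_p0I)
   fix \<alpha> assume \<alpha>: "\<alpha> \<in> Rp"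
   hence e: "co \<alpha> (t *\<^sub>R p0) = t * co \<alpha> p0" using Rp_subset by (auto simp: co_simps)
   show "0 < co \<alpha> (t *\<^sub>R p0)" unfolding e using t p0[OF \<alpha>] by simp
   have "t * co \<alpha> p0 \<le> 1 * co \<alpha> p0" using t p0[OF \<alpha>] by (intro mult_right_mono) auto
   thus "co \<alpha> (t *\<^sub>R p0) < 1" unfolding e using p0[OF \<alpha>] by linarith
  qed
  moreover have "dist (t *\<^sub>R p0) 0 < e"
  proof -
   have "norm p0 * t \<le> norm p0 * (e / (norm p0 + 1))" unfolding t_def by (intro mult_left_mono) auto
   also have "\<dots> < e" using e np by (simp add: field_simps)
   finally show ?thesis using t by (simp add: mult.commute)
  qed
  ultimately show "\<exists>y\<in>alc p0. dist y 0 < e" by blast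
 qed
 thus "alc p0 \<in> alcoves D \<and> alc p0 \<subseteq> {v. \<forall>\<alpha>\<in>Rp. coroot D \<alpha> v > 0} \<and> 0 \<in> closure (alc p0)"
  using Reg_p0 alcoves_eq dom by blast
next
 fix A assume A: "A \<in> alcoves D \<and> A \<subseteq> {v. \<forall>\<alpha>\<in>Rp. coroot D \<alpha> v > 0} \<and> 0 \<in> closure A"
 then obtain p where p: "Reg p" "A = alc p" unfolding alcoves_eq by blast
 have "p \<in> alc p0"
 proof (rule alc_p0I)
  fix \<alpha> assume \<alpha>: "\<alpha> \<in> Rp"
  show "0 < co \<alpha> p" using A p alc_self \<alpha> by blast
  have a: "(\<alpha>, 1) \<in> AR" using \<alpha> Rp_subset by (auto simp: AR_def)
  show "co \<alpha> p < 1"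
  proof (rule ccontr)
   \<comment> \<open>Then all of \<open>A\<close> lies beyond the hyperplane on which \<alpha> takes
     the value 1, and 0 is not in its closure.\<close>
   assume "\<not> co \<alpha> p < 1"
   hence "ev (\<alpha>, 1) p > 0" using p(1) a unfolding Reg_def
    by (metis ev_def fst_conv snd_conv of_int_1 diff_gt_0_iff_gt linorder_neqE_linordered_idom right_minus_eq)
   hence "A \<subseteq> {v. ev (\<alpha>, 1) v \<ge> 0}" using p(2) a by (force simp: alc_def)
   moreover have "closed {v. ev (\<alpha>, 1) v \<ge> 0}"
    using continuous_ev[OF a] by (intro closed_Collect_le continuous_on_const)
   ultimately have "closure A \<subseteq> {v. ev (\<alpha>, 1) v \<ge> 0}" by (rule closure_minimal)
   hence "ev (\<alpha>, 1) 0 \<ge> 0" using A by blast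
   thus False using a by (simp add: ev_def AR_def co_simps)
  qed
 qed
 thus "A = alc p0" using alc_eq[OF Reg_p0] p(2) by simp
qed

text \<open>Of the two affine roots of a separating hyperplane, only the one positive at
  \<open>p\<close> is taken, so the cardinality counts hyperplanes.\<close>

definition sep :: "'v \<Rightarrow> 'v \<Rightarrow> ('v \<times> int) set" where "sep p q = {a\<in>AR. ev a p > 0 \<and> ev a q < 0}"

lemma finite_sep: "finite (sep p q)"
proof (rule finite_subset)
 show "sep p q \<subseteq> (SIGMA \<alpha>:R. {\<lfloor>co \<alpha> q\<rfloor>..\<lceil>co \<alpha> p\<rceil>})"
 proof
  fix a assume a: "a \<in> sep p q"
  obtain \<alpha> n where [simp]: "a = (\<alpha>, n)" by (cases a)
  have "\<alpha> \<in> R" "of_int n < co \<alpha> p" "co \<alpha> q < of_int n" using a by (auto simp: sep_def AR_def ev_def)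
  thus "a \<in> (SIGMA \<alpha>:R. {\<lfloor>co \<alpha> q\<rfloor>..\<lceil>co \<alpha> p\<rceil>})"
   by (simp add: floor_le_iff le_ceiling_iff)
 qed
qed (use finite_R in auto)

lemma sep_swap: "card (sep q p) = card (sep p q)"
proof (rule bij_betw_same_card[of ng])
 show "bij_betw ng (sep q p) (sep p q)"
  by (rule bij_betwI[where g=ng]) (auto simp: sep_def ng)
qed

lemma sep_affW: assumes w: "w \<in> affW" shows "card (sep (w p) (w q)) = card (sep p q)"
proof (rule bij_betw_same_card[of "pb w"])
 let ?u = "Hilbert_Choice.inv w"
 note u = affW_inv[OF w]
 have wu: "w (?u v) = v" "?u (w v) = v" for v using affW_bij[OF w]
  by (auto simp: surj_f_inv_f bij_is_surj bij_is_inj)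
 have i: "pb ?u (pb w a) = a" "pb w (pb ?u a) = a" if "a \<in> AR" for a
  by (intro ev_inj; simp add: that pb(1,2)[OF w] pb(1,2)[OF u] wu)+
 show "bij_betw (pb w) (sep (w p) (w q)) (sep p q)"
  by (rule bij_betwI[where g="pb ?u"]) (auto simp: sep_def pb(1,2)[OF w] pb(1,2)[OF u] i wu simp del: split_paired_All)
qed

lemma sep_empty: "Reg p ==> Reg q ==> sep p q = {} ==> alc q = alc p"
 by (rule alc_eq) (force simp: sep_def alc_def Reg_def)+

text \<open>The walls of the base alcove, by the property that matters for length arguments: the
  reflection of \<open>p0\<close> in a wall crosses no other hyperplane. The sign is the one
  positive at \<open>p0\<close>.\<close>

definition Pi :: "('v \<times> int) set" where "Pi = {a\<in>AR. sep p0 (rf a p0) = {a}}"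

lemma Pi_AR: "a \<in> Pi ==> a \<in> AR" by (simp add: Pi_def)

lemma Pi_pos: assumes "a \<in> Pi" shows "ev a p0 > 0"
proof -
 have "a \<in> sep p0 (rf a p0)" using assms unfolding Pi_def by blast
 thus ?thesis by (simp add: sep_def)
qed

lemma Pi_rf: assumes "a \<in> Pi" "b \<in> AR" "b \<noteq> a" "ev b p0 > 0" shows "ev b (rf a p0) > 0"
proof -
 have "ev b (rf a p0) \<noteq> 0" using affW_Reg[OF rf_affW[OF Pi_AR[OF assms(1)]] Reg_p0] assms(2) by (auto simp: Reg_def)
 moreover have "b \<notin> sep p0 (rf a p0)" using assms by (auto simp: Pi_def)
 ultimately show ?thesis using assms by (auto simp: sep_def)
qed

text \<open>Strict Cauchy-Schwarz: for non-proportional vectors the component of \<open>x\<close>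
  orthogonal to \<open>y\<close> has positive norm.\<close>

lemma form_CS: assumes "form x y > 0" "\<nexists>c. x = c *\<^sub>R y"
 shows "form x y < sqrt (form x x) * sqrt (form y y)"
proof -
 have y: "y \<noteq> 0" using assms(1) form_simps(6)[of x 0 y] by auto
 define c where "c = form x y / form y y"
 have "x - c *\<^sub>R y \<noteq> 0" using assms(2) by auto
 hence "0 < form (x - c *\<^sub>R y) (x - c *\<^sub>R y)" by (rule form_pos)
 also have "\<dots> = form x x - form x y * form x y / form y y"
  using form_pos[OF y] by (simp add: form_simps form_sym[of y x] c_def field_simps)
 finally have "form x y * form x y < form x x * form y y" using form_pos[OF y] by (simp add: field_simps)
 hence "sqrt (form x y * form x y) < sqrt (form x x * form y y)" by (rule real_sqrt_less_mono)
 thus ?thesis using assms(1) by (simp add: real_sqrt_mult)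
qed

text \<open>Move along the segment from \<open>p0\<close> to \<open>q\<close> and consider the
  hyperplanes met first, all passing through one point \<open>x\<close>. Among these, one nearest to
  \<open>p0\<close> is a wall: if the reflection in it crossed a further hyperplane
  \<open>b\<close>, then \<open>b\<close> and its mirror image would on average be nearer.\<close>

lemma wall_exists:
 assumes q: "Reg q" and ne: "sep p0 q \<noteq> {}"
 obtains a where "a \<in> Pi" "a \<in> sep p0 q"
proof -
 \<comment> \<open>The parameter at which the segment from \<open>p0\<close> to \<open>q\<close>
   meets the hyperplane.\<close>
 define tm where "tm a = ev a p0 / (ev a p0 - ev a q)" for a
 \<comment> \<open>Twice the distance of \<open>p0\<close> from the hyperplane in the metric of
   \<open>form\<close>.\<close>
 define wt where "wt a = ev a p0 * sqrt (form (fst a) (fst a))" for a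
 define X where "X = {a\<in>sep p0 q. \<forall>b\<in>sep p0 q. tm a \<le> tm b}"
 have "finite X" unfolding X_def using finite_sep by simp
 moreover have "X \<noteq> {}"
 proof -
  obtain a where "is_arg_min tm (\<lambda>a. a \<in> sep p0 q) a"
   using ex_is_arg_min_if_finite[OF finite_sep ne] by blast
  hence "a \<in> X" unfolding X_def is_arg_min_linorder by blast
  thus ?thesis by blast
 qed
 ultimately obtain a where "is_arg_min wt (\<lambda>a. a \<in> X) a"
  using ex_is_arg_min_if_finite by blast
 hence a: "a \<in> X" "\<And>b. b \<in> X ==> wt a \<le> wt b" unfolding is_arg_min_linorder by blast+
 have as: "a \<in> sep p0 q" and mn: "\<And>b. b \<in> sep p0 q ==> tm a \<le> tm b" using a(1) by (auto simp: X_def)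
 have aAR: "a \<in> AR" and ap: "ev a p0 > 0" and aq: "ev a q < 0" using as by (auto simp: sep_def)
 have aR: "fst a \<in> R" using aAR by (auto simp: AR_def)
 define t where "t = tm a"
 have t: "0 < t" "t < 1" using ap aq by (auto simp: t_def tm_def field_simps)
 define x where "x = p0 + t *\<^sub>R (q - p0)"
 have evx: "ev b x = (1 - t) * ev b p0 + t * ev b q" if "b \<in> AR" for b
  using that by (auto simp: x_def ev_def AR_def co_simps algebra_simps)
 have ax: "ev a x = 0" unfolding evx[OF aAR] t_def tm_def using ap aq by (simp add: field_simps)
 have nonneg: "ev b x \<ge> 0" if b: "b \<in> AR" "ev b p0 > 0" for b
 proof (cases "ev b q < 0")
  case True
  hence "t \<le> tm b" using mn b by (auto simp: t_def sep_def)
  hence "t * (ev b p0 - ev b q) \<le> ev b p0" using True b unfolding tm_def by (simp add: field_simps)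
  thus ?thesis unfolding evx[OF b(1)] by (simp add: algebra_simps)
 next
  case False
  thus ?thesis unfolding evx[OF b(1)] using t b by simp
 qed
 have inX: "b \<in> X" if b: "b \<in> AR" "ev b p0 > 0" "ev b x = 0" for b
 proof -
  have e: "t * (ev b p0 - ev b q) = ev b p0" using b(3) unfolding evx[OF b(1)] by (simp add: algebra_simps)
  hence pos: "ev b p0 - ev b q > 0" using b(2) t(1) by (metis zero_less_mult_pos)
  hence "tm b = t" using e unfolding tm_def by (simp add: field_simps)
  moreover have "t * ev b q = - (1 - t) * ev b p0" using e by (simp add: algebra_simps)
  hence "t * ev b q < 0" using t b(2) by (simp add: mult_neg_pos)
  hence "ev b q < 0" using t(1) by (simp add: mult_less_0_iff)
  ultimately show ?thesis using b mn by (auto simp: X_def sep_def t_def)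
 qed
 have "b = a" if bs: "b \<in> sep p0 (rf a p0)" for b
 proof (rule ccontr)
  assume ba: "b \<noteq> a"
  \<comment> \<open>The mirror image of \<open>b\<close>, with the sign that is positive at
    \<open>p0\<close>. The sum of \<open>b\<close> and \<open>b'\<close> is a multiple of
    \<open>a\<close>, hence vanishes at \<open>x\<close>; both being nonnegative there, both belong
    to \<open>X\<close>.\<close>
  define b' where "b' = ng (pb (rf a) b)"
  have b: "b \<in> AR" "ev b p0 > 0" "ev b (rf a p0) < 0" using bs by (auto simp: sep_def)
  hence bR: "fst b \<in> R" by (auto simp: AR_def)
  note pbb = pb[OF rf_affW[OF aAR] b(1)]
  have b': "b' \<in> AR" "\<And>v. ev b' v = - ev b (rf a v)" unfolding b'_def using ng pbb by auto
  define k where "k = co (fst b) (fst a)"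
  have ks: "k * ev a v = ev b v + ev b' v" for v
   using bR by (simp add: b'(2) rf_ev ev_def[of b] co_simps k_def algebra_simps)
  have bp': "ev b' p0 > 0" using b b' by simp
  have k: "k > 0" using ks[of p0] ap b(2) bp' by (metis add_pos_pos zero_less_mult_pos2)
  have "ev b x + ev b' x = 0" using ks[of x] ax by simp
  hence "ev b x = 0" "ev b' x = 0" using nonneg[OF b(1,2)] nonneg[OF b'(1) bp'] by auto
  hence X: "b \<in> X" "b' \<in> X" using inX b b' bp' by auto
  \<comment> \<open>A reflection relates the two roots up to sign, so they have the same length and
    the weights can be added.\<close>
  have nb: "form (fst b') (fst b') = form (fst b) (fst b)"
  proof -
   obtain c where c: "c \<in> R" "co c = co (fst b')" "c = fst b'" using b'(1) by (auto simp: AR_def)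
   have "co (fst b') v = - co (fst b) (aff_refl D (fst a) 0 v)" for v
   proof -
    have "ev b' v - ev b' 0 = - (ev b (rf a v) - ev b (rf a 0))" using b'(2) by simp
    moreover have "ev b' v - ev b' 0 = co (fst b') v" using c by (simp add: ev_def co_simps)
    moreover have "ev b (rf a v) - ev b (rf a 0) = co (fst b) (aff_refl D (fst a) 0 v)"
     using aR bR by (simp add: rf_def aff_refl_def ev_def co_simps algebra_simps)
    ultimately show ?thesis by simp
   qed
   moreover have "co (- aff_refl D (fst a) 0 (fst b)) v = - co (fst b) (aff_refl D (fst a) 0 v)" for v
    using co_sym_grp(2)[OF refl_sym_grp[OF aR] bR, of "aff_refl D (fst a) 0 v"]
     co_neg[OF co_sym_grp(1)[OF refl_sym_grp[OF aR] bR]] aff_refl_invol[OF aR] by simp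
   ultimately have *: "\<And>v. co (fst b') v = co (- aff_refl D (fst a) 0 (fst b)) v" by simp
   have r: "- aff_refl D (fst a) 0 (fst b) \<in> R"
    using neg_root co_sym_grp(1)[OF refl_sym_grp[OF aR] bR] by blast
   have "(fst b', 0) = (- aff_refl D (fst a) 0 (fst b), 0::int)"
    using c r * by (intro ev_inj) (auto simp: AR_def ev_def)
   thus ?thesis using form_refl[OF aR, of "fst b" "fst b"] by (simp add: form_simps)
  qed
  have bpos: "form (fst b) (fst b) > 0" and apos: "form (fst a) (fst a) > 0"
   using aR bR root_nonzero form_pos by auto
  show False
  \<comment> \<open>Parallel roots give \<open>b = a\<close>, since both vanish at \<open>x\<close>;
    otherwise strict Cauchy-Schwarz contradicts the minimal weight of \<open>a\<close>.\<close>
  proof (cases "\<exists>c. fst a = c *\<^sub>R fst b")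
   case True
   then obtain c where c: "fst a = c *\<^sub>R fst b" by blast
   hence "c = 1 \<or> c = -1" using reduced aR bR unfolding reduced_root_system_def by metis
   moreover have "c > 0" using k c bR by (simp add: k_def co_simps co_self)
   ultimately have fe: "fst a = fst b" using c by auto
   have "snd a = snd b" using ax \<open>ev b x = 0\<close> fe by (simp add: ev_def)
   thus False using ba fe by (simp add: prod_eq_iff)
  next
   case False
   let ?r = "sqrt (form (fst b) (fst b))" and ?s = "sqrt (form (fst a) (fst a))"
   have kf: "k * form (fst b) (fst b) = 2 * form (fst a) (fst b)"
    using co_form[OF bR, of "fst a"] bpos by (simp add: k_def)
   hence "form (fst a) (fst b) > 0" using k bpos by (metis zero_less_mult_iff mult_pos_pos zero_less_numeral zero_less_mult_pos)
   hence "form (fst a) (fst b) < ?s * ?r" using form_CS False by blast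
   hence "k * (?r * ?r) < 2 * ?s * ?r" using kf bpos by simp
   hence "?r * (k * ?r) < ?r * (2 * ?s)" by (simp only: ac_simps)
   hence kr: "k * ?r < 2 * ?s" using bpos by (simp only: mult_less_cancel_left_pos real_sqrt_gt_zero)
   have "wt b + wt b' = (ev b p0 + ev b' p0) * ?r" unfolding wt_def nb by (simp add: algebra_simps)
   also have "\<dots> = (k * ?r) * ev a p0" using ks[of p0] by simp
   also have "\<dots> < 2 * ?s * ev a p0" using kr ap by (intro mult_strict_right_mono)
   also have "\<dots> = 2 * wt a" unfolding wt_def by simp
   finally show False using a(2)[OF X(1)] a(2)[OF X(2)] by simp
  qed
 qed
 moreover have "a \<in> sep p0 (rf a p0)" using aAR ap ev_rf[OF aAR] by (simp add: sep_def)
 ultimately have "a \<in> Pi" unfolding Pi_def using aAR by blast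
 thus ?thesis using that as by blast
qed

end

section \<open>Words in wall reflections and simple transitivity\<close>

context root_datum
begin

definition rprod :: "('v \<times> int) list \<Rightarrow> 'v \<Rightarrow> 'v" where "rprod as = foldr (\<lambda>a f. rf a \<circ> f) as id"

lemma rprod_simps [simp]: "rprod [] = id" "rprod (a # as) = rf a \<circ> rprod as"
 by (simp_all add: rprod_def)

lemma rprod_append: "rprod (as @ bs) = rprod as \<circ> rprod bs"
 by (induction as) (simp_all add: comp_assoc)

lemma rprod_affW: "set as \<subseteq> Pi ==> rprod as \<in> affW"
proof (induction as)
 case Nil
 thus ?case using affW_id by (simp only: rprod_simps)
next
 case (Cons a as)
 hence "rf a \<circ> rprod as \<in> affW" by (intro affW_comp rf_affW Pi_AR) auto
 thus ?case by (simp only: rprod_simps)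
qed

text \<open>Replacing \<open>p0\<close> by its mirror image in a wall changes the sign of that
  single affine root and of its negative.\<close>

lemma sep_Pi_diff:
 assumes a: "a \<in> Pi" and q: "Reg q"
 shows "ev a q < 0 ==> sep (rf a p0) q = sep p0 q - {a}"
proof -
 note aAR = Pi_AR[OF a]
 assume aq: "ev a q < 0"
 show "sep (rf a p0) q = sep p0 q - {a}"
 proof (intro equalityI subsetI)
  fix b assume b: "b \<in> sep (rf a p0) q"
  hence bAR: "b \<in> AR" and bp: "ev b (rf a p0) > 0" "ev b q < 0" by (auto simp: sep_def)
  have ba: "b \<noteq> a" using bp(1) Pi_pos[OF a] ev_rf[OF aAR] by auto
  have "ev b p0 > 0"
  proof (rule ccontr)
   assume "\<not> ev b p0 > 0"
   hence n: "ev (ng b) p0 > 0" using Reg_p0 bAR ng(2)[OF bAR] unfolding Reg_def by force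
   have "ng b \<noteq> a" using bp(2) aq ng(2)[OF bAR] by auto
   thus False using Pi_rf[OF a ng(1)[OF bAR] _ n] bp ng(2)[OF bAR] by simp
  qed
  thus "b \<in> sep p0 q - {a}" using bAR bp ba by (auto simp: sep_def)
 next
  fix b assume "b \<in> sep p0 q - {a}"
  thus "b \<in> sep (rf a p0) q" using Pi_rf[OF a] by (auto simp: sep_def)
 qed
qed

lemma sep_Pi_card:
 assumes a: "a \<in> Pi" and q: "Reg q" and s: "a \<in> sep p0 q"
 shows "card (sep p0 (rf a q)) < card (sep p0 q)"
proof -
 have w: "rf a \<in> affW" using rf_affW Pi_AR a by blast
 have "card (sep p0 (rf a q)) = card (sep (rf a p0) (rf a (rf a q)))"
  using sep_affW[OF w, of p0 "rf a q"] by simp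
 also have "\<dots> = card (sep p0 q - {a})"
  using sep_Pi_diff[OF a q] s by (simp add: rf_rf[OF Pi_AR[OF a]] sep_def)
 also have "\<dots> < card (sep p0 q)" using s finite_sep by (metis card_Diff1_less)
 finally show ?thesis .
qed

text \<open>Induction on the number of hyperplanes between \<open>p0\<close> and \<open>q\<close>:
  reflecting \<open>q\<close> in a wall of the base alcove that separates the two lowers it.\<close>

lemma transitive:
 assumes "Reg q" shows "\<exists>as. set as \<subseteq> Pi \<and> alc (rprod as p0) = alc q"
 using assms
proof (induction "card (sep p0 q)" arbitrary: q rule: less_induct)
 case less
 show ?case
 proof (cases "sep p0 q = {}")
  case True
  thus ?thesis using sep_empty[OF Reg_p0 less(2)] by (intro exI[of _ "[]"]) simp
 next
  case False
  then obtain a where a: "a \<in> Pi" "a \<in> sep p0 q" using wall_exists less(2) by blast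
  have w: "rf a \<in> affW" using rf_affW Pi_AR a by blast
  obtain as where as: "set as \<subseteq> Pi" "alc (rprod as p0) = alc (rf a q)"
   using less(1)[OF sep_Pi_card[OF a(1) less(2) a(2)] affW_Reg[OF w less(2)]] by blast
  have "alc (rprod (a # as) p0) = rf a ` alc (rprod as p0)" using affW_alc[OF w] by simp
  also have "\<dots> = alc q" unfolding as affW_alc[OF w] by (simp add: rf_rf[OF Pi_AR[OF a(1)]])
  finally show ?thesis using as(1) a(1) by (intro exI[of _ "a # as"]) simp
 qed
qed

lemma sep_refl_nonempty: assumes "b \<in> AR" shows "sep p0 (rf b p0) \<noteq> {}"
proof -
 have "ev b p0 \<noteq> 0" using Reg_p0 assms by (auto simp: Reg_def)
 hence "b \<in> sep p0 (rf b p0) \<or> ng b \<in> sep p0 (rf b p0)"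
  using assms ev_rf[OF assms] ng[OF assms] by (auto simp: sep_def)
 thus ?thesis by blast
qed

text \<open>Conjugation by a separating wall reflection \<open>rf a\<close> brings the mirror image
  of \<open>p0\<close> strictly closer with each of the two factors, unless the two reflections
  coincide. So the conjugate is covered by induction.\<close>

lemma refl_rprod:
 assumes "b \<in> AR" shows "\<exists>as. set as \<subseteq> Pi \<and> rprod as = rf b"
 using assms
proof (induction "card (sep p0 (rf b p0))" arbitrary: b rule: less_induct)
 case less
 note b = less(2)
 note rb = rf_affW[OF b]
 obtain a where a: "a \<in> Pi" "a \<in> sep p0 (rf b p0)"
  using wall_exists[OF affW_Reg[OF rb Reg_p0] sep_refl_nonempty[OF b]] .
 note aAR = Pi_AR[OF a(1)]
 note ra = rf_affW[OF aAR]
 show ?case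
 proof (cases "rf a = rf b")
  case True
  thus ?thesis using a by (intro exI[of _ "[a]"]) auto
 next
  case False
  define c where "c = pb (rf a) b"
  have c: "c \<in> AR" unfolding c_def using pb[OF ra b] by blast
  have rc: "rf c v = rf a (rf b (rf a v))" for v
   using pb(3)[OF ra b, of v] rf_rf[OF aAR] unfolding c_def by metis
  have bap: "ev a (rf b p0) < 0" "ev a p0 > 0" using a by (auto simp: sep_def)
  have 1: "card (sep (rf a p0) (rf b p0)) < card (sep p0 (rf b p0))"
   using sep_Pi_diff[OF a(1) affW_Reg[OF rb Reg_p0] bap(1)] a(2) finite_sep by (metis card_Diff1_less)
  have 2: "card (sep p0 (rf b (rf a p0))) = card (sep (rf a p0) (rf b p0))"
   using sep_affW[OF rb, of p0 "rf b (rf a p0)"] sep_swap rf_rf[OF b] by simp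
  have "ev a (rf b (rf a p0)) < 0"
  proof (rule ccontr)
   assume n: "\<not> ?thesis"
   \<comment> \<open>If \<open>a\<close> did not separate here as well, its pullback along
     \<open>rf b\<close> would be crossed by the wall reflection \<open>rf a\<close>, hence equal
     \<open>a\<close> up to sign. Then \<open>rf b\<close> negates \<open>a\<close>, so that
     \<open>a\<close> and \<open>b\<close> are proportional.\<close>
   define a' where "a' = ng (pb (rf b) a)"
   note pba = pb[OF rb aAR]
   have a': "a' \<in> AR" "\<And>v. ev a' v = - ev a (rf b v)" unfolding a'_def using pba ng by auto
   have r: "Reg (rf b (rf a p0))" using affW_Reg Reg_p0 ra rb by blast
   have "a' \<in> sep p0 (rf a p0)"
    using a' bap(1) n r aAR unfolding sep_def Reg_def by force
   hence "a' = a" using a(1) unfolding Pi_def by blast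
   hence e: "ev a (rf b v) = - ev a v" for v using a'(2)[of v] by simp
   have aR: "fst a \<in> R" using aAR by (auto simp: AR_def)
   define k where "k = co (fst a) (fst b)"
   have k: "2 * ev a v = k * ev b v" for v
    using e[of v] aR by (simp add: rf_ev[of b] ev_def[of a] co_simps k_def algebra_simps)
   have "a = b \<or> a = ng b" using ev_prop[OF aAR b, of "k / 2"] k by (metis (no_types, opaque_lifting) mult.commute times_divide_eq_left nonzero_mult_div_cancel_left zero_neq_numeral)
   thus False using False ng(3)[OF b] by auto
  qed
  hence s: "a \<in> sep p0 (rf b (rf a p0))" using aAR bap by (simp add: sep_def)
  have r: "Reg (rf b (rf a p0))" using affW_Reg Reg_p0 ra rb by blast
  have "card (sep p0 (rf c p0)) < card (sep p0 (rf b (rf a p0)))"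
   unfolding rc by (rule sep_Pi_card[OF a(1) r s])
  hence "card (sep p0 (rf c p0)) < card (sep p0 (rf b p0))" using 1 2 by simp
  then obtain as where as: "set as \<subseteq> Pi" "rprod as = rf c" using less(1) c by blast
  have "rprod (a # as @ [a]) = rf b"
   by (rule ext) (simp add: rprod_append as rc rf_rf[OF aAR])
  thus ?thesis using as a(1) by (intro exI[of _ "a # as @ [a]"]) auto
 qed
qed

lemma affW_rprod: assumes "w \<in> affW" shows "\<exists>as. set as \<subseteq> Pi \<and> rprod as = w"
 using assms
proof (induction rule: affW_induct)
 case id
 show ?case by (rule exI[of _ "[]"]) auto
next
 case (refl \<alpha> n)
 thus ?case using refl_rprod[of "(\<alpha>, n)"] by (auto simp: AR_def rf_def)
next
 case (comp u v)
 then obtain as bs where "set as \<subseteq> Pi" "rprod as = u" "set bs \<subseteq> Pi" "rprod bs = v" by blast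
 thus ?case by (intro exI[of _ "as @ bs"]) (auto simp: rprod_append)
qed

text \<open>The exchange condition. The affine root \<open>b\<close> is pushed through the word from
  the left. It stays positive at \<open>p0\<close> as long as it differs from the letter it meets,
  so it must meet itself, and there two reflections cancel.\<close>

lemma exchange:
 assumes "set as \<subseteq> Pi" "b \<in> AR" "ev b p0 > 0" "ev b (rprod as p0) < 0"
 shows "\<exists>bs. set bs \<subseteq> Pi \<and> length as = Suc (length bs) \<and> rf b \<circ> rprod as = rprod bs"
 using assms
proof (induction as arbitrary: b)
 case (Cons t us)
 have t: "t \<in> Pi" "t \<in> AR" using Cons.prems Pi_AR by auto
 note rt = rf_affW[OF t(2)]
 show ?case
 proof (cases "b = t")
  case True
  hence "rf b \<circ> rprod (t # us) = rprod us" by (auto simp: rf_rf[OF t(2)])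
  moreover have "set us \<subseteq> Pi" "length (t # us) = Suc (length us)" using Cons.prems by auto
  ultimately show ?thesis by blast
 next
  case False
  define c where "c = pb (rf t) b"
  note pbc = pb[OF rt Cons.prems(2), folded c_def]
  have "ev c p0 > 0" using Pi_rf[OF t(1) Cons.prems(2) False Cons.prems(3)] pbc by simp
  moreover have "ev c (rprod us p0) < 0" using Cons.prems(4) pbc by simp
  ultimately obtain vs where vs: "set vs \<subseteq> Pi" "length us = Suc (length vs)" "rf c \<circ> rprod us = rprod vs"
   using Cons.IH[OF _ pbc(1)] t(1) Cons.prems(1) by (metis set_subset_Cons subset_trans)
  have "rf b \<circ> rprod (t # us) = rf t \<circ> (rf c \<circ> rprod us)"
   using pbc(3) by (auto simp: fun_eq_iff)
  hence "rf b \<circ> rprod (t # us) = rprod (t # vs)" using vs(3) by (simp only: rprod_simps)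
  moreover have "set (t # vs) \<subseteq> Pi" "length (t # us) = Suc (length (t # vs))" using vs t(1) by auto
  ultimately show ?thesis by blast
 qed
qed simp

text \<open>If a nonempty word fixes the base alcove, its tail takes \<open>p0\<close> to the
  negative side of the first letter, and \<open>exchange\<close> replaces the word by one that is
  two letters shorter.\<close>

lemma affW_free:
 assumes w: "w \<in> affW" and fx: "alc (w p0) = alc p0" shows "w = id"
proof -
 have "rprod as = id" if "set as \<subseteq> Pi" "alc (rprod as p0) = alc p0" for as
  using that
 proof (induction as rule: length_induct)
  case (1 as)
  show ?case
  proof (cases as)
   case (Cons t us)
   have t: "t \<in> Pi" "t \<in> AR" "set us \<subseteq> Pi" using Cons 1 Pi_AR by auto
   have "rprod as p0 \<in> alc p0" using 1(3) alc_self by metis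
   hence "ev t (rprod as p0) > 0" using t Pi_pos by (auto simp: alc_def)
   hence "ev t (rprod us p0) < 0" using ev_rf[OF t(2)] Cons by simp
   then obtain bs where bs: "set bs \<subseteq> Pi" "length us = Suc (length bs)" "rf t \<circ> rprod us = rprod bs"
    using exchange[OF t(3) t(2) Pi_pos[OF t(1)]] by blast
   hence e: "rprod as = rprod bs" using Cons by simp
   moreover have "length bs < length as" using bs Cons by simp
   ultimately show ?thesis using 1(1,3) bs(1) by metis
  qed simp
 qed
 thus ?thesis using affW_rprod[OF w] fx by metis
qed

text \<open>Links the facet condition to \<open>Pi\<close>. An affine root crossed by the reflection
  is nonnegative on the closed alcove and nonpositive on its mirror image, so it vanishes on the
  facet. The facet spans the hyperplane, hence the affine root is that of the hyperplane up to
  sign.\<close>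

lemma simple_Pi:
 assumes s: "s \<in> simple_affine_refls D" obtains a where "a \<in> Pi" "s = rf a"
proof -
 obtain \<alpha> n where \<alpha>: "\<alpha> \<in> Rp" and sr: "s = aff_refl D \<alpha> n"
  and ad: "aff_dim (hyperplane D \<alpha> n \<inter> closure (alc p0)) = int DIM('v) - 1"
  using s unfolding simple_affine_refls_def base_alcove_eq by blast
 let ?H = "hyperplane D \<alpha> n" and ?C = "hyperplane D \<alpha> n \<inter> closure (alc p0)"
 have R: "\<alpha> \<in> R" using \<alpha> Rp_subset by blast
 define a0 where "a0 = (\<alpha>, n)"
 have a0: "a0 \<in> AR" "s = rf a0" using R sr by (auto simp: a0_def AR_def rf_def)
 have H: "?H = {v. ev a0 v = 0}" by (auto simp: hyperplane_def ev_def a0_def)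
 \<comment> \<open>The coroot as a vector for the class inner product, for which the dimension of a
   hyperplane is known.\<close>
 obtain h where h: "\<And>v. co \<alpha> v = h \<bullet> v"
 proof -
  have "co \<alpha> v = (\<Sum>b\<in>Basis. co \<alpha> b *\<^sub>R b) \<bullet> v" for v
  proof -
   have "co \<alpha> v = co \<alpha> (\<Sum>b\<in>Basis. (v \<bullet> b) *\<^sub>R b)" by (simp add: euclidean_representation)
   also have "\<dots> = (\<Sum>b\<in>Basis. co \<alpha> b * (b \<bullet> v))"
    using linear_co[OF R] by (simp add: linear_sum linear_scale inner_commute mult.commute)
   finally show ?thesis by (simp add: inner_sum_left)
  qed
  thus ?thesis using that by blast
 qed
 have h0: "h \<noteq> 0" using h[of \<alpha>] co_self[OF R] by auto
 have Hh: "?H = {v. h \<bullet> v = of_int n}" by (simp add: hyperplane_def h)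
 have adH: "aff_dim ?H = int DIM('v) - 1" unfolding Hh using h0 by simp
 have CH: "affine hull ?C \<subseteq> ?H" unfolding Hh by (rule hull_minimal) (auto simp: affine_hyperplane Hh)
 have "?C \<noteq> {}"
 proof
  assume "?C = {}"
  hence "int DIM('v) = 0" using ad by simp
  thus False by simp
 qed
 hence CeqH: "affine hull ?C = ?H"
  using CH ad adH by (intro affine_dim_equal) (auto simp: Hh affine_hyperplane)
 have key: "b = a0 \<or> b = ng a0" if b: "b \<in> sep p0 (rf a0 p0)" for b
 proof -
  have bAR: "b \<in> AR" and b1: "ev b p0 > 0" and b2: "ev b (rf a0 p0) < 0" using b by (auto simp: sep_def)
  have bR: "fst b \<in> R" using bAR by (auto simp: AR_def)
  have cb: "continuous_on UNIV (ev b)" using continuous_ev[OF bAR] .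
  have ge: "ev b v \<ge> 0" if "v \<in> closure (alc p0)" for v
  proof -
   have "alc p0 \<subseteq> {v. ev b v \<ge> 0}" using b1 bAR by (force simp: alc_def)
   hence "closure (alc p0) \<subseteq> {v. ev b v \<ge> 0}"
    using cb by (intro closure_minimal closed_Collect_le continuous_on_const) auto
   thus ?thesis using that by blast
  qed
  have le: "ev b (rf a0 v) \<le> 0" if "v \<in> closure (alc p0)" for v
  proof -
   note pbb = pb[OF rf_affW[OF a0(1)] bAR]
   have e: "ev (pb (rf a0) b) x = ev b (rf a0 x)" for x using pbb by simp
   have "alc p0 \<subseteq> {v. ev (pb (rf a0) b) v \<le> 0}"
    using b2 pbb(1) alc_sgn(2)[OF Reg_p0, of _ "pb (rf a0) b"] e by force
   hence "closure (alc p0) \<subseteq> {v. ev (pb (rf a0) b) v \<le> 0}"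
    using continuous_ev[OF pbb(1)] by (intro closure_minimal closed_Collect_le continuous_on_const) auto
   thus ?thesis using that e by auto
  qed
  have "?C \<subseteq> {v. ev b v = 0}"
  proof
   fix v assume v: "v \<in> ?C"
   hence "rf a0 v = v" unfolding H by (simp add: rf_ev)
   thus "v \<in> {v. ev b v = 0}" using ge[of v] le[of v] v by auto
  qed
  moreover have "affine {v. ev b v = 0}"
   unfolding affine_def
  proof clarify
   fix x y :: 'v and u v :: real assume e: "ev b x = 0" "ev b y = 0" and uv: "u + v = (1::real)"
   have "ev b (u *\<^sub>R x + v *\<^sub>R y) = u * ev b x + v * ev b y + (u + v - 1) * of_int (snd b)"
    using bR by (simp add: ev_def co_simps algebra_simps)
   thus "ev b (u *\<^sub>R x + v *\<^sub>R y) = 0" using e uv by simp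
  qed
  ultimately have "affine hull ?C \<subseteq> {v. ev b v = 0}" by (rule hull_minimal)
  hence Hb: "\<And>v. ev a0 v = 0 ==> ev b v = 0" using CeqH H by blast
  define k where "k = co (fst b) \<alpha> / 2"
  have "ev b v = k * ev a0 v" for v
  proof -
   \<comment> \<open>The projection of \<open>v\<close> to the hyperplane along \<alpha>.\<close>
   define u where "u = v - (ev a0 v / 2) *\<^sub>R \<alpha>"
   have "ev a0 u = 0" unfolding u_def a0_def ev_def using R by (simp add: co_simps co_self diff_divide_distrib)
   hence "ev b u = 0" by (rule Hb)
   moreover have "ev b u = ev b v - (ev a0 v / 2) * co (fst b) \<alpha>"
    unfolding u_def ev_def[of b] using bR by (simp add: co_simps)
   ultimately show ?thesis by (simp add: k_def)
  qed
  thus ?thesis using ev_prop[OF bAR a0(1)] by blast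
 qed
 define a where "a = (if ev a0 p0 > 0 then a0 else ng a0)"
 have a: "a \<in> AR" "s = rf a" using a0 ng[OF a0(1)] by (auto simp: a_def)
 have "ev a0 p0 \<noteq> 0" using Reg_p0 a0 by (auto simp: Reg_def)
 hence ap: "ev a p0 > 0" using ng(2)[OF a0(1)] by (auto simp: a_def)
 have "b = a" if b: "b \<in> sep p0 (rf a p0)" for b
 proof -
  have "b \<in> sep p0 (rf a0 p0)" using b a a0 by simp
  hence "b = a0 \<or> b = ng a0" using key by blast
  moreover have "ev b p0 > 0" using b by (simp add: sep_def)
  ultimately show ?thesis using ng(2)[OF a0(1), of p0] unfolding a_def by auto
 qed
 moreover have "a \<in> sep p0 (rf a p0)" using a ap ev_rf[OF a(1)] by (simp add: sep_def)
 ultimately have "a \<in> Pi" unfolding Pi_def using a by blast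
 thus ?thesis using that a by blast
qed

end

section \<open>Orbits of alcoves and the right action\<close>

context root_datum
begin

definition al :: "('v \<Rightarrow> 'v) \<Rightarrow> 'v set" where "al w = w ` base_alcove D"

lemma al_alc: "w \<in> affW ==> al w = alc (w p0)"
 by (simp add: al_def base_alcove_eq affW_alc)

lemma al_comp: "al (u \<circ> w) = u ` al w"
 by (simp add: al_def image_comp)

lemma al_alcove: "w \<in> affW ==> al w \<in> alcoves D"
 using al_alc affW_Reg Reg_p0 unfolding alcoves_eq by blast

lemma al_inj: assumes "u \<in> affW" "w \<in> affW" "al u = al w" shows "u = w"
proof -
 let ?i = "Hilbert_Choice.inv u"
 have iu: "?i \<circ> u = id" "u \<circ> ?i = id"
  using affW_bij[OF assms(1)] by (simp_all add: bij_is_inj surj_iff[THEN iffD1] bij_is_surj)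
 have i: "?i \<circ> w \<in> affW" using assms affW_inv affW_comp by blast
 have "al (?i \<circ> w) = al (?i \<circ> u)" unfolding al_comp assms(3) ..
 hence "al (?i \<circ> w) = al id" using iu by metis
 hence "?i \<circ> w = id" using affW_free[OF i] al_alc[OF i] al_alc[OF affW_id] by simp
 hence "u \<circ> (?i \<circ> w) = u" by simp
 thus ?thesis using iu(2) by (metis comp_assoc comp_id fun.map_id id_comp)
qed

lemma alcove_cases: assumes "A \<in> alcoves D" obtains w where "w \<in> affW" "A = al w"
proof -
 obtain q where q: "Reg q" "A = alc q" using assms unfolding alcoves_eq by blast
 then obtain as where "set as \<subseteq> Pi" "alc (rprod as p0) = alc q" using transitive by blast
 thus ?thesis using that[of "rprod as"] rprod_affW al_alc q by auto
qed

lemma affW_image_alcove: "u \<in> affW ==> A \<in> alcoves D ==> u ` A \<in> alcoves D"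
 by (metis alcove_cases al_comp affW_comp al_alcove)

definition orb :: "'v set \<Rightarrow> 'v set set" where "orb A = {(+) \<gamma> ` A | \<gamma>. \<gamma> \<in> Q}"

lemma orbits_eq: "orbits D = orb ` alcoves D"
 by (auto simp: orbits_def orb_def)

lemma transl_transl: "(+) \<gamma> ` (+) \<delta> ` A = (+) (\<gamma> + \<delta>) ` (A::'v set)"
 by (auto simp: image_image add.assoc)

lemma orb_self: "A \<in> orb A"
 unfolding orb_def using Q_0 by (intro CollectI exI[of _ 0]) simp

lemma orb_eq: assumes "B \<in> orb A" shows "orb B = orb A"
proof -
 obtain \<gamma> where \<gamma>: "\<gamma> \<in> Q" "B = (+) \<gamma> ` A" using assms unfolding orb_def by blast
 show ?thesis
 proof
  show "orb B \<subseteq> orb A" unfolding orb_def \<gamma>(2) transl_transl using Q_add \<gamma>(1) by blast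
  have "(+) \<delta> ` A = (+) (\<delta> - \<gamma>) ` B" for \<delta> unfolding \<gamma>(2) transl_transl by simp
  moreover have "\<delta> \<in> Q ==> \<delta> - \<gamma> \<in> Q" for \<delta> using Q_add Q_neg \<gamma>(1) by (metis diff_conv_add_uminus)
  ultimately show "orb A \<subseteq> orb B" unfolding orb_def by blast
 qed
qed

lemma orb_alcoves: "A \<in> alcoves D ==> orb A \<subseteq> alcoves D"
 unfolding orb_def using affW_image_alcove affW_transl by blast

lemma orbit_orb: assumes "x \<in> orbits D" "A \<in> x" shows "x = orb A" "A \<in> alcoves D"
 using assms orb_eq orb_alcoves unfolding orbits_eq by blast+

lemma orbit_cases: assumes "x \<in> orbits D" obtains w where "w \<in> affW" "x = orb (al w)"
 using assms alcove_cases unfolding orbits_eq by (metis image_iff)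

lemma orb_affW: assumes "w = (\<lambda>v. g v + \<gamma>)" "\<gamma> \<in> Q" shows "orb (w ` A) = orb (g ` A)"
proof -
 have "w ` A = (+) \<gamma> ` g ` A" unfolding assms(1) by (auto simp: image_image add.commute)
 thus ?thesis using orb_eq assms(2) unfolding orb_def by blast
qed

text \<open>An orbit forgets the translation part, and the possible linear parts form a finite
  set.\<close>

lemma finite_orbits: "finite (orbits D)"
proof (rule finite_subset)
 show "orbits D \<subseteq> (\<lambda>g. orb (g ` base_alcove D)) ` sym_grp"
 proof
  fix x assume "x \<in> orbits D"
  then obtain w where w: "w \<in> affW" "x = orb (al w)" by (rule orbit_cases)
  obtain g \<gamma> where "g \<in> sym_grp" "\<gamma> \<in> Q" "w = (\<lambda>v. g v + \<gamma>)" using affW_decomp[OF w(1)] .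
  thus "x \<in> (\<lambda>g. orb (g ` base_alcove D)) ` sym_grp"
   using w(2) orb_affW unfolding al_def by blast
 qed
qed (use finite_sym_grp in auto)

lemma orb_image_affW: assumes "u \<in> affW" shows "(\<lambda>A. u ` A) ` orb A = orb (u ` A)"
proof -
 obtain g \<delta> where g: "g \<in> sym_grp" "\<delta> \<in> Q" "u = (\<lambda>v. g v + \<delta>)" using affW_decomp[OF assms] .
 have *: "u ` (+) \<gamma> ` B = (+) (g \<gamma>) ` u ` B" for \<gamma> B
  unfolding g(3) by (simp add: image_image linear_add[OF sym_grp_linear[OF g(1)]] add.assoc)
 \<comment> \<open>The linear part permutes \<open>R\<close>, so it maps the root lattice onto
   itself.\<close>
 have surj: "\<exists>\<gamma>'\<in>Q. \<gamma> = g \<gamma>'" if "\<gamma> \<in> Q" for \<gamma> using that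
 proof (induction rule: Q_induct)
  case zero
  show ?case using Q_0 linear_0[OF sym_grp_linear[OF g(1)]] by metis
 next
  case (root \<alpha>)
  hence "\<alpha> \<in> g ` R" using g(1) unfolding sym_grp_def by blast
  thus ?case using Q_root by blast
 next
  case (add x y)
  thus ?case using Q_add linear_add[OF sym_grp_linear[OF g(1)]] by metis
 next
  case (neg x)
  thus ?case using Q_neg linear_neg[OF sym_grp_linear[OF g(1)]] by metis
 qed
 show ?thesis
 proof
  show "(\<lambda>A. u ` A) ` orb A \<subseteq> orb (u ` A)"
  proof
   fix B assume "B \<in> (\<lambda>A. u ` A) ` orb A"
   then obtain \<gamma> where \<gamma>: "\<gamma> \<in> Q" "B = u ` (+) \<gamma> ` A" unfolding orb_def by blast
   thus "B \<in> orb (u ` A)" unfolding orb_def \<gamma>(2) * using sym_grp_Q[OF \<gamma>(1) g(1)] by blast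
  qed
  show "orb (u ` A) \<subseteq> (\<lambda>A. u ` A) ` orb A"
  proof
   fix B assume "B \<in> orb (u ` A)"
   then obtain \<gamma> where \<gamma>: "\<gamma> \<in> Q" "B = (+) \<gamma> ` u ` A" unfolding orb_def by blast
   then obtain \<gamma>' where "\<gamma>' \<in> Q" "\<gamma> = g \<gamma>'" using surj by blast
   thus "B \<in> (\<lambda>A. u ` A) ` orb A" using \<gamma>(2) * unfolding orb_def by blast
  qed
 qed
qed

lemma refl_orbit_orb: "\<alpha> \<in> R ==> refl_orbit D \<alpha> (orb A) = orb (aff_refl D \<alpha> 0 ` A)"
 unfolding refl_orbit_def by (rule orb_image_affW[OF affW_refl])

lemma orb_aff_refl: assumes "\<alpha> \<in> R" shows "orb (aff_refl D \<alpha> n ` A) = refl_orbit D \<alpha> (orb A)"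
proof -
 have "aff_refl D \<alpha> n = (\<lambda>v. aff_refl D \<alpha> 0 v + of_int n *\<^sub>R \<alpha>)"
  by (auto simp: aff_refl_def algebra_simps)
 from orb_affW[OF this Q_int[OF Q_root[OF assms]]] show ?thesis by (simp add: refl_orbit_orb[OF assms])
qed

lemma refl_orbit_orbits: "\<alpha> \<in> R ==> x \<in> orbits D ==> refl_orbit D \<alpha> x \<in> orbits D"
 unfolding orbits_eq using refl_orbit_orb affW_image_alcove[OF affW_refl] by blast

lemma refl_orbit_neg: "\<alpha> \<in> R ==> refl_orbit D (- \<alpha>) x = refl_orbit D \<alpha> x"
 unfolding refl_orbit_def using aff_refl_neg[of \<alpha> 0] by simp

text \<open>The linear part of the elements that carry the base alcove into the orbit. Freeness of
  the action, and the fact that translations have trivial linear part, make it depend on the orbit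
  alone.\<close>

definition lp :: "'v set set \<Rightarrow> 'v \<Rightarrow> 'v" where
 "lp x = (SOME g. g \<in> sym_grp \<and> (\<exists>\<gamma>\<in>Q. (\<lambda>v. g v + \<gamma>) \<in> affW \<and> al (\<lambda>v. g v + \<gamma>) \<in> x))"

lemma lp_eq:
 assumes w: "(\<lambda>v. g v + \<gamma>) \<in> affW" and g: "g \<in> sym_grp" "\<gamma> \<in> Q"
 shows "lp (orb (al (\<lambda>v. g v + \<gamma>))) = g"
proof -
 let ?x = "orb (al (\<lambda>v. g v + \<gamma>))"
 have "\<exists>g. g \<in> sym_grp \<and> (\<exists>\<gamma>\<in>Q. (\<lambda>v. g v + \<gamma>) \<in> affW \<and> al (\<lambda>v. g v + \<gamma>) \<in> ?x)"
  using w g orb_self by blast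
 from someI_ex[OF this] obtain \<delta> where h: "lp ?x \<in> sym_grp" "\<delta> \<in> Q" "(\<lambda>v. lp ?x v + \<delta>) \<in> affW"
  "al (\<lambda>v. lp ?x v + \<delta>) \<in> ?x" unfolding lp_def by blast
 then obtain \<epsilon> where e: "\<epsilon> \<in> Q" "al (\<lambda>v. lp ?x v + \<delta>) = (+) \<epsilon> ` al (\<lambda>v. g v + \<gamma>)" unfolding orb_def by blast
 hence "(\<lambda>v. lp ?x v + \<delta>) = (+) \<epsilon> \<circ> (\<lambda>v. g v + \<gamma>)"
  using al_inj[OF h(3) affW_comp[OF affW_transl[OF e(1)] w]] by (simp add: al_comp)
 hence *: "lp ?x v + \<delta> = \<epsilon> + (g v + \<gamma>)" for v by (metis comp_apply)
 hence "\<delta> = \<epsilon> + \<gamma>" using *[of 0] linear_0[OF sym_grp_linear[OF h(1)]] linear_0[OF sym_grp_linear[OF g(1)]] by simp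
 thus ?thesis using * by (auto simp: fun_eq_iff)
qed

end

section \<open>The right action of a simple affine reflection\<close>

locale wall_datum = root_datum D for D :: "('v::euclidean_space, 'x) root_data_scheme" +
 fixes s :: "'v \<Rightarrow> 'v"
 assumes s: "s \<in> simple_affine_refls D"
begin

abbreviation "ra \<equiv> right_act D s"
abbreviation "ro \<equiv> right_act_orbit D s"

definition as :: "'v \<times> int" where "as = (SOME a. a \<in> Pi \<and> s = rf a)"

lemma as: "as \<in> Pi" "s = rf as"
proof -
 have "\<exists>a. a \<in> Pi \<and> s = rf a" using simple_Pi[OF s] by metis
 from someI_ex[OF this] show "as \<in> Pi" "s = rf as" unfolding as_def by auto
qed

lemma as_AR: "as \<in> AR" and as_R: "fst as \<in> R" using Pi_AR[OF as(1)] by (auto simp: AR_def)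

lemma s_affW: "s \<in> affW" using as rf_affW as_AR by metis

lemma s_ev: "s v = v - ev as v *\<^sub>R fst as" using fun_cong[OF as(2), of v] by (simp only: rf_ev)

lemma s_s: "s \<circ> s = id"
proof -
 have "rf as \<circ> rf as = id" by (auto simp: rf_rf[OF as_AR])
 thus ?thesis by (simp only: as(2)[symmetric])
qed

text \<open>Freeness of the action makes the witness in the definition of \<open>right_act\<close>
  unique.\<close>

lemma ra_al: assumes w: "w \<in> affW" shows "ra (al w) = al (w \<circ> s)"
 unfolding right_act_def
proof (rule the_equality)
 show "\<exists>x\<in>affW. al w = x ` base_alcove D \<and> al (w \<circ> s) = (x \<circ> s) ` base_alcove D"
  using w by (intro bexI[of _ w]) (auto simp: al_def)
 fix B assume "\<exists>x\<in>affW. al w = x ` base_alcove D \<and> B = (x \<circ> s) ` base_alcove D"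
 then obtain x where x: "x \<in> affW" "al w = al x" "B = al (x \<circ> s)" unfolding al_def by blast
 thus "B = al (w \<circ> s)" using al_inj[OF w x(1,2)] by simp
qed

lemma ra_alcove: "A \<in> alcoves D ==> ra A \<in> alcoves D"
 by (metis alcove_cases ra_al al_alcove affW_comp s_affW)

lemma ra_ra: assumes "A \<in> alcoves D" shows "ra (ra A) = A"
proof -
 obtain w where w: "w \<in> affW" "A = al w" using assms by (rule alcove_cases)
 hence "ra (ra A) = al (w \<circ> s \<circ> s)" using ra_al affW_comp s_affW by metis
 thus ?thesis using w s_s by (metis comp_assoc comp_id)
qed

lemma ra_left: assumes "u \<in> affW" "A \<in> alcoves D" shows "ra (u ` A) = u ` ra A"
proof -
 obtain w where w: "w \<in> affW" "A = al w" using assms(2) by (rule alcove_cases)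
 have "ra (u ` A) = al ((u \<circ> w) \<circ> s)" using w assms ra_al affW_comp al_comp by metis
 also have "\<dots> = u ` ra A" using w ra_al al_comp by (metis comp_assoc)
 finally show ?thesis .
qed

lemma alcove_neg:
 assumes "A = al w" "w \<in> affW" "a \<in> AR"
 shows "A \<subseteq> {v. ev a v < 0} \<longleftrightarrow> ev a (w p0) < 0"
 using assms al_alc alc_sgn(2)[OF affW_Reg[OF assms(2) Reg_p0]] alc_self by blast

text \<open>Pulled back to the base alcove, an affine root that separates \<open>A\<close> from its
  neighbour separates \<open>p0\<close> from \<open>s p0\<close>; by definition of \<open>Pi\<close>
  there is only one such affine root.\<close>

lemma wall_sep:
 assumes A: "A \<in> alcoves D" and b: "b \<in> AR" and n: "A \<subseteq> {v. ev b v < 0}" "\<not> ra A \<subseteq> {v. ev b v < 0}"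
 shows "rf b ` A = ra A"
proof -
 obtain w where w: "w \<in> affW" "A = al w" using A by (rule alcove_cases)
 note ws = affW_comp[OF w(1) s_affW]
 have 1: "ev b (w p0) < 0" using n(1) alcove_neg[OF w(2,1) b] by simp
 have "\<not> ev b (w (s p0)) < 0" using n(2) alcove_neg[OF _ ws b] ra_al[OF w(1)] w(2) by simp
 moreover have "ev b (w (s p0)) \<noteq> 0" using affW_Reg[OF ws Reg_p0] b by (auto simp: Reg_def)
 ultimately have 2: "ev b (w (s p0)) > 0" by simp
 define c where "c = ng (pb w b)"
 note pbw = pb[OF w(1) b]
 have c: "c \<in> AR" "\<And>v. ev c v = - ev b (w v)" "rf c = rf (pb w b)" unfolding c_def using pbw ng by auto
 have "c \<in> sep p0 (s p0)" using c 1 2 by (simp add: sep_def)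
 hence "c \<in> sep p0 (rf as p0)" by (simp only: as(2)[symmetric])
 hence "c = as" using as(1) unfolding Pi_def by blast
 hence "w \<circ> s = rf b \<circ> w" using pbw(3) c(3) by (auto simp: as(2)[symmetric])
 thus ?thesis using w ra_al al_comp by metis
qed

lemma ro_orb: assumes "A \<in> alcoves D" shows "ro (orb A) = orb (ra A)"
proof -
 have "ra ((+) \<gamma> ` A) = (+) \<gamma> ` ra A" if "\<gamma> \<in> Q" for \<gamma> using ra_left[OF affW_transl[OF that] assms] .
 thus ?thesis unfolding right_act_orbit_def orb_def by (auto simp: image_iff)
qed

lemma ro_orbits: "x \<in> orbits D ==> ro x \<in> orbits D"
 unfolding orbits_eq using ro_orb ra_alcove by auto

lemma ro_ro: "x \<in> orbits D ==> ro (ro x) = x"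
 unfolding orbits_eq using ro_orb ra_alcove ra_ra by auto

lemma ra_in_ro: "A \<in> x ==> ra A \<in> ro x"
 unfolding right_act_orbit_def by blast

lemma refl_ro: assumes "\<alpha> \<in> R" "x \<in> orbits D" shows "refl_orbit D \<alpha> (ro x) = ro (refl_orbit D \<alpha> x)"
proof -
 obtain A where A: "A \<in> alcoves D" "x = orb A" using assms(2) unfolding orbits_eq by blast
 thus ?thesis using assms(1) ro_orb refl_orbit_orb ra_alcove affW_image_alcove affW_refl ra_left by metis
qed

text \<open>The root of the wall between an alcove of \<open>x\<close> and its neighbour, signed so
  that the alcove lies on the positive side.\<close>

definition croot :: "'v set set \<Rightarrow> 'v" where "croot x = lp x (fst as)"

text \<open>Separates what depends on the alcove, the integer \<open>m\<close>, from what depends on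
  the orbit alone, the signed root and its behaviour under \<open>ro\<close> and under
  reflections.\<close>

lemma wall_refl:
 assumes x: "x \<in> orbits D" and A: "A \<in> x"
 obtains m where "croot x \<in> R" "ra A = aff_refl D (croot x) m ` A" "A \<subseteq> {v. ev (croot x, m) v > 0}"
  "croot (ro x) = - croot x"
  "\<And>\<gamma>. \<gamma> \<in> R ==> croot (refl_orbit D \<gamma> x) = aff_refl D \<gamma> 0 (croot x)"
proof -
 obtain w where w: "w \<in> affW" "A = al w" using orbit_orb(2)[OF x A] by (rule alcove_cases)
 obtain g \<gamma> where g: "g \<in> sym_grp" "\<gamma> \<in> Q" "w = (\<lambda>v. g v + \<gamma>)" using affW_decomp[OF w(1)] .
 have xw: "x = orb (al w)" using orbit_orb(1)[OF x A] w by simp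
 have lpx: "lp x = g" using lp_eq[of g \<gamma>] g w(1) xw by simp
 hence cx: "croot x = g (fst as)" by (simp add: croot_def)
 have cR: "croot x \<in> R" unfolding cx using co_sym_grp(1)[OF g(1) as_R] .
 obtain m0 where m0: "co (croot x) \<gamma> = of_int m0" using co_Q[OF g(2) cR] by (auto elim: Ints_cases)
 define m where "m = snd as + m0"
 have e: "ev (croot x, m) (w v) = ev as v" for v
  using co_sym_grp(2)[OF g(1) as_R, of v] cR m0 unfolding cx[symmetric] g(3) ev_def m_def by (simp add: co_simps)
 have lin: "linear g" using sym_grp_linear[OF g(1)] .
 have ws: "w \<circ> s = aff_refl D (croot x) m \<circ> w"
 proof
  fix v
  have "w (s v) = g v - ev as v *\<^sub>R g (fst as) + \<gamma>"
   using lin s_ev[of v] g(3) by (simp add: linear_diff linear_scale)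
  also have "\<dots> = w v - ev (croot x, m) (w v) *\<^sub>R croot x" by (simp only: e) (simp add: cx g(3))
  also have "\<dots> = aff_refl D (croot x) m (w v)" by (simp add: ev_def aff_refl_def)
  finally show "(w \<circ> s) v = (aff_refl D (croot x) m \<circ> w) v" by simp
 qed
 have raA: "ra A = aff_refl D (croot x) m ` A" using ws w ra_al al_comp by metis
 have pos: "A \<subseteq> {v. ev (croot x, m) v > 0}"
 proof
  fix v assume "v \<in> A"
  then obtain p where p: "p \<in> alc p0" "v = w p" using w(2) by (auto simp: al_def base_alcove_eq)
  have "ev as p > 0" using p(1) Pi_pos[OF as(1)] as_AR by (simp add: alc_def)
  thus "v \<in> {v. ev (croot x, m) v > 0}" using e p(2) by simp
 qed
 have lp_gen: "croot (orb (al u)) = h (fst as)" if "u \<in> affW" "u = (\<lambda>v. h v + \<delta>)" "h \<in> sym_grp" "\<delta> \<in> Q" for u h \<delta>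
  using lp_eq[of h \<delta>] that by (simp add: croot_def)
 have ro: "croot (ro x) = - croot x"
 proof -
  let ?s0 = "aff_refl D (fst as) 0"
  have "w \<circ> s = (\<lambda>v. (g \<circ> ?s0) v + (of_int (snd as) *\<^sub>R g (fst as) + \<gamma>))"
   unfolding g(3) using lin
   by (auto simp: fun_eq_iff s_ev ev_def aff_refl_def linear_diff linear_scale linear_add algebra_simps)
  from lp_gen[OF affW_comp[OF w(1) s_affW] this sym_grp_comp[OF g(1) refl_sym_grp[OF as_R]]
    Q_add[OF Q_int[OF Q_root[OF co_sym_grp(1)[OF g(1) as_R]]] g(2)]]
  have "croot (orb (al (w \<circ> s))) = (g \<circ> ?s0) (fst as)" .
  also have "\<dots> = - croot x" using as_R lin by (simp add: refl0 co_self scaleR_2 cx linear_neg)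
  also have "orb (al (w \<circ> s)) = ro x" using xw ro_orb[OF al_alcove[OF w(1)]] ra_al[OF w(1)] by simp
  finally show ?thesis .
 qed
 have refl: "croot (refl_orbit D \<beta> x) = aff_refl D \<beta> 0 (croot x)" if \<beta>: "\<beta> \<in> R" for \<beta>
 proof -
  let ?r = "aff_refl D \<beta> 0"
  have lr: "linear ?r" using sym_grp_linear[OF refl_sym_grp[OF \<beta>]] .
  have "?r \<circ> w = (\<lambda>v. (?r \<circ> g) v + ?r \<gamma>)" unfolding g(3) using lr by (auto simp: linear_add)
  from lp_gen[OF affW_comp[OF affW_refl[OF \<beta>] w(1)] this sym_grp_comp[OF refl_sym_grp[OF \<beta>] g(1)]
    sym_grp_Q[OF g(2) refl_sym_grp[OF \<beta>]]]
  have "croot (orb (al (?r \<circ> w))) = (?r \<circ> g) (fst as)" .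
  thus ?thesis using xw refl_orbit_orb[OF \<beta>] cx by (simp add: al_comp)
 qed
 show ?thesis using that[OF cR raA pos ro refl] .
qed

lemma orbit_nonempty: "x \<in> orbits D ==> \<exists>A. A \<in> x"
 unfolding orbits_eq using orb_self by blast

lemma croot_R: "x \<in> orbits D ==> croot x \<in> R"
 and croot_ro: "x \<in> orbits D ==> croot (ro x) = - croot x"
 and croot_refl: "x \<in> orbits D ==> \<gamma> \<in> R ==> croot (refl_orbit D \<gamma> x) = aff_refl D \<gamma> 0 (croot x)"
 using wall_refl orbit_nonempty by metis+

text \<open>Through this equation, the congruence that an element of the structure algebra satisfies
  for the wall root compares its values at \<open>x\<close> and at \<open>ro x\<close>.\<close>

lemma refl_croot: assumes x: "x \<in> orbits D" shows "refl_orbit D (croot x) x = ro x"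
proof -
 obtain A where A: "A \<in> x" using orbit_nonempty[OF x] by blast
 obtain m where m: "croot x \<in> R" "ra A = aff_refl D (croot x) m ` A" using wall_refl[OF x A] by metis
 have "ro x = orb (ra A)" using ro_orb orbit_orb[OF x A] by metis
 thus ?thesis using m orb_aff_refl orbit_orb(1)[OF x A] by metis
qed

text \<open>The signed wall root changes sign under \<open>ro\<close>, and no root equals its
  negative.\<close>

lemma ro_neq: assumes "x \<in> orbits D" shows "ro x \<noteq> x"
 using croot_ro[OF assms] root_nonzero[OF croot_R[OF assms]] by (metis eq_neg_iff_add_eq_0 scaleR_2 scaleR_eq_0_iff zero_neq_numeral)

end

section \<open>The topology on the set of alcoves\<close>

locale wall_base = wall_datum D s for D :: "('v::euclidean_space, 'k, 't) base_data" and s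
begin

abbreviation "affWT \<equiv> affine_weyl_T D"
abbreviation "alcove_le A B \<equiv> (A, B) \<in> alcove_order D"

definition alcove_step :: "('v set \<times> 'v set) set" where
 "alcove_step = {(A, B). A \<in> alcoves D \<and> B \<in> alcoves D \<and>
   ((\<exists>\<gamma>\<in>pos_root_cone D. B = (+) \<gamma> ` A) \<or>
   (\<exists>\<alpha>\<in>R_T D. \<exists>n. B = aff_refl D \<alpha> n ` A \<and> A \<subseteq> neg_halfspace D \<alpha> n))}"

lemma alcove_order_eq: "alcove_order D = alcove_step\<^sup>*"
 by (simp add: alcove_order_def alcove_step_def)

lemma le_refl: "alcove_le A A" by (simp add: alcove_order_eq)

lemma le_trans: "alcove_le A B ==> alcove_le B C ==> alcove_le A C"
 by (simp add: alcove_order_eq)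

lemma pos_root_cone_Q: "pos_root_cone D \<subseteq> Q"
proof
 fix x assume "x \<in> pos_root_cone D"
 then obtain c :: "'v \<Rightarrow> nat" where c: "x = (\<Sum>\<alpha>\<in>Rp. of_nat (c \<alpha>) *\<^sub>R \<alpha>)" unfolding pos_root_cone_def by blast
 have "(\<Sum>\<alpha>\<in>S. of_nat (c \<alpha>) *\<^sub>R \<alpha>) \<in> Q" if "finite S" "S \<subseteq> R" for S
  using that
 proof (induction S rule: finite_induct)
  case (insert \<alpha> S)
  thus ?case using Q_add Q_int[OF Q_root, of \<alpha> "int (c \<alpha>)"] by simp
 qed (use Q_0 in simp)
 thus "x \<in> Q" using c finite_Rp Rp_subset by blast
qed

lemma I_T_subset: "I_T D \<subseteq> Rp" and R_T_subset: "R_T D \<subseteq> Rp"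
 by (auto simp: I_T_def R_T_def)

lemma affWT_gen:
 assumes "h \<in> {(+) \<gamma> | \<gamma>. \<gamma> \<in> Q} \<union> {aff_refl D \<alpha> m | \<alpha> m. \<alpha> \<in> I_T D}"
 shows "h \<in> affW" "bij h"
proof -
 show "h \<in> affW" using assms affW_transl affW_refl I_T_subset Rp_subset by blast
 thus "bij h" by (rule affW_bij)
qed

lemma affWT_comp: "u \<in> affWT ==> w \<in> affWT ==> u \<circ> w \<in> affWT"
 unfolding affine_weyl_T_def by (rule generate_Bij_comp[OF affWT_gen(2)])

lemma affWT_id: "id \<in> affWT"
 unfolding affine_weyl_T_def by (rule generate_Bij_id[OF affWT_gen(2)])

lemma affWT_transl: "\<gamma> \<in> Q ==> (+) \<gamma> \<in> affWT"
 unfolding affine_weyl_T_def by (rule generate.incl) blast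

lemma affWT_affW: assumes "w \<in> affWT" shows "w \<in> affW"
proof (rule generate_Bij_induct[of "{(+) \<gamma> | \<gamma>. \<gamma> \<in> Q} \<union> {aff_refl D \<alpha> m | \<alpha> m. \<alpha> \<in> I_T D}" w, OF affWT_gen(2)])
 show "w \<in> generate (BijGroup UNIV) ({(+) \<gamma> |\<gamma>. \<gamma> \<in> Q} \<union> {aff_refl D \<alpha> m |\<alpha> m. \<alpha> \<in> I_T D})"
  using assms by (simp add: affine_weyl_T_def)
qed (use affW_id affW_comp affWT_gen(1) affW_inv in \<open>blast+\<close>)

lemma affWT_inv: assumes "w \<in> affWT" shows "Hilbert_Choice.inv w \<in> affWT"
proof -
 have "w \<in> carrier (BijGroup UNIV)" using affW_bij[OF affWT_affW[OF assms]] by (simp add: carrier_BijGroup_UNIV)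
 have "inv\<^bsub>BijGroup UNIV\<^esub> w \<in> affWT"
  using assms unfolding affine_weyl_T_def
  by (intro group.generate_m_inv_closed[OF group_BijGroup]) (use affWT_gen(2) in \<open>auto simp: carrier_BijGroup_UNIV\<close>)
 thus ?thesis using inv_BijGroup_UNIV[OF affW_bij[OF affWT_affW[OF assms]]] by simp
qed

text \<open>The definition of \<open>R_T\<close> provides one \<open>m\<close>; reflections in
  parallel hyperplanes differ by translations by multiples of the root.\<close>

lemma R_T_affWT: assumes "\<alpha> \<in> R_T D" shows "aff_refl D \<alpha> n \<in> affWT"
proof -
 obtain m where m: "aff_refl D \<alpha> m \<in> affWT" using assms unfolding R_T_def by blast
 have R: "\<alpha> \<in> R" using assms R_T_subset Rp_subset by blast
 have "aff_refl D \<alpha> n = (+) (of_int (n - m) *\<^sub>R \<alpha>) \<circ> aff_refl D \<alpha> m"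
  by (auto simp: aff_refl_def fun_eq_iff algebra_simps)
 thus ?thesis using affWT_comp[OF affWT_transl[OF Q_int[OF Q_root[OF R], of "n - m"]] m] by (simp only:)
qed

lemma step_affWT: "(A, B) \<in> alcove_step ==> \<exists>w\<in>affWT. B = w ` A"
 unfolding alcove_step_def using affWT_transl R_T_affWT pos_root_cone_Q by blast

lemma le_affWT: assumes "alcove_le A B" shows "\<exists>w\<in>affWT. B = w ` A"
 using assms unfolding alcove_order_eq
proof (induction rule: rtrancl_induct)
 case base
 show ?case by (rule bexI[OF _ affWT_id]) simp
next
 case (step B C)
 then obtain u v where "u \<in> affWT" "B = u ` A" "v \<in> affWT" "C = v ` B" using step_affWT by blast
 thus ?case using affWT_comp[of v u] by (metis image_comp)
qed

lemma le_alcoves: assumes "alcove_le A B" shows "A \<in> alcoves D \<longleftrightarrow> B \<in> alcoves D"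
 using assms unfolding alcove_order_eq
 by (induction rule: rtrancl_induct) (auto simp: alcove_step_def)

text \<open>An elementary step is preserved by the right action unless it crosses the wall itself.\<close>

lemma step_ra:
 assumes "(A, B) \<in> alcove_step" shows "(ra A, ra B) \<in> alcove_step \<or> (ra A = B \<and> ra B = A)"
proof -
 have AB: "A \<in> alcoves D" "B \<in> alcoves D" using assms by (auto simp: alcove_step_def)
 note rAB = ra_alcove[OF AB(1)] ra_alcove[OF AB(2)]
 from assms consider \<gamma> where "\<gamma> \<in> pos_root_cone D" "B = (+) \<gamma> ` A"
  | \<alpha> n where "\<alpha> \<in> R_T D" "B = aff_refl D \<alpha> n ` A" "A \<subseteq> neg_halfspace D \<alpha> n"
  unfolding alcove_step_def by blast
 thus ?thesis
 proof cases
  case 1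
  hence "ra B = (+) \<gamma> ` ra A" using ra_left[OF affW_transl AB(1)] pos_root_cone_Q by blast
  thus ?thesis using 1 rAB unfolding alcove_step_def by blast
 next
  case 2
  have R: "\<alpha> \<in> R" using 2 R_T_subset Rp_subset by blast
  have H: "neg_halfspace D \<alpha> n = {v. ev (\<alpha>, n) v < 0}" by (auto simp: neg_halfspace_def ev_def)
  have a: "(\<alpha>, n) \<in> AR" using R by (simp add: AR_def)
  have rB: "ra B = aff_refl D \<alpha> n ` ra A" using ra_left[OF affW_refl[OF R] AB(1)] 2 by blast
  show ?thesis
  proof (cases "ra A \<subseteq> neg_halfspace D \<alpha> n")
   case True
   thus ?thesis using rB rAB 2(1) unfolding alcove_step_def by blast
  next
   case False
   \<comment> \<open>The hyperplane has \<open>A\<close> but not its neighbour on the negative side,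
     so it is their common wall.\<close>
   hence "rf (\<alpha>, n) ` A = ra A" using wall_sep[OF AB(1) a] 2 unfolding H by blast
   hence "ra A = B" using 2 by (simp add: rf_def)
   thus ?thesis using ra_ra[OF AB(1)] by simp
  qed
 qed
qed

text \<open>This lemma and the next replace monotonicity of the right action. The translated chain
  breaks off at a step that is the wall crossing itself, but there the remaining part of the given
  chain serves instead.\<close>

lemma ra_mono_or1:
 assumes "alcove_le B A" "A \<in> alcoves D" shows "alcove_le (ra B) A \<or> alcove_le (ra B) (ra A)"
 using assms(1) unfolding alcove_order_eq
proof (induction rule: converse_rtrancl_induct)
 case (step B C)
 thus ?case using step_ra[OF step(1)] by (metis converse_rtrancl_into_rtrancl)
qed auto

lemma ra_mono_or2:
 assumes "alcove_le B A" "A \<in> alcoves D" shows "alcove_le (ra B) (ra A) \<or> alcove_le B (ra A)"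
 using assms(1) unfolding alcove_order_eq
proof (induction rule: rtrancl_induct)
 case (step A C)
 thus ?case using step_ra[OF step(2)] by (metis rtrancl.rtrancl_into_rtrancl)
qed auto

text \<open>The two kinds of orbits on which an alcove and its neighbour are comparable, in the same
  direction throughout. By \<open>orbit_type_le\<close>, on all other orbits no alcove of
  \<open>x\<close> is comparable to any alcove of \<open>ro x\<close>.\<close>

definition up :: "'v set set \<Rightarrow> bool" where "up x \<longleftrightarrow> (\<forall>A\<in>x. alcove_le A (ra A))"
definition down :: "'v set set \<Rightarrow> bool" where "down x \<longleftrightarrow> (\<forall>A\<in>x. alcove_le (ra A) A)"

lemma down_if_R_T: assumes x: "x \<in> orbits D" and r: "croot x \<in> R_T D" shows "down x"
 unfolding down_def
proof
 fix A assume A: "A \<in> x"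
 then obtain m where m: "croot x \<in> R" "ra A = aff_refl D (croot x) m ` A" "A \<subseteq> {v. ev (croot x, m) v > 0}"
  using wall_refl[OF x] by metis
 have a: "(croot x, m) \<in> AR" using m(1) by (simp add: AR_def)
 have "A = aff_refl D (croot x) m ` ra A" unfolding m(2) using aff_refl_invol[OF m(1)] by (simp add: image_image)
 moreover have "ra A \<subseteq> neg_halfspace D (croot x) m"
  unfolding m(2) using ev_rf[OF a] m(3) by (auto simp: neg_halfspace_def rf_def ev_def)
 ultimately have "(ra A, A) \<in> alcove_step"
  using r orbit_orb[OF x A] ra_alcove unfolding alcove_step_def by blast
 thus "alcove_le (ra A) A" by (auto simp: alcove_order_eq)
qed

lemma up_if_R_T: assumes x: "x \<in> orbits D" and r: "- croot x \<in> R_T D" shows "up x"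
 unfolding up_def
proof
 fix A assume A: "A \<in> x"
 have AD: "A \<in> alcoves D" using orbit_orb[OF x A] by simp
 have "down (ro x)" using down_if_R_T[OF ro_orbits[OF x]] r croot_ro[OF x] by simp
 hence "alcove_le (ra (ra A)) (ra A)" using ra_in_ro[OF A] unfolding down_def by blast
 thus "alcove_le A (ra A)" using ra_ra[OF AD] by simp
qed

text \<open>Up to a translation, an element that takes an alcove of \<open>x\<close> to one of
  \<open>ro x\<close> is the reflection in the wall, by freeness. So the wall root or its negative
  lies in \<open>R_T\<close>.\<close>

lemma orbit_type:
 assumes x: "x \<in> orbits D" and A: "A \<in> x" and B: "B \<in> ro x" and w: "w \<in> affWT" "B = w ` A"
 shows "up x \<or> down x"
proof -
 have AD: "A \<in> alcoves D" using orbit_orb[OF x A] by simp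
 have "B \<in> orb (ra A)" using B ro_orb[OF AD] orbit_orb(1)[OF x A] by simp
 then obtain \<gamma> where \<gamma>: "\<gamma> \<in> Q" "B = (+) \<gamma> ` ra A" unfolding orb_def by blast
 obtain m where m: "croot x \<in> R" "ra A = aff_refl D (croot x) m ` A" using wall_refl[OF x A] by metis
 obtain u where u: "u \<in> affW" "A = al u" using AD by (rule alcove_cases)
 note rr = affW_refl[OF m(1), of m]
 have "al (w \<circ> u) = al (((+) \<gamma> \<circ> aff_refl D (croot x) m) \<circ> u)"
  using w(2) \<gamma>(2) m(2) u(2) by (simp only: al_comp) (simp add: image_image)
 hence "w \<circ> u = ((+) \<gamma> \<circ> aff_refl D (croot x) m) \<circ> u"
  by (intro al_inj affW_comp affW_transl \<gamma> rr u affWT_affW w)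
 hence "w = (+) \<gamma> \<circ> aff_refl D (croot x) m"
  using affW_bij[OF u(1)] by (metis bij_is_surj comp_assoc comp_id surj_iff)
 hence "aff_refl D (croot x) m = (+) (- \<gamma>) \<circ> w" by (auto simp: fun_eq_iff)
 hence T: "aff_refl D (croot x) m \<in> affWT"
  using affWT_comp[OF affWT_transl[OF Q_neg[OF \<gamma>(1)]] w(1)] by (simp only:)
 hence T': "aff_refl D (- croot x) (- m) \<in> affWT" using aff_refl_neg[OF m(1)] by simp
 show ?thesis using Rp_cases[OF m(1)] T T' down_if_R_T[OF x] up_if_R_T[OF x] unfolding R_T_def by blast
qed

lemma orbit_type_le:
 assumes "x \<in> orbits D" "A \<in> x" "B \<in> ro x" "alcove_le A B \<or> alcove_le B A" shows "up x \<or> down x"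
proof -
 obtain w where w: "w \<in> affWT" "B = w ` A"
 proof (cases "alcove_le A B")
  case False
  then obtain u where u: "u \<in> affWT" "A = u ` B" using assms(4) le_affWT by blast
  hence "B = Hilbert_Choice.inv u ` A" using affW_bij[OF affWT_affW] by (metis bij_is_inj image_inv_f_f)
  thus ?thesis using that affWT_inv u by blast
 qed (use that le_affWT in blast)
 thus ?thesis using orbit_type assms by blast
qed

section \<open>Open sets, hulls and the operation sharp\<close>

lemma opens_iff: "J \<in> opens D \<longleftrightarrow> J \<subseteq> alcoves D \<and> (\<forall>B\<in>J. \<forall>A. alcove_le A B --> A \<in> J)"
 by (simp add: opens_def)

lemma opens_le: "J \<in> opens D ==> B \<in> J ==> alcove_le A B ==> A \<in> J"
 and opens_alcoves: "J \<in> opens D ==> A \<in> J ==> A \<in> alcoves D"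
 by (auto simp: opens_iff)

abbreviation "hl \<equiv> open_hull D"

lemma hull_eq: assumes "\<T> \<subseteq> alcoves D" shows "hl \<T> = {A. \<exists>B\<in>\<T>. alcove_le A B}"
proof -
 have "{A. \<exists>B\<in>\<T>. alcove_le A B} \<in> opens D"
  using assms le_alcoves le_trans unfolding opens_iff by blast
 thus ?thesis unfolding open_hull_def using le_refl opens_le by blast
qed

lemma hull_opens: "\<T> \<subseteq> alcoves D ==> hl \<T> \<in> opens D"
 unfolding hull_eq opens_iff using le_alcoves le_trans by blast

lemma hull_superset: "\<T> \<subseteq> hl \<T>"
 unfolding open_hull_def by blast

lemma hull_least: "J \<in> opens D ==> \<T> \<subseteq> J ==> hl \<T> \<subseteq> J"
 unfolding open_hull_def by blast

lemma hull_Int: "J \<in> opens D ==> hl (J \<inter> X) \<in> opens D"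
 and hull_Int_sub: "J \<in> opens D ==> hl (J \<inter> X) \<subseteq> J"
 and hull_Int_Int: "J \<in> opens D ==> hl (J \<inter> X) \<inter> X = J \<inter> X"
proof -
 assume J: "J \<in> opens D"
 show "hl (J \<inter> X) \<in> opens D" using J opens_alcoves by (intro hull_opens) blast
 show s: "hl (J \<inter> X) \<subseteq> J" using hull_least[OF J] by blast
 show "hl (J \<inter> X) \<inter> X = J \<inter> X" using s hull_superset by blast
qed

lemma hull_Int_hull: "J \<in> opens D ==> hl (hl (J \<inter> X) \<inter> X) = hl (J \<inter> X)"
 by (simp only: hull_Int_Int)

lemma empty_opens: "{} \<in> opens D" by (simp add: opens_iff)

abbreviation "sh \<equiv> sharp D s"

text \<open>By \<open>ra_mono_or2\<close>, an alcove below \<open>ra C\<close> lies below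
  \<open>C\<close> itself or has its neighbour below \<open>C\<close>; in both cases it belongs to
  \<open>sh J\<close>.\<close>

lemma sh_opens: assumes J: "J \<in> opens D" shows "sh J \<in> opens D"
 unfolding opens_iff
proof (intro conjI ballI allI impI)
 show "sh J \<subseteq> alcoves D" using opens_alcoves[OF J] ra_alcove by (auto simp: sharp_def)
 fix B A assume B: "B \<in> sh J" and le: "alcove_le A B"
 show "A \<in> sh J"
 proof (cases "B \<in> J")
  case True
  thus ?thesis using opens_le[OF J _ le] by (simp add: sharp_def)
 next
  case False
  then obtain C where C: "C \<in> J" "B = ra C" using B by (auto simp: sharp_def)
  have D: "C \<in> alcoves D" "B \<in> alcoves D" using opens_alcoves[OF J] ra_alcove C by auto
  hence A: "A \<in> alcoves D" using le le_alcoves by blast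
  have "alcove_le (ra A) C \<or> alcove_le A C" using ra_mono_or2[OF le D(2)] C(2) ra_ra[OF D(1)] by simp
  hence "ra A \<in> J \<or> A \<in> J" using opens_le[OF J C(1)] by blast
  thus ?thesis using ra_ra[OF A] unfolding sharp_def by (metis UnI1 UnI2 imageI)
 qed
qed

lemma sh_superset: "J \<subseteq> sh J" by (simp add: sharp_def)

lemma sh_mono: "J \<subseteq> K ==> sh J \<subseteq> sh K" by (auto simp: sharp_def)

lemma ra_sh: assumes "J \<in> opens D" shows "ra ` sh J = sh J"
proof -
 have "ra ` ra ` J = J" using ra_ra opens_alcoves[OF assms] by (force simp: image_image)
 thus ?thesis by (auto simp: sharp_def image_Un)
qed

lemma sh_invariant: "ra ` J = J ==> sh J = J" by (simp add: sharp_def)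

lemma sh_sh: "J \<in> opens D ==> sh (sh J) = sh J"
 by (rule sh_invariant[OF ra_sh])

lemma sh_empty: "sh {} = {}" by (simp add: sharp_def)

text \<open>An alcove \<open>A\<close> of \<open>x\<close> that enters through its neighbour makes
  this neighbour comparable to an element of \<open>x\<close>. So the orbit is of type
  \<open>up\<close> or \<open>down\<close>, and in either case \<open>A\<close> already lies below
  that element. Uniqueness rests on this equality.\<close>

lemma sh_hull_Int:
 assumes J: "J \<in> opens D" and x: "x \<in> orbits D" shows "sh (hl (J \<inter> x)) \<inter> x = J \<inter> x"
proof
 show "J \<inter> x \<subseteq> sh (hl (J \<inter> x)) \<inter> x" using hull_superset[of "J \<inter> x"] sh_superset by blast
 show "sh (hl (J \<inter> x)) \<inter> x \<subseteq> J \<inter> x"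
 proof
  fix A assume A: "A \<in> sh (hl (J \<inter> x)) \<inter> x"
  have AD: "A \<in> alcoves D" using orbit_orb[OF x] A by blast
  show "A \<in> J \<inter> x"
  proof (cases "A \<in> hl (J \<inter> x)")
   case True
   thus ?thesis using hull_Int_sub[OF J] A by blast
  next
   case False
   then obtain B where B: "B \<in> hl (J \<inter> x)" "A = ra B" using A by (auto simp: sharp_def)
   have sub: "J \<inter> x \<subseteq> alcoves D" using opens_alcoves[OF J] by blast
   obtain C where C: "C \<in> J \<inter> x" "alcove_le B C" using B(1) unfolding hull_eq[OF sub] by blast
   have BD: "B \<in> alcoves D" "C \<in> alcoves D" using C sub le_alcoves by blast+
   have Br: "B = ra A" using B ra_ra[OF BD(1)] by simp
   have Bx: "B \<in> ro x" using Br ra_in_ro A by blast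
   have "up x \<or> down x" using orbit_type_le[OF x, of C B] C Bx by blast
   hence "alcove_le A C"
   proof
    assume "up x"
    hence "alcove_le A B" using A Br unfolding up_def by blast
    thus ?thesis using C le_trans by blast
   next
    assume "down x"
    hence "alcove_le (ra C) C" using C unfolding down_def by blast
    thus ?thesis using ra_mono_or1[OF C(2) BD(2)] B(2) le_trans by blast
   qed
   thus ?thesis using opens_le[OF J] C A by blast
  qed
 qed
qed

text \<open>The combinatorial heart of the finiteness of \<open>\<vartheta>\<^sub>s M\<close>.\<close>

lemma finitary_cover:
 assumes J: "J \<in> opens D" and x: "x \<in> orbits D" and T: "T \<subseteq> alcoves D"
 defines "K \<equiv> sh (hl (J \<inter> x))" and "J' \<equiv> hl (J \<inter> (T \<union> ra ` T))"
 shows "hl (K \<inter> T) \<inter> x \<subseteq> sh (hl (J' \<inter> x))" "hl (K \<inter> T) \<inter> ro x \<subseteq> sh (hl (J' \<inter> x))"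
proof -
 have subJ: "J \<inter> X \<subseteq> alcoves D" for X using opens_alcoves[OF J] by blast
 have J': "J' \<in> opens D" unfolding J'_def using hull_Int[OF J] .
 have J'I: "B \<in> J'" if "alcove_le B A" "A \<in> J" "A \<in> T \<or> A \<in> ra ` T" for A B
  unfolding J'_def using that hull_eq[OF subJ] by blast
 have main: "\<exists>A. alcove_le B A \<and> A \<in> T \<and> A \<in> alcoves D \<and>
   (\<exists>C\<in>J \<inter> x. C \<in> alcoves D \<and> (alcove_le A C \<or> alcove_le (ra A) C))"
  if B: "B \<in> hl (K \<inter> T)" for B
 proof -
  have KT: "K \<inter> T \<subseteq> alcoves D" using T by blast
  obtain A where A: "A \<in> K" "A \<in> T" "alcove_le B A" using B unfolding hull_eq[OF KT] by blast
  have AD: "A \<in> alcoves D" using A T by blast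
  have "A \<in> hl (J \<inter> x) \<or> ra A \<in> hl (J \<inter> x)"
   using A(1) ra_ra opens_alcoves[OF hull_Int[OF J]] unfolding K_def sharp_def by force
  thus ?thesis using A AD unfolding hull_eq[OF subJ] using subJ by blast
 qed
 have in1: "B \<in> sh (hl (J' \<inter> x))" if "B \<in> x" "B \<in> J'" for B
  using that hull_superset[of "J' \<inter> x"] sh_superset by blast
 show "hl (K \<inter> T) \<inter> x \<subseteq> sh (hl (J' \<inter> x))"
 proof
  fix B assume B: "B \<in> hl (K \<inter> T) \<inter> x"
  then obtain A C where A: "alcove_le B A" "A \<in> T" "A \<in> alcoves D" "C \<in> J" "C \<in> x" "C \<in> alcoves D"
   "alcove_le A C \<or> alcove_le (ra A) C" using main by blast
  \<comment> \<open>If \<open>A\<close> is in \<open>J\<close>, then \<open>B\<close> lies in the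
    hull through \<open>A\<close>. Otherwise only the neighbour of \<open>A\<close> need be in
    \<open>J\<close>, which is why the neighbours of \<open>T\<close> are added to the finite
    set.\<close>
  have "B \<in> J'"
  proof (cases "alcove_le A C")
   case True
   thus ?thesis using J'I A opens_le[OF J] by blast
  next
   case False
   hence AC: "alcove_le (ra A) C" using A by blast
   hence raJ: "ra A \<in> J" using opens_le[OF J] A by blast
   show ?thesis
   proof (cases "alcove_le B (ra A)")
    case True
    thus ?thesis using J'I raJ A by blast
   next
    case nle: False
    hence le: "alcove_le (ra B) (ra A)" using ra_mono_or2[OF A(1,3)] by blast
    \<comment> \<open>\<open>ra B\<close> lies below \<open>C\<close>, an element of
      \<open>x\<close>, so the orbit has a direction; each direction contradicts one of the case
      assumptions.\<close>
    have "up x \<or> down x"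
     using orbit_type_le[OF x A(5) ra_in_ro, of B] le_trans[OF le AC] B by blast
    thus ?thesis
    proof
     assume "up x"
     hence "alcove_le B (ra B)" using B unfolding up_def by blast
     thus ?thesis using le le_trans nle by blast
    next
     assume "down x"
     hence "alcove_le (ra C) C" using A unfolding down_def by blast
     hence "alcove_le A C" using ra_mono_or1[OF AC A(6)] ra_ra[OF A(3)] le_trans[of A "ra C" C] by auto
     thus ?thesis using False by blast
    qed
   qed
  qed
  thus "B \<in> sh (hl (J' \<inter> x))" using in1 B by blast
 qed
 show "hl (K \<inter> T) \<inter> ro x \<subseteq> sh (hl (J' \<inter> x))"
 proof
  fix B assume B: "B \<in> hl (K \<inter> T) \<inter> ro x"
  then obtain A C where A: "alcove_le B A" "A \<in> T" "A \<in> alcoves D" "C \<in> J" "C \<in> x" "C \<in> alcoves D"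
   "alcove_le A C \<or> alcove_le (ra A) C" using main by blast
  have BD: "B \<in> alcoves D" using A le_alcoves by blast
  \<comment> \<open>The neighbour of \<open>B\<close> lies in \<open>x\<close>; once it is placed in
    \<open>J'\<close>, passing to sharp recovers \<open>B\<close>.\<close>
  have rBx: "ra B \<in> x" using ra_in_ro[of B "ro x"] B ro_ro[OF x] by simp
  have upB: "up x ==> alcove_le (ra B) B" using rBx ra_ra[OF BD] unfolding up_def by metis
  have downC: "down x ==> alcove_le (ra C) C" using A unfolding down_def by blast
  have ty: "up x \<or> down x" if "alcove_le B C" using orbit_type_le[OF x A(5), of B] B that by blast
  have down1: "ra B \<in> J'" if d: "down x" and AC: "alcove_le A C"
  proof -
   have "alcove_le (ra A) C" using ra_mono_or1[OF AC A(6)] downC[OF d] le_trans by blast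
   hence "ra A \<in> J" "A \<in> J" using opens_le[OF J] A AC by blast+
   thus ?thesis using ra_mono_or1[OF A(1,3)] J'I A by blast
  qed
  have "ra B \<in> J'"
  proof (cases "alcove_le A C")
   case True
   hence AJ: "A \<in> J" using opens_le[OF J] A by blast
   from ty[OF le_trans[OF A(1) True]] show ?thesis
   proof
    assume "up x"
    thus ?thesis using upB J'I AJ A le_trans by blast
   qed (use down1 True in blast)
  next
   case False
   hence AC: "alcove_le (ra A) C" using A by blast
   hence raJ: "ra A \<in> J" using opens_le[OF J] A by blast
   show ?thesis
   proof (cases "alcove_le (ra B) (ra A)")
    case True
    thus ?thesis using J'I raJ A by blast
   next
    case nle: False
    hence le: "alcove_le B (ra A)" using ra_mono_or2[OF A(1,3)] by blast
    from ty[OF le_trans[OF le AC]] show ?thesis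
    proof
     assume "up x"
     thus ?thesis using upB le le_trans nle by blast
    next
     assume d: "down x"
     hence "alcove_le A C" using ra_mono_or1[OF AC A(6)] downC[OF d] ra_ra[OF A(3)] le_trans[of A "ra C" C] by auto
     thus ?thesis using False by blast
    qed
   qed
  qed
  hence "ra B \<in> hl (J' \<inter> x)" using rBx by (intro subsetD[OF hull_superset] IntI)
  hence "ra (ra B) \<in> sh (hl (J' \<inter> x))" unfolding sharp_def by blast
  thus "B \<in> sh (hl (J' \<inter> x))" using ra_ra[OF BD] by simp
 qed
qed

end

section \<open>Symmetric algebras\<close>

lemma finite_submultisets: "finite {a. a \<subseteq># m}"
proof (induction m)
 case (add x m)
 have "{a. a \<subseteq># add_mset x m} \<subseteq> {a. a \<subseteq># m} \<union> add_mset x ` {a. a \<subseteq># m}"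
 proof
  fix a assume "a \<in> {a. a \<subseteq># add_mset x m}"
  hence a: "a \<subseteq># add_mset x m" by simp
  show "a \<in> {a. a \<subseteq># m} \<union> add_mset x ` {a. a \<subseteq># m}"
  proof (cases "x \<in># a")
   case True
   then obtain b where b: "a = add_mset x b" by (metis mset_add)
   thus ?thesis using a by auto
  next
   case False
   hence "a \<subseteq># m" using a by (metis add_mset_remove_trivial diff_single_trivial subset_eq_diff_conv
     mset_subset_eq_add_mset_cancel subset_mset.add_diff_inverse diff_subset_eq_self subset_mset.order_trans
     add_mset_add_single)
   thus ?thesis by simp
  qed
 qed
 thus ?case using add by (meson finite_UnI finite_imageI finite_subset)
qed simp

context abelian_monoid
begin

lemma finsum_Sigma:
 assumes "finite A" "\<And>a. a \<in> A ==> finite (B a)"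
  and "\<And>a b. a \<in> A ==> b \<in> B a ==> g a b \<in> carrier G"
 shows "(\<Oplus>a\<in>A. \<Oplus>b\<in>B a. g a b) = (\<Oplus>p\<in>Sigma A B. g (fst p) (snd p))"
 using assms
proof (induction A rule: finite_induct)
 case (insert a A)
 have e: "Sigma (insert a A) B = Pair a ` B a \<union> Sigma A B" by auto
 have "(\<Oplus>p\<in>Sigma (insert a A) B. g (fst p) (snd p)) =
   (\<Oplus>p\<in>Pair a ` B a. g (fst p) (snd p)) \<oplus> (\<Oplus>p\<in>Sigma A B. g (fst p) (snd p))"
  unfolding e using insert by (intro finsum_Un_disjoint) auto
 also have "(\<Oplus>p\<in>Pair a ` B a. g (fst p) (snd p)) = (\<Oplus>b\<in>B a. g a b)"
  using insert by (subst finsum_reindex) (auto simp: inj_on_def)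
 also have "\<dots> \<oplus> (\<Oplus>p\<in>Sigma A B. g (fst p) (snd p)) = (\<Oplus>b\<in>B a. g a b) \<oplus> (\<Oplus>a\<in>A. \<Oplus>b\<in>B a. g a b)"
  using insert by (subst insert.IH) auto
 finally show ?case using insert by simp
qed simp

lemma finsum_bij:
 assumes "bij_betw h A B" "\<And>b. b \<in> B ==> f b \<in> carrier G"
 shows "(\<Oplus>b\<in>B. f b) = (\<Oplus>a\<in>A. f (h a))"
 using finsum_reindex[of f h A] assms unfolding bij_betw_def by auto

end

lemma (in abelian_group) minus_eq_zero_iff:
 assumes "a \<in> carrier G" "b \<in> carrier G" shows "a \<ominus> b = \<zero> \<longleftrightarrow> a = b"
proof
 assume z: "a \<ominus> b = \<zero>"
 have "a = (a \<ominus> b) \<oplus> b" using assms by (simp add: minus_eq a_assoc l_neg)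
 thus "a = b" using z assms by simp
qed (use assms in \<open>simp add: minus_eq r_neg\<close>)

section \<open>Polynomial rings\<close>

locale mpoly = cring k for k :: "('k, 'x) ring_scheme" (structure) +
 fixes I :: "'e set"
begin

definition P :: "('e multiset \<Rightarrow> 'k) ring" where "P = mpoly_ring k I"

abbreviation P_mult (infixl "*\<^sub>P" 70) where "a *\<^sub>P b \<equiv> a \<otimes>\<^bsub>P\<^esub> b"
abbreviation P_add (infixl "+\<^sub>P" 65) where "a +\<^sub>P b \<equiv> a \<oplus>\<^bsub>P\<^esub> b"
abbreviation P_minus (infixl "-\<^sub>P" 65) where "a -\<^sub>P b \<equiv> a \<ominus>\<^bsub>P\<^esub> b"
abbreviation P_zero ("0\<^sub>P") where "0\<^sub>P \<equiv> \<zero>\<^bsub>P\<^esub>"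
abbreviation P_one ("1\<^sub>P") where "1\<^sub>P \<equiv> \<one>\<^bsub>P\<^esub>"

abbreviation supp :: "('e multiset \<Rightarrow> 'k) \<Rightarrow> 'e multiset set" where "supp p \<equiv> {m. p m \<noteq> \<zero>}"

lemma P_iff: "p \<in> carrier P \<longleftrightarrow> (\<forall>m. p m \<in> carrier k) \<and> finite (supp p) \<and> (\<forall>m. p m \<noteq> \<zero> --> set_mset m \<subseteq> I)"
 by (simp add: P_def mpoly_ring_def)

lemma P_ops: "p *\<^sub>P q = (\<lambda>m. \<Oplus>a\<in>{a. a \<subseteq># m}. p a \<otimes> q (m - a))"
 "p +\<^sub>P q = (\<lambda>m. p m \<oplus> q m)" "0\<^sub>P = (\<lambda>m. \<zero>)" "1\<^sub>P = (\<lambda>m. if m = {#} then \<one> else \<zero>)"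
 by (auto simp: P_def mpoly_ring_def)

lemma P_val [simp]: "p \<in> carrier P ==> p m \<in> carrier k" by (simp add: P_iff)

lemma mult_supp:
 assumes "p \<in> carrier P" "q \<in> carrier P" "(p *\<^sub>P q) m \<noteq> \<zero>"
 obtains a b where "p a \<noteq> \<zero>" "q b \<noteq> \<zero>" "m = a + b"
proof -
 have "\<exists>a. a \<subseteq># m \<and> p a \<otimes> q (m - a) \<noteq> \<zero>"
 proof (rule ccontr)
  assume "\<not> ?thesis"
  hence "(\<Oplus>a\<in>{a. a \<subseteq># m}. p a \<otimes> q (m - a)) = (\<Oplus>a\<in>{a. a \<subseteq># m}. \<zero>)"
   by (intro finsum_cong') auto
  thus False using assms(3) by (simp add: P_ops)
 qed
 then obtain a where a: "a \<subseteq># m" "p a \<otimes> q (m - a) \<noteq> \<zero>" by blast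
 hence "p a \<noteq> \<zero>" "q (m - a) \<noteq> \<zero>" "m = a + (m - a)" using assms by auto
 thus ?thesis using that by blast
qed

lemma mult_closed: assumes p: "p \<in> carrier P" and q: "q \<in> carrier P" shows "p *\<^sub>P q \<in> carrier P"
 unfolding P_iff
proof (intro conjI allI impI)
 show "(p *\<^sub>P q) m \<in> carrier k" for m unfolding P_ops using p q by (intro finsum_closed) auto
 have "supp (p *\<^sub>P q) \<subseteq> (\<lambda>(a, b). a + b) ` (supp p \<times> supp q)"
 proof
  fix m assume "m \<in> supp (p *\<^sub>P q)"
  then obtain a b where "p a \<noteq> \<zero>" "q b \<noteq> \<zero>" "m = a + b" using mult_supp[OF p q] by blast
  thus "m \<in> (\<lambda>(a, b). a + b) ` (supp p \<times> supp q)" by blast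
 qed
 moreover have "finite ((\<lambda>(a, b). a + b) ` (supp p \<times> supp q))" using p q by (simp add: P_iff)
 ultimately show "finite (supp (p *\<^sub>P q))" by (rule finite_subset)
 show "set_mset m \<subseteq> I" if nz: "(p *\<^sub>P q) m \<noteq> \<zero>" for m
 proof -
  obtain a b where "p a \<noteq> \<zero>" "q b \<noteq> \<zero>" "m = a + b" using mult_supp[OF p q nz] .
  thus ?thesis using p q unfolding P_iff by auto
 qed
qed

lemma mult_comm: assumes p: "p \<in> carrier P" and q: "q \<in> carrier P" shows "p *\<^sub>P q = q *\<^sub>P p"
proof
 fix m :: "'e multiset"
 have "bij_betw (\<lambda>a. m - a) {a. a \<subseteq># m} {a. a \<subseteq># m}"
  by (rule bij_betwI[where g="\<lambda>a. m - a"]) (auto simp: double_diff multiset_eq_iff mset_subset_eq_count)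
 hence "(\<Oplus>a\<in>{a. a \<subseteq># m}. p a \<otimes> q (m - a)) = (\<Oplus>a\<in>{a. a \<subseteq># m}. p (m - a) \<otimes> q (m - (m - a)))"
  using p q by (intro finsum_bij) auto
 also have "\<dots> = (\<Oplus>a\<in>{a. a \<subseteq># m}. q a \<otimes> p (m - a))"
 proof (rule finsum_cong')
  fix a assume "a \<in> {a. a \<subseteq># m}"
  hence "m - (m - a) = a" by (simp add: multiset_eq_iff mset_subset_eq_count)
  thus "p (m - a) \<otimes> q (m - (m - a)) = q a \<otimes> p (m - a)" using p q m_comm by simp
 qed (use p q in auto)
 finally show "(p *\<^sub>P q) m = (q *\<^sub>P p) m" by (simp add: P_ops)
qed

lemma mult_assoc:
 assumes p: "p \<in> carrier P" and q: "q \<in> carrier P" and r: "r \<in> carrier P"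
 shows "p *\<^sub>P q *\<^sub>P r = p *\<^sub>P (q *\<^sub>P r)"
proof
 fix m
 let ?S = "\<lambda>m::'e multiset. {a. a \<subseteq># m}"
 \<comment> \<open>Both sides sum over decompositions of \<open>m\<close> into three parts; the
   first records the sum of two parts and one of them, the second records the two parts.\<close>
 have bij: "bij_betw (\<lambda>(b, c). (b + c, b)) (SIGMA b:?S m. ?S (m - b)) (SIGMA a:?S m. ?S a)"
  by (rule bij_betwI[where g="\<lambda>(a, b). (b, a - b)"])
   (auto simp: multiset_eq_iff subseteq_mset_def le_diff_conv2 add.commute intro: le_trans intro!: diff_le_mono)
 have "(p *\<^sub>P q *\<^sub>P r) m = (\<Oplus>a\<in>?S m. \<Oplus>b\<in>?S a. p b \<otimes> q (a - b) \<otimes> r (m - a))"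
  unfolding P_ops using p q r by (intro finsum_cong' finsum_ldistr) (auto simp: finite_submultisets)
 also have "\<dots> = (\<Oplus>t\<in>(SIGMA a:?S m. ?S a). p (snd t) \<otimes> q (fst t - snd t) \<otimes> r (m - fst t))"
  using p q r by (intro finsum_Sigma) (auto simp: finite_submultisets)
 also have "\<dots> = (\<Oplus>t\<in>(SIGMA b:?S m. ?S (m - b)). p (fst t) \<otimes> (q (snd t) \<otimes> r (m - fst t - snd t)))"
  using p q r by (subst finsum_bij[OF bij]) (auto simp: m_assoc intro!: finsum_cong')
 also have "\<dots> = (\<Oplus>b\<in>?S m. \<Oplus>c\<in>?S (m - b). p b \<otimes> (q c \<otimes> r (m - b - c)))"
  using p q r by (intro finsum_Sigma[symmetric]) (auto simp: finite_submultisets)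
 also have "\<dots> = (p *\<^sub>P (q *\<^sub>P r)) m"
  unfolding P_ops using p q r by (intro finsum_cong' finsum_rdistr[symmetric]) (auto simp: finite_submultisets)
 finally show "(p *\<^sub>P q *\<^sub>P r) m = (p *\<^sub>P (q *\<^sub>P r)) m" .
qed

lemma add_closed: assumes p: "p \<in> carrier P" and q: "q \<in> carrier P" shows "p +\<^sub>P q \<in> carrier P"
 unfolding P_iff P_ops
proof (intro conjI allI impI)
 have "supp (\<lambda>m. p m \<oplus> q m) \<subseteq> supp p \<union> supp q" by auto
 thus "finite (supp (\<lambda>m. p m \<oplus> q m))" using p q by (auto simp: P_iff intro: finite_subset)
 show "set_mset m \<subseteq> I" if "p m \<oplus> q m \<noteq> \<zero>" for m
  using that p q by (metis P_iff add.l_one zero_closed)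
qed (use p q in auto)

lemma const_mult:
 assumes c: "c \<in> carrier k" and p: "p \<in> carrier P" and x: "set_mset x \<subseteq> I"
 shows "mpoly_monom k c x *\<^sub>P p = (\<lambda>m. if x \<subseteq># m then c \<otimes> p (m - x) else \<zero>)"
proof
 fix m
 have "(mpoly_monom k c x *\<^sub>P p) m = (\<Oplus>a\<in>{a. a \<subseteq># m}. if x = a then c \<otimes> p (m - a) else \<zero>)"
  unfolding P_ops mpoly_monom_def using c p by (intro finsum_cong') auto
 also have "\<dots> = (if x \<subseteq># m then c \<otimes> p (m - x) else \<zero>)"
  using finsum_singleton[of x "{a. a \<subseteq># m}" "\<lambda>a. c \<otimes> p (m - a)"] c p finite_submultisets[of m]
  by (auto intro!: add.finprod_one_eqI)
 finally show "(mpoly_monom k c x *\<^sub>P p) m = (if x \<subseteq># m then c \<otimes> p (m - x) else \<zero>)" .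
qed

lemma monom_P: "c \<in> carrier k ==> set_mset x \<subseteq> I ==> mpoly_monom k c x \<in> carrier P"
 by (auto simp: P_iff mpoly_monom_def)

lemma one_monom: "1\<^sub>P = mpoly_monom k \<one> {#}"
 by (auto simp: P_ops mpoly_monom_def)

lemma cring_P: "cring P"
proof (rule cringI)
 show "abelian_group P"
 proof (rule abelian_groupI)
  fix p assume p: "p \<in> carrier P"
  show "\<exists>q\<in>carrier P. q +\<^sub>P p = 0\<^sub>P"
  proof (rule bexI[of _ "\<lambda>m. \<ominus> p m"])
   show "(\<lambda>m. \<ominus> p m) +\<^sub>P p = 0\<^sub>P" unfolding P_ops using p by (auto simp: l_neg)
   have "supp (\<lambda>m. \<ominus> p m) \<subseteq> supp p" by auto
   thus "(\<lambda>m. \<ominus> p m) \<in> carrier P" using p unfolding P_iff by (auto intro: finite_subset)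
  qed
 next
  fix p q r assume "p \<in> carrier P" "q \<in> carrier P" "r \<in> carrier P"
  thus "p +\<^sub>P q +\<^sub>P r = p +\<^sub>P (q +\<^sub>P r)"
   by (simp add: P_ops a_assoc)
 qed (auto simp: add_closed, auto simp: P_ops P_iff a_comm)
 show "Group.comm_monoid P"
 proof (rule Group.comm_monoidI)
  show "1\<^sub>P \<in> carrier P" by (simp add: one_monom monom_P)
  fix p assume p: "p \<in> carrier P"
  show "1\<^sub>P *\<^sub>P p = p" using p by (auto simp: one_monom const_mult)
 next
  fix p q r assume "p \<in> carrier P" "q \<in> carrier P" "r \<in> carrier P"
  thus "p *\<^sub>P q *\<^sub>P r = p *\<^sub>P (q *\<^sub>P r)" by (rule mult_assoc)
 qed (auto simp: mult_closed intro: mult_comm)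
next
 fix p q r assume pqr: "p \<in> carrier P" "q \<in> carrier P" "r \<in> carrier P"
 show "(p +\<^sub>P q) *\<^sub>P r = p *\<^sub>P r +\<^sub>P q *\<^sub>P r"
 proof
  fix m
  have "((p +\<^sub>P q) *\<^sub>P r) m = (\<Oplus>a\<in>{a. a \<subseteq># m}. p a \<otimes> r (m - a) \<oplus> q a \<otimes> r (m - a))"
   unfolding P_ops using pqr by (intro finsum_cong') (auto simp: l_distr)
  also have "\<dots> = (p *\<^sub>P r +\<^sub>P q *\<^sub>P r) m"
   unfolding P_ops using pqr by (intro finsum_addf) auto
  finally show "((p +\<^sub>P q) *\<^sub>P r) m = (p *\<^sub>P r +\<^sub>P q *\<^sub>P r) m" .
 qed
qed

lemma finsum_P: "finite A ==> (\<And>a. a \<in> A ==> f a \<in> carrier P) ==> finsum P f A m = (\<Oplus>a\<in>A. f a m)"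
proof (induction A rule: finite_induct)
 case empty
 interpret P: cring P by (rule cring_P)
 show ?case by (simp add: P_ops)
next
 case (insert a A)
 interpret P: cring P by (rule cring_P)
 show ?case using insert by (subst P.finsum_insert) (auto simp: P_ops)
qed

lemma P_expansion: assumes p: "p \<in> carrier P" shows "p = finsum P (\<lambda>m. mpoly_monom k (p m) m) (supp p)"
proof
 fix m
 have f: "finite (supp p)" using p by (simp add: P_iff)
 have "finsum P (\<lambda>m. mpoly_monom k (p m) m) (supp p) m = (\<Oplus>a\<in>supp p. if m = a then p a else \<zero>)"
  using p f by (subst finsum_P) (auto simp: mpoly_monom_def P_iff intro!: finsum_cong')
 also have "\<dots> = p m"
  using finsum_singleton[of m "supp p" p] f p by (cases "p m = \<zero>") (auto intro!: add.finprod_one_eqI)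
 finally show "p m = finsum P (\<lambda>m. mpoly_monom k (p m) m) (supp p) m" ..
qed

end

section \<open>The symmetric algebra and twisted derivations\<close>

locale sym_alg = mpoly k "carrier E" for k :: "('k, 'x) ring_scheme" (structure) and E :: "('k, 'e, 'y) module_scheme" +
 assumes mod: "Module.module k E"
begin

abbreviation PE_mult (infixl "*\<^sub>P" 70) where "a *\<^sub>P b \<equiv> a \<otimes>\<^bsub>P\<^esub> b"
abbreviation PE_add (infixl "+\<^sub>P" 65) where "a +\<^sub>P b \<equiv> a \<oplus>\<^bsub>P\<^esub> b"
abbreviation PE_minus (infixl "-\<^sub>P" 65) where "a -\<^sub>P b \<equiv> a \<ominus>\<^bsub>P\<^esub> b"
abbreviation PE_zero ("0\<^sub>P") where "0\<^sub>P \<equiv> \<zero>\<^bsub>P\<^esub>"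
abbreviation PE_one ("1\<^sub>P") where "1\<^sub>P \<equiv> \<one>\<^bsub>P\<^esub>"

abbreviation E_smult (infixl "\<cdot>\<^sub>E" 70) where "a \<cdot>\<^sub>E b \<equiv> a \<odot>\<^bsub>E\<^esub> b"
abbreviation E_add (infixl "+\<^sub>E" 65) where "a +\<^sub>E b \<equiv> a \<oplus>\<^bsub>E\<^esub> b"
abbreviation E_zero ("0\<^sub>E") where "0\<^sub>E \<equiv> \<zero>\<^bsub>E\<^esub>"

sublocale E: module k E by (rule mod)
sublocale P: cring P by (rule cring_P)

definition S where "S = sym_algebra k E"

abbreviation S_mult (infixl "*\<^sub>S" 70) where "a *\<^sub>S b \<equiv> a \<otimes>\<^bsub>S\<^esub> b"
abbreviation S_add (infixl "+\<^sub>S" 65) where "a +\<^sub>S b \<equiv> a \<oplus>\<^bsub>S\<^esub> b"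
abbreviation S_minus (infixl "-\<^sub>S" 65) where "a -\<^sub>S b \<equiv> a \<ominus>\<^bsub>S\<^esub> b"
abbreviation S_zero ("0\<^sub>S") where "0\<^sub>S \<equiv> \<zero>\<^bsub>S\<^esub>"
abbreviation S_one ("1\<^sub>S") where "1\<^sub>S \<equiv> \<one>\<^bsub>S\<^esub>"
definition J where "J = sym_ideal k E"
definition X :: "'e \<Rightarrow> 'e multiset \<Rightarrow> 'k" where "X e = mpoly_monom k \<one> {#e#}"
definition cls where "cls p = J +>\<^bsub>P\<^esub> p"
definition gen where "gen e = sym_elt k E e"
definition iota where "iota c = cls (mpoly_monom k c {#})"

definition rels where "rels =
 {X (e +\<^sub>E f) -\<^sub>P (X e +\<^sub>P X f) | e f. e \<in> carrier E \<and> f \<in> carrier E} \<union>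
 {X (c \<cdot>\<^sub>E e) -\<^sub>P mpoly_monom k c {#e#} | c e. c \<in> carrier k \<and> e \<in> carrier E}"

lemma X_P [simp]: "e \<in> carrier E ==> X e \<in> carrier P"
 by (simp add: X_def monom_P)

lemma monom1_P [simp]: "c \<in> carrier k ==> e \<in> carrier E ==> mpoly_monom k c {#e#} \<in> carrier P"
 and monom0_P [simp]: "c \<in> carrier k ==> mpoly_monom k c {#} \<in> carrier P"
 by (simp_all add: monom_P)

lemma J_eq: "J = genideal P rels"
 by (simp add: J_def sym_ideal_def P_def[symmetric] rels_def X_def Let_def)

lemma rels_P: "rels \<subseteq> carrier P"
 unfolding rels_def by auto

sublocale J: ideal J P
 unfolding J_eq by (rule P.genideal_ideal[OF rels_P])

lemma S_eq: "S = P Quot J"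
 by (simp add: S_def sym_algebra_def P_def[symmetric] J_def)

sublocale S: cring S
 unfolding S_eq by (rule J.quotient_is_cring[OF cring_P])

sublocale cls: ring_hom_cring P S cls
 unfolding S_eq cls_def[abs_def] by (rule J.rcos_ring_hom_cring[OF cring_P])

lemma gen_cls: "gen e = cls (X e)"
 by (simp add: gen_def sym_elt_def cls_def P_def[symmetric] J_def X_def)

lemma S_cases: assumes "u \<in> carrier S" obtains p where "p \<in> carrier P" "u = cls p"
 using assms that unfolding S_eq cls_def by (auto simp: FactRing_def A_RCOSETS_def')

lemma cls_eq_iff:
 assumes "p \<in> carrier P" "q \<in> carrier P" shows "cls p = cls q \<longleftrightarrow> p -\<^sub>P q \<in> J"
 unfolding cls_def using P.quotient_eq_iff_same_a_r_cos[OF J.is_ideal assms] by simp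

lemma gen_S [simp]: "e \<in> carrier E ==> gen e \<in> carrier S"
 by (simp add: gen_cls)

lemma iota_S [simp]: "c \<in> carrier k ==> iota c \<in> carrier S"
 by (simp add: iota_def)

lemma monom_mult_const:
 assumes "c \<in> carrier k" "d \<in> carrier k" "set_mset m \<subseteq> carrier E"
 shows "mpoly_monom k c {#} *\<^sub>P mpoly_monom k d m = mpoly_monom k (c \<otimes> d) m"
 using assms by (auto simp: const_mult monom_P) (auto simp: mpoly_monom_def)

lemma monom_mult_X:
 assumes "e \<in> carrier E" "d \<in> carrier k" "set_mset m \<subseteq> carrier E"
 shows "X e *\<^sub>P mpoly_monom k d m = mpoly_monom k d (add_mset e m)"
proof
 fix m'
 have "(e \<in># m' \<and> m' - {#e#} = m) = (m' = add_mset e m)" by auto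
 thus "(X e *\<^sub>P mpoly_monom k d m) m' = mpoly_monom k d (add_mset e m) m'"
  using assms unfolding X_def by (subst const_mult) (auto simp: monom_P, auto simp: mpoly_monom_def)
qed

lemma monom_add: "c \<in> carrier k ==> d \<in> carrier k ==> mpoly_monom k (c \<oplus> d) m = mpoly_monom k c m +\<^sub>P mpoly_monom k d m"
 by (auto simp: P_ops mpoly_monom_def)

lemma iota_ops:
 assumes "c \<in> carrier k" "d \<in> carrier k"
 shows "iota (c \<otimes> d) = iota c *\<^sub>S iota d" "iota (c \<oplus> d) = iota c +\<^sub>S iota d"
proof -
 show "iota (c \<otimes> d) = iota c *\<^sub>S iota d"
  unfolding iota_def using monom_mult_const[OF assms, of "{#}"] assms by (simp flip: cls.hom_mult)
 show "iota (c \<oplus> d) = iota c +\<^sub>S iota d"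
  unfolding iota_def using assms by (simp add: monom_add)
qed

lemma iota_one: "iota \<one> = 1\<^sub>S"
 by (simp add: iota_def one_monom[symmetric])

lemma iota_zero: "iota \<zero> = 0\<^sub>S"
proof -
 have "mpoly_monom k \<zero> {#} = 0\<^sub>P" by (auto simp: mpoly_monom_def P_ops)
 thus ?thesis by (simp add: iota_def)
qed

lemma gen_add: "e \<in> carrier E ==> f \<in> carrier E ==> gen (e +\<^sub>E f) = gen e +\<^sub>S gen f"
proof -
 assume ef: "e \<in> carrier E" "f \<in> carrier E"
 have "X (e +\<^sub>E f) -\<^sub>P (X e +\<^sub>P X f) \<in> rels" using ef unfolding rels_def by blast
 hence "X (e +\<^sub>E f) -\<^sub>P (X e +\<^sub>P X f) \<in> J" unfolding J_eq using P.genideal_self[OF rels_P] by blast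
 hence "cls (X (e +\<^sub>E f)) = cls (X e +\<^sub>P X f)" using ef by (subst cls_eq_iff) auto
 thus ?thesis using ef by (simp add: gen_cls)
qed

lemma gen_smult: "c \<in> carrier k ==> e \<in> carrier E ==> gen (c \<cdot>\<^sub>E e) = iota c *\<^sub>S gen e"
proof -
 assume ce: "c \<in> carrier k" "e \<in> carrier E"
 have "X (c \<cdot>\<^sub>E e) -\<^sub>P mpoly_monom k c {#e#} \<in> rels" using ce unfolding rels_def by blast
 hence "X (c \<cdot>\<^sub>E e) -\<^sub>P mpoly_monom k c {#e#} \<in> J" unfolding J_eq using P.genideal_self[OF rels_P] by blast
 hence "cls (X (c \<cdot>\<^sub>E e)) = cls (mpoly_monom k c {#e#})" using ce by (subst cls_eq_iff) auto
 also have "mpoly_monom k c {#e#} = mpoly_monom k c {#} *\<^sub>P X e"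
  unfolding X_def using ce by (subst monom_mult_const) auto
 finally show ?thesis using ce by (simp add: gen_cls iota_def)
qed

lemma gen_minus: "e \<in> carrier E ==> gen (\<ominus>\<^bsub>E\<^esub> e) = \<ominus>\<^bsub>S\<^esub> gen e"
proof -
 assume e: "e \<in> carrier E"
 have z: "gen 0\<^sub>E = 0\<^sub>S"
  using gen_smult[of \<zero> "0\<^sub>E"] by (simp add: E.smult_l_null iota_zero)
 have "gen (\<ominus>\<^bsub>E\<^esub> e) +\<^sub>S gen e = 0\<^sub>S"
  using gen_add[of "\<ominus>\<^bsub>E\<^esub> e" e] e z by (simp add: E.M.l_neg)
 thus ?thesis using e S.minus_equality by simp
qed

text \<open>The linear extension of values \<open>h\<close> prescribed on monomials, used to define
  maps on the polynomial ring before passing to the quotient.\<close>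

definition lin where "lin h p = finsum S (\<lambda>m. iota (p m) *\<^sub>S h m) (supp p)"

context
 fixes h assumes h: "\<And>m. set_mset m \<subseteq> carrier E ==> h m \<in> carrier S"
begin

lemma lin_term: "p \<in> carrier P ==> m \<in> supp p ==> iota (p m) *\<^sub>S h m \<in> carrier S"
 using h by (auto simp: P_iff)

lemma lin_closed [simp]: "p \<in> carrier P ==> lin h p \<in> carrier S"
 unfolding lin_def using lin_term by (intro S.finsum_closed) auto

lemma lin_superset:
 assumes "p \<in> carrier P" "finite A" "supp p \<subseteq> A" "\<And>m. m \<in> A ==> set_mset m \<subseteq> carrier E"
 shows "lin h p = finsum S (\<lambda>m. iota (p m) *\<^sub>S h m) A"
 unfolding lin_def using assms h
 by (intro S.add.finprod_mono_neutral_cong_left) (auto simp: iota_zero)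

lemma lin_add:
 assumes "p \<in> carrier P" "q \<in> carrier P" shows "lin h (p +\<^sub>P q) = lin h p +\<^sub>S lin h q"
proof -
 let ?A = "supp p \<union> supp q"
 have A: "finite ?A" "\<And>m. m \<in> ?A ==> set_mset m \<subseteq> carrier E" using assms by (auto simp: P_iff)
 have s: "supp (p +\<^sub>P q) \<subseteq> ?A" by (auto simp: P_ops)
 have "lin h (p +\<^sub>P q) = finsum S (\<lambda>m. iota ((p +\<^sub>P q) m) *\<^sub>S h m) ?A"
  using assms A s by (intro lin_superset) auto
 also have "\<dots> = finsum S (\<lambda>m. iota (p m) *\<^sub>S h m +\<^sub>S iota (q m) *\<^sub>S h m) ?A"
  using assms A h by (intro S.finsum_cong') (auto simp: P_ops iota_ops S.l_distr)
 also have "\<dots> = finsum S (\<lambda>m. iota (p m) *\<^sub>S h m) ?A +\<^sub>S finsum S (\<lambda>m. iota (q m) *\<^sub>S h m) ?A"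
  using assms A h by (intro S.finsum_addf) auto
 also have "finsum S (\<lambda>m. iota (p m) *\<^sub>S h m) ?A = lin h p"
  using assms A by (intro lin_superset[symmetric]) auto
 also have "finsum S (\<lambda>m. iota (q m) *\<^sub>S h m) ?A = lin h q"
  using assms A by (intro lin_superset[symmetric]) auto
 finally show ?thesis .
qed

lemma lin_minus:
 assumes "p \<in> carrier P" "q \<in> carrier P" shows "lin h (p -\<^sub>P q) = lin h p -\<^sub>S lin h q"
proof -
 have "lin h p = lin h ((p -\<^sub>P q) +\<^sub>P q)" using assms by (simp add: P.minus_eq P.a_assoc P.l_neg)
 also have "\<dots> = lin h (p -\<^sub>P q) +\<^sub>S lin h q" using assms by (intro lin_add) auto
 finally show ?thesis using assms by (simp add: S.minus_eq S.a_assoc S.r_neg)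
qed

lemma lin_mult_monom:
 assumes p: "p \<in> carrier P" and c: "c \<in> carrier k" and x: "set_mset x \<subseteq> carrier E"
 shows "lin h (mpoly_monom k c x *\<^sub>P p) = iota c *\<^sub>S lin (\<lambda>m. h (x + m)) p"
proof -
 let ?A = "supp p"
 have A: "finite ?A" "\<And>m. m \<in> ?A ==> set_mset m \<subseteq> carrier E" using p by (auto simp: P_iff)
 have B: "supp (mpoly_monom k c x *\<^sub>P p) \<subseteq> (+) x ` ?A"
 proof
  fix m assume "m \<in> supp (mpoly_monom k c x *\<^sub>P p)"
  hence m: "x \<subseteq># m" "c \<otimes> p (m - x) \<noteq> \<zero>" using const_mult[OF c p x] by (auto split: if_splits)
  hence "p (m - x) \<noteq> \<zero>" using c by auto
  thus "m \<in> (+) x ` ?A" using m(1) by (intro image_eqI[of _ _ "m - x"]) auto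
 qed
 have "lin h (mpoly_monom k c x *\<^sub>P p) = finsum S (\<lambda>m. iota ((mpoly_monom k c x *\<^sub>P p) m) *\<^sub>S h m) ((+) x ` ?A)"
 proof (rule lin_superset)
  show "set_mset m \<subseteq> carrier E" if "m \<in> (+) x ` ?A" for m using that A(2) x by fastforce
 qed (use A B x p c in \<open>simp_all add: monom_P\<close>)
 also have "\<dots> = finsum S (\<lambda>m. iota ((mpoly_monom k c x *\<^sub>P p) (x + m)) *\<^sub>S h (x + m)) ?A"
  using A x p c h by (intro S.finsum_reindex) (auto simp: monom_P)
 also have "\<dots> = finsum S (\<lambda>m. iota c *\<^sub>S (iota (p m) *\<^sub>S h (x + m))) ?A"
  using A x p c h by (intro S.finsum_cong') (auto simp: const_mult iota_ops S.m_assoc)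
 also have "\<dots> = iota c *\<^sub>S lin (\<lambda>m. h (x + m)) p"
  unfolding lin_def using A x p c h by (intro S.finsum_rdistr[symmetric]) auto
 finally show ?thesis .
qed

end

text \<open>A linear functional \<open>g\<close> and a vector \<open>\<beta>\<close> define the endomorphism \<open>\<sigma>\<close> of the symmetric algebra given by
 \<open>e \<mapsto> e - g(e) \<beta>\<close> and the \<open>\<sigma>\<close>-derivation extending \<open>g\<close>; if \<open>g(\<beta>) = 1\<close>, the latter is
 \<open>u \<mapsto> (u - \<sigma>(u)) / \<beta>\<close>.\<close>

context
 fixes g :: "'e \<Rightarrow> 'k" and \<beta> :: 'e
 assumes g: "\<And>e. e \<in> carrier E ==> g e \<in> carrier k"
  and g_add: "\<And>e f. e \<in> carrier E ==> f \<in> carrier E ==> g (e +\<^sub>E f) = g e \<oplus> g f"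
  and g_smult: "\<And>c e. c \<in> carrier k ==> e \<in> carrier E ==> g (c \<cdot>\<^sub>E e) = c \<otimes> g e"
  and \<beta>: "\<beta> \<in> carrier E"
begin

definition sig where "sig e = gen e -\<^sub>S iota (g e) *\<^sub>S gen \<beta>"

text \<open>One application of the twisted Leibniz rule: multiplying a monomial by \<open>e\<close>
  updates the pair of its class and its derivative. The default branch makes the steps commute for
  all arguments, as a fold over multisets requires.\<close>

definition stp where "stp e = (\<lambda>(a, d). if e \<in> carrier E \<and> a \<in> carrier S \<and> d \<in> carrier S
 then (gen e *\<^sub>S a, iota (g e) *\<^sub>S a +\<^sub>S sig e *\<^sub>S d) else (a, d))"

lemma sig_S [simp]: "e \<in> carrier E ==> sig e \<in> carrier S"
 using g \<beta> by (simp add: sig_def)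

text \<open>On a product of two generators the derivation takes the value g(e) f + g(f) e - g(e)
  g(f) \<beta>, which is symmetric in e and f.\<close>

lemma stp_commute: "stp e \<circ> stp f = stp f \<circ> stp e"
proof
 fix p :: "('e multiset \<Rightarrow> 'k) set \<times> ('e multiset \<Rightarrow> 'k) set"
 obtain a d where [simp]: "p = (a, d)" by (cases p)
 show "(stp e \<circ> stp f) p = (stp f \<circ> stp e) p"
 proof (cases "e \<in> carrier E \<and> f \<in> carrier E \<and> a \<in> carrier S \<and> d \<in> carrier S")
  case True
  hence c: "gen e \<in> carrier S" "gen f \<in> carrier S" "gen \<beta> \<in> carrier S" "iota (g e) \<in> carrier S"
   "iota (g f) \<in> carrier S" "a \<in> carrier S" "d \<in> carrier S" using g \<beta> by auto
  have "iota (g e) *\<^sub>S (gen f *\<^sub>S a) +\<^sub>S sig e *\<^sub>S (iota (g f) *\<^sub>S a +\<^sub>S sig f *\<^sub>S d) =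
   iota (g f) *\<^sub>S (gen e *\<^sub>S a) +\<^sub>S sig f *\<^sub>S (iota (g e) *\<^sub>S a +\<^sub>S sig e *\<^sub>S d)"
  proof -
   have st: "sig e \<in> carrier S" "sig f \<in> carrier S" using True by auto
   have "iota (g e) *\<^sub>S gen f +\<^sub>S sig e *\<^sub>S iota (g f) = iota (g f) *\<^sub>S gen e +\<^sub>S sig f *\<^sub>S iota (g e)"
    unfolding sig_def using c by (simp add: S.minus_eq S.l_distr S.r_distr S.l_minus S.r_minus S.m_ac S.a_ac)
   hence "(iota (g e) *\<^sub>S gen f +\<^sub>S sig e *\<^sub>S iota (g f)) *\<^sub>S a =
    (iota (g f) *\<^sub>S gen e +\<^sub>S sig f *\<^sub>S iota (g e)) *\<^sub>S a" by simp
   hence "iota (g e) *\<^sub>S (gen f *\<^sub>S a) +\<^sub>S sig e *\<^sub>S (iota (g f) *\<^sub>S a) =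
    iota (g f) *\<^sub>S (gen e *\<^sub>S a) +\<^sub>S sig f *\<^sub>S (iota (g e) *\<^sub>S a)"
    using c st by (simp add: S.l_distr S.m_assoc)
   moreover have "sig e *\<^sub>S (sig f *\<^sub>S d) = sig f *\<^sub>S (sig e *\<^sub>S d)" using c st by (simp add: S.m_lcomm)
   ultimately show ?thesis using c st by (simp add: S.r_distr S.a_assoc[symmetric])
  qed
  moreover have "gen e *\<^sub>S (gen f *\<^sub>S a) = gen f *\<^sub>S (gen e *\<^sub>S a)" using c by (simp add: S.m_lcomm)
  ultimately show ?thesis using True g by (simp add: stp_def)
 next
  case False
  have 1: "h \<notin> carrier E ==> stp h q = q" for h q by (simp add: stp_def split: prod.split)
  have 2: "a \<notin> carrier S \<or> d \<notin> carrier S ==> stp h (a, d) = (a, d)" for h by (auto simp: stp_def)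
  from False consider "e \<notin> carrier E" | "f \<notin> carrier E" | "a \<notin> carrier S \<or> d \<notin> carrier S" by blast
  thus ?thesis by cases (simp_all add: 1 2)
 qed
qed

definition md where "md m = fold_mset stp (1\<^sub>S, 0\<^sub>S) m"

lemma md_simps: "md {#} = (1\<^sub>S, 0\<^sub>S)" "md (add_mset e m) = stp e (md m)"
proof -
 interpret comp_fun_commute stp by unfold_locales (rule stp_commute)
 show "md {#} = (1\<^sub>S, 0\<^sub>S)" "md (add_mset e m) = stp e (md m)"
  unfolding md_def by simp_all
qed

definition dm where "dm m = snd (md m)"

lemma md_S: "set_mset m \<subseteq> carrier E ==> fst (md m) = cls (mpoly_monom k \<one> m) \<and> dm m \<in> carrier S"
proof (induction m)
 case empty
 show ?case by (simp add: md_simps dm_def iota_one[symmetric] iota_def)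
next
 case (add e m)
 hence IH: "fst (md m) = cls (mpoly_monom k \<one> m)" "snd (md m) \<in> carrier S" by (auto simp: dm_def)
 have m: "mpoly_monom k \<one> m \<in> carrier P" using add by (intro monom_P) auto
 have "cls (mpoly_monom k \<one> (add_mset e m)) = gen e *\<^sub>S cls (mpoly_monom k \<one> m)"
  using monom_mult_X[of e \<one> m] add m by (simp add: gen_cls flip: cls.hom_mult)
 thus ?case using IH m g add by (simp add: dm_def md_simps stp_def case_prod_unfold)
qed

lemma dm_S: "set_mset m \<subseteq> carrier E ==> dm m \<in> carrier S" using md_S by blast

lemma dm_add:
 assumes "e \<in> carrier E" "set_mset m \<subseteq> carrier E"
 shows "dm (add_mset e m) = iota (g e) *\<^sub>S cls (mpoly_monom k \<one> m) +\<^sub>S sig e *\<^sub>S dm m"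
 using md_S[OF assms(2)] assms by (simp add: dm_def md_simps(2) stp_def case_prod_unfold monom_P)

lemma lin_cls: assumes p: "p \<in> carrier P" shows "lin (\<lambda>m. cls (mpoly_monom k \<one> m)) p = cls p"
proof -
 have A: "\<And>m. p m \<in> carrier k" "\<And>m. m \<in> supp p ==> set_mset m \<subseteq> carrier E" using p by (auto simp: P_iff)
 have "cls p = cls (finsum P (\<lambda>m. mpoly_monom k (p m) m) (supp p))" using P_expansion[OF p] by (rule arg_cong)
 also have "\<dots> = finsum S (cls \<circ> (\<lambda>m. mpoly_monom k (p m) m)) (supp p)"
  using A by (intro cls.hom_finsum) (auto intro!: monom_P)
 also have "\<dots> = finsum S (\<lambda>m. cls (mpoly_monom k (p m) m)) (supp p)" by (simp add: comp_def)
 also have "\<dots> = lin (\<lambda>m. cls (mpoly_monom k \<one> m)) p"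
  unfolding lin_def
 proof (rule S.finsum_cong'[OF refl])
  show "(\<lambda>m. iota (p m) *\<^sub>S cls (mpoly_monom k \<one> m)) \<in> supp p \<rightarrow> carrier S"
  proof
   fix m assume "m \<in> supp p"
   thus "iota (p m) *\<^sub>S cls (mpoly_monom k \<one> m) \<in> carrier S"
    using A(1) A(2)[of m] by (simp add: monom_P)
  qed
  fix m assume m: "m \<in> supp p"
  show "cls (mpoly_monom k (p m) m) = iota (p m) *\<^sub>S cls (mpoly_monom k \<one> m)"
   using monom_mult_const[of "p m" \<one> m] A(1) A(2)[OF m] by (simp add: iota_def monom_P flip: cls.hom_mult)
 qed
 finally show ?thesis ..
qed

abbreviation "Dv \<equiv> lin dm"

lemma Dv_X:
 assumes e: "e \<in> carrier E" and p: "p \<in> carrier P"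
 shows "Dv (X e *\<^sub>P p) = iota (g e) *\<^sub>S cls p +\<^sub>S sig e *\<^sub>S Dv p"
proof -
 let ?mo = "\<lambda>m. cls (mpoly_monom k \<one> m)"
 have A: "finite (supp p)" "\<And>m. m \<in> supp p ==> set_mset m \<subseteq> carrier E" using p by (auto simp: P_iff)
 have "Dv (X e *\<^sub>P p) = iota \<one> *\<^sub>S lin (\<lambda>m. dm ({#e#} + m)) p"
  unfolding X_def using e p dm_S by (intro lin_mult_monom) auto
 also have "\<dots> = lin (\<lambda>m. dm (add_mset e m)) p"
  using e p dm_S by (simp add: iota_one)
 also have "\<dots> = finsum S (\<lambda>m. iota (g e) *\<^sub>S (iota (p m) *\<^sub>S ?mo m) +\<^sub>S sig e *\<^sub>S (iota (p m) *\<^sub>S dm m)) (supp p)"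
  unfolding lin_def
 proof (rule S.finsum_cong')
  fix m assume m: "m \<in> supp p"
  have c: "iota (p m) \<in> carrier S" "iota (g e) \<in> carrier S" "?mo m \<in> carrier S" "sig e \<in> carrier S" "dm m \<in> carrier S"
   using A(2)[OF m] p g e dm_S by (auto simp: monom_P)
  show "iota (p m) *\<^sub>S dm (add_mset e m) = iota (g e) *\<^sub>S (iota (p m) *\<^sub>S ?mo m) +\<^sub>S sig e *\<^sub>S (iota (p m) *\<^sub>S dm m)"
   unfolding dm_add[OF e A(2)[OF m]] using c by algebra
 qed (use A p g e dm_S in \<open>auto simp: monom_P\<close>)
 also have "\<dots> = finsum S (\<lambda>m. iota (g e) *\<^sub>S (iota (p m) *\<^sub>S ?mo m)) (supp p) +\<^sub>S
   finsum S (\<lambda>m. sig e *\<^sub>S (iota (p m) *\<^sub>S dm m)) (supp p)"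
  using A p g e dm_S by (intro S.finsum_addf) (auto simp: monom_P)
 also have "finsum S (\<lambda>m. iota (g e) *\<^sub>S (iota (p m) *\<^sub>S ?mo m)) (supp p) = iota (g e) *\<^sub>S lin ?mo p"
  unfolding lin_def using A p g e by (intro S.finsum_rdistr[symmetric]) (auto simp: monom_P)
 also have "finsum S (\<lambda>m. sig e *\<^sub>S (iota (p m) *\<^sub>S dm m)) (supp p) = sig e *\<^sub>S Dv p"
  unfolding lin_def using A p g e dm_S by (intro S.finsum_rdistr[symmetric]) auto
 finally show ?thesis using p by (simp add: lin_cls)
qed

lemma Dv_const:
 assumes "c \<in> carrier k" "p \<in> carrier P" shows "Dv (mpoly_monom k c {#} *\<^sub>P p) = iota c *\<^sub>S Dv p"
 using lin_mult_monom[of dm p c "{#}"] dm_S assms by simp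

text \<open>By the Leibniz rule the kernel of the derivation is not an ideal, so vanishing is
  claimed for all multiples of a relation; there it follows from linearity of \<open>g\<close> and
  of \<open>sig\<close>.\<close>

lemma Dv_rels:
 assumes r: "r \<in> rels" and q: "q \<in> carrier P" shows "Dv (r *\<^sub>P q) = 0\<^sub>S"
proof -
 note DS = lin_closed[of dm, OF dm_S] and Da = lin_add[of dm, OF dm_S] and Dm = lin_minus[of dm, OF dm_S]
 have cq: "cls q \<in> carrier S" "Dv q \<in> carrier S" using q DS by auto
 from r consider e f where "r = X (e +\<^sub>E f) -\<^sub>P (X e +\<^sub>P X f)" "e \<in> carrier E" "f \<in> carrier E"
  | c e where "r = X (c \<cdot>\<^sub>E e) -\<^sub>P mpoly_monom k c {#e#}" "c \<in> carrier k" "e \<in> carrier E"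
  unfolding rels_def by blast
 thus ?thesis
 proof cases
  case 1
  have c: "gen e \<in> carrier S" "gen f \<in> carrier S" "gen \<beta> \<in> carrier S" "iota (g e) \<in> carrier S"
   "iota (g f) \<in> carrier S" using 1 g \<beta> by auto
  have ge: "iota (g (e +\<^sub>E f)) = iota (g e) +\<^sub>S iota (g f)" using 1 g by (simp add: g_add iota_ops)
  have "r *\<^sub>P q = X (e +\<^sub>E f) *\<^sub>P q -\<^sub>P (X e *\<^sub>P q +\<^sub>P X f *\<^sub>P q)"
   using 1 q by (simp add: P.minus_eq P.l_distr P.l_minus)
  hence "Dv (r *\<^sub>P q) = Dv (X (e +\<^sub>E f) *\<^sub>P q) -\<^sub>S (Dv (X e *\<^sub>P q) +\<^sub>S Dv (X f *\<^sub>P q))"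
   using 1 q by (simp add: Dm Da)
  also have "\<dots> = 0\<^sub>S"
  proof -
   have "sig (e +\<^sub>E f) = sig e +\<^sub>S sig f"
    using c by (simp add: sig_def gen_add[OF 1(2,3)] ge S.l_distr S.minus_eq S.minus_add S.a_ac)
   hence "Dv (X (e +\<^sub>E f) *\<^sub>P q) = Dv (X e *\<^sub>P q) +\<^sub>S Dv (X f *\<^sub>P q)"
    using 1 q c cq by (simp add: Dv_X ge S.l_distr S.a_ac)
   thus ?thesis using 1 q by (simp add: DS S.minus_eq_zero_iff)
  qed
  finally show ?thesis .
 next
  case 2
  have c: "gen e \<in> carrier S" "gen \<beta> \<in> carrier S" "iota (g e) \<in> carrier S" "iota c \<in> carrier S" using 2 g \<beta> by auto
  have ge: "iota (g (c \<cdot>\<^sub>E e)) = iota c *\<^sub>S iota (g e)" using 2 g by (simp add: g_smult iota_ops)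
  have m: "mpoly_monom k c {#e#} = mpoly_monom k c {#} *\<^sub>P X e"
   unfolding X_def using 2 by (subst monom_mult_const) auto
  have "r *\<^sub>P q = X (c \<cdot>\<^sub>E e) *\<^sub>P q -\<^sub>P mpoly_monom k c {#} *\<^sub>P (X e *\<^sub>P q)"
   using 2 q unfolding m by (simp add: P.minus_eq P.l_distr P.l_minus P.m_assoc)
  hence "Dv (r *\<^sub>P q) = Dv (X (c \<cdot>\<^sub>E e) *\<^sub>P q) -\<^sub>S iota c *\<^sub>S Dv (X e *\<^sub>P q)"
   using 2 q by (simp add: Dm Dv_const)
  also have "\<dots> = 0\<^sub>S"
  proof -
   have "sig (c \<cdot>\<^sub>E e) = iota c *\<^sub>S sig e"
    using c by (simp add: sig_def gen_smult[OF 2(2,3)] ge S.r_distr S.minus_eq S.r_minus S.m_assoc)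
   hence "Dv (X (c \<cdot>\<^sub>E e) *\<^sub>P q) = iota c *\<^sub>S Dv (X e *\<^sub>P q)"
    using 2 q c cq by (simp add: Dv_X ge S.r_distr S.m_assoc)
   thus ?thesis using 2 q c by (simp add: DS S.minus_eq_zero_iff)
  qed
  finally show ?thesis .
 qed
qed

lemma Dv_J: assumes "p \<in> J" shows "Dv p = 0\<^sub>S"
proof -
 note DS = lin_closed[of dm, OF dm_S] and Da = lin_add[of dm, OF dm_S] and Dm = lin_minus[of dm, OF dm_S]
 \<comment> \<open>The largest ideal contained in the kernel of \<open>Dv\<close>; comparing with it
   avoids a description of the elements of the generated ideal.\<close>
 let ?K = "{p \<in> carrier P. \<forall>q\<in>carrier P. Dv (p *\<^sub>P q) = 0\<^sub>S}"
 have "ideal ?K P"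
 proof (rule idealI)
  show "subgroup ?K (add_monoid P)"
  proof (rule P.add.subgroupI)
   have "Dv 0\<^sub>P = 0\<^sub>S" by (simp add: lin_def P_ops)
   hence "0\<^sub>P \<in> ?K" by simp
   thus "?K \<noteq> {}" by blast
  next
   fix a assume a: "a \<in> ?K"
   have "Dv (\<ominus>\<^bsub>P\<^esub> a *\<^sub>P q) = 0\<^sub>S" if q: "q \<in> carrier P" for q
   proof -
    have "\<ominus>\<^bsub>P\<^esub> a *\<^sub>P q = a *\<^sub>P (\<ominus>\<^bsub>P\<^esub> q)" using a q by (simp add: P.l_minus P.r_minus)
    thus ?thesis using a q by simp
   qed
   thus "\<ominus>\<^bsub>P\<^esub> a \<in> ?K" using a by simp
  qed (auto simp: P.l_distr Da)
  fix a x assume a: "a \<in> ?K" and x: "x \<in> carrier P"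
  have "Dv (a *\<^sub>P x *\<^sub>P q) = 0\<^sub>S" if "q \<in> carrier P" for q
   using a x that by (simp add: P.m_assoc)
  thus "a *\<^sub>P x \<in> ?K" using a x by simp
  thus "x *\<^sub>P a \<in> ?K" using a x by (simp add: P.m_comm)
 qed (rule P.ring_axioms)
 moreover have "rels \<subseteq> ?K" using rels_P Dv_rels by blast
 ultimately have "J \<subseteq> ?K" unfolding J_eq by (rule P.genideal_minimal)
 hence "p \<in> ?K" using assms by (rule subsetD)
 hence "Dv (p *\<^sub>P 1\<^sub>P) = 0\<^sub>S" "p \<in> carrier P" using P.one_closed by blast+
 thus ?thesis by simp
qed

text \<open>Apply the derivation to both sides. Since g(\<beta>) = 1, \<sigma> kills \<beta> and the
  left side becomes \<open>u\<close>; since g(\<gamma>) = 0, \<sigma> fixes \<gamma> and the right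
  side becomes \<gamma> times the derivative of a representative of \<open>v\<close>.\<close>

lemma sym_regular_aux:
 assumes g1: "g \<beta> = \<one>" and \<gamma>: "\<gamma> \<in> carrier E" "g \<gamma> = \<zero>"
  and u: "u \<in> carrier S" and v: "v \<in> carrier S" and eq: "gen \<beta> *\<^sub>S u = gen \<gamma> *\<^sub>S v"
 shows "\<exists>w\<in>carrier S. u = gen \<gamma> *\<^sub>S w"
proof -
 note DS = lin_closed[of dm, OF dm_S] and Dm = lin_minus[of dm, OF dm_S]
 obtain p where p: "p \<in> carrier P" "u = cls p" using u by (rule S_cases)
 obtain q where q: "q \<in> carrier P" "v = cls q" using v by (rule S_cases)
 have "cls (X \<beta> *\<^sub>P p) = cls (X \<gamma> *\<^sub>P q)" using eq p q \<beta> \<gamma> by (simp add: gen_cls)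
 hence "X \<beta> *\<^sub>P p -\<^sub>P X \<gamma> *\<^sub>P q \<in> J" using p q \<beta> \<gamma> by (subst (asm) cls_eq_iff) auto
 hence "Dv (X \<beta> *\<^sub>P p) -\<^sub>S Dv (X \<gamma> *\<^sub>P q) = 0\<^sub>S"
  using Dv_J Dm[of "X \<beta> *\<^sub>P p" "X \<gamma> *\<^sub>P q"] p q \<beta> \<gamma> by simp
 hence "Dv (X \<beta> *\<^sub>P p) = Dv (X \<gamma> *\<^sub>P q)" using p q \<beta> \<gamma> DS by (simp add: S.minus_eq_zero_iff)
 moreover have "Dv (X \<beta> *\<^sub>P p) = u"
  using p \<beta> g1 DS[OF _ p(1)] gen_S[OF \<beta>] by (simp add: Dv_X sig_def iota_one S.minus_eq S.r_neg)
 moreover have "Dv (X \<gamma> *\<^sub>P q) = gen \<gamma> *\<^sub>S Dv q"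
  using q \<gamma> \<beta> DS[OF _ q(1)] by (simp add: Dv_X sig_def iota_zero S.minus_eq)
 moreover have "Dv q \<in> carrier S" using DS[OF _ q(1)] by simp
 ultimately show ?thesis by metis
qed

end

end

section \<open>Separating functionals and coprimality\<close>

context sym_alg
begin

definition subspace where
 "subspace U \<longleftrightarrow> U \<subseteq> carrier E \<and> (\<forall>x\<in>U. \<forall>y\<in>U. x +\<^sub>E y \<in> U) \<and> (\<forall>c\<in>carrier k. \<forall>x\<in>U. c \<cdot>\<^sub>E x \<in> U)"

lemma subspace_minus: assumes "subspace U" "x \<in> U" shows "\<ominus>\<^bsub>E\<^esub> x \<in> U"
proof -
 have "x \<in> carrier E" using assms by (auto simp: subspace_def)
 hence "\<ominus>\<^bsub>E\<^esub> x = (\<ominus> \<one>) \<cdot>\<^sub>E x" by (simp add: E.smult_l_minus)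
 thus ?thesis using assms by (auto simp: subspace_def)
qed

text \<open>Zorn gives a subspace maximal among those that contain \<gamma> and avoid \<beta>.
  Maximality makes it a complement of the line through \<beta>, and \<open>g\<close> is the
  coordinate along \<beta>.\<close>

lemma functional_exists:
 assumes fld: "field k" and \<beta>: "\<beta> \<in> carrier E" and \<gamma>: "\<gamma> \<in> carrier E"
  and ind: "\<And>c. c \<in> carrier k ==> \<beta> \<noteq> c \<cdot>\<^sub>E \<gamma>"
 obtains g where "\<And>e. e \<in> carrier E ==> g e \<in> carrier k"
  "\<And>e f. e \<in> carrier E ==> f \<in> carrier E ==> g (e +\<^sub>E f) = g e \<oplus> g f"
  "\<And>c e. c \<in> carrier k ==> e \<in> carrier E ==> g (c \<cdot>\<^sub>E e) = c \<otimes> g e"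
  "g \<beta> = \<one>" "g \<gamma> = \<zero>"
proof -
 interpret k: field k by (rule fld)
 define \<U> where "\<U> = {U. subspace U \<and> \<gamma> \<in> U \<and> \<beta> \<notin> U}"
 have ne: "{c \<cdot>\<^sub>E \<gamma> | c. c \<in> carrier k} \<in> \<U>" (is "?U0 \<in> _")
 proof -
  have "\<gamma> \<in> ?U0" using \<gamma> by (intro CollectI exI[of _ \<one>]) simp
  moreover have "subspace ?U0" unfolding subspace_def
  proof (intro conjI ballI)
   show "?U0 \<subseteq> carrier E" using \<gamma> by auto
   fix x y assume "x \<in> ?U0" "y \<in> ?U0"
   then obtain c d where "c \<in> carrier k" "x = c \<cdot>\<^sub>E \<gamma>" "d \<in> carrier k" "y = d \<cdot>\<^sub>E \<gamma>" by blast
   thus "x +\<^sub>E y \<in> ?U0" using \<gamma> by (intro CollectI exI[of _ "c \<oplus> d"]) (simp add: E.smult_l_distr)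
  next
   fix d x assume "d \<in> carrier k" "x \<in> ?U0"
   then obtain c where "c \<in> carrier k" "x = c \<cdot>\<^sub>E \<gamma>" by blast
   thus "d \<cdot>\<^sub>E x \<in> ?U0" using \<gamma> \<open>d \<in> carrier k\<close>
    by (intro CollectI exI[of _ "d \<otimes> c"]) (simp add: E.smult_assoc1)
  qed
  ultimately show ?thesis using ind by (auto simp: \<U>_def)
 qed
 have "\<exists>M\<in>\<U>. \<forall>X\<in>\<U>. M \<subseteq> X --> X = M"
 proof (rule subset_Zorn_nonempty)
  show "\<U> \<noteq> {}" using ne by blast
  fix \<C> assume C: "\<C> \<noteq> {}" "subset.chain \<U> \<C>"
  hence sub: "\<And>U. U \<in> \<C> ==> subspace U \<and> \<gamma> \<in> U \<and> \<beta> \<notin> U" by (auto simp: \<U>_def subset.chain_def)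
  have tot: "\<And>U V. U \<in> \<C> ==> V \<in> \<C> ==> U \<subseteq> V \<or> V \<subseteq> U" using C(2) by (auto simp: subset.chain_def)
  have "subspace (\<Union>\<C>)" unfolding subspace_def
  proof (intro conjI ballI)
   show "\<Union>\<C> \<subseteq> carrier E" using sub unfolding subspace_def by blast
   fix x y assume "x \<in> \<Union>\<C>" "y \<in> \<Union>\<C>"
   then obtain U where "U \<in> \<C>" "x \<in> U" "y \<in> U" using tot by blast
   thus "x +\<^sub>E y \<in> \<Union>\<C>" using sub unfolding subspace_def by blast
  next
   fix c x assume "c \<in> carrier k" "x \<in> \<Union>\<C>"
   thus "c \<cdot>\<^sub>E x \<in> \<Union>\<C>" using sub unfolding subspace_def by blast
  qed
  thus "\<Union>\<C> \<in> \<U>" using sub C(1) by (auto simp: \<U>_def)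
 qed
 then obtain M where M: "subspace M" "\<gamma> \<in> M" "\<beta> \<notin> M" and mx: "\<And>X. X \<in> \<U> ==> M \<subseteq> X ==> X = M"
  by (auto simp: \<U>_def)
 have ME: "M \<subseteq> carrier E" and Madd: "\<And>x y. x \<in> M ==> y \<in> M ==> x +\<^sub>E y \<in> M"
  and Msm: "\<And>c x. c \<in> carrier k ==> x \<in> M ==> c \<cdot>\<^sub>E x \<in> M" using M(1) by (auto simp: subspace_def)
 have inv: "inv c \<in> carrier k" "inv c \<otimes> c = \<one>" if "c \<in> carrier k" "c \<noteq> \<zero>" for c
  using that k.field_Units by auto
 have ex: "\<exists>c\<in>carrier k. \<exists>m\<in>M. e = m +\<^sub>E c \<cdot>\<^sub>E \<beta>" if e: "e \<in> carrier E" for e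
 proof (cases "e \<in> M")
  case True
  thus ?thesis using e \<beta> by (intro bexI[of _ \<zero>] bexI[of _ e]) (auto simp: E.smult_l_null)
 next
  case False
  let ?M' = "{m +\<^sub>E c \<cdot>\<^sub>E e | m c. m \<in> M \<and> c \<in> carrier k}"
  have in1: "m \<in> ?M'" if "m \<in> M" for m
   using that ME e by (intro CollectI exI[of _ m] exI[of _ \<zero>]) (auto simp: E.smult_l_null)
  have z: "0\<^sub>E \<in> M" using Msm[OF zero_closed M(2)] \<gamma> by (simp add: E.smult_l_null)
  have in2: "e \<in> ?M'"
   using z e by (intro CollectI exI[of _ "0\<^sub>E"] exI[of _ \<one>]) auto
  have "subspace ?M'" unfolding subspace_def
  proof (intro conjI ballI)
   show "?M' \<subseteq> carrier E" using ME e by auto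
   fix x y assume "x \<in> ?M'" "y \<in> ?M'"
   then obtain m c n d where *: "m \<in> M" "c \<in> carrier k" "x = m +\<^sub>E c \<cdot>\<^sub>E e"
    "n \<in> M" "d \<in> carrier k" "y = n +\<^sub>E d \<cdot>\<^sub>E e" by blast
   have "m \<in> carrier E" "n \<in> carrier E" using * ME by auto
   hence "x +\<^sub>E y = (m +\<^sub>E n) +\<^sub>E (c \<oplus> d) \<cdot>\<^sub>E e"
    using * e by (simp add: E.smult_l_distr E.M.a_ac)
   thus "x +\<^sub>E y \<in> ?M'" using * Madd by blast
  next
   fix d x assume d: "d \<in> carrier k" and "x \<in> ?M'"
   then obtain m c where *: "m \<in> M" "c \<in> carrier k" "x = m +\<^sub>E c \<cdot>\<^sub>E e" by blast
   have "m \<in> carrier E" using * ME by auto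
   hence "d \<cdot>\<^sub>E x = d \<cdot>\<^sub>E m +\<^sub>E (d \<otimes> c) \<cdot>\<^sub>E e" using * d e by (simp add: E.smult_r_distr E.smult_assoc1)
   thus "d \<cdot>\<^sub>E x \<in> ?M'" using * d Msm by blast
  qed
  moreover have "?M' \<noteq> M" using in2 False by blast
  \<comment> \<open>Enlarging \<open>M\<close> by \<open>e\<close> must capture \<beta> by
    maximality; the resulting equation is then solved for \<open>e\<close>.\<close>
  ultimately have "?M' \<notin> \<U>" using mx[of ?M'] in1 by blast
  hence "\<beta> \<in> ?M'" using \<open>subspace ?M'\<close> in1[OF M(2)] unfolding \<U>_def by blast
  then obtain m c where mc: "m \<in> M" "c \<in> carrier k" "\<beta> = m +\<^sub>E c \<cdot>\<^sub>E e" by blast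
  have mE: "m \<in> carrier E" using mc ME by auto
  have c0: "c \<noteq> \<zero>"
  proof
   assume "c = \<zero>"
   hence "\<beta> = m" using mc e mE by (simp add: E.smult_l_null)
   thus False using mc M(3) by simp
  qed
  have "inv c \<cdot>\<^sub>E \<beta> = inv c \<cdot>\<^sub>E m +\<^sub>E e"
   using mc(3) inv[OF mc(2) c0] mc(2) mE e by (simp add: E.smult_r_distr flip: E.smult_assoc1)
  hence "e = \<ominus>\<^bsub>E\<^esub> (inv c \<cdot>\<^sub>E m) +\<^sub>E inv c \<cdot>\<^sub>E \<beta>"
   using inv[OF mc(2) c0] mE e by (simp add: E.M.a_assoc[symmetric] E.M.l_neg)
  thus ?thesis using inv[OF mc(2) c0] subspace_minus[OF M(1) Msm[OF _ mc(1)]] by blast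
 qed
 have uniq: "c = d" if "m \<in> M" "n \<in> M" "c \<in> carrier k" "d \<in> carrier k" "m +\<^sub>E c \<cdot>\<^sub>E \<beta> = n +\<^sub>E d \<cdot>\<^sub>E \<beta>" for m n c d
 proof (rule ccontr)
  assume "c \<noteq> d"
  hence cd: "c \<ominus> d \<in> carrier k" "c \<ominus> d \<noteq> \<zero>" using that by (auto simp: minus_eq_zero_iff)
  have mE: "m \<in> carrier E" "n \<in> carrier E" using that ME by auto
  have "(c \<ominus> d) \<cdot>\<^sub>E \<beta> = c \<cdot>\<^sub>E \<beta> +\<^sub>E \<ominus>\<^bsub>E\<^esub> (d \<cdot>\<^sub>E \<beta>)"
   using that \<beta> by (simp add: minus_eq E.smult_l_distr E.smult_l_minus)
  also have "c \<cdot>\<^sub>E \<beta> = \<ominus>\<^bsub>E\<^esub> m +\<^sub>E (n +\<^sub>E d \<cdot>\<^sub>E \<beta>)"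
   unfolding that(5)[symmetric] using mE that(3) \<beta> by (simp add: E.M.a_assoc[symmetric] E.M.l_neg)
  also have "\<dots> +\<^sub>E \<ominus>\<^bsub>E\<^esub> (d \<cdot>\<^sub>E \<beta>) = \<ominus>\<^bsub>E\<^esub> m +\<^sub>E n"
   using mE that \<beta> by (simp add: E.M.a_assoc E.M.r_neg)
  finally have "(c \<ominus> d) \<cdot>\<^sub>E \<beta> \<in> M" using Madd subspace_minus[OF M(1)] that by simp
  hence "inv (c \<ominus> d) \<cdot>\<^sub>E ((c \<ominus> d) \<cdot>\<^sub>E \<beta>) \<in> M" using Msm inv[OF cd] by blast
  hence "\<beta> \<in> M" using inv[OF cd] cd \<beta> by (simp flip: E.smult_assoc1)
  thus False using M by blast
 qed
 define g where "g e = (THE c. c \<in> carrier k \<and> (\<exists>m\<in>M. e = m +\<^sub>E c \<cdot>\<^sub>E \<beta>))" for e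
 have gI: "g (m +\<^sub>E c \<cdot>\<^sub>E \<beta>) = c" if "c \<in> carrier k" "m \<in> M" for c m
  unfolding g_def using that uniq by (intro the_equality) blast+
 have cl: "\<And>e. e \<in> carrier E ==> g e \<in> carrier k" using ex gI by metis
 have add: "g (e +\<^sub>E f) = g e \<oplus> g f" if e: "e \<in> carrier E" and f: "f \<in> carrier E" for e f
 proof -
  obtain c m d n where *: "c \<in> carrier k" "m \<in> M" "e = m +\<^sub>E c \<cdot>\<^sub>E \<beta>" "d \<in> carrier k" "n \<in> M" "f = n +\<^sub>E d \<cdot>\<^sub>E \<beta>"
   using ex[OF e] ex[OF f] by blast
  have "m \<in> carrier E" "n \<in> carrier E" using * ME by auto
  hence "e +\<^sub>E f = (m +\<^sub>E n) +\<^sub>E (c \<oplus> d) \<cdot>\<^sub>E \<beta>"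
   using * \<beta> by (simp add: E.smult_l_distr E.M.a_ac)
  thus ?thesis using * gI Madd by simp
 qed
 have sm: "g (d \<cdot>\<^sub>E e) = d \<otimes> g e" if d: "d \<in> carrier k" "e \<in> carrier E" for d e
 proof -
  obtain c m where *: "c \<in> carrier k" "m \<in> M" "e = m +\<^sub>E c \<cdot>\<^sub>E \<beta>" using ex[OF d(2)] by blast
  have "m \<in> carrier E" using * ME by auto
  hence "d \<cdot>\<^sub>E e = d \<cdot>\<^sub>E m +\<^sub>E (d \<otimes> c) \<cdot>\<^sub>E \<beta>" using * d \<beta> by (simp add: E.smult_r_distr E.smult_assoc1)
  thus ?thesis using * gI Msm d by simp
 qed
 have z: "0\<^sub>E \<in> M" using Msm[OF zero_closed M(2)] \<gamma> by (simp add: E.smult_l_null)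
 have "g \<beta> = \<one>" using gI[of \<one> "0\<^sub>E"] z \<beta> by simp
 moreover have "g \<gamma> = \<zero>" using gI[of \<zero> \<gamma>] M \<gamma> \<beta> by (simp add: E.smult_l_null)
 ultimately show ?thesis using that cl add sm by blast
qed

text \<open>Non-proportional vectors behave like coprime elements of \<open>S\<close>; this takes
  the place of unique factorization.\<close>

lemma sym_regular:
 assumes "field k" "\<beta> \<in> carrier E" "\<gamma> \<in> carrier E" "\<And>c. c \<in> carrier k ==> \<beta> \<noteq> c \<cdot>\<^sub>E \<gamma>"
  and "u \<in> carrier S" "v \<in> carrier S" "gen \<beta> *\<^sub>S u = gen \<gamma> *\<^sub>S v"
 shows "\<exists>w\<in>carrier S. u = gen \<gamma> *\<^sub>S w"
proof -
 obtain g where g: "\<And>e. e \<in> carrier E ==> g e \<in> carrier k"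
  "\<And>e f. e \<in> carrier E ==> f \<in> carrier E ==> g (e +\<^sub>E f) = g e \<oplus> g f"
  "\<And>c e. c \<in> carrier k ==> e \<in> carrier E ==> g (c \<cdot>\<^sub>E e) = c \<otimes> g e"
  "g \<beta> = \<one>" "g \<gamma> = \<zero>" using functional_exists[OF assms(1-4)] by blast
 show ?thesis using sym_regular_aux[OF g(1-3) assms(2) g(4) assms(3) g(5) assms(5-7)] .
qed

end

section \<open>Tensor products\<close>

definition tensor_gens where
 "tensor_gens R A B =
   {frag_of (a \<oplus>\<^bsub>A\<^esub> a', b) - frag_of (a, b) - frag_of (a', b) | a a' b.
     a \<in> carrier A \<and> a' \<in> carrier A \<and> b \<in> carrier B} \<union>
   {frag_of (a, b \<oplus>\<^bsub>B\<^esub> b') - frag_of (a, b) - frag_of (a, b') | a b b'.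
     a \<in> carrier A \<and> b \<in> carrier B \<and> b' \<in> carrier B} \<union>
   {frag_of (r \<odot>\<^bsub>A\<^esub> a, b) - frag_of (a, r \<odot>\<^bsub>B\<^esub> b) | r a b.
     r \<in> carrier R \<and> a \<in> carrier A \<and> b \<in> carrier B}"

lemma tensor_rel_eq: "tensor_rel R A B = generate (tensor_free A B) (tensor_gens R A B)"
 by (simp add: tensor_rel_def tensor_gens_def)

text \<open>Only the additive structures and the closure of the scalar multiplications matter for the
 tensor product; in particular the scalars need not form a ring.\<close>

locale scalar_action = ab: abelian_group A for R :: "('r, 'z) ring_scheme" and A :: "('r, 'a, 'x) module_scheme" +
 assumes act_closed: "r \<in> carrier R ==> a \<in> carrier A ==> r \<odot>\<^bsub>A\<^esub> a \<in> carrier A"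

locale tens = A: scalar_action R A + B: scalar_action R B
 for R :: "('r, 'z) ring_scheme" and A :: "('r, 'a, 'x) module_scheme" and B :: "('r, 'b, 'y) module_scheme"
begin

abbreviation "F \<equiv> tensor_free A B"
abbreviation "N \<equiv> tensor_rel R A B"
abbreviation "G \<equiv> tensor R A B"
abbreviation "te \<equiv> tensor_elt R A B"

sublocale F: comm_group F
 unfolding tensor_free_def by (rule abelian_free_Abelian_group)

lemma F_simps [simp]: "x \<otimes>\<^bsub>F\<^esub> y = x + y" "\<one>\<^bsub>F\<^esub> = 0"
 "x \<in> carrier F \<longleftrightarrow> Poly_Mapping.keys x \<subseteq> carrier A \<times> carrier B"
 by (simp_all add: tensor_free_def)

lemma F_inv [simp]: "x \<in> carrier F ==> inv\<^bsub>F\<^esub> x = - x"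
 by (simp add: tensor_free_def)

lemma F_minus: "x \<in> carrier F ==> y \<in> carrier F ==> x - y \<in> carrier F"
 using keys_diff by fastforce

lemma F_add: "x \<in> carrier F ==> y \<in> carrier F ==> x + y \<in> carrier F"
 using F.m_closed by simp

lemma frag_F: "a \<in> carrier A ==> b \<in> carrier B ==> frag_of (a, b) \<in> carrier F"
 by simp

lemma gens_F: "tensor_gens R A B \<subseteq> carrier F"
 unfolding tensor_gens_def using A.act_closed B.act_closed
 by (intro Un_least subsetI) (elim CollectE exE conjE, hypsubst, intro F_minus frag_F; simp)+

sublocale N: normal N F
 unfolding F.normal_iff_subgroup tensor_rel_eq by (rule F.generate_is_subgroup[OF gens_F])

lemma N_subgroup: "subgroup N F" by (rule N.is_subgroup)

sublocale G: comm_group G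
 unfolding tensor_def by (rule F.abelian_FactGroup[OF N_subgroup])

lemma coset_eq_iff: "x \<in> carrier F ==> y \<in> carrier F ==> N #>\<^bsub>F\<^esub> x = N #>\<^bsub>F\<^esub> y \<longleftrightarrow> x - y \<in> N"
proof -
 assume xy: "x \<in> carrier F" "y \<in> carrier F"
 have "x \<in> N #>\<^bsub>F\<^esub> y \<longleftrightarrow> x - y \<in> N"
  unfolding r_coset_def by (auto intro!: bexI[of _ "x - y"])
 thus ?thesis using xy N_subgroup F.repr_independence[of x N y] F.repr_independenceD[OF N_subgroup, of y x]
  F.rcos_self[OF _ N_subgroup, of x] by blast
qed

lemma G_carrier: "X \<in> carrier G \<longleftrightarrow> (\<exists>h\<in>carrier F. X = N #>\<^bsub>F\<^esub> h)"
 unfolding tensor_def carrier_FactGroup by blast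

lemma G_mult: "x \<in> carrier F ==> y \<in> carrier F ==> (N #>\<^bsub>F\<^esub> x) \<otimes>\<^bsub>G\<^esub> (N #>\<^bsub>F\<^esub> y) = N #>\<^bsub>F\<^esub> (x + y)"
 unfolding tensor_def using N.rcos_sum[of x y] by simp

lemma te_G [simp]: "a \<in> carrier A ==> b \<in> carrier B ==> te a b \<in> carrier G"
 unfolding G_carrier tensor_elt_def using frag_F by blast

lemma gen_in_N: "x \<in> tensor_gens R A B ==> x \<in> N"
 unfolding tensor_rel_eq by (rule generate.incl)

lemma te_add_left:
 assumes "a \<in> carrier A" "a' \<in> carrier A" "b \<in> carrier B"
 shows "te (a \<oplus>\<^bsub>A\<^esub> a') b = te a b \<otimes>\<^bsub>G\<^esub> te a' b"
proof -
 have "frag_of (a \<oplus>\<^bsub>A\<^esub> a', b) - frag_of (a, b) - frag_of (a', b) \<in> N"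
  by (rule gen_in_N) (use assms in \<open>unfold tensor_gens_def, blast\<close>)
 thus ?thesis unfolding tensor_elt_def using assms
  by (simp add: G_mult coset_eq_iff frag_F F_add diff_diff_eq del: F_simps(3))
qed

lemma te_add_right:
 assumes "a \<in> carrier A" "b \<in> carrier B" "b' \<in> carrier B"
 shows "te a (b \<oplus>\<^bsub>B\<^esub> b') = te a b \<otimes>\<^bsub>G\<^esub> te a b'"
proof -
 have "frag_of (a, b \<oplus>\<^bsub>B\<^esub> b') - frag_of (a, b) - frag_of (a, b') \<in> N"
  by (rule gen_in_N) (use assms in \<open>unfold tensor_gens_def, blast\<close>)
 thus ?thesis unfolding tensor_elt_def using assms
  by (simp add: G_mult coset_eq_iff frag_F F_add diff_diff_eq del: F_simps(3))
qed

lemma te_smult: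
 assumes "r \<in> carrier R" "a \<in> carrier A" "b \<in> carrier B"
 shows "te (r \<odot>\<^bsub>A\<^esub> a) b = te a (r \<odot>\<^bsub>B\<^esub> b)"
proof -
 have "frag_of (r \<odot>\<^bsub>A\<^esub> a, b) - frag_of (a, r \<odot>\<^bsub>B\<^esub> b) \<in> N"
  by (rule gen_in_N) (use assms in \<open>unfold tensor_gens_def, blast\<close>)
 thus ?thesis unfolding tensor_elt_def using assms A.act_closed B.act_closed
  by (subst coset_eq_iff) auto
qed

lemma te_zero: "b \<in> carrier B ==> te \<zero>\<^bsub>A\<^esub> b = \<one>\<^bsub>G\<^esub>" "a \<in> carrier A ==> te a \<zero>\<^bsub>B\<^esub> = \<one>\<^bsub>G\<^esub>"
proof -
 show "te \<zero>\<^bsub>A\<^esub> b = \<one>\<^bsub>G\<^esub>" if "b \<in> carrier B"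
  using te_add_left[of "\<zero>\<^bsub>A\<^esub>" "\<zero>\<^bsub>A\<^esub>" b] that by (simp add: G.l_cancel_one')
 show "te a \<zero>\<^bsub>B\<^esub> = \<one>\<^bsub>G\<^esub>" if "a \<in> carrier A"
  using te_add_right[of a "\<zero>\<^bsub>B\<^esub>" "\<zero>\<^bsub>B\<^esub>"] that by (simp add: G.l_cancel_one')
qed

lemma te_minus: assumes "a \<in> carrier A" "b \<in> carrier B" shows "inv\<^bsub>G\<^esub> te a b = te (\<ominus>\<^bsub>A\<^esub> a) b"
proof (rule G.inv_equality)
 show "te (\<ominus>\<^bsub>A\<^esub> a) b \<otimes>\<^bsub>G\<^esub> te a b = \<one>\<^bsub>G\<^esub>"
  using te_add_left[of "\<ominus>\<^bsub>A\<^esub> a" a b] assms te_zero(1) by (simp add: A.ab.l_neg)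
qed (use assms in auto)

text \<open>The negative of a pure tensor is pure, so pure tensors generate without
  inverses.\<close>

lemma tensor_induct [consumes 1, case_names elt mult]:
 assumes X: "X \<in> carrier G"
  and elt: "\<And>a b. a \<in> carrier A ==> b \<in> carrier B ==> Q (te a b)"
  and mult: "\<And>x y. x \<in> carrier G ==> y \<in> carrier G ==> Q x ==> Q y ==> Q (x \<otimes>\<^bsub>G\<^esub> y)"
 shows "Q X"
proof -
 obtain h where h: "h \<in> carrier F" "X = N #>\<^bsub>F\<^esub> h" using X unfolding G_carrier by blast
 \<comment> \<open>The inverse is carried along because the induction over the free group proceeds
   by differences.\<close>
 let ?P = "\<lambda>h. h \<in> carrier F \<and> Q (N #>\<^bsub>F\<^esub> h) \<and> Q (inv\<^bsub>G\<^esub> (N #>\<^bsub>F\<^esub> h))"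
 have "Poly_Mapping.keys h \<subseteq> carrier A \<times> carrier B" using h(1) by simp
 hence "?P h"
 proof (induction rule: frag_induction)
  case zero
  have "N #>\<^bsub>F\<^esub> 0 = \<one>\<^bsub>G\<^esub>" using F.coset_join2[of 0 N] N_subgroup N.one_closed by (simp add: tensor_def)
  thus ?case using elt[of "\<zero>\<^bsub>A\<^esub>" "\<zero>\<^bsub>B\<^esub>"] te_zero(1)[of "\<zero>\<^bsub>B\<^esub>"] by simp
 next
  case (one x)
  then obtain a b where ab: "x = (a, b)" "a \<in> carrier A" "b \<in> carrier B" by auto
  have "Q (te a b)" "Q (inv\<^bsub>G\<^esub> (te a b))" using elt ab te_minus by auto
  thus ?case using ab unfolding tensor_elt_def by simp
 next
  case (diff x y)
  have xy: "x \<in> carrier F" "y \<in> carrier F" "- y \<in> carrier F" using diff by auto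
  have cl: "N #>\<^bsub>F\<^esub> x \<in> carrier G" "N #>\<^bsub>F\<^esub> y \<in> carrier G" using xy unfolding G_carrier by blast+
  have "(N #>\<^bsub>F\<^esub> (- y)) \<otimes>\<^bsub>G\<^esub> (N #>\<^bsub>F\<^esub> y) = \<one>\<^bsub>G\<^esub>"
   using G_mult[OF xy(3,2)] F.coset_join2[of 0 N] N_subgroup N.one_closed by (simp add: tensor_def)
  hence "inv\<^bsub>G\<^esub> (N #>\<^bsub>F\<^esub> y) = N #>\<^bsub>F\<^esub> (- y)"
   using xy cl by (intro G.inv_equality) (auto simp: G_carrier)
  hence "N #>\<^bsub>F\<^esub> (x - y) = (N #>\<^bsub>F\<^esub> x) \<otimes>\<^bsub>G\<^esub> inv\<^bsub>G\<^esub> (N #>\<^bsub>F\<^esub> y)"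
   using G_mult[OF xy(1,3)] by simp
  moreover have "inv\<^bsub>G\<^esub> ((N #>\<^bsub>F\<^esub> x) \<otimes>\<^bsub>G\<^esub> inv\<^bsub>G\<^esub> (N #>\<^bsub>F\<^esub> y)) = inv\<^bsub>G\<^esub> (N #>\<^bsub>F\<^esub> x) \<otimes>\<^bsub>G\<^esub> (N #>\<^bsub>F\<^esub> y)"
   using cl by (simp add: G.inv_mult)
  ultimately show ?case using diff cl F_minus[OF xy(1,2)] mult by simp
 qed
 thus ?thesis using h by simp
qed

lemma tensor_universal:
 assumes H: "comm_group H"
  and cl: "\<And>a b. a \<in> carrier A ==> b \<in> carrier B ==> f a b \<in> carrier H"
  and l: "\<And>a a' b. a \<in> carrier A ==> a' \<in> carrier A ==> b \<in> carrier B ==> f (a \<oplus>\<^bsub>A\<^esub> a') b = f a b \<otimes>\<^bsub>H\<^esub> f a' b"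
  and r: "\<And>a b b'. a \<in> carrier A ==> b \<in> carrier B ==> b' \<in> carrier B ==> f a (b \<oplus>\<^bsub>B\<^esub> b') = f a b \<otimes>\<^bsub>H\<^esub> f a b'"
  and m: "\<And>s a b. s \<in> carrier R ==> a \<in> carrier A ==> b \<in> carrier B ==> f (s \<odot>\<^bsub>A\<^esub> a) b = f a (s \<odot>\<^bsub>B\<^esub> b)"
 obtains \<phi> where "\<phi> \<in> hom G H" "\<And>a b. a \<in> carrier A ==> b \<in> carrier B ==> \<phi> (te a b) = f a b"
proof -
 interpret H: comm_group H by (rule H)
 obtain \<psi> where \<psi>: "\<psi> \<in> hom F H" "\<And>x. x \<in> carrier A \<times> carrier B ==> \<psi> (frag_of x) = (case x of (a, b) \<Rightarrow> f a b)"
  using H.free_Abelian_group_universal[of "\<lambda>(a, b). f a b" "carrier A \<times> carrier B"] cl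
  unfolding tensor_free_def by (auto simp: image_subset_iff)
 interpret \<psi>: group_hom F H \<psi> using \<psi>(1) by unfold_locales
 have \<psi>d: "\<psi> (x - y) = \<psi> x \<otimes>\<^bsub>H\<^esub> inv\<^bsub>H\<^esub> \<psi> y" if "x \<in> carrier F" "y \<in> carrier F" for x y
 proof -
  have "x - y = x \<otimes>\<^bsub>F\<^esub> inv\<^bsub>F\<^esub> y" using that by simp
  thus ?thesis using that by (metis \<psi>.hom_inv \<psi>.hom_mult F.inv_closed)
 qed
 have \<psi>f: "\<psi> (frag_of (a, b)) = f a b" if "a \<in> carrier A" "b \<in> carrier B" for a b using \<psi>(2) that by simp
 have ker: "\<psi> x = \<one>\<^bsub>H\<^esub>" if "x \<in> tensor_gens R A B" for x
 proof -
  from that show ?thesis unfolding tensor_gens_def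
  proof (elim UnE CollectE exE conjE, goal_cases)
   case (1 a a' b)
   hence "\<psi> x = f a b \<otimes>\<^bsub>H\<^esub> f a' b \<otimes>\<^bsub>H\<^esub> inv\<^bsub>H\<^esub> (f a b) \<otimes>\<^bsub>H\<^esub> inv\<^bsub>H\<^esub> (f a' b)"
    by (simp add: \<psi>d \<psi>f l frag_F F_minus del: F_simps(3))
   also have "\<dots> = \<one>\<^bsub>H\<^esub>" using 1 cl by (simp add: H.m_comm[of "f a b"] H.m_assoc)
   finally show ?case .
  next
   case (2 a b b')
   hence "\<psi> x = f a b \<otimes>\<^bsub>H\<^esub> f a b' \<otimes>\<^bsub>H\<^esub> inv\<^bsub>H\<^esub> (f a b) \<otimes>\<^bsub>H\<^esub> inv\<^bsub>H\<^esub> (f a b')"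
    by (simp add: \<psi>d \<psi>f r frag_F F_minus del: F_simps(3))
   also have "\<dots> = \<one>\<^bsub>H\<^esub>" using 2 cl by (simp add: H.m_comm[of "f a b"] H.m_assoc)
   finally show ?case .
  next
   case (3 s a b)
   thus ?case using cl A.act_closed B.act_closed by (simp add: \<psi>d \<psi>f m frag_F del: F_simps(3))
  qed
 qed
 have kerN: "\<psi> x = \<one>\<^bsub>H\<^esub>" if "x \<in> N" for x
  using that unfolding tensor_rel_eq
 proof (induction rule: generate.induct)
  case (inv h)
  hence "h \<in> carrier F" using gens_F by blast
  thus ?case using ker[OF inv] by (metis \<psi>.hom_inv H.inv_one)
 next
  case (eng h1 h2)
  hence "h1 \<in> carrier F" "h2 \<in> carrier F" using F.generate_in_carrier[OF gens_F] by blast+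
  thus ?case using eng \<psi>.hom_mult by simp
 qed (use ker in \<open>auto simp del: F_simps\<close>)
 have "\<psi> x = \<psi> y" if "x \<in> carrier F" "y \<in> carrier F" "N #>\<^bsub>F\<^esub> x = N #>\<^bsub>F\<^esub> y" for x y
 proof -
  have "\<psi> x \<otimes>\<^bsub>H\<^esub> inv\<^bsub>H\<^esub> \<psi> y = \<one>\<^bsub>H\<^esub>" using kerN coset_eq_iff[OF that(1,2)] that \<psi>d by metis
  thus ?thesis using that \<psi>.hom_closed by (metis H.inv_equality H.inv_inv H.inv_closed)
 qed
 then obtain \<phi> where \<phi>: "\<phi> \<in> hom G H" "\<And>x. x \<in> carrier F ==> \<phi> (N #>\<^bsub>F\<^esub> x) = \<psi> x"
  using FactGroup_universal[OF \<psi>(1) N.normal_axioms] unfolding tensor_def by metis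
 have "\<phi> (te a b) = f a b" if "a \<in> carrier A" "b \<in> carrier B" for a b
  using \<phi>(2)[OF frag_F[OF that]] \<psi>f that unfolding tensor_elt_def by simp
 thus ?thesis using that \<phi>(1) by blast
qed

end

section \<open>Functoriality of the tensor product\<close>

locale tens_map = AB: tens R A B + CD: tens R C D
 for R :: "('r, 'z) ring_scheme" and A :: "('r, 'a, 'x) module_scheme" and B :: "('r, 'b, 'y) module_scheme"
  and C :: "('r, 'c, 'u) module_scheme" and D :: "('r, 'd, 'w) module_scheme" +
 fixes f :: "'a \<Rightarrow> 'c" and g :: "'b \<Rightarrow> 'd"
 assumes f: "a \<in> carrier A ==> f a \<in> carrier C" and g: "b \<in> carrier B ==> g b \<in> carrier D"
  and f_add: "a \<in> carrier A ==> a' \<in> carrier A ==> f (a \<oplus>\<^bsub>A\<^esub> a') = f a \<oplus>\<^bsub>C\<^esub> f a'"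
  and g_add: "b \<in> carrier B ==> b' \<in> carrier B ==> g (b \<oplus>\<^bsub>B\<^esub> b') = g b \<oplus>\<^bsub>D\<^esub> g b'"
  and f_smult: "r \<in> carrier R ==> a \<in> carrier A ==> f (r \<odot>\<^bsub>A\<^esub> a) = r \<odot>\<^bsub>C\<^esub> f a"
  and g_smult: "r \<in> carrier R ==> b \<in> carrier B ==> g (r \<odot>\<^bsub>B\<^esub> b) = r \<odot>\<^bsub>D\<^esub> g b"
begin

abbreviation "tm \<equiv> tensor_map R C D f g"

abbreviation "fg \<equiv> frag_extend (\<lambda>(a, b). frag_of (f a, g b))"

lemma fg_F: "x \<in> carrier AB.F ==> fg x \<in> carrier CD.F"
proof -
 assume "x \<in> carrier AB.F"
 hence "Poly_Mapping.keys x \<subseteq> carrier A \<times> carrier B" by simp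
 thus ?thesis
 proof (induction rule: frag_induction)
  case (diff a b)
  thus ?case using CD.F_minus[of "fg a" "fg b"] by (simp add: frag_extend_diff)
 qed (use f g in auto)
qed

lemma fg_N: "x \<in> AB.N ==> fg x \<in> CD.N"
 unfolding tensor_rel_eq[of R A B]
proof (induction rule: generate.induct)
 case (incl h)
 hence "fg h \<in> tensor_gens R C D"
  unfolding tensor_gens_def[of R A B]
  by (elim UnE CollectE exE conjE; simp add: frag_extend_diff f_add g_add f_smult g_smult; unfold tensor_gens_def)
   (use f g in blast)+
 thus ?case by (rule CD.gen_in_N)
next
 case (inv h)
 hence "fg h \<in> tensor_gens R C D"
  unfolding tensor_gens_def[of R A B]
  by (elim UnE CollectE exE conjE; simp add: frag_extend_diff f_add g_add f_smult g_smult; unfold tensor_gens_def)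
   (use f g in blast)+
 hence "fg h \<in> CD.N" by (rule CD.gen_in_N)
 hence "inv\<^bsub>CD.F\<^esub> fg h \<in> CD.N" by (rule CD.N.m_inv_closed)
 moreover have "fg h \<in> carrier CD.F" using \<open>fg h \<in> CD.N\<close> CD.N.mem_carrier by blast
 moreover have "h \<in> carrier AB.F" using inv AB.gens_F by blast
 ultimately show ?case by (simp add: frag_extend_minus del: AB.F_simps CD.F_simps)
next
 case (eng h1 h2)
 thus ?case using CD.N.m_closed[of "fg h1" "fg h2"] by (simp add: frag_extend_add)
qed (use CD.N.one_closed in simp)

lemma tm_coset: assumes x: "x \<in> carrier AB.F" shows "tm (AB.N #>\<^bsub>AB.F\<^esub> x) = CD.N #>\<^bsub>CD.F\<^esub> fg x"
proof -
 have "CD.N #>\<^bsub>CD.F\<^esub> fg h = CD.N #>\<^bsub>CD.F\<^esub> fg x" if "h \<in> AB.N #>\<^bsub>AB.F\<^esub> x" for h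
 proof -
  obtain n where n: "n \<in> AB.N" "h = n + x" using \<open>h \<in> AB.N #>\<^bsub>AB.F\<^esub> x\<close> unfolding r_coset_def by auto
  have nF: "n \<in> carrier AB.F" using n AB.N.mem_carrier by blast
  have "fg h - fg x \<in> CD.N" using fg_N[OF n(1)] n(2) by (simp add: frag_extend_add)
  thus ?thesis using CD.coset_eq_iff[OF fg_F fg_F] AB.F_add[OF nF x] x n(2) by blast
 qed
 moreover have "x \<in> AB.N #>\<^bsub>AB.F\<^esub> x" using AB.F.rcos_self[OF x AB.N_subgroup] .
 ultimately show ?thesis unfolding tensor_map_def by blast
qed

lemma tm_hom: "tm \<in> hom AB.G CD.G"
proof (rule homI)
 fix X assume "X \<in> carrier AB.G"
 thus "tm X \<in> carrier CD.G" using tm_coset fg_F unfolding AB.G_carrier CD.G_carrier by blast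
 fix Y assume "Y \<in> carrier AB.G"
 then obtain x y where xy: "x \<in> carrier AB.F" "X = AB.N #>\<^bsub>AB.F\<^esub> x" "y \<in> carrier AB.F" "Y = AB.N #>\<^bsub>AB.F\<^esub> y"
  using \<open>X \<in> carrier AB.G\<close> unfolding AB.G_carrier by blast
 have "x + y \<in> carrier AB.F" using AB.F.m_closed[OF xy(1,3)] by (simp del: AB.F_simps(3))
 thus "tm (X \<otimes>\<^bsub>AB.G\<^esub> Y) = tm X \<otimes>\<^bsub>CD.G\<^esub> tm Y"
  using xy tm_coset AB.G_mult CD.G_mult fg_F by (simp add: frag_extend_add del: AB.F_simps CD.F_simps)
qed

lemma tm_te: "a \<in> carrier A ==> b \<in> carrier B ==> tm (AB.te a b) = CD.te (f a) (g b)"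
 using tm_coset[OF AB.frag_F] by (simp add: tensor_elt_def)

end

section \<open>The structure algebra\<close>

lemma abelian_group_of_comm_group:
 assumes "comm_group G" "carrier M = carrier G" "\<zero>\<^bsub>M\<^esub> = \<one>\<^bsub>G\<^esub>"
  "\<And>x y. x \<in> carrier G ==> y \<in> carrier G ==> x \<oplus>\<^bsub>M\<^esub> y = x \<otimes>\<^bsub>G\<^esub> y"
 shows "abelian_group M"
proof -
 interpret G: comm_group G by (rule assms(1))
 show ?thesis
  by (rule abelian_groupI) (auto simp: assms G.m_ac intro: bexI[of _ "inv\<^bsub>G\<^esub> _"])
qed

section \<open>Coroots in the symmetric algebra\<close>

locale ring_base = wall_base D s for D :: "('v::euclidean_space, 'k, 't) base_data" and s +
 assumes fld: "field (ground D)" and gkm: "gkm D"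
begin

abbreviation "K \<equiv> ground D"
abbreviation "XX \<equiv> coweights D"
abbreviation "KZ \<equiv> ground_int_module D"
abbreviation "E \<equiv> coweights_k D"

sublocale K: field K by (rule fld)

lemma XX_simps: "f \<in> carrier XX \<longleftrightarrow> linear f \<and> (\<forall>\<alpha>\<in>R. f \<alpha> \<in> \<int>)"
 "f \<oplus>\<^bsub>XX\<^esub> g = (\<lambda>x. f x + g x)" "\<zero>\<^bsub>XX\<^esub> = (\<lambda>x. 0)" "n \<odot>\<^bsub>XX\<^esub> f = (\<lambda>x. of_int n * f x)"
 by (simp_all add: coweights_def)

lemma KZ_simps: "carrier KZ = carrier K" "a \<oplus>\<^bsub>KZ\<^esub> b = a \<oplus>\<^bsub>K\<^esub> b" "\<zero>\<^bsub>KZ\<^esub> = \<zero>\<^bsub>K\<^esub>" "n \<odot>\<^bsub>KZ\<^esub> a = [n] \<cdot>\<^bsub>K\<^esub> a"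
 by (simp_all add: ground_int_module_def)

lemma XX_action: "scalar_action \<Z> XX"
proof (rule scalar_action.intro)
 show "abelian_group XX"
 proof (rule abelian_groupI)
  fix f assume "f \<in> carrier XX"
  thus "\<exists>g\<in>carrier XX. g \<oplus>\<^bsub>XX\<^esub> f = \<zero>\<^bsub>XX\<^esub>"
   by (intro bexI[of _ "\<lambda>x. - f x"]) (auto simp: XX_simps linear_compose_neg)
 qed (auto simp: XX_simps linear_compose_add linear_zero algebra_simps)
 show "scalar_action_axioms \<Z> XX"
  by unfold_locales (auto simp: XX_simps linear_add linear_scale algebra_simps intro!: linearI)
qed

lemma KZ_action: "scalar_action \<Z> KZ"
proof (rule scalar_action.intro)
 show "abelian_group KZ"
  by (rule abelian_groupI) (auto simp: KZ_simps K.a_ac intro: bexI[of _ "\<ominus>\<^bsub>K\<^esub> _"] K.l_neg)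
 show "scalar_action_axioms \<Z> KZ" by unfold_locales (simp add: KZ_simps)
qed

sublocale XK: tens \<Z> XX KZ
 by (rule tens.intro[OF XX_action KZ_action])

lemma E_simps: "carrier E = carrier XK.G" "x \<oplus>\<^bsub>E\<^esub> y = x \<otimes>\<^bsub>XK.G\<^esub> y" "\<zero>\<^bsub>E\<^esub> = \<one>\<^bsub>XK.G\<^esub>"
 "c \<odot>\<^bsub>E\<^esub> x = tensor_map \<Z> XX KZ (\<lambda>f. f) (\<lambda>d. c \<otimes>\<^bsub>K\<^esub> d) x"
 by (simp_all add: coweights_k_def Let_def)

lemma scale_map: "c \<in> carrier K ==> tens_map \<Z> XX KZ XX KZ (\<lambda>f. f) (\<lambda>d. c \<otimes>\<^bsub>K\<^esub> d)"
 by unfold_locales (auto simp: KZ_simps K.r_distr K.add_pow_rdistr_int)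

lemma scale_te: "c \<in> carrier K ==> f \<in> carrier XX ==> d \<in> carrier K ==> c \<odot>\<^bsub>E\<^esub> XK.te f d = XK.te f (c \<otimes>\<^bsub>K\<^esub> d)"
 unfolding E_simps using tens_map.tm_te[OF scale_map] by (simp add: KZ_simps)

lemma scale_hom: "c \<in> carrier K ==> (\<lambda>x. c \<odot>\<^bsub>E\<^esub> x) \<in> hom XK.G XK.G"
 using tens_map.tm_hom[OF scale_map] by (simp add: E_simps(4)[abs_def])

lemma scale_mult:
 assumes "c \<in> carrier K" "x \<in> carrier XK.G" "y \<in> carrier XK.G"
 shows "c \<odot>\<^bsub>E\<^esub> (x \<otimes>\<^bsub>XK.G\<^esub> y) = (c \<odot>\<^bsub>E\<^esub> x) \<otimes>\<^bsub>XK.G\<^esub> (c \<odot>\<^bsub>E\<^esub> y)" "c \<odot>\<^bsub>E\<^esub> x \<in> carrier XK.G"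
 using scale_hom[OF assms(1)] assms by (auto simp: hom_def)

lemma E_module: "Module.module K E"
proof (rule moduleI)
 show "abelian_group E"
  by (rule abelian_group_of_comm_group[of XK.G]) (auto simp: E_simps XK.G.comm_group_axioms)
 fix a b x assume a: "a \<in> carrier K" and b: "b \<in> carrier K" and "x \<in> carrier E"
 hence x: "x \<in> carrier XK.G" by (simp add: E_simps(1))
 show "a \<odot>\<^bsub>E\<^esub> x \<in> carrier E" using scale_mult(2) a x by (simp add: E_simps(1))
 from x show "(a \<oplus>\<^bsub>K\<^esub> b) \<odot>\<^bsub>E\<^esub> x = a \<odot>\<^bsub>E\<^esub> x \<oplus>\<^bsub>E\<^esub> b \<odot>\<^bsub>E\<^esub> x" unfolding E_simps(2)
 proof (induction rule: XK.tensor_induct)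
  case (elt f d)
  thus ?case using a b XK.te_add_right[of f "a \<otimes>\<^bsub>K\<^esub> d" "b \<otimes>\<^bsub>K\<^esub> d"]
   by (simp add: KZ_simps scale_te K.l_distr)
 next
  case (mult x y)
  thus ?case using a b by (simp add: scale_mult XK.G.m_ac)
 qed
 from x show "(a \<otimes>\<^bsub>K\<^esub> b) \<odot>\<^bsub>E\<^esub> x = a \<odot>\<^bsub>E\<^esub> (b \<odot>\<^bsub>E\<^esub> x)"
 proof (induction rule: XK.tensor_induct)
  case (elt f d)
  thus ?case using a b by (simp add: KZ_simps scale_te K.m_assoc)
 next
  case (mult x y)
  thus ?case using a b by (simp add: scale_mult)
 qed
next
 fix a x y assume "a \<in> carrier K" "x \<in> carrier E" "y \<in> carrier E"
 thus "a \<odot>\<^bsub>E\<^esub> (x \<oplus>\<^bsub>E\<^esub> y) = a \<odot>\<^bsub>E\<^esub> x \<oplus>\<^bsub>E\<^esub> a \<odot>\<^bsub>E\<^esub> y"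
  using scale_mult(1) by (simp add: E_simps(1,2))
next
 fix x assume "x \<in> carrier E"
 hence x: "x \<in> carrier XK.G" by (simp add: E_simps(1))
 thus "\<one>\<^bsub>K\<^esub> \<odot>\<^bsub>E\<^esub> x = x"
 proof (induction rule: XK.tensor_induct)
  case (elt f d)
  thus ?case by (simp add: KZ_simps scale_te)
 next
  case (mult x y)
  thus ?case by (simp add: scale_mult)
 qed
qed (rule K.is_cring)

sublocale SA: sym_alg K E
 by (intro sym_alg.intro mpoly.intro sym_alg_axioms.intro K.is_cring E_module)

abbreviation "S \<equiv> sym_ring D"

abbreviation SR_mult (infixl "*\<^sub>s" 70) where "a *\<^sub>s b \<equiv> a \<otimes>\<^bsub>S\<^esub> b"
abbreviation SR_add (infixl "+\<^sub>s" 65) where "a +\<^sub>s b \<equiv> a \<oplus>\<^bsub>S\<^esub> b"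
abbreviation SR_minus (infixl "-\<^sub>s" 65) where "a -\<^sub>s b \<equiv> a \<ominus>\<^bsub>S\<^esub> b"
abbreviation SR_zero ("0\<^sub>s") where "0\<^sub>s \<equiv> \<zero>\<^bsub>S\<^esub>"
abbreviation SR_one ("1\<^sub>s") where "1\<^sub>s \<equiv> \<one>\<^bsub>S\<^esub>"

lemma S_eq: "SA.S = S" by (simp add: SA.S_def sym_ring_def)

sublocale S: cring S using SA.S.is_cring unfolding S_eq .

abbreviation "cS \<equiv> coroot_S D"
abbreviation "cE \<alpha> \<equiv> coweight_in_k D (co \<alpha>)"

lemma cS_gen: "cS \<alpha> = SA.gen (cE \<alpha>)" by (simp add: coroot_S_def SA.gen_def)

lemma co_XX: "\<alpha> \<in> R ==> co \<alpha> \<in> carrier XX"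
 by (simp add: XX_simps linear_co co_int)

lemma cE_te: "coweight_in_k D f = XK.te f \<one>\<^bsub>K\<^esub>" by (simp add: coweight_in_k_def)

lemma cE_E: "\<alpha> \<in> R ==> cE \<alpha> \<in> carrier E"
 unfolding cE_te E_simps by (rule XK.te_G) (simp_all add: co_XX KZ_simps)

lemma cS_S [simp]: "\<alpha> \<in> R ==> cS \<alpha> \<in> carrier S"
 using SA.gen_S[OF cE_E] by (simp add: cS_gen S_eq)

text \<open>The coroots of a root and of its reflection differ by a multiple of the coroot of
  \<gamma>, and the integrality of the factor lets it move across the tensor sign.\<close>

lemma cE_refl:
 assumes "\<gamma> \<in> R" "\<beta> \<in> R" shows "\<exists>c\<in>carrier K. cE \<beta> = cE (aff_refl D \<gamma> 0 \<beta>) \<oplus>\<^bsub>E\<^esub> c \<odot>\<^bsub>E\<^esub> cE \<gamma>"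
proof -
 obtain n where n: "co \<beta> \<gamma> = of_int n" using co_int[OF assms(2,1)] by (auto elim: Ints_cases)
 let ?\<beta>' = "aff_refl D \<gamma> 0 \<beta>"
 have \<beta>': "?\<beta>' \<in> R" using co_sym_grp(1)[OF refl_sym_grp[OF assms(1)] assms(2)] .
 have "co ?\<beta>' x = co \<beta> x - of_int n * co \<gamma> x" for x
 proof -
  have "co ?\<beta>' x = co \<beta> (aff_refl D \<gamma> 0 x)"
   using co_sym_grp(2)[OF refl_sym_grp[OF assms(1)] assms(2), of "aff_refl D \<gamma> 0 x"] aff_refl_invol[OF assms(1)]
   by simp
  thus ?thesis using assms n by (simp add: refl0 co_simps)
 qed
 hence eq: "co \<beta> = co ?\<beta>' \<oplus>\<^bsub>XX\<^esub> n \<odot>\<^bsub>XX\<^esub> co \<gamma>" by (auto simp: XX_simps)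
 have n\<gamma>: "n \<odot>\<^bsub>XX\<^esub> co \<gamma> \<in> carrier XX"
  using scalar_action.act_closed[OF XX_action, of n] co_XX[OF assms(1)] by simp
 have "cE \<beta> = cE ?\<beta>' \<otimes>\<^bsub>XK.G\<^esub> XK.te (n \<odot>\<^bsub>XX\<^esub> co \<gamma>) \<one>\<^bsub>K\<^esub>"
  unfolding cE_te eq by (rule XK.te_add_left) (use co_XX[OF \<beta>'] n\<gamma> in \<open>auto simp: KZ_simps\<close>)
 also have "XK.te (n \<odot>\<^bsub>XX\<^esub> co \<gamma>) \<one>\<^bsub>K\<^esub> = XK.te (co \<gamma>) (n \<odot>\<^bsub>KZ\<^esub> \<one>\<^bsub>K\<^esub>)"
  by (rule XK.te_smult) (use co_XX assms in \<open>auto simp: KZ_simps\<close>)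
 also have "\<dots> = ([n] \<cdot>\<^bsub>K\<^esub> \<one>\<^bsub>K\<^esub>) \<odot>\<^bsub>E\<^esub> cE \<gamma>"
  unfolding cE_te using co_XX assms by (subst scale_te) (auto simp: KZ_simps)
 finally show ?thesis unfolding E_simps(2) by (intro bexI) auto
qed

lemma cS_refl:
 assumes "\<gamma> \<in> R" "\<beta> \<in> R" shows "\<exists>u\<in>carrier S. cS \<beta> = cS (aff_refl D \<gamma> 0 \<beta>) +\<^sub>s u *\<^sub>s cS \<gamma>"
proof -
 obtain c where c: "c \<in> carrier K" "cE \<beta> = cE (aff_refl D \<gamma> 0 \<beta>) \<oplus>\<^bsub>E\<^esub> c \<odot>\<^bsub>E\<^esub> cE \<gamma>" using cE_refl[OF assms] by blast
 have "cE (aff_refl D \<gamma> 0 \<beta>) \<in> carrier E" using cE_E co_sym_grp(1)[OF refl_sym_grp[OF assms(1)] assms(2)] by blast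
 hence "cS \<beta> = cS (aff_refl D \<gamma> 0 \<beta>) +\<^sub>s SA.iota c *\<^sub>s cS \<gamma>"
  unfolding cS_gen using c cE_E[OF assms(1)] by (simp add: SA.gen_add SA.gen_smult S_eq[symmetric])
 thus ?thesis using SA.iota_S[OF c(1)] unfolding S_eq by blast
qed

lemma cS_neg: assumes "\<beta> \<in> R" shows "cS (- \<beta>) = \<ominus>\<^bsub>S\<^esub> cS \<beta>"
proof -
 have "co (- \<beta>) \<oplus>\<^bsub>XX\<^esub> co \<beta> = \<zero>\<^bsub>XX\<^esub>" using co_neg[OF assms] by (auto simp: XX_simps)
 hence "cE (- \<beta>) \<otimes>\<^bsub>XK.G\<^esub> cE \<beta> = \<one>\<^bsub>XK.G\<^esub>"
  unfolding cE_te using XK.te_add_left[of "co (- \<beta>)" "co \<beta>" "\<one>\<^bsub>K\<^esub>"] XK.te_zero(1)[of "\<one>\<^bsub>K\<^esub>"] co_XX assms neg_root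
  by (simp add: KZ_simps)
 hence "cE (- \<beta>) \<oplus>\<^bsub>E\<^esub> cE \<beta> = \<zero>\<^bsub>E\<^esub>" by (simp add: E_simps(2,3))
 hence "cE (- \<beta>) = \<ominus>\<^bsub>E\<^esub> cE \<beta>" using cE_E assms neg_root SA.E.M.minus_equality[of "cE (- \<beta>)" "cE \<beta>"] by simp
 thus ?thesis unfolding cS_gen using SA.gen_minus[OF cE_E[OF assms]] by (simp add: S_eq)
qed

text \<open>The GKM condition speaks of positive roots; for arbitrary roots the signs are absorbed
  into \<open>u\<close> and \<open>v\<close>.\<close>

lemma cS_regular:
 assumes \<beta>: "\<beta> \<in> R" and \<gamma>: "\<gamma> \<in> R" and ne: "\<beta> \<noteq> \<gamma>" "\<beta> \<noteq> - \<gamma>"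
  and u: "u \<in> carrier S" and v: "v \<in> carrier S" and eq: "cS \<beta> *\<^sub>s u = cS \<gamma> *\<^sub>s v"
 shows "\<exists>w\<in>carrier S. u = cS \<gamma> *\<^sub>s w"
proof -
 have pos: "\<exists>w\<in>carrier S. u = cS \<gamma> *\<^sub>s w"
  if "\<beta> \<in> Rp" "\<gamma> \<in> Rp" "\<beta> \<noteq> \<gamma>" "u \<in> carrier S" "v \<in> carrier S" "cS \<beta> *\<^sub>s u = cS \<gamma> *\<^sub>s v" for \<beta> \<gamma> u v
 proof -
  have R: "\<beta> \<in> R" "\<gamma> \<in> R" using that Rp_subset by auto
  have "cE \<beta> \<noteq> c \<odot>\<^bsub>E\<^esub> cE \<gamma>" if "c \<in> carrier K" for c
   using gkm that \<open>\<beta> \<in> Rp\<close> \<open>\<gamma> \<in> Rp\<close> \<open>\<beta> \<noteq> \<gamma>\<close> unfolding gkm_def by blast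
  thus ?thesis
   using SA.sym_regular[OF fld cE_E[OF R(1)] cE_E[OF R(2)], of u v] that unfolding S_eq cS_gen by blast
 qed
 define p where "p \<alpha> = (if \<alpha> \<in> Rp then \<alpha> else - \<alpha>)" for \<alpha>
 have p: "p \<alpha> \<in> Rp" "cS (p \<alpha>) = (if \<alpha> \<in> Rp then cS \<alpha> else \<ominus>\<^bsub>S\<^esub> cS \<alpha>)" if "\<alpha> \<in> R" for \<alpha>
  using Rp_cases[OF that] cS_neg[OF that] by (auto simp: p_def)
 have "p \<beta> \<noteq> p \<gamma>" using ne by (auto simp: p_def)
 define u' where "u' = (if \<beta> \<in> Rp then u else \<ominus>\<^bsub>S\<^esub> u)"
 define v' where "v' = (if \<gamma> \<in> Rp then v else \<ominus>\<^bsub>S\<^esub> v)"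
 have "cS (p \<beta>) *\<^sub>s u' = cS (p \<gamma>) *\<^sub>s v'"
  using eq \<beta> \<gamma> u v by (simp add: p u'_def v'_def S.l_minus S.r_minus)
 moreover have "u' \<in> carrier S" "v' \<in> carrier S" using u v by (auto simp: u'_def v'_def)
 ultimately obtain w where w: "w \<in> carrier S" "u' = cS (p \<gamma>) *\<^sub>s w"
  using pos[OF p(1)[OF \<beta>] p(1)[OF \<gamma>] \<open>p \<beta> \<noteq> p \<gamma>\<close>] by blast
 have "u = cS \<gamma> *\<^sub>s w \<or> u = cS \<gamma> *\<^sub>s (\<ominus>\<^bsub>S\<^esub> w)"
 proof (cases "\<beta> \<in> Rp")
  case True
  thus ?thesis using w \<gamma> by (auto simp: u'_def p S.l_minus S.r_minus)
 next
  case False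
  hence "u = \<ominus>\<^bsub>S\<^esub> u'" using u by (simp add: u'_def)
  thus ?thesis using w \<gamma> by (auto simp: p S.l_minus S.r_minus)
 qed
 thus ?thesis using w(1) S.a_inv_closed[OF w(1)] by blast
qed

text \<open>This is where the characteristic being different from 2 enters. The half serves to take
  antisymmetric parts in \<open>Z_decomp\<close> and, through \<open>half_T\<close>, to cancel 2 in
  \<open>double_inj\<close>.\<close>

lemma half_S: "\<exists>h\<in>carrier S. h +\<^sub>s h = 1\<^sub>s"
proof -
 let ?two = "\<one>\<^bsub>K\<^esub> \<oplus>\<^bsub>K\<^esub> \<one>\<^bsub>K\<^esub>"
 have "?two \<noteq> \<zero>\<^bsub>K\<^esub>" using gkm unfolding gkm_def by blast
 hence u: "?two \<in> Units K" using K.field_Units by simp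
 define h where "h = inv\<^bsub>K\<^esub> ?two"
 have h: "h \<in> carrier K" "h \<otimes>\<^bsub>K\<^esub> ?two = \<one>\<^bsub>K\<^esub>" unfolding h_def using u K.Units_l_inv by auto
 have "h \<oplus>\<^bsub>K\<^esub> h = \<one>\<^bsub>K\<^esub>" using h by (simp add: K.r_distr)
 hence "SA.iota h +\<^sub>s SA.iota h = 1\<^sub>s"
  using SA.iota_ops(2)[OF h(1) h(1)] SA.iota_one by (simp add: S_eq)
 thus ?thesis using SA.iota_S[OF h(1)] unfolding S_eq by blast
qed

lemma cS_homog: "\<alpha> \<in> R ==> cS \<alpha> \<in> sym_homog K E 2"
 unfolding coroot_S_def sym_elt_def sym_homog_def
 using SA.X_P[OF cE_E, of \<alpha>]
 by (intro CollectI exI[of _ "mpoly_monom K \<one>\<^bsub>K\<^esub> {#cE \<alpha>#}"]) (auto simp: SA.X_def SA.P_def mpoly_monom_def)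

end

section \<open>Congruences modulo coroots and the algebra over \<open>S\<close>\<close>

locale T_base = ring_base D s for D :: "('v::euclidean_space, 'k, 't) base_data" and s +
 assumes cring_T: "cring (base D)" and struct_hom: "struct_map D \<in> ring_hom (sym_ring D) (base D)"
  and base_graded: "\<And>h. base_grading D = Some h ==> graded_ring (base D) h \<and>
    (\<forall>n. struct_map D ` sym_homog (ground D) (coweights_k D) n \<subseteq> h n)"
begin

abbreviation "T \<equiv> base D"

abbreviation T_mult (infixl "*\<^sub>T" 70) where "a *\<^sub>T b \<equiv> a \<otimes>\<^bsub>T\<^esub> b"
abbreviation T_add (infixl "+\<^sub>T" 65) where "a +\<^sub>T b \<equiv> a \<oplus>\<^bsub>T\<^esub> b"
abbreviation T_zero ("0\<^sub>T") where "0\<^sub>T \<equiv> \<zero>\<^bsub>T\<^esub>"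
abbreviation T_one ("1\<^sub>T") where "1\<^sub>T \<equiv> \<one>\<^bsub>T\<^esub>"
abbreviation "\<phi> \<equiv> struct_map D"
abbreviation "cT \<equiv> coroot_T D"
abbreviation "orbs \<equiv> orbits D"
abbreviation "rfo \<equiv> refl_orbit D"

sublocale T: cring T by (rule cring_T)
sublocale \<phi>: ring_hom_cring S T \<phi>
 by (intro ring_hom_cring.intro ring_hom_cring_axioms.intro S.is_cring cring_T struct_hom)

lemma cT_eq: "cT \<alpha> = \<phi> (cS \<alpha>)" by (simp add: coroot_T_def)
lemma cT_T [simp]: "\<alpha> \<in> R ==> cT \<alpha> \<in> carrier T" by (simp add: cT_eq)

lemma half_T: "\<exists>h\<in>carrier T. h +\<^sub>T h = 1\<^sub>T"
 using half_S \<phi>.hom_add \<phi>.hom_one \<phi>.hom_closed by metis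

text \<open>Congruence modulo a coroot with the quotient at hand, which is what dividing by coroots
  requires.\<close>

definition dv where "dv \<alpha> a b \<longleftrightarrow> (\<exists>w\<in>carrier S. a -\<^sub>s b = cS \<alpha> *\<^sub>s w)"

lemma PIdl_iff: "\<alpha> \<in> R ==> a -\<^sub>s b \<in> PIdl\<^bsub>S\<^esub> (cS \<alpha>) \<longleftrightarrow> dv \<alpha> a b"
 unfolding dv_def cgenideal_def using S.m_comm[of _ "cS \<alpha>"] by auto

context fixes \<alpha> assumes \<alpha>: "\<alpha> \<in> R" begin

lemma dvI: "w \<in> carrier S ==> a -\<^sub>s b = cS \<alpha> *\<^sub>s w ==> dv \<alpha> a b" by (auto simp: dv_def)

lemma dv_refl: "a \<in> carrier S ==> dv \<alpha> a a"
 by (rule dvI[of "0\<^sub>s"]) (use \<alpha> in \<open>auto simp: S.minus_eq S.r_neg\<close>)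

lemma dv_sym: assumes "a \<in> carrier S" "b \<in> carrier S" "dv \<alpha> a b" shows "dv \<alpha> b a"
proof -
 obtain w where "w \<in> carrier S" "a -\<^sub>s b = cS \<alpha> *\<^sub>s w" using assms(3) by (auto simp: dv_def)
 moreover have "b -\<^sub>s a = \<ominus>\<^bsub>S\<^esub> (a -\<^sub>s b)" using assms by (simp add: S.minus_eq S.minus_add S.a_comm)
 ultimately show ?thesis using \<alpha> by (intro dvI[of "\<ominus>\<^bsub>S\<^esub> w"]) (auto simp: S.r_minus)
qed

lemma dv_add:
 assumes "a \<in> carrier S" "b \<in> carrier S" "c \<in> carrier S" "d \<in> carrier S" "dv \<alpha> a b" "dv \<alpha> c d"
 shows "dv \<alpha> (a +\<^sub>s c) (b +\<^sub>s d)"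
proof -
 obtain w v where wv: "w \<in> carrier S" "a -\<^sub>s b = cS \<alpha> *\<^sub>s w" "v \<in> carrier S" "c -\<^sub>s d = cS \<alpha> *\<^sub>s v"
  using assms(5,6) by (auto simp: dv_def)
 have "(a +\<^sub>s c) -\<^sub>s (b +\<^sub>s d) = (a -\<^sub>s b) +\<^sub>s (c -\<^sub>s d)"
  using assms by (simp add: S.minus_eq S.minus_add S.a_ac)
 thus ?thesis using \<alpha> wv by (intro dvI[of "w +\<^sub>s v"]) (auto simp: S.r_distr)
qed

lemma dv_mult_left:
 assumes "a \<in> carrier S" "b \<in> carrier S" "c \<in> carrier S" "dv \<alpha> a b" shows "dv \<alpha> (c *\<^sub>s a) (c *\<^sub>s b)"
proof -
 obtain w where w: "w \<in> carrier S" "a -\<^sub>s b = cS \<alpha> *\<^sub>s w" using assms(4) by (auto simp: dv_def)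
 have "(c *\<^sub>s a) -\<^sub>s (c *\<^sub>s b) = c *\<^sub>s (a -\<^sub>s b)"
  using assms by (simp add: S.minus_eq S.r_distr S.r_minus)
 thus ?thesis using \<alpha> w assms by (intro dvI[of "c *\<^sub>s w"]) (auto simp: S.m_lcomm)
qed

lemma dv_trans:
 assumes "a \<in> carrier S" "b \<in> carrier S" "c \<in> carrier S" "dv \<alpha> a b" "dv \<alpha> b c" shows "dv \<alpha> a c"
proof -
 obtain w v where wv: "w \<in> carrier S" "a -\<^sub>s b = cS \<alpha> *\<^sub>s w" "v \<in> carrier S" "b -\<^sub>s c = cS \<alpha> *\<^sub>s v"
  using assms(4,5) by (auto simp: dv_def)
 have "a -\<^sub>s c = (a -\<^sub>s b) +\<^sub>s (b -\<^sub>s c)"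
  using assms by (simp add: S.minus_eq S.a_assoc) (simp add: S.a_assoc[symmetric] S.l_neg)
 thus ?thesis using \<alpha> wv by (intro dvI[of "w +\<^sub>s v"]) (auto simp: S.r_distr)
qed

lemma dv_mult:
 assumes "a \<in> carrier S" "b \<in> carrier S" "c \<in> carrier S" "d \<in> carrier S" "dv \<alpha> a b" "dv \<alpha> c d"
 shows "dv \<alpha> (a *\<^sub>s c) (b *\<^sub>s d)"
proof (rule dv_trans)
 show "dv \<alpha> (a *\<^sub>s c) (b *\<^sub>s c)" using dv_mult_left[of a b c] assms by (simp add: S.m_comm)
 show "dv \<alpha> (b *\<^sub>s c) (b *\<^sub>s d)" using dv_mult_left[of c d b] assms by simp
qed (use assms in auto)

end

definition ZS where "ZS = struct_alg_S D"

lemma ZS_iff: "z \<in> ZS \<longleftrightarrow> z \<in> orbs \<rightarrow>\<^sub>E carrier S \<and> (\<forall>x\<in>orbs. \<forall>\<alpha>\<in>Rp. dv \<alpha> (z x) (z (rfo \<alpha> x)))"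
proof -
 have "(z x -\<^sub>s z (rfo \<alpha> x) \<in> PIdl\<^bsub>S\<^esub> (cS \<alpha>)) = dv \<alpha> (z x) (z (rfo \<alpha> x))" if "\<alpha> \<in> Rp" for x \<alpha>
  using PIdl_iff that Rp_subset by blast
 thus ?thesis unfolding ZS_def struct_alg_S_def by (simp cong: ball_cong)
qed

lemma ZS_val: "z \<in> ZS ==> x \<in> orbs ==> z x \<in> carrier S" by (auto simp: ZS_iff)

lemma rfo_orbs: "\<alpha> \<in> Rp ==> x \<in> orbs ==> rfo \<alpha> x \<in> orbs"
 using refl_orbit_orbits Rp_subset by blast

lemma ZS_I:
 assumes "\<And>x. x \<in> orbs ==> f x \<in> carrier S" "\<And>x \<alpha>. x \<in> orbs ==> \<alpha> \<in> Rp ==> dv \<alpha> (f x) (f (rfo \<alpha> x))"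
 shows "(\<lambda>x\<in>orbs. f x) \<in> ZS"
 using assms rfo_orbs by (auto simp: ZS_iff)

lemma ZS_const: "a \<in> carrier S ==> (\<lambda>x\<in>orbs. a) \<in> ZS"
 using Rp_subset by (intro ZS_I dv_refl) auto

lemma ZS_mult: "y \<in> ZS ==> z \<in> ZS ==> (\<lambda>x\<in>orbs. y x *\<^sub>s z x) \<in> ZS"
 using Rp_subset by (intro ZS_I dv_mult) (auto simp: ZS_val rfo_orbs ZS_iff subset_iff)

lemma ZS_add: "y \<in> ZS ==> z \<in> ZS ==> (\<lambda>x\<in>orbs. y x +\<^sub>s z x) \<in> ZS"
 using Rp_subset by (intro ZS_I dv_add) (auto simp: ZS_val rfo_orbs ZS_iff subset_iff)

definition \<delta>S where "\<delta>S = finprod S cS Rp"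

lemma cS_funcset: "cS \<in> Rp \<rightarrow> carrier S" using Rp_subset by auto

lemma \<delta>S [simp]: "\<delta>S \<in> carrier S" unfolding \<delta>S_def using cS_funcset by (rule S.finprod_closed)

lemma \<delta>S_dv: assumes "\<alpha> \<in> Rp" shows "dv \<alpha> \<delta>S 0\<^sub>s"
proof (rule dvI)
 show cl: "finprod S cS (Rp - {\<alpha>}) \<in> carrier S" using cS_funcset by (intro S.finprod_closed) auto
 have "\<alpha> \<in> R" using assms Rp_subset by blast
 have "Rp = insert \<alpha> (Rp - {\<alpha>})" using assms by blast
 hence "\<delta>S = cS \<alpha> *\<^sub>s finprod S cS (Rp - {\<alpha>})"
  unfolding \<delta>S_def using finite_Rp cS_funcset S.finprod_insert[of "Rp - {\<alpha>}" \<alpha> cS] assms by auto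
 thus "\<delta>S -\<^sub>s 0\<^sub>s = cS \<alpha> *\<^sub>s finprod S cS (Rp - {\<alpha>})" using cl \<open>\<alpha> \<in> R\<close> by (simp add: S.minus_eq)
qed (use assms Rp_subset in auto)

text \<open>The product of all positive coroots is divisible by each of them, so a function
  concentrated in one orbit with this value satisfies every congruence.\<close>

lemma ZS_unit: "x \<in> orbs ==> (\<lambda>y\<in>orbs. if y = x then \<delta>S else 0\<^sub>s) \<in> ZS"
 using Rp_subset \<delta>S_dv dv_refl dv_sym by (intro ZS_I) (auto simp: subset_iff)

text \<open>The wall root is equivariant under reflections, and reflecting a root changes its coroot
  by a multiple of the coroot of the reflection.\<close>

lemma ZS_croot: "(\<lambda>x\<in>orbs. cS (croot x)) \<in> ZS"
proof (rule ZS_I)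
 fix x \<alpha> assume x: "x \<in> orbs" and \<alpha>: "\<alpha> \<in> Rp"
 have R: "\<alpha> \<in> R" "croot x \<in> R" using \<alpha> Rp_subset croot_R x by auto
 obtain u where u: "u \<in> carrier S" "cS (croot x) = cS (aff_refl D \<alpha> 0 (croot x)) +\<^sub>s u *\<^sub>s cS \<alpha>"
  using cS_refl[OF R] by blast
 have r: "aff_refl D \<alpha> 0 (croot x) \<in> R" using co_sym_grp(1)[OF refl_sym_grp[OF R(1)] R(2)] .
 have "cS (croot x) -\<^sub>s cS (aff_refl D \<alpha> 0 (croot x)) = cS \<alpha> *\<^sub>s u"
  unfolding u(2) using u(1) R r
  by (simp add: S.minus_eq S.a_comm[of "cS (aff_refl D \<alpha> 0 (croot x))"] S.a_assoc S.r_neg S.m_comm)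
 thus "dv \<alpha> (cS (croot x)) (cS (croot (rfo \<alpha> x)))"
  unfolding croot_refl[OF x R(1)] using u(1) R by (intro dvI) auto
qed (simp add: croot_R)

text \<open>Division of the antisymmetric part of \<open>z\<close> by the function \<open>x \<mapsto> cS (croot x)\<close>; this is where the
 GKM condition enters.\<close>

lemma ZS_antisym:
 assumes z: "z \<in> ZS"
 obtains u where "u \<in> ZS" "\<And>x. x \<in> orbs ==> u (ro x) = u x"
  "\<And>x. x \<in> orbs ==> z x -\<^sub>s z (ro x) = cS (croot x) *\<^sub>s u x"
proof -
 have ex: "\<exists>w\<in>carrier S. z x -\<^sub>s z (ro x) = cS (croot x) *\<^sub>s w" if x: "x \<in> orbs" for x
 proof (cases "croot x \<in> Rp")
  case True
  hence "dv (croot x) (z x) (z (rfo (croot x) x))" using z x unfolding ZS_iff by blast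
  thus ?thesis using refl_croot[OF x] unfolding dv_def by simp
 next
  case False
  hence n: "- croot x \<in> Rp" using Rp_cases croot_R x by blast
  have "rfo (- croot x) x = ro x" using refl_orbit_neg[OF croot_R[OF x]] refl_croot[OF x] by simp
  then obtain w where w: "w \<in> carrier S" "z x -\<^sub>s z (ro x) = cS (- croot x) *\<^sub>s w"
   using z x n unfolding ZS_iff dv_def by metis
  thus ?thesis using cS_neg[OF croot_R[OF x]] croot_R[OF x]
   by (intro bexI[of _ "\<ominus>\<^bsub>S\<^esub> w"]) (auto simp: S.l_minus S.r_minus)
 qed
 then obtain w where w: "\<And>x. x \<in> orbs ==> w x \<in> carrier S"
  "\<And>x. x \<in> orbs ==> z x -\<^sub>s z (ro x) = cS (croot x) *\<^sub>s w x" by metis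
 \<comment> \<open>Taking the quotient at one representative of each pair \<open>x\<close>,
   \<open>ro x\<close> makes \<open>u\<close> invariant by construction, without a cancellation in
   \<open>S\<close>.\<close>
 define rep where "rep x = (SOME y. y \<in> {x, ro x})" for x
 have rep: "rep x \<in> {x, ro x}" for x unfolding rep_def by (rule someI[of _ x]) simp
 have rep_ro: "rep (ro x) = rep x" if "x \<in> orbs" for x
  unfolding rep_def ro_ro[OF that] by (simp add: insert_commute)
 define u where "u = (\<lambda>x\<in>orbs. w (rep x))"
 have uS: "u x \<in> carrier S" if "x \<in> orbs" for x using w(1) rep[of x] ro_orbits[OF that] that by (auto simp: u_def)
 have u_ro: "u (ro x) = u x" if "x \<in> orbs" for x using rep_ro that ro_orbits by (simp add: u_def)
 have key: "z x -\<^sub>s z (ro x) = cS (croot x) *\<^sub>s u x" if x: "x \<in> orbs" for x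
 proof (cases "rep x = x")
  case True
  thus ?thesis using w(2) x by (simp add: u_def)
 next
  case False
  hence r: "rep x = ro x" using rep[of x] by simp
  have rx: "ro x \<in> orbs" using ro_orbits x .
  have zz: "z x \<in> carrier S" "z (ro x) \<in> carrier S" using ZS_val z x rx by auto
  have "z x -\<^sub>s z (ro x) = \<ominus>\<^bsub>S\<^esub> (z (ro x) -\<^sub>s z x)" using zz by (simp add: S.minus_eq S.minus_add S.a_comm)
  also have "\<dots> = \<ominus>\<^bsub>S\<^esub> (cS (- croot x) *\<^sub>s w (ro x))"
   using w(2)[OF rx] ro_ro[OF x] croot_ro[OF x] by simp
  also have "\<dots> = cS (croot x) *\<^sub>s u x"
   using x r w(1)[OF rx] croot_R[OF x] by (simp add: u_def cS_neg S.l_minus)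
  finally show ?thesis .
 qed
 have "u \<in> ZS" unfolding ZS_iff
 proof (intro conjI ballI)
  show "u \<in> orbs \<rightarrow>\<^sub>E carrier S" using uS by (auto simp: u_def)
  fix x \<alpha> assume x: "x \<in> orbs" and \<alpha>: "\<alpha> \<in> Rp"
  have R: "\<alpha> \<in> R" "croot x \<in> R" using \<alpha> Rp_subset croot_R x by auto
  show "dv \<alpha> (u x) (u (rfo \<alpha> x))"
  proof (cases "croot x = \<alpha> \<or> croot x = - \<alpha>")
   case True
   hence "rfo \<alpha> x = ro x" using refl_croot[OF x] refl_orbit_neg[OF R(1)] by auto
   thus ?thesis using u_ro[OF x] dv_refl[OF R(1) uS[OF x]] by simp
  next
   case False
   \<comment> \<open>Modulo the coroot of \<alpha>, the wall coroot times the difference of the two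
     values of \<open>u\<close> vanishes; as \<alpha> is not the wall root up to sign, regularity
     cancels the wall coroot.\<close>
   let ?y = "rfo \<alpha> x"
   have y: "?y \<in> orbs" using rfo_orbs \<alpha> x .
   have ry: "ro ?y = rfo \<alpha> (ro x)" using refl_ro[OF R(1) x] by simp
   have rr: "ro x \<in> orbs" "ro ?y \<in> orbs" using ro_orbits x y by auto
   have cl: "z x \<in> carrier S" "z (ro x) \<in> carrier S" "z ?y \<in> carrier S" "z (ro ?y) \<in> carrier S"
    using ZS_val[OF z] x y rr by auto
   have c: "cS (croot x) \<in> carrier S" "cS (croot ?y) \<in> carrier S" "u x \<in> carrier S" "u ?y \<in> carrier S"
    using R croot_R[OF y] uS x y by auto
   have d1: "dv \<alpha> (z x) (z ?y)" using z x \<alpha> unfolding ZS_iff by blast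
   have d2: "dv \<alpha> (z (ro x)) (z (ro ?y))" using z rr(1) \<alpha> unfolding ZS_iff ry by blast
   have "dv \<alpha> (\<ominus>\<^bsub>S\<^esub> 1\<^sub>s *\<^sub>s z (ro x)) (\<ominus>\<^bsub>S\<^esub> 1\<^sub>s *\<^sub>s z (ro ?y))"
    using dv_mult_left[OF R(1) cl(2,4) _ d2] by simp
   hence "dv \<alpha> (\<ominus>\<^bsub>S\<^esub> z (ro x)) (\<ominus>\<^bsub>S\<^esub> z (ro ?y))" using cl by (simp add: S.l_minus)
   hence "dv \<alpha> (z x -\<^sub>s z (ro x)) (z ?y -\<^sub>s z (ro ?y))"
    using dv_add[OF R(1) cl(1,3) _ _ d1] cl by (simp add: S.minus_eq)
   hence 1: "dv \<alpha> (cS (croot x) *\<^sub>s u x) (cS (croot ?y) *\<^sub>s u ?y)" using key x y by simp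
   have "dv \<alpha> ((\<lambda>x\<in>orbs. cS (croot x)) x) ((\<lambda>x\<in>orbs. cS (croot x)) ?y)"
    using ZS_croot x \<alpha> unfolding ZS_iff by blast
   hence "dv \<alpha> (cS (croot x)) (cS (croot ?y))" using x y by simp
   hence "dv \<alpha> (cS (croot ?y)) (cS (croot x))" by (rule dv_sym[OF R(1) c(1,2)])
   hence "dv \<alpha> (u ?y *\<^sub>s cS (croot ?y)) (u ?y *\<^sub>s cS (croot x))"
    by (rule dv_mult_left[OF R(1) c(2,1,4)])
   hence "dv \<alpha> (cS (croot ?y) *\<^sub>s u ?y) (cS (croot x) *\<^sub>s u ?y)"
    by (simp only: S.m_comm[OF c(4,2)] S.m_comm[OF c(4,1)])
   hence "dv \<alpha> (cS (croot x) *\<^sub>s u x) (cS (croot x) *\<^sub>s u ?y)"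
    using c by (intro dv_trans[OF R(1) _ _ _ 1]) auto
   then obtain v where v: "v \<in> carrier S"
    "cS (croot x) *\<^sub>s u x -\<^sub>s cS (croot x) *\<^sub>s u ?y = cS \<alpha> *\<^sub>s v" unfolding dv_def by blast
   hence "cS (croot x) *\<^sub>s (u x -\<^sub>s u ?y) = cS \<alpha> *\<^sub>s v"
    using c by (simp add: S.minus_eq S.r_distr S.r_minus)
   thus ?thesis using cS_regular[OF R(2,1) _ _ _ v(1)] False c unfolding dv_def by simp
  qed
 qed
 thus ?thesis using that u_ro key by blast
qed

section \<open>Base change of the structure algebra to \<open>T\<close>\<close>

abbreviation "OF \<equiv> orbit_functions D"
abbreviation "ZA \<equiv> struct_alg D"

abbreviation ZA_mult (infixl "*\<^sub>Z" 70) where "a *\<^sub>Z b \<equiv> a \<otimes>\<^bsub>ZA\<^esub> b"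
abbreviation ZA_add (infixl "+\<^sub>Z" 65) where "a +\<^sub>Z b \<equiv> a \<oplus>\<^bsub>ZA\<^esub> b"
abbreviation ZA_zero ("0\<^sub>Z") where "0\<^sub>Z \<equiv> \<zero>\<^bsub>ZA\<^esub>"
abbreviation ZA_one ("1\<^sub>Z") where "1\<^sub>Z \<equiv> \<one>\<^bsub>ZA\<^esub>"
abbreviation "Z \<equiv> carrier ZA"

lemma OF_simps: "carrier OF = orbs \<rightarrow>\<^sub>E carrier T" "y \<otimes>\<^bsub>OF\<^esub> z = (\<lambda>x\<in>orbs. y x *\<^sub>T z x)"
 "\<one>\<^bsub>OF\<^esub> = (\<lambda>x\<in>orbs. 1\<^sub>T)" "\<zero>\<^bsub>OF\<^esub> = (\<lambda>x\<in>orbs. 0\<^sub>T)" "y \<oplus>\<^bsub>OF\<^esub> z = (\<lambda>x\<in>orbs. y x +\<^sub>T z x)"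
 by (simp_all add: orbit_functions_def)

lemma OF_eqI: "y \<in> orbs \<rightarrow>\<^sub>E carrier T ==> z \<in> orbs \<rightarrow>\<^sub>E carrier T ==> (\<And>x. x \<in> orbs ==> y x = z x) ==> y = z"
 by (rule PiE_ext)

lemma cring_OF: "cring OF"
proof (rule cringI)
 show "abelian_group OF"
 proof (rule abelian_groupI)
  fix y assume y: "y \<in> carrier OF"
  show "\<exists>z\<in>carrier OF. z \<oplus>\<^bsub>OF\<^esub> y = \<zero>\<^bsub>OF\<^esub>"
   using y by (intro bexI[of _ "\<lambda>x\<in>orbs. \<ominus>\<^bsub>T\<^esub> y x"]) (auto simp: OF_simps T.l_neg PiE_iff intro!: restrict_ext)
 qed (auto simp: OF_simps T.a_ac PiE_iff extensional_def intro!: restrict_ext ext)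
 show "Group.comm_monoid OF"
  by (rule comm_monoidI) (auto simp: OF_simps T.m_ac PiE_iff extensional_def intro!: restrict_ext ext)
qed (auto simp: OF_simps T.l_distr PiE_iff intro!: restrict_ext)

sublocale OF: cring OF by (rule cring_OF)

text \<open>The function that represents the pure tensor of \<open>z\<close> and
  \<open>t\<close>.\<close>

definition zt where "zt z t = (\<lambda>x\<in>orbs. \<phi> (z x) *\<^sub>T t)"

lemma zt_OF: "z \<in> ZS ==> t \<in> carrier T ==> zt z t \<in> carrier OF"
 using ZS_val by (auto simp: zt_def OF_simps)

lemma Z_gen: "Z = generate (add_monoid OF) {zt z t | z t. z \<in> ZS \<and> t \<in> carrier T}"
 by (simp add: struct_alg_def zt_def ZS_def)

lemma gens_OF: "{zt z t | z t. z \<in> ZS \<and> t \<in> carrier T} \<subseteq> carrier OF"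
 using zt_OF by blast

lemma ZA_simps: "y *\<^sub>Z z = (\<lambda>x\<in>orbs. y x *\<^sub>T z x)"
 "1\<^sub>Z = (\<lambda>x\<in>orbs. 1\<^sub>T)" "0\<^sub>Z = (\<lambda>x\<in>orbs. 0\<^sub>T)" "y +\<^sub>Z z = (\<lambda>x\<in>orbs. y x +\<^sub>T z x)"
 by (simp_all add: struct_alg_def OF_simps)

lemma Z_sub: "Z \<subseteq> carrier OF"
 unfolding Z_gen using OF.add.generate_incl[OF gens_OF] .

lemma Z_subgroup: "subgroup Z (add_monoid OF)"
 unfolding Z_gen by (rule OF.add.generate_is_subgroup[OF gens_OF])

lemma zt_Z: "z \<in> ZS ==> t \<in> carrier T ==> zt z t \<in> Z"
 unfolding Z_gen by (rule generate.incl) blast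

lemma Z_add: "y \<in> Z ==> z \<in> Z ==> y \<oplus>\<^bsub>OF\<^esub> z \<in> Z" using subgroup.m_closed[OF Z_subgroup, of y z] by simp

text \<open>Negatives need no case of their own, since a sign is absorbed by
  \<open>t\<close>.\<close>

lemma Z_induct [consumes 1, case_names zt add]:
 assumes "z \<in> Z" and g: "\<And>z t. z \<in> ZS ==> t \<in> carrier T ==> PP (zt z t)"
  and a: "\<And>y z. y \<in> Z ==> z \<in> Z ==> PP y ==> PP z ==> PP (y \<oplus>\<^bsub>OF\<^esub> z)"
 shows "PP z"
 using assms(1) unfolding Z_gen
proof (induction rule: generate.induct)
 case one
 have "zt (\<lambda>x\<in>orbs. 1\<^sub>s) 0\<^sub>T = \<zero>\<^bsub>OF\<^esub>" by (auto simp: zt_def OF_simps intro!: restrict_ext)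
 thus ?case using g[OF ZS_const[OF S.one_closed] T.zero_closed] by simp
next
 case (incl h)
 thus ?case using g by blast
next
 case (inv h)
 then obtain z t where zt: "h = zt z t" "z \<in> ZS" "t \<in> carrier T" by blast
 have "zt z (\<ominus>\<^bsub>T\<^esub> t) \<oplus>\<^bsub>OF\<^esub> zt z t = \<zero>\<^bsub>OF\<^esub>"
  using zt ZS_val by (auto simp: zt_def OF_simps T.r_minus T.l_neg intro!: restrict_ext)
 hence "\<ominus>\<^bsub>OF\<^esub> h = zt z (\<ominus>\<^bsub>T\<^esub> t)"
  using zt_OF zt by (intro OF.minus_equality) auto
 hence "PP (\<ominus>\<^bsub>OF\<^esub> h)" using g zt by simp
 thus ?case unfolding a_inv_def .
next
 case (eng y z)
 thus ?case using a[of y z] unfolding Z_gen by simp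
qed

lemma Z_mult: assumes "y \<in> Z" "z \<in> Z" shows "y \<otimes>\<^bsub>OF\<^esub> z \<in> Z"
 using assms(1)
proof (induction rule: Z_induct)
 case (zt y' t)
 note y = zt
 show ?case using assms(2)
 proof (induction rule: Z_induct)
  case (zt z' t')
  have "zt y' t \<otimes>\<^bsub>OF\<^esub> zt z' t' = zt (\<lambda>x\<in>orbs. y' x *\<^sub>s z' x) (t *\<^sub>T t')"
   using y zt ZS_val by (auto simp: zt_def OF_simps T.m_ac intro!: restrict_ext)
  thus ?case using zt_Z[OF ZS_mult] y zt by simp
 next
  case (add a b)
  thus ?case using Z_sub zt_OF y Z_add by (simp add: OF.r_distr subset_iff)
 qed
next
 case (add a b)
 thus ?case using Z_sub assms(2) Z_add by (simp add: OF.l_distr subset_iff)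
qed

lemma Z_one: "\<one>\<^bsub>OF\<^esub> \<in> Z"
proof -
 have "zt (\<lambda>x\<in>orbs. 1\<^sub>s) 1\<^sub>T = \<one>\<^bsub>OF\<^esub>" by (auto simp: zt_def OF_simps intro!: restrict_ext)
 thus ?thesis using zt_Z[OF ZS_const[OF S.one_closed] T.one_closed] by simp
qed

lemma cring_ZA: "cring ZA"
proof -
 have "subring Z OF"
  using Z_sub Z_one Z_mult Z_add subgroup.m_inv_closed[OF Z_subgroup]
  by (intro OF.subringI) (auto simp: a_inv_def)
 hence "subcring Z OF" using OF.subcringI' by blast
 hence "cring (OF\<lparr>carrier := Z\<rparr>)" using OF.subcring_iff[OF Z_sub] by simp
 moreover have "OF\<lparr>carrier := Z\<rparr> = ZA" by (simp add: struct_alg_def)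
 ultimately show ?thesis by simp
qed

sublocale ZA: cring ZA by (rule cring_ZA)

lemma Z_val [simp]: "z \<in> Z ==> x \<in> orbs ==> z x \<in> carrier T" using Z_sub by (auto simp: OF_simps)

lemma Z_eqI: "y \<in> Z ==> z \<in> Z ==> (\<And>x. x \<in> orbs ==> y x = z x) ==> y = z"
 using Z_sub OF_eqI unfolding OF_simps by blast

lemma ZA_minus: assumes "y \<in> Z" "x \<in> orbs" shows "(\<ominus>\<^bsub>ZA\<^esub> y) x = \<ominus>\<^bsub>T\<^esub> y x"
proof -
 have "(\<ominus>\<^bsub>ZA\<^esub> y +\<^sub>Z y) x = 0\<^sub>T" using assms by (subst ZA.l_neg) (auto simp: ZA_simps)
 hence "(\<ominus>\<^bsub>ZA\<^esub> y) x +\<^sub>T y x = 0\<^sub>T" using assms by (simp add: ZA_simps)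
 thus ?thesis using assms by (intro T.minus_equality[symmetric]) auto
qed

abbreviation "dg \<equiv> diag D"

lemma dg_Z [simp]: "t \<in> carrier T ==> dg t \<in> Z"
proof -
 assume t: "t \<in> carrier T"
 have "zt (\<lambda>x\<in>orbs. 1\<^sub>s) t = dg t" using t by (auto simp: zt_def diag_def intro!: restrict_ext)
 thus ?thesis using zt_Z[OF ZS_const[OF S.one_closed] t] by simp
qed

lemma dg_val: "x \<in> orbs ==> dg t x = t" by (simp add: diag_def)

lemma dg_ops: "t \<in> carrier T ==> u \<in> carrier T ==> dg (t *\<^sub>T u) = dg t *\<^sub>Z dg u"
 "t \<in> carrier T ==> u \<in> carrier T ==> dg (t +\<^sub>T u) = dg t +\<^sub>Z dg u"
 "dg 1\<^sub>T = 1\<^sub>Z" "dg 0\<^sub>T = 0\<^sub>Z"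
 by (auto simp: diag_def ZA_simps intro!: restrict_ext)

definition \<delta> where "\<delta> = \<phi> \<delta>S"
definition un where "un x = (\<lambda>y\<in>orbs. if y = x then \<delta> else 0\<^sub>T)"
text \<open>The antisymmetric element: it multiplies the second summand in \<open>Z_decomp\<close>,
  and its values are nonzerodivisors on torsion free modules.\<close>

definition cc where "cc = (\<lambda>x\<in>orbs. cT (croot x))"

lemma \<delta>_T [simp]: "\<delta> \<in> carrier T" by (simp add: \<delta>_def)

lemma \<delta>_prod: "\<delta> = finprod T cT Rp"
 unfolding \<delta>_def \<delta>S_def using cS_funcset \<phi>.hom_finprod[of cS Rp] by (simp add: comp_def cT_eq[abs_def])

lemma un_Z [simp]: "x \<in> orbs ==> un x \<in> Z"
proof -
 assume x: "x \<in> orbs"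
 have "zt (\<lambda>y\<in>orbs. if y = x then \<delta>S else 0\<^sub>s) 1\<^sub>T = un x" by (auto simp: zt_def un_def \<delta>_def intro!: restrict_ext)
 thus ?thesis using zt_Z[OF ZS_unit[OF x] T.one_closed] by simp
qed

lemma cc_Z [simp]: "cc \<in> Z"
proof -
 have "zt (\<lambda>x\<in>orbs. cS (croot x)) 1\<^sub>T = cc" using croot_R by (auto simp: zt_def cc_def cT_eq intro!: restrict_ext)
 thus ?thesis using zt_Z[OF ZS_croot T.one_closed] by simp
qed

lemma cc_ro: "x \<in> orbs ==> cc (ro x) = \<ominus>\<^bsub>T\<^esub> cc x"
 using croot_R croot_ro ro_orbits by (simp add: cc_def cT_eq cS_neg)

abbreviation "Zs \<equiv> carrier (struct_inv D s)"

lemma Zs_iff: "z \<in> Zs \<longleftrightarrow> z \<in> Z \<and> (\<forall>x\<in>orbs. z (ro x) = z x)"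
 by (auto simp: struct_inv_def)

lemma Zs_add: assumes "a \<in> Zs" "b \<in> Zs" shows "a +\<^sub>Z b \<in> Zs"
proof -
 have "a +\<^sub>Z b \<in> Z" using assms by (simp add: Zs_iff)
 moreover have "(a +\<^sub>Z b) (ro x) = (a +\<^sub>Z b) x" if "x \<in> orbs" for x
  unfolding ZA_simps using assms that ro_orbits[OF that] by (simp add: Zs_iff)
 ultimately show ?thesis by (simp add: Zs_iff)
qed

text \<open>On a generator, \<open>b\<close> comes from half the quotient of z(x) - z(xs) by the
  wall coroot, and \<open>a\<close> is the remainder; the statement is additive in
  \<open>z\<close>.\<close>

lemma Z_decomp: assumes "z \<in> Z" shows "\<exists>a\<in>Zs. \<exists>b\<in>Zs. z = a +\<^sub>Z cc *\<^sub>Z b"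
 using assms
proof (induction rule: Z_induct)
 case (zt z t)
 obtain h where h: "h \<in> carrier S" "h +\<^sub>s h = 1\<^sub>s" using half_S by blast
 obtain u where u: "u \<in> ZS" "\<And>x. x \<in> orbs ==> u (ro x) = u x"
  "\<And>x. x \<in> orbs ==> z x -\<^sub>s z (ro x) = cS (croot x) *\<^sub>s u x" using ZS_antisym[OF zt(1)] by blast
 define b where "b = (\<lambda>x\<in>orbs. (\<lambda>x\<in>orbs. h) x *\<^sub>s u x)"
 have b: "b \<in> ZS" unfolding b_def using ZS_mult[OF ZS_const[OF h(1)] u(1)] .
 \<comment> \<open>The negative of the product of \<open>b\<close> with the wall coroots, assembled
   from products so that it visibly lies in \<open>ZS\<close>.\<close>
 define cb where "cb = (\<lambda>x\<in>orbs. (\<lambda>x\<in>orbs. \<ominus>\<^bsub>S\<^esub> 1\<^sub>s) x *\<^sub>s (\<lambda>x\<in>orbs. (\<lambda>x\<in>orbs. cS (croot x)) x *\<^sub>s b x) x)"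
 have cb: "cb \<in> ZS" unfolding cb_def by (intro ZS_mult ZS_const ZS_croot b) simp
 define a where "a = (\<lambda>x\<in>orbs. z x +\<^sub>s cb x)"
 have a: "a \<in> ZS" unfolding a_def by (rule ZS_add[OF zt(1) cb])
 have bv: "b x = h *\<^sub>s u x" if "x \<in> orbs" for x using that by (simp add: b_def)
 have av: "a x = z x -\<^sub>s cS (croot x) *\<^sub>s b x" if "x \<in> orbs" for x
  using that croot_R ZS_val[OF b that] by (simp add: a_def cb_def S.minus_eq S.l_minus)
 have a_ro: "a (ro x) = a x" if x: "x \<in> orbs" for x
 proof -
  note rx = ro_orbits[OF x]
  define p q w v where "p = z x" "q = z (ro x)" "w = cS (croot x)" "v = u x"
  have cl: "p \<in> carrier S" "q \<in> carrier S" "w \<in> carrier S" "v \<in> carrier S"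
   using ZS_val[OF zt(1)] ZS_val[OF u(1)] x rx croot_R[OF x] by (auto simp: p_q_w_v_def)
  have pq: "p -\<^sub>s q = w *\<^sub>s v" using u(3)[OF x] by (simp add: p_q_w_v_def)
  have wv: "w *\<^sub>s v = w *\<^sub>s (h *\<^sub>s v) +\<^sub>s w *\<^sub>s (h *\<^sub>s v)"
  proof -
   have "w *\<^sub>s (h *\<^sub>s v) +\<^sub>s w *\<^sub>s (h *\<^sub>s v) = w *\<^sub>s ((h +\<^sub>s h) *\<^sub>s v)"
    using cl h(1) by (simp add: S.l_distr S.r_distr)
   thus ?thesis using cl h by simp
  qed
  have "a (ro x) = q +\<^sub>s w *\<^sub>s (h *\<^sub>s v)"
   using av[OF rx] bv[OF rx] u(2)[OF x] croot_ro[OF x] croot_R[OF x] cl h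
   by (simp add: p_q_w_v_def cS_neg S.minus_eq S.l_minus)
  moreover have "a x = p -\<^sub>s w *\<^sub>s (h *\<^sub>s v)" using av[OF x] bv[OF x] by (simp add: p_q_w_v_def)
  moreover have "p = q +\<^sub>s (w *\<^sub>s (h *\<^sub>s v) +\<^sub>s w *\<^sub>s (h *\<^sub>s v))"
  proof -
   have "p = q +\<^sub>s (p -\<^sub>s q)" using cl by (simp add: S.minus_eq S.a_lcomm[of q] S.r_neg)
   thus ?thesis using pq wv by simp
  qed
  ultimately show ?thesis using cl h by (simp add: S.minus_eq S.a_assoc S.r_neg)
 qed
 have A: "zt a t \<in> Zs" unfolding Zs_iff using zt_Z[OF a zt(2)] a_ro ro_orbits by (auto simp: zt_def)
 have B: "zt b t \<in> Zs" unfolding Zs_iff using zt_Z[OF b zt(2)] u(2) bv ro_orbits by (auto simp: zt_def)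
 have "zt z t = zt a t +\<^sub>Z cc *\<^sub>Z zt b t"
 proof (rule Z_eqI)
  fix x assume x: "x \<in> orbs"
  have cl: "z x \<in> carrier S" "b x \<in> carrier S" "cS (croot x) \<in> carrier S" using ZS_val[OF zt(1)] ZS_val[OF b] croot_R x by auto
  have "z x = a x +\<^sub>s cS (croot x) *\<^sub>s b x" using cl av[OF x] by (simp add: S.minus_eq S.a_assoc S.l_neg)
  hence "\<phi> (z x) = \<phi> (a x) +\<^sub>T cT (croot x) *\<^sub>T \<phi> (b x)" using cl ZS_val[OF a x] by (simp add: cT_eq)
  thus "zt z t x = (zt a t +\<^sub>Z cc *\<^sub>Z zt b t) x"
   using x cl zt(2) ZS_val[OF a x] croot_R[OF x] by (simp add: zt_def ZA_simps cc_def T.l_distr T.m_assoc)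
 qed (use zt_Z[OF a zt(2)] zt_Z[OF b zt(2)] zt_Z[OF zt(1,2)] in auto)
 thus ?case using A B by blast
next
 case (add y z)
 then obtain a b a' b' where *: "a \<in> Zs" "b \<in> Zs" "y = a +\<^sub>Z cc *\<^sub>Z b"
  "a' \<in> Zs" "b' \<in> Zs" "z = a' +\<^sub>Z cc *\<^sub>Z b'" by blast
 have Z: "a \<in> Z" "b \<in> Z" "a' \<in> Z" "b' \<in> Z" using * by (auto simp: Zs_iff)
 have "a +\<^sub>Z a' \<in> Zs" "b +\<^sub>Z b' \<in> Zs" using *(1,2,4,5) Zs_add by blast+
 moreover have "y \<oplus>\<^bsub>OF\<^esub> z = (a +\<^sub>Z a') +\<^sub>Z cc *\<^sub>Z (b +\<^sub>Z b')"
 proof -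
  have "y \<oplus>\<^bsub>OF\<^esub> z = y +\<^sub>Z z" by (simp add: ZA_simps OF_simps)
  thus ?thesis using Z *(3,6) by (simp add: ZA.r_distr ZA.a_ac)
 qed
 ultimately show ?case by blast
qed

end

section \<open>Localization and stalks\<close>

text \<open>The additive group of a localized module. It is used for \<open>T\<close> itself, where
  it recovers \<open>T_gen\<close>, and for a module over the structure algebra, where it detects
  which tensors vanish.\<close>

locale mloc = Module.module T M for T :: "('t, 'x) ring_scheme" (structure) and M :: "('t, 'm, 'y) module_scheme" +
 fixes \<Delta> :: "'t set"
 assumes \<Delta>_T: "\<Delta> \<subseteq> carrier T" and \<Delta>_one: "\<one> \<in> \<Delta>" and \<Delta>_mult: "d \<in> \<Delta> ==> e \<in> \<Delta> ==> d \<otimes> e \<in> \<Delta>"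
begin

definition mfrac where "mfrac m d = {(m', d') \<in> carrier M \<times> \<Delta>. \<exists>u\<in>\<Delta>. u \<odot>\<^bsub>M\<^esub> (d' \<odot>\<^bsub>M\<^esub> m) = u \<odot>\<^bsub>M\<^esub> (d \<odot>\<^bsub>M\<^esub> m')}"

lemma \<Delta>_carrier [simp]: "d \<in> \<Delta> ==> d \<in> carrier T" using \<Delta>_T by auto

lemma mfrac_self: "m \<in> carrier M ==> d \<in> \<Delta> ==> (m, d) \<in> mfrac m d"
 using \<Delta>_one by (auto simp: mfrac_def)

lemma mfrac_mem:
 assumes m: "m \<in> carrier M" and d: "d \<in> \<Delta>" and mem: "(m', d') \<in> mfrac m d" shows "mfrac m' d' = mfrac m d"
proof -
 obtain u where u: "u \<in> \<Delta>" "u \<odot>\<^bsub>M\<^esub> (d' \<odot>\<^bsub>M\<^esub> m) = u \<odot>\<^bsub>M\<^esub> (d \<odot>\<^bsub>M\<^esub> m')" and c: "m' \<in> carrier M" "d' \<in> \<Delta>"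
  using mem by (auto simp: mfrac_def)
 have sub: "mfrac m2 d2 \<subseteq> mfrac m1 d1"
  if 1: "m1 \<in> carrier M" "d1 \<in> \<Delta>" "m2 \<in> carrier M" "d2 \<in> \<Delta>" "u \<in> \<Delta>" "u \<odot>\<^bsub>M\<^esub> (d2 \<odot>\<^bsub>M\<^esub> m1) = u \<odot>\<^bsub>M\<^esub> (d1 \<odot>\<^bsub>M\<^esub> m2)"
  for m1 d1 m2 d2 u
 proof
  fix p assume "p \<in> mfrac m2 d2"
  then obtain n e v where n: "p = (n, e)" "n \<in> carrier M" "e \<in> \<Delta>" "v \<in> \<Delta>"
   "v \<odot>\<^bsub>M\<^esub> (e \<odot>\<^bsub>M\<^esub> m2) = v \<odot>\<^bsub>M\<^esub> (d2 \<odot>\<^bsub>M\<^esub> n)" by (auto simp: mfrac_def)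
  \<comment> \<open>Both witnesses and the middle denominator: the usual transitivity argument when
    denominators cannot be cancelled.\<close>
  let ?w = "u \<otimes> v \<otimes> d2"
  have "?w \<odot>\<^bsub>M\<^esub> (e \<odot>\<^bsub>M\<^esub> m1) = v \<odot>\<^bsub>M\<^esub> (e \<odot>\<^bsub>M\<^esub> (u \<odot>\<^bsub>M\<^esub> (d2 \<odot>\<^bsub>M\<^esub> m1)))"
   using n(2-4) 1(1-5) by (simp add: m_ac flip: smult_assoc1)
  also have "\<dots> = d1 \<odot>\<^bsub>M\<^esub> (u \<odot>\<^bsub>M\<^esub> (v \<odot>\<^bsub>M\<^esub> (e \<odot>\<^bsub>M\<^esub> m2)))"
   unfolding 1(6) using n(2-4) 1(1-5) by (simp add: m_ac flip: smult_assoc1)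
  also have "\<dots> = ?w \<odot>\<^bsub>M\<^esub> (d1 \<odot>\<^bsub>M\<^esub> n)"
   unfolding n(5) using n(2-4) 1(1-5) by (simp add: m_ac flip: smult_assoc1)
  finally have "?w \<odot>\<^bsub>M\<^esub> (e \<odot>\<^bsub>M\<^esub> m1) = ?w \<odot>\<^bsub>M\<^esub> (d1 \<odot>\<^bsub>M\<^esub> n)" .
  moreover have "?w \<in> \<Delta>" using n 1 \<Delta>_mult by simp
  ultimately show "p \<in> mfrac m1 d1" using n unfolding mfrac_def by blast
 qed
 show ?thesis using sub[OF m d c u] sub[OF c m d u(1) u(2)[symmetric]] by blast
qed

lemma mfrac_eqI:
 assumes "m \<in> carrier M" "d \<in> \<Delta>" "m' \<in> carrier M" "d' \<in> \<Delta>" "d' \<odot>\<^bsub>M\<^esub> m = d \<odot>\<^bsub>M\<^esub> m'"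
 shows "mfrac m d = mfrac m' d'"
proof -
 have "(m', d') \<in> mfrac m d" unfolding mfrac_def using assms \<Delta>_one by (auto intro!: bexI[of _ \<one>])
 thus ?thesis using mfrac_mem assms by blast
qed

definition madd where "madd X Y = (\<Union>(m, d)\<in>X. \<Union>(n, e)\<in>Y. mfrac (e \<odot>\<^bsub>M\<^esub> m \<oplus>\<^bsub>M\<^esub> d \<odot>\<^bsub>M\<^esub> n) (d \<otimes> e))"

lemma madd_welldef:
 assumes m: "m \<in> carrier M" "d \<in> \<Delta>" "n \<in> carrier M" "e \<in> \<Delta>" and mem: "(m', d') \<in> mfrac m d" "(n', e') \<in> mfrac n e"
 shows "mfrac (e' \<odot>\<^bsub>M\<^esub> m' \<oplus>\<^bsub>M\<^esub> d' \<odot>\<^bsub>M\<^esub> n') (d' \<otimes> e') = mfrac (e \<odot>\<^bsub>M\<^esub> m \<oplus>\<^bsub>M\<^esub> d \<odot>\<^bsub>M\<^esub> n) (d \<otimes> e)"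
proof -
 obtain u where u: "u \<in> \<Delta>" "u \<odot>\<^bsub>M\<^esub> (d' \<odot>\<^bsub>M\<^esub> m) = u \<odot>\<^bsub>M\<^esub> (d \<odot>\<^bsub>M\<^esub> m')" and c: "m' \<in> carrier M" "d' \<in> \<Delta>"
  using mem(1) by (auto simp: mfrac_def)
 obtain v where v: "v \<in> \<Delta>" "v \<odot>\<^bsub>M\<^esub> (e' \<odot>\<^bsub>M\<^esub> n) = v \<odot>\<^bsub>M\<^esub> (e \<odot>\<^bsub>M\<^esub> n')" and c': "n' \<in> carrier M" "e' \<in> \<Delta>"
  using mem(2) by (auto simp: mfrac_def)
 let ?w = "u \<otimes> v" and ?p = "e \<odot>\<^bsub>M\<^esub> m \<oplus>\<^bsub>M\<^esub> d \<odot>\<^bsub>M\<^esub> n" and ?p' = "e' \<odot>\<^bsub>M\<^esub> m' \<oplus>\<^bsub>M\<^esub> d' \<odot>\<^bsub>M\<^esub> n'"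
 have "?w \<odot>\<^bsub>M\<^esub> ((d' \<otimes> e') \<odot>\<^bsub>M\<^esub> ?p) =
   (v \<otimes> e' \<otimes> e) \<odot>\<^bsub>M\<^esub> (u \<odot>\<^bsub>M\<^esub> (d' \<odot>\<^bsub>M\<^esub> m)) \<oplus>\<^bsub>M\<^esub> (u \<otimes> d' \<otimes> d) \<odot>\<^bsub>M\<^esub> (v \<odot>\<^bsub>M\<^esub> (e' \<odot>\<^bsub>M\<^esub> n))"
  using m c c' u(1) v(1) by (simp add: smult_r_distr m_ac flip: smult_assoc1)
 also have "\<dots> = ?w \<odot>\<^bsub>M\<^esub> ((d \<otimes> e) \<odot>\<^bsub>M\<^esub> ?p')"
  unfolding u(2) v(2) using m c c' u(1) v(1) by (simp add: smult_r_distr m_ac flip: smult_assoc1)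
 finally have "(?p', d' \<otimes> e') \<in> mfrac ?p (d \<otimes> e)"
  unfolding mfrac_def using u v c c' \<Delta>_mult by auto
 thus ?thesis using m \<Delta>_mult by (intro mfrac_mem) auto
qed

lemma madd_mfrac:
 assumes m: "m \<in> carrier M" "d \<in> \<Delta>" "n \<in> carrier M" "e \<in> \<Delta>"
 shows "madd (mfrac m d) (mfrac n e) = mfrac (e \<odot>\<^bsub>M\<^esub> m \<oplus>\<^bsub>M\<^esub> d \<odot>\<^bsub>M\<^esub> n) (d \<otimes> e)"
 unfolding madd_def using madd_welldef[OF m] mfrac_self[OF m(1,2)] mfrac_self[OF m(3,4)] by blast

definition "LG = \<lparr>carrier = {mfrac m d | m d. m \<in> carrier M \<and> d \<in> \<Delta>}, monoid.mult = madd, one = mfrac \<zero>\<^bsub>M\<^esub> \<one>\<rparr>"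

lemma LG_simps: "carrier LG = {mfrac m d | m d. m \<in> carrier M \<and> d \<in> \<Delta>}" "x \<otimes>\<^bsub>LG\<^esub> y = madd x y" "\<one>\<^bsub>LG\<^esub> = mfrac \<zero>\<^bsub>M\<^esub> \<one>"
 by (simp_all add: LG_def)

lemma mfrac_LG: "m \<in> carrier M ==> d \<in> \<Delta> ==> mfrac m d \<in> carrier LG"
 by (auto simp: LG_simps)

lemma LG_cases: assumes "x \<in> carrier LG" obtains m d where "m \<in> carrier M" "d \<in> \<Delta>" "x = mfrac m d"
 using assms by (auto simp: LG_simps)

lemma comm_group_LG: "comm_group LG"
proof (rule comm_groupI)
 fix x y assume "x \<in> carrier LG" "y \<in> carrier LG"
 then obtain m d n e where *: "m \<in> carrier M" "d \<in> \<Delta>" "x = mfrac m d" "n \<in> carrier M" "e \<in> \<Delta>" "y = mfrac n e"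
  by (metis LG_cases)
 thus "x \<otimes>\<^bsub>LG\<^esub> y \<in> carrier LG"
  unfolding LG_simps(2) using madd_mfrac mfrac_LG \<Delta>_mult by simp
 show "x \<otimes>\<^bsub>LG\<^esub> y = y \<otimes>\<^bsub>LG\<^esub> x"
  unfolding LG_simps(2) using * by (simp add: madd_mfrac m_comm M.a_comm)
 fix z assume "z \<in> carrier LG"
 then obtain p f where p: "p \<in> carrier M" "f \<in> \<Delta>" "z = mfrac p f" by (metis LG_cases)
 show "x \<otimes>\<^bsub>LG\<^esub> y \<otimes>\<^bsub>LG\<^esub> z = x \<otimes>\<^bsub>LG\<^esub> (y \<otimes>\<^bsub>LG\<^esub> z)"
  unfolding LG_simps(2) using * p \<Delta>_mult
  by (simp add: madd_mfrac smult_r_distr m_ac M.a_ac flip: smult_assoc1)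
next
 show "\<one>\<^bsub>LG\<^esub> \<in> carrier LG" unfolding LG_simps(3) by (rule mfrac_LG) (auto simp: \<Delta>_one)
 fix x assume "x \<in> carrier LG"
 then obtain m d where *: "m \<in> carrier M" "d \<in> \<Delta>" "x = mfrac m d" by (metis LG_cases)
 thus "\<one>\<^bsub>LG\<^esub> \<otimes>\<^bsub>LG\<^esub> x = x"
  unfolding LG_simps(2,3) using \<Delta>_one by (simp add: madd_mfrac)
 show "\<exists>y\<in>carrier LG. y \<otimes>\<^bsub>LG\<^esub> x = \<one>\<^bsub>LG\<^esub>"
 proof (rule bexI[of _ "mfrac (\<ominus>\<^bsub>M\<^esub> m) d"])
  have "mfrac (\<ominus>\<^bsub>M\<^esub> m) d \<otimes>\<^bsub>LG\<^esub> x = mfrac \<zero>\<^bsub>M\<^esub> (d \<otimes> d)"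
   unfolding LG_simps(2) * using * by (simp add: madd_mfrac smult_r_minus M.l_neg)
  also have "\<dots> = \<one>\<^bsub>LG\<^esub>" unfolding LG_simps(3) using * \<Delta>_mult \<Delta>_one by (intro mfrac_eqI) auto
  finally show "mfrac (\<ominus>\<^bsub>M\<^esub> m) d \<otimes>\<^bsub>LG\<^esub> x = \<one>\<^bsub>LG\<^esub>" .
 qed (use * in \<open>auto intro: mfrac_LG\<close>)
qed

end

lemma (in cring) regular_module: "Module.module R (regular_module R)"
proof (rule moduleI)
 show "abelian_group (regular_module R)"
  by (rule abelian_groupI) (auto simp: regular_module_def a_ac intro: bexI[of _ "\<ominus> _"] l_neg)
qed (auto simp: regular_module_def l_distr r_distr m_assoc is_cring)

lemma regular_simps: "carrier (regular_module R) = carrier R" "x \<oplus>\<^bsub>regular_module R\<^esub> y = x \<oplus>\<^bsub>R\<^esub> y"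
 "\<zero>\<^bsub>regular_module R\<^esub> = \<zero>\<^bsub>R\<^esub>" "a \<odot>\<^bsub>regular_module R\<^esub> x = a \<otimes>\<^bsub>R\<^esub> x"
 by (simp_all add: regular_module_def)

section \<open>The generic base ring\<close>

context T_base
begin

definition \<Delta> where "\<Delta> = {finprod T (\<lambda>\<beta>. cT \<beta> [^]\<^bsub>T\<^esub> n \<beta>) Rp | n :: 'v \<Rightarrow> nat. True}"

lemma cT_pow_funcset: "(\<lambda>\<beta>. cT \<beta> [^]\<^bsub>T\<^esub> (n \<beta> :: nat)) \<in> Rp \<rightarrow> carrier T"
 using Rp_subset by auto

sublocale TL: mloc T "regular_module T" \<Delta>
proof (intro mloc.intro mloc_axioms.intro T.regular_module)
 show "\<Delta> \<subseteq> carrier T" unfolding \<Delta>_def by (safe, rule T.finprod_closed[OF cT_pow_funcset])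
 show "1\<^sub>T \<in> \<Delta>" unfolding \<Delta>_def by (intro CollectI exI[of _ "\<lambda>_. 0"]) simp
 fix d e assume "d \<in> \<Delta>" "e \<in> \<Delta>"
 then obtain n m :: "'v \<Rightarrow> nat" where "d = finprod T (\<lambda>\<beta>. cT \<beta> [^]\<^bsub>T\<^esub> n \<beta>) Rp" "e = finprod T (\<lambda>\<beta>. cT \<beta> [^]\<^bsub>T\<^esub> m \<beta>) Rp"
  unfolding \<Delta>_def by blast
 hence "d *\<^sub>T e = finprod T (\<lambda>\<beta>. cT \<beta> [^]\<^bsub>T\<^esub> n \<beta> *\<^sub>T cT \<beta> [^]\<^bsub>T\<^esub> m \<beta>) Rp"
  using T.finprod_multf[OF cT_pow_funcset[of n] cT_pow_funcset[of m]] by simp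
 also have "\<dots> = finprod T (\<lambda>\<beta>. cT \<beta> [^]\<^bsub>T\<^esub> (n \<beta> + m \<beta>)) Rp"
 proof (rule T.finprod_cong'[OF refl cT_pow_funcset])
  fix \<beta> assume "\<beta> \<in> Rp"
  hence "cT \<beta> \<in> carrier T" using Rp_subset by auto
  thus "cT \<beta> [^]\<^bsub>T\<^esub> n \<beta> *\<^sub>T cT \<beta> [^]\<^bsub>T\<^esub> m \<beta> = cT \<beta> [^]\<^bsub>T\<^esub> (n \<beta> + m \<beta>)" by (rule T.nat_pow_mult)
 qed
 finally show "d *\<^sub>T e \<in> \<Delta>" unfolding \<Delta>_def by (intro CollectI exI[of _ "\<lambda>\<beta>. n \<beta> + m \<beta>"]) simp
qed

lemma \<delta>_\<Delta>: "\<delta> \<in> \<Delta>"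
proof -
 have "\<delta> = finprod T (\<lambda>\<beta>. cT \<beta> [^]\<^bsub>T\<^esub> (1::nat)) Rp"
  unfolding \<delta>_prod using Rp_subset by (intro T.finprod_cong') auto
 thus ?thesis unfolding \<Delta>_def by (intro CollectI exI[of _ "\<lambda>_. 1"]) simp
qed

text \<open>Extends properties from single coroots to all denominators, without bookkeeping of
  exponents.\<close>

lemma \<Delta>_induct:
 assumes "d \<in> \<Delta>" "PP 1\<^sub>T" "\<And>\<beta> t. \<beta> \<in> Rp ==> t \<in> carrier T ==> PP t ==> PP (cT \<beta> *\<^sub>T t)"
 shows "PP d"
proof -
 have pow: "PP (cT \<beta> [^]\<^bsub>T\<^esub> (n::nat) *\<^sub>T t)" if "\<beta> \<in> Rp" "t \<in> carrier T" "PP t" for \<beta> n t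
 proof (induction n)
  case (Suc n)
  have "cT \<beta> \<in> carrier T" using that Rp_subset by auto
  hence "cT \<beta> [^]\<^bsub>T\<^esub> Suc n *\<^sub>T t = cT \<beta> *\<^sub>T (cT \<beta> [^]\<^bsub>T\<^esub> n *\<^sub>T t)"
   using that by (simp add: T.m_ac)
  thus ?case using assms(3)[OF that(1) _ Suc] \<open>cT \<beta> \<in> carrier T\<close> that by simp
 qed (use that in simp)
 have "PP (finprod T (\<lambda>\<beta>. cT \<beta> [^]\<^bsub>T\<^esub> (n \<beta> :: nat)) A)" if "A \<subseteq> Rp" "finite A" for A n
  using that(2,1)
 proof (induction A rule: finite_induct)
  case (insert a A)
  have f: "(\<lambda>\<beta>. cT \<beta> [^]\<^bsub>T\<^esub> (n \<beta> :: nat)) \<in> A \<rightarrow> carrier T" "cT a \<in> carrier T" using insert Rp_subset by auto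
  thus ?case using insert pow[of a "finprod T (\<lambda>\<beta>. cT \<beta> [^]\<^bsub>T\<^esub> (n \<beta> :: nat)) A" "n a"] by simp
 qed (use assms(2) in simp)
 thus ?thesis using assms(1) finite_Rp unfolding \<Delta>_def by blast
qed

abbreviation "TG \<equiv> T_gen D"
abbreviation "fr \<equiv> fraction T \<Delta>"

lemma TG_eq: "TG = localization T \<Delta>" by (simp add: T_gen_def \<Delta>_def)

lemma fr_mfrac: "a \<in> carrier T ==> d \<in> \<Delta> ==> fr a d = TL.mfrac a d"
 unfolding fraction_def TL.mfrac_def by (auto simp: regular_simps T.m_comm)

lemma fr_eqI: "a \<in> carrier T ==> d \<in> \<Delta> ==> a' \<in> carrier T ==> d' \<in> \<Delta> ==> a *\<^sub>T d' = a' *\<^sub>T d ==> fr a d = fr a' d'"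
 unfolding fr_mfrac by (rule TL.mfrac_eqI) (auto simp: regular_simps T.m_comm)

lemma TG_simps: "carrier TG = {fr a d | a d. a \<in> carrier T \<and> d \<in> \<Delta>}" "\<zero>\<^bsub>TG\<^esub> = fr 0\<^sub>T 1\<^sub>T" "\<one>\<^bsub>TG\<^esub> = fr 1\<^sub>T 1\<^sub>T"
 by (simp_all add: TG_eq localization_def)

lemma fr_rep:
 assumes "a \<in> carrier T" "d \<in> \<Delta>" "(a', d') \<in> fr a d" shows "a' \<in> carrier T" "d' \<in> \<Delta>" "(a', d') \<in> TL.mfrac a d"
 using assms fr_mfrac by (auto simp: fraction_def)

lemma TG_add:
 assumes "a \<in> carrier T" "d \<in> \<Delta>" "b \<in> carrier T" "e \<in> \<Delta>"
 shows "fr a d \<oplus>\<^bsub>TG\<^esub> fr b e = fr (a *\<^sub>T e +\<^sub>T b *\<^sub>T d) (d *\<^sub>T e)"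
proof -
 have *: "fr (a' *\<^sub>T e' +\<^sub>T b' *\<^sub>T d') (d' *\<^sub>T e') = fr (a *\<^sub>T e +\<^sub>T b *\<^sub>T d) (d *\<^sub>T e)"
  if "(a', d') \<in> fr a d" "(b', e') \<in> fr b e" for a' b' d' e'
  using TL.madd_welldef[of a d b e a' d' b' e'] fr_rep[OF assms(1,2) that(1)] fr_rep[OF assms(3,4) that(2)] assms TL.\<Delta>_mult
  by (simp add: fr_mfrac regular_simps T.m_comm)
 have "(a, d) \<in> fr a d" "(b, e) \<in> fr b e" using assms TL.mfrac_self by (auto simp: fr_mfrac regular_simps)
 hence "(\<Union>(a', d')\<in>fr a d. \<Union>(b', e')\<in>fr b e. fr (a' *\<^sub>T e' +\<^sub>T b' *\<^sub>T d') (d' *\<^sub>T e')) =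
  fr (a *\<^sub>T e +\<^sub>T b *\<^sub>T d) (d *\<^sub>T e)" using * by blast
 thus ?thesis by (simp add: TG_eq localization_def)
qed

lemma TG_smult:
 assumes "t \<in> carrier T" "a \<in> carrier T" "d \<in> \<Delta>" shows "t \<odot>\<^bsub>TG\<^esub> fr a d = fr (t *\<^sub>T a) d"
proof -
 have *: "fr (t *\<^sub>T a') d' = fr (t *\<^sub>T a) d" if mem: "(a', d') \<in> fr a d" for a' d'
 proof -
  note r = fr_rep[OF assms(2,3) mem]
  obtain u where u: "u \<in> \<Delta>" "u *\<^sub>T (a *\<^sub>T d') = u *\<^sub>T (a' *\<^sub>T d)" using mem by (auto simp: fraction_def)
  have uT: "u \<in> carrier T" "d \<in> carrier T" "d' \<in> carrier T" using u r assms TL.\<Delta>_T by auto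
  have "u *\<^sub>T (t *\<^sub>T a *\<^sub>T d') = t *\<^sub>T (u *\<^sub>T (a *\<^sub>T d'))" using assms r uT by (simp add: T.m_ac)
  also have "\<dots> = u *\<^sub>T (t *\<^sub>T a' *\<^sub>T d)" unfolding u(2) using assms r uT by (simp add: T.m_ac)
  finally have "(t *\<^sub>T a', d') \<in> fr (t *\<^sub>T a) d" unfolding fraction_def using u(1) r assms by auto
  thus ?thesis using TL.mfrac_mem[of "t *\<^sub>T a" d "t *\<^sub>T a'" d'] assms r by (simp add: fr_mfrac regular_simps)
 qed
 have "(a, d) \<in> fr a d" using assms TL.mfrac_self by (auto simp: fr_mfrac regular_simps)
 hence "(\<Union>(a', d')\<in>fr a d. fr (t *\<^sub>T a') d') = fr (t *\<^sub>T a) d" using * by blast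
 thus ?thesis by (simp add: TG_eq localization_def)
qed

lemma TG_action: "scalar_action T TG"
proof (rule scalar_action.intro)
 show "abelian_group TG"
 proof (rule abelian_group_of_comm_group[OF TL.comm_group_LG])
  show "carrier TG = carrier TL.LG"
   unfolding TG_simps TL.LG_simps using fr_mfrac by (auto simp: regular_simps) blast+
  show "\<zero>\<^bsub>TG\<^esub> = \<one>\<^bsub>TL.LG\<^esub>" unfolding TG_simps TL.LG_simps using fr_mfrac TL.\<Delta>_one by (simp add: regular_simps)
  fix x y assume "x \<in> carrier TL.LG" "y \<in> carrier TL.LG"
  then obtain a d b e where "a \<in> carrier T" "d \<in> \<Delta>" "x = TL.mfrac a d" "b \<in> carrier T" "e \<in> \<Delta>" "y = TL.mfrac b e"
   unfolding TL.LG_simps regular_simps by blast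
  thus "x \<oplus>\<^bsub>TG\<^esub> y = x \<otimes>\<^bsub>TL.LG\<^esub> y"
   unfolding TL.LG_simps using TG_add[of a d b e] TL.madd_mfrac[of a d b e] TL.\<Delta>_mult
   by (simp add: fr_mfrac regular_simps T.m_comm)
 qed
 show "scalar_action_axioms T TG"
 proof (rule scalar_action_axioms.intro)
  fix r q assume r: "r \<in> carrier T" and "q \<in> carrier TG"
  then obtain a d where ad: "a \<in> carrier T" "d \<in> \<Delta>" "q = fr a d" unfolding TG_simps by blast
  hence "fr (r *\<^sub>T a) d \<in> carrier TG" unfolding TG_simps using r T.m_closed by blast
  thus "r \<odot>\<^bsub>TG\<^esub> q \<in> carrier TG" using TG_smult[of r a d] r ad by simp
 qed
qed

end

context T_base
begin

text \<open>The \<open>un x\<close> are \<delta> times the idempotents of the generic fibre; this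
  identity and \<open>un_sum\<close> are the scaled forms of the idempotent relations.\<close>

lemma un_mult: "z \<in> Z ==> x \<in> orbs ==> z *\<^sub>Z un x = dg (z x) *\<^sub>Z un x"
 by (auto simp: ZA_simps un_def dg_val intro!: restrict_ext)

lemma un_val: "y \<in> orbs ==> un x y = (if y = x then \<delta> else 0\<^sub>T)"
 by (simp add: un_def)

lemma un_sum_val: "A \<subseteq> orbs ==> finite A ==> x \<in> orbs ==> finsum ZA un A x = (if x \<in> A then \<delta> else 0\<^sub>T)"
proof (induction A rule: infinite_finite_induct)
 case (insert y A)
 have un: "finsum ZA un (insert y A) = un y +\<^sub>Z finsum ZA un A"
  using insert by (intro ZA.finsum_insert) (auto simp: subset_iff)
 show ?case using insert unfolding un ZA_simps(4) by (simp add: un_val)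
qed (auto simp: ZA_simps)

lemma un_sum: "finsum ZA un orbs = dg \<delta>"
 by (rule Z_eqI) (auto simp: un_sum_val finite_orbits dg_val)

end

section \<open>The generic fibre of a module\<close>

locale zmod = T_base D s for D :: "('v::euclidean_space, 'k, 't) base_data" and s +
 fixes M :: "('v, 't, 'm) zmodule" (structure)
 assumes zm: "is_zmodule D M"
begin

sublocale M: Module.module ZA M
 using zm by (simp add: is_zmodule_def is_module_def)

abbreviation "MT \<equiv> restrict_scalars dg M"

lemma MT_simps [simp]: "carrier MT = carrier M" "x \<oplus>\<^bsub>MT\<^esub> y = x \<oplus> y" "\<zero>\<^bsub>MT\<^esub> = \<zero>" "t \<odot>\<^bsub>MT\<^esub> x = dg t \<odot> x"
 by (simp_all add: restrict_scalars_def)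

lemma MT_module: "Module.module T MT"
proof (rule moduleI)
 show "abelian_group MT"
  by (rule abelian_groupI) (auto simp: M.a_ac intro: bexI[of _ "\<ominus> _"] M.l_neg)
qed (auto simp: dg_ops M.smult_l_distr M.smult_r_distr M.smult_assoc1 T.is_cring)

sublocale MT: mloc T MT \<Delta>
 by (intro mloc.intro mloc_axioms.intro MT_module TL.\<Delta>_T TL.\<Delta>_one TL.\<Delta>_mult)

lemma MT_action: "scalar_action T MT"
 by (intro scalar_action.intro scalar_action_axioms.intro MT.M.abelian_group_axioms) simp

sublocale GG: tens T MT TG
 by (intro tens.intro MT_action TG_action)

lemma GG_eq: "gen_group D M = GG.G" by (simp add: gen_group_def)

abbreviation "te \<equiv> GG.te"

lemma fr_TG [simp]: "a \<in> carrier T ==> d \<in> \<Delta> ==> fr a d \<in> carrier TG"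
 by (auto simp: TG_simps)

lemma te_num:
 assumes "m \<in> carrier M" "a \<in> carrier T" "d \<in> \<Delta>" shows "te m (fr a d) = te (dg a \<odot> m) (fr 1\<^sub>T d)"
 using GG.te_smult[of a m "fr 1\<^sub>T d"] assms by (simp add: TG_smult)

lemma te_expand:
 assumes "m \<in> carrier M" "d \<in> \<Delta>" "e \<in> \<Delta>"
 shows "te m (fr 1\<^sub>T d) = te (dg e \<odot> m) (fr 1\<^sub>T (d *\<^sub>T e))"
proof -
 have "fr 1\<^sub>T d = fr e (d *\<^sub>T e)" using assms TL.\<Delta>_mult by (intro fr_eqI) (auto simp: T.m_comm)
 thus ?thesis using te_num[of m e "d *\<^sub>T e"] assms TL.\<Delta>_mult by simp
qed

text \<open>Sums of tensors can be brought to a common denominator, so every element of the generic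
  fibre is a single tensor with numerator 1.\<close>

lemma te_normal: assumes "X \<in> carrier GG.G" shows "\<exists>m\<in>carrier M. \<exists>d\<in>\<Delta>. X = te m (fr 1\<^sub>T d)"
 using assms
proof (induction rule: GG.tensor_induct)
 case (elt m q)
 then obtain a d where ad: "a \<in> carrier T" "d \<in> \<Delta>" "q = fr a d" by (auto simp: TG_simps)
 hence "te m q = te (dg a \<odot> m) (fr 1\<^sub>T d)" using te_num[of m a d] elt by simp
 moreover have "dg a \<odot> m \<in> carrier M" using ad elt by simp
 ultimately show ?case using ad by blast
next
 case (mult x y)
 then obtain m d n e where *: "m \<in> carrier M" "d \<in> \<Delta>" "x = te m (fr 1\<^sub>T d)" "n \<in> carrier M" "e \<in> \<Delta>" "y = te n (fr 1\<^sub>T e)"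
  by blast
 have "te m (fr 1\<^sub>T d) = te (dg e \<odot> m) (fr 1\<^sub>T (d *\<^sub>T e))" using te_expand[of m d e] * by simp
 moreover have "te n (fr 1\<^sub>T e) = te (dg d \<odot> n) (fr 1\<^sub>T (d *\<^sub>T e))"
  using te_expand[of n e d] * by (simp add: T.m_comm)
 moreover have "te (dg e \<odot> m \<oplus>\<^bsub>MT\<^esub> dg d \<odot> n) (fr 1\<^sub>T (d *\<^sub>T e)) =
  te (dg e \<odot> m) (fr 1\<^sub>T (d *\<^sub>T e)) \<otimes>\<^bsub>GG.G\<^esub> te (dg d \<odot> n) (fr 1\<^sub>T (d *\<^sub>T e))"
  using * TL.\<Delta>_mult by (intro GG.te_add_left) auto
 ultimately have "x \<otimes>\<^bsub>GG.G\<^esub> y = te (dg e \<odot> m \<oplus> dg d \<odot> n) (fr 1\<^sub>T (d *\<^sub>T e))" using * by simp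
 moreover have "dg e \<odot> m \<oplus> dg d \<odot> n \<in> carrier M" "d *\<^sub>T e \<in> \<Delta>" using * TL.\<Delta>_mult by auto
 ultimately show ?case by blast
qed

text \<open>The map \<open>m \<otimes> a/d \<mapsto> am/d\<close> to the localization of the module detects the kernel.\<close>

lemma te_kernel:
 assumes m: "m \<in> carrier M" "n \<in> carrier M" and d: "d \<in> \<Delta>" and eq: "te m (fr 1\<^sub>T d) = te n (fr 1\<^sub>T d)"
 shows "\<exists>u\<in>\<Delta>. dg u \<odot> m = dg u \<odot> n"
proof -
 \<comment> \<open>A representative of the fraction is chosen; the next claim shows that the value
   does not depend on it.\<close>
 define f where "f m q = (let p = SOME p. p \<in> q in MT.mfrac (dg (fst p) \<odot> m) (snd p))" for m q
 have f: "f m (fr a d) = MT.mfrac (dg a \<odot> m) d" if m: "m \<in> carrier M" and ad: "a \<in> carrier T" "d \<in> \<Delta>" for m a d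
 proof -
  let ?p = "SOME p. p \<in> fr a d"
  have "(a, d) \<in> fr a d" using ad TL.\<Delta>_one by (auto simp: fraction_def)
  hence "?p \<in> fr a d" by (rule someI)
  then obtain a' d' where p: "?p = (a', d')" "(a', d') \<in> fr a d" by (metis prod.exhaust)
  then obtain u where u: "u \<in> \<Delta>" "u *\<^sub>T (a *\<^sub>T d') = u *\<^sub>T (a' *\<^sub>T d)" "a' \<in> carrier T" "d' \<in> \<Delta>"
   by (auto simp: fraction_def)
  have "u \<odot>\<^bsub>MT\<^esub> (d' \<odot>\<^bsub>MT\<^esub> (a \<odot>\<^bsub>MT\<^esub> m)) = (u *\<^sub>T (a *\<^sub>T d')) \<odot>\<^bsub>MT\<^esub> m"
   using u ad m by (simp add: T.m_ac flip: MT.smult_assoc1 del: MT_simps(4))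
  also have "\<dots> = u \<odot>\<^bsub>MT\<^esub> (d \<odot>\<^bsub>MT\<^esub> (a' \<odot>\<^bsub>MT\<^esub> m))"
   unfolding u(2) using u ad m by (simp add: T.m_ac flip: MT.smult_assoc1 del: MT_simps(4))
  finally have "(a' \<odot>\<^bsub>MT\<^esub> m, d') \<in> MT.mfrac (a \<odot>\<^bsub>MT\<^esub> m) d" unfolding MT.mfrac_def using u m by auto
  hence "MT.mfrac (a' \<odot>\<^bsub>MT\<^esub> m) d' = MT.mfrac (a \<odot>\<^bsub>MT\<^esub> m) d" using m ad by (intro MT.mfrac_mem) auto
  thus ?thesis unfolding f_def Let_def p(1) by simp
 qed
 have cl: "f m q \<in> carrier MT.LG" if "m \<in> carrier MT" "q \<in> carrier TG" for m q
  using that f MT.mfrac_LG by (auto simp: TG_simps)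
 obtain \<psi> where \<psi>: "\<psi> \<in> hom GG.G MT.LG" "\<And>m q. m \<in> carrier MT ==> q \<in> carrier TG ==> \<psi> (te m q) = f m q"
 proof (rule GG.tensor_universal[OF MT.comm_group_LG, of f])
  fix m m' q assume mq: "m \<in> carrier MT" "m' \<in> carrier MT" "q \<in> carrier TG"
  then obtain a d where ad: "a \<in> carrier T" "d \<in> \<Delta>" "q = fr a d" by (auto simp: TG_simps)
  have "MT.mfrac (a \<odot>\<^bsub>MT\<^esub> (m \<oplus>\<^bsub>MT\<^esub> m')) d = MT.mfrac (d \<odot>\<^bsub>MT\<^esub> (a \<odot>\<^bsub>MT\<^esub> m) \<oplus>\<^bsub>MT\<^esub> d \<odot>\<^bsub>MT\<^esub> (a \<odot>\<^bsub>MT\<^esub> m')) (d *\<^sub>T d)"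
   using ad mq TL.\<Delta>_mult by (intro MT.mfrac_eqI) (auto simp: MT.smult_r_distr T.m_ac simp flip: MT.smult_assoc1 simp del: MT_simps)
  thus "f (m \<oplus>\<^bsub>MT\<^esub> m') q = f m q \<otimes>\<^bsub>MT.LG\<^esub> f m' q"
   using ad mq f MT.madd_mfrac by (simp add: MT.LG_simps)
 next
  fix m q q' assume mq: "m \<in> carrier MT" "q \<in> carrier TG" "q' \<in> carrier TG"
  then obtain a d b e where ad: "a \<in> carrier T" "d \<in> \<Delta>" "q = fr a d" "b \<in> carrier T" "e \<in> \<Delta>" "q' = fr b e" by (auto simp: TG_simps)
  have "(a *\<^sub>T e +\<^sub>T b *\<^sub>T d) \<odot>\<^bsub>MT\<^esub> m = e \<odot>\<^bsub>MT\<^esub> (a \<odot>\<^bsub>MT\<^esub> m) \<oplus>\<^bsub>MT\<^esub> d \<odot>\<^bsub>MT\<^esub> (b \<odot>\<^bsub>MT\<^esub> m)"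
   using ad mq by (simp add: MT.smult_l_distr T.m_ac flip: MT.smult_assoc1 del: MT_simps)
  thus "f m (q \<oplus>\<^bsub>TG\<^esub> q') = f m q \<otimes>\<^bsub>MT.LG\<^esub> f m q'"
   using ad mq f MT.madd_mfrac TL.\<Delta>_mult by (simp add: MT.LG_simps TG_add)
 next
  fix t m q assume mq: "t \<in> carrier T" "m \<in> carrier MT" "q \<in> carrier TG"
  then obtain a d where ad: "a \<in> carrier T" "d \<in> \<Delta>" "q = fr a d" by (auto simp: TG_simps)
  have "a \<odot>\<^bsub>MT\<^esub> (t \<odot>\<^bsub>MT\<^esub> m) = (t *\<^sub>T a) \<odot>\<^bsub>MT\<^esub> m" using ad mq by (simp add: T.m_ac flip: MT.smult_assoc1 del: MT_simps)
  thus "f (t \<odot>\<^bsub>MT\<^esub> m) q = f m (t \<odot>\<^bsub>TG\<^esub> q)" using ad mq f by (simp add: TG_smult)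
 qed (use cl in auto)
 have "MT.mfrac m d = MT.mfrac n d"
  using \<psi>(2)[of m "fr 1\<^sub>T d"] \<psi>(2)[of n "fr 1\<^sub>T d"] eq f[of m "1\<^sub>T" d] f[of n "1\<^sub>T" d] m d by (simp add: dg_ops)
 hence "(n, d) \<in> MT.mfrac m d" using MT.mfrac_self[of n d] m d by simp
 then obtain u where "u \<in> \<Delta>" "u \<odot>\<^bsub>MT\<^esub> (d \<odot>\<^bsub>MT\<^esub> m) = u \<odot>\<^bsub>MT\<^esub> (d \<odot>\<^bsub>MT\<^esub> n)" by (auto simp: MT.mfrac_def)
 hence "dg (u *\<^sub>T d) \<odot> m = dg (u *\<^sub>T d) \<odot> n" "u *\<^sub>T d \<in> \<Delta>"
  using m d TL.\<Delta>_mult by (auto simp: dg_ops M.smult_assoc1)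
 thus ?thesis by blast
qed

lemma act_map: "z \<in> Z ==> tens_map T MT TG MT TG (\<lambda>m. z \<odot> m) (\<lambda>q. q)"
 by unfold_locales (auto simp: M.smult_r_distr ZA.m_comm simp flip: M.smult_assoc1)

lemma gen_act_te: "z \<in> Z ==> m \<in> carrier M ==> q \<in> carrier TG ==> gen_act D M z (te m q) = te (z \<odot> m) q"
 unfolding gen_act_def gen_map_def using tens_map.tm_te[OF act_map] by simp

lemma gen_act_hom: "z \<in> Z ==> gen_act D M z \<in> hom GG.G GG.G"
 unfolding gen_act_def gen_map_def using tens_map.tm_hom[OF act_map] .

lemma finprod_te:
 assumes "m \<in> carrier M" "finite A" "A \<subseteq> orbs"
 shows "finprod GG.G (\<lambda>y. te (un y \<odot> m) (fr 1\<^sub>T \<delta>)) A = te (finsum ZA un A \<odot> m) (fr 1\<^sub>T \<delta>)"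
 using assms(2,3)
proof (induction A rule: finite_induct)
 case empty
 show ?case using assms(1) \<delta>_\<Delta> GG.te_zero(1)[of "fr 1\<^sub>T \<delta>"] by (simp add: M.smult_l_null)
next
 case (insert y A)
 have un: "finsum ZA un A \<in> Z" "un y \<in> Z" using insert by (auto intro!: ZA.finsum_closed simp: subset_iff)
 have "finprod GG.G (\<lambda>y. te (un y \<odot> m) (fr 1\<^sub>T \<delta>)) (insert y A) =
   te (un y \<odot> m) (fr 1\<^sub>T \<delta>) \<otimes>\<^bsub>GG.G\<^esub> finprod GG.G (\<lambda>y. te (un y \<odot> m) (fr 1\<^sub>T \<delta>)) A"
  using insert assms(1) \<delta>_\<Delta> by (intro GG.G.finprod_insert) (auto simp: subset_iff)
 also have "\<dots> = te (un y \<odot> m) (fr 1\<^sub>T \<delta>) \<otimes>\<^bsub>GG.G\<^esub> te (finsum ZA un A \<odot> m) (fr 1\<^sub>T \<delta>)"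
  using insert by simp
 also have "\<dots> = te (un y \<odot> m \<oplus>\<^bsub>MT\<^esub> finsum ZA un A \<odot> m) (fr 1\<^sub>T \<delta>)"
  using un assms(1) \<delta>_\<Delta> by (intro GG.te_add_left[symmetric]) auto
 also have "un y \<odot> m \<oplus>\<^bsub>MT\<^esub> finsum ZA un A \<odot> m = finsum ZA un (insert y A) \<odot> m"
  using insert un assms(1) by (subst ZA.finsum_insert) (auto simp: M.smult_l_distr subset_iff)
 finally show ?case .
qed

lemma hom_T:
 assumes N: "is_zmodule D N" and f: "f \<in> zhom D M N"
 shows "f \<in> carrier M \<rightarrow> carrier N" "m \<in> carrier M ==> n \<in> carrier M ==> f (m \<oplus> n) = f m \<oplus>\<^bsub>N\<^esub> f n"
  "z \<in> Z ==> m \<in> carrier M ==> f (z \<odot> m) = z \<odot>\<^bsub>N\<^esub> f m"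
 using f by (auto simp: zhom_def module_hom_def)

end

section \<open>Torsion free modules and their stalks\<close>

locale tf_zmod = zmod D s M for D :: "('v::euclidean_space, 'k, 't) base_data" and s and M :: "('v, 't, 'm) zmodule" (structure) +
 assumes tf: "root_torsion_free D M"
begin

lemma cT_inj: "\<beta> \<in> Rp ==> m \<in> carrier M ==> dg (cT \<beta>) \<odot> m = \<zero> ==> m = \<zero>"
 using tf Rp_subset inj_onD[of "\<lambda>m. dg (cT \<beta>) \<odot> m" "carrier M" m "\<zero>"]
 unfolding root_torsion_free_def by (simp add: subset_iff M.smult_r_null)

lemma \<Delta>_kernel: assumes "d \<in> \<Delta>" shows "m \<in> carrier M ==> dg d \<odot> m = \<zero> ==> m = \<zero>"
 using assms
proof (induction d arbitrary: m rule: \<Delta>_induct[consumes 1, case_names one mult])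
 case (mult \<beta> t)
 have R: "\<beta> \<in> R" using mult(1) Rp_subset by auto
 have "dg (cT \<beta>) \<odot> (dg t \<odot> m) = \<zero>" using mult(2,4,5) R by (simp add: dg_ops M.smult_assoc1)
 hence "dg t \<odot> m = \<zero>" using cT_inj[OF mult(1), of "dg t \<odot> m"] mult(2,4) by simp
 thus ?case using mult(3)[OF mult(4)] by simp
next
 case one
 thus ?case by (simp add: dg_ops)
qed

lemma \<Delta>_inj:
 assumes "d \<in> \<Delta>" "m \<in> carrier M" "n \<in> carrier M" "dg d \<odot> m = dg d \<odot> n" shows "m = n"
proof -
 have "dg d \<odot> (m \<ominus> n) = \<zero>" using assms by (simp add: M.minus_eq M.smult_r_distr M.smult_r_minus M.r_neg)
 hence "m \<ominus> n = \<zero>" using \<Delta>_kernel assms by simp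
 thus ?thesis using assms M.minus_eq_zero_iff by simp
qed

lemma te_inj:
 assumes "m \<in> carrier M" "n \<in> carrier M" "d \<in> \<Delta>" shows "te m (fr 1\<^sub>T d) = te n (fr 1\<^sub>T d) \<longleftrightarrow> m = n"
 using te_kernel[OF assms] \<Delta>_inj assms by blast

text \<open>The \<open>un x\<close> add up to \<delta>, which acts injectively.\<close>

lemma un_all_zero: assumes "m \<in> carrier M" "\<And>x. x \<in> orbs ==> un x \<odot> m = \<zero>" shows "m = \<zero>"
proof -
 have "finsum ZA un A \<odot> m = \<zero>" if "finite A" "A \<subseteq> orbs" for A
  using that
 proof (induction A rule: finite_induct)
  case (insert y A)
  have "finsum ZA un A \<in> Z" "un y \<in> Z" using insert by (auto intro!: ZA.finsum_closed simp: subset_iff)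
  thus ?case using insert assms by (subst ZA.finsum_insert) (auto simp: M.smult_l_distr subset_iff)
 qed (use assms in \<open>simp add: M.smult_l_null\<close>)
 hence "dg \<delta> \<odot> m = \<zero>" using finite_orbits by (simp flip: un_sum)
 thus ?thesis using \<Delta>_kernel[OF \<delta>_\<Delta>] assms by blast
qed

lemma gen_act_\<delta>_inj:
 assumes X: "X \<in> carrier GG.G" and Y: "Y \<in> carrier GG.G" and eq: "gen_act D M (dg \<delta>) X = gen_act D M (dg \<delta>) Y" shows "X = Y"
proof -
 obtain m d n e where *: "m \<in> carrier M" "d \<in> \<Delta>" "X = te m (fr 1\<^sub>T d)" "n \<in> carrier M" "e \<in> \<Delta>" "Y = te n (fr 1\<^sub>T e)"
  using te_normal X Y by metis
 have X': "X = te (dg e \<odot> m) (fr 1\<^sub>T (d *\<^sub>T e))" using te_expand[of m d e] *(1-3,5) by simp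
 have Y': "Y = te (dg d \<odot> n) (fr 1\<^sub>T (d *\<^sub>T e))" using te_expand[of n e d] *(2,4-6) by (simp add: T.m_comm)
 have de: "d *\<^sub>T e \<in> \<Delta>" using * TL.\<Delta>_mult by simp
 have "te (dg \<delta> \<odot> (dg e \<odot> m)) (fr 1\<^sub>T (d *\<^sub>T e)) = te (dg \<delta> \<odot> (dg d \<odot> n)) (fr 1\<^sub>T (d *\<^sub>T e))"
  using eq[unfolded X' Y'] *(1,2,4,5) de by (simp add: gen_act_te)
 hence "dg \<delta> \<odot> (dg e \<odot> m) = dg \<delta> \<odot> (dg d \<odot> n)" using *(1,2,4,5) de by (simp add: te_inj)
 hence "dg e \<odot> m = dg d \<odot> n" using *(1,2,4,5) \<Delta>_inj[OF \<delta>_\<Delta>, of "dg e \<odot> m" "dg d \<odot> n"] by simp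
 thus ?thesis unfolding X' Y' by simp
qed

lemma summand_te:
 assumes "x \<in> orbs" "m \<in> carrier M" shows "te (un x \<odot> m) (fr 1\<^sub>T \<delta>) \<in> gen_summand D M x"
proof -
 have "z \<odot> (un x \<odot> m) = dg (z x) \<odot> (un x \<odot> m)" if "z \<in> Z" for z
  using un_mult[OF that assms(1)] assms that by (simp flip: M.smult_assoc1)
 thus ?thesis unfolding gen_summand_def GG_eq using assms \<delta>_\<Delta> by (simp add: gen_act_te)
qed

text \<open>Up to the factor \<delta>, \<open>un x\<close> acts as the projection to the summand of
  \<open>x\<close>. This yields the uniqueness of the decomposition chosen in
  \<open>gen_proj\<close>.\<close>

lemma summand_act:
 assumes c: "c \<in> (\<Pi>\<^sub>E y\<in>orbs. gen_summand D M y)" and x: "x \<in> orbs" and A: "finite A" "A \<subseteq> orbs"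
 shows "gen_act D M (un x) (finprod GG.G c A) = (if x \<in> A then gen_act D M (dg \<delta>) (c x) else \<one>\<^bsub>GG.G\<^esub>)"
 using A
proof (induction A rule: finite_induct)
 case empty
 show ?case using hom_one[OF gen_act_hom[OF un_Z[OF x]]] GG.G.group_axioms by simp
next
 case (insert y A)
 have cG: "c y \<in> carrier GG.G" if "y \<in> orbs" for y using c that by (auto simp: gen_summand_def GG_eq PiE_iff)
 have Z0: "gen_act D M (dg 0\<^sub>T) X = \<one>\<^bsub>GG.G\<^esub>" if "X \<in> carrier GG.G" for X
 proof -
  obtain m d where "m \<in> carrier M" "d \<in> \<Delta>" "X = te m (fr 1\<^sub>T d)" using te_normal \<open>X \<in> carrier GG.G\<close> by blast
  thus ?thesis using GG.te_zero(1)[of "fr 1\<^sub>T d"] by (simp add: gen_act_te dg_ops M.smult_l_null)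
 qed
 have yx: "gen_act D M (un x) (c y) = gen_act D M (dg (un x y)) (c y)"
  using c insert(4) un_Z[OF x] by (auto simp: gen_summand_def PiE_iff)
 have "finprod GG.G c (insert y A) = c y \<otimes>\<^bsub>GG.G\<^esub> finprod GG.G c A"
  using insert cG by (intro GG.G.finprod_insert) (auto simp: subset_iff)
 hence "gen_act D M (un x) (finprod GG.G c (insert y A)) =
   gen_act D M (un x) (c y) \<otimes>\<^bsub>GG.G\<^esub> gen_act D M (un x) (finprod GG.G c A)"
  using insert cG by (simp add: hom_mult[OF gen_act_hom[OF un_Z[OF x]]] GG.G.finprod_closed subset_iff Pi_def)
 also have "\<dots> = gen_act D M (dg (un x y)) (c y) \<otimes>\<^bsub>GG.G\<^esub> (if x \<in> A then gen_act D M (dg \<delta>) (c x) else \<one>\<^bsub>GG.G\<^esub>)"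
  using insert yx by simp
 also have "\<dots> = (if x \<in> insert y A then gen_act D M (dg \<delta>) (c x) else \<one>\<^bsub>GG.G\<^esub>)"
 proof -
  have g: "gen_act D M (dg \<delta>) (c x) \<in> carrier GG.G"
   using gen_act_hom[of "dg \<delta>"] cG[OF x] by (auto simp: hom_def)
  show ?thesis using insert x g Z0[OF cG[of y]] by (auto simp: un_def)
 qed
 finally show ?case .
qed

text \<open>Replaces the definite description by a formula: the tensors of the \<open>un y\<close>
  multiples of \<open>m\<close> with denominator \<delta> lie in the right summands and multiply to
  the tensor of \<open>m\<close>, and the decomposition is unique.\<close>

lemma to_stalk_te:
 assumes x: "x \<in> orbs" and m: "m \<in> carrier M" shows "to_stalk D M x m = te (un x \<odot> m) (fr 1\<^sub>T \<delta>)"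
proof -
 define c0 where "c0 = (\<lambda>y\<in>orbs. te (un y \<odot> m) (fr 1\<^sub>T \<delta>))"
 have c0: "c0 \<in> (\<Pi>\<^sub>E y\<in>orbs. gen_summand D M y)" unfolding c0_def using summand_te m by auto
 have "finprod GG.G c0 orbs = finprod GG.G (\<lambda>y. te (un y \<odot> m) (fr 1\<^sub>T \<delta>)) orbs"
  unfolding c0_def using m \<delta>_\<Delta> by (intro GG.G.finprod_cong') auto
 also have "\<dots> = te (dg \<delta> \<odot> m) (fr 1\<^sub>T \<delta>)" using finprod_te[OF m finite_orbits] by (simp add: un_sum)
 also have "\<dots> = te m (fr \<delta> \<delta>)" using te_num[OF m _ \<delta>_\<Delta>] by simp
 also have "fr \<delta> \<delta> = \<one>\<^bsub>TG\<^esub>" unfolding TG_simps using \<delta>_\<Delta> TL.\<Delta>_one by (intro fr_eqI) auto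
 finally have p0: "finprod GG.G c0 orbs = te m \<one>\<^bsub>TG\<^esub>" .
 have "(THE c. c \<in> (\<Pi>\<^sub>E y\<in>orbs. gen_summand D M y) \<and> finprod GG.G c orbs = te m \<one>\<^bsub>TG\<^esub>) = c0"
 proof (rule the_equality)
  show "c0 \<in> (\<Pi>\<^sub>E y\<in>orbs. gen_summand D M y) \<and> finprod GG.G c0 orbs = te m \<one>\<^bsub>TG\<^esub>" using c0 p0 by blast
  fix c assume c: "c \<in> (\<Pi>\<^sub>E y\<in>orbs. gen_summand D M y) \<and> finprod GG.G c orbs = te m \<one>\<^bsub>TG\<^esub>"
  show "c = c0"
  proof (rule PiE_ext[of _ orbs "gen_summand D M"])
   fix y assume y: "y \<in> orbs"
   have "gen_act D M (dg \<delta>) (c y) = gen_act D M (dg \<delta>) (c0 y)"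
    using summand_act[OF _ y finite_orbits subset_refl] c c0 p0 y by metis
   moreover have "c y \<in> carrier GG.G" "c0 y \<in> carrier GG.G"
    using c c0 y by (auto simp: gen_summand_def GG_eq PiE_iff)
   ultimately show "c y = c0 y" by (rule gen_act_\<delta>_inj[rotated 2])
  qed (use c c0 in auto)
 qed
 thus ?thesis using x unfolding to_stalk_def gen_proj_def GG_eq by (simp add: c0_def)
qed

lemma stalk_eq_iff:
 assumes "x \<in> orbs" "m \<in> carrier M" "n \<in> carrier M"
 shows "to_stalk D M x m = to_stalk D M x n \<longleftrightarrow> un x \<odot> m = un x \<odot> n"
 using assms \<delta>_\<Delta> by (simp add: to_stalk_te te_inj)

lemma to_stalk_add:
 assumes "x \<in> orbs" "m \<in> carrier M" "n \<in> carrier M"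
 shows "to_stalk D M x (m \<oplus> n) = to_stalk D M x m \<otimes>\<^bsub>gen_group D M\<^esub> to_stalk D M x n"
 using assms \<delta>_\<Delta> GG.te_add_left[of "un x \<odot> m" "un x \<odot> n" "fr 1\<^sub>T \<delta>"]
 by (simp add: to_stalk_te M.smult_r_distr GG_eq)

lemma to_stalk_zero: "x \<in> orbs ==> to_stalk D M x \<zero> = \<one>\<^bsub>gen_group D M\<^esub>"
 using \<delta>_\<Delta> GG.te_zero(1)[of "fr 1\<^sub>T \<delta>"] by (simp add: to_stalk_te M.smult_r_null GG_eq)

lemma to_stalk_smult:
 assumes "x \<in> orbs" "m \<in> carrier M" "z \<in> Z"
 shows "to_stalk D M x (z \<odot> m) = gen_act D M z (to_stalk D M x m)"
 using assms \<delta>_\<Delta> by (simp add: to_stalk_te gen_act_te ZA.m_comm flip: M.smult_assoc1)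

end

text \<open>By \<open>to_stalk_te\<close> both sides are the tensor of \<open>un x\<close> applied
  to \<open>f m\<close>, with denominator \<delta>.\<close>

lemma (in T_base) gen_map_stalk:
 assumes M: "tf_zmod D s M" and N: "tf_zmod D s N" and f: "f \<in> zhom D M N" and x: "x \<in> orbs" and m: "m \<in> carrier M"
 shows "gen_map D N f (to_stalk D M x m) = to_stalk D N x (f m)"
proof -
 interpret M: tf_zmod D s M by (rule M)
 interpret N: tf_zmod D s N by (rule N)
 note fT = M.hom_T[OF N.zm f]
 have "tens_map T M.MT TG N.MT TG f (\<lambda>q. q)"
  by unfold_locales (use fT in auto)
 thus ?thesis unfolding gen_map_def
  using tens_map.tm_te[of T M.MT TG N.MT TG f "\<lambda>q. q" "un x \<odot>\<^bsub>M\<^esub> m" "fr 1\<^sub>T \<delta>"] fT x m \<delta>_\<Delta>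
  by (auto simp: M.to_stalk_te N.to_stalk_te Pi_iff)
qed

section \<open>Gradings\<close>

locale add_map = A: abelian_group A + B: abelian_group B
 for A :: "('a, 'x) ring_scheme" and B :: "('b, 'y) ring_scheme" +
 fixes f :: "'a \<Rightarrow> 'b"
 assumes closed [simp]: "a \<in> carrier A ==> f a \<in> carrier B"
  and add: "a \<in> carrier A ==> b \<in> carrier A ==> f (a \<oplus>\<^bsub>A\<^esub> b) = f a \<oplus>\<^bsub>B\<^esub> f b"
begin

lemma zero [simp]: "f \<zero>\<^bsub>A\<^esub> = \<zero>\<^bsub>B\<^esub>"
proof -
 have "f \<zero>\<^bsub>A\<^esub> \<oplus>\<^bsub>B\<^esub> f \<zero>\<^bsub>A\<^esub> = f \<zero>\<^bsub>A\<^esub>" using add[of "\<zero>\<^bsub>A\<^esub>" "\<zero>\<^bsub>A\<^esub>"] by simp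
 thus ?thesis using B.add.l_cancel_one[of "f \<zero>\<^bsub>A\<^esub>" "f \<zero>\<^bsub>A\<^esub>"] by simp
qed

lemma minus: assumes "a \<in> carrier A" shows "f (\<ominus>\<^bsub>A\<^esub> a) = \<ominus>\<^bsub>B\<^esub> f a"
proof -
 have "f (\<ominus>\<^bsub>A\<^esub> a) \<oplus>\<^bsub>B\<^esub> f a = \<zero>\<^bsub>B\<^esub>" using add[of "\<ominus>\<^bsub>A\<^esub> a" a] assms by (simp add: A.l_neg)
 thus ?thesis using assms by (intro B.minus_equality[symmetric]) auto
qed

lemma diff: "a \<in> carrier A ==> b \<in> carrier A ==> f (a \<ominus>\<^bsub>A\<^esub> b) = f a \<ominus>\<^bsub>B\<^esub> f b"
 by (simp add: A.minus_eq B.minus_eq add minus)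

lemma diff_zero: "a \<in> carrier A ==> b \<in> carrier A ==> f (a \<ominus>\<^bsub>A\<^esub> b) = \<zero>\<^bsub>B\<^esub> \<longleftrightarrow> f a = f b"
 by (simp add: diff B.minus_eq_zero_iff)

lemma finsum: assumes "c \<in> I \<rightarrow> carrier A" shows "f (finsum A c I) = finsum B (\<lambda>i. f (c i)) I"
 using assms
proof (induction I rule: infinite_finite_induct)
 case (insert i I)
 hence "c i \<in> carrier A" "finsum A c I \<in> carrier A" by (auto intro!: A.finsum_closed)
 thus ?case using insert by (simp add: A.finsum_insert B.finsum_insert add Pi_iff)
qed auto

lemma inj_onI: assumes "\<And>a. a \<in> carrier A ==> f a = \<zero>\<^bsub>B\<^esub> ==> a = \<zero>\<^bsub>A\<^esub>" shows "inj_on f (carrier A)"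
proof (rule Fun.inj_onI)
 fix a b assume ab: "a \<in> carrier A" "b \<in> carrier A" "f a = f b"
 hence "f (a \<ominus>\<^bsub>A\<^esub> b) = \<zero>\<^bsub>B\<^esub>" by (simp add: diff_zero)
 hence "a \<ominus>\<^bsub>A\<^esub> b = \<zero>\<^bsub>A\<^esub>" using assms[of "a \<ominus>\<^bsub>A\<^esub> b"] ab by simp
 thus "a = b" using ab by (simp add: A.minus_eq_zero_iff)
qed

end

context
 fixes M :: "('a, 'x) ring_scheme" (structure)
 assumes M: "abelian_group M"
begin

interpretation abelian_group M by (rule M)

lemma gfinprod_add_monoid:
 assumes "finite A" "{n. c n \<noteq> \<zero>} \<subseteq> A" "\<And>n. c n \<in> carrier M"
 shows "gfinprod (add_monoid M) c UNIV = finsum M c A"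
proof -
 have "finite {n. c n \<noteq> \<zero>}" using assms finite_subset by blast
 hence "gfinprod (add_monoid M) c UNIV = finprod (add_monoid M) c {n. c n \<noteq> \<zero>}"
  by (simp add: gfinprod_def)
 also have "\<dots> = finprod (add_monoid M) c A"
  by (rule comm_monoid.finprod_mono_neutral_cong_left[OF a_comm_monoid]) (use assms in auto)
 finally show ?thesis by (simp add: finsum_def)
qed

text \<open>Replaces unique existence of families indexed by all integers by two conditions on
  finite sums, decomposability and independence.\<close>

lemma gradingI:
 assumes sub: "\<And>n. subgroup (h n) (add_monoid M)"
  and ex: "\<And>m. m \<in> carrier M ==> \<exists>c A. finite A \<and> (\<forall>n. c n \<in> h n) \<and> m = finsum M c A"
  and un: "\<And>c A n. finite A ==> (\<And>n. c n \<in> h n) ==> finsum M c A = \<zero> ==> n \<in> A ==> c n = \<zero>"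
 shows "grading M h"
 unfolding grading_def
proof (intro conjI allI ballI sub)
 have hM: "c \<in> carrier M" if "c \<in> h n" for c n using subgroup.mem_carrier[OF sub that] by simp
 have z: "\<zero> \<in> h n" for n using subgroup.one_closed[OF sub, of n] by simp
 have mi: "a \<ominus> b \<in> h n" if "a \<in> h n" "b \<in> h n" for a b n
  using subgroup.m_closed[OF sub that(1) subgroup.m_inv_closed[OF sub that(2)]]
  by (simp add: minus_eq a_inv_def)
 fix m assume m: "m \<in> carrier M"
 obtain c A where c: "finite A" "\<And>n. c n \<in> h n" "m = finsum M c A" using ex[OF m] by blast
 \<comment> \<open>Outside \<open>A\<close> the family may be nonzero; cutting it off makes the
   support finite.\<close>
 define c' where "c' n = (if n \<in> A then c n else \<zero>)" for n
 have c'h: "c' n \<in> h n" for n using c z by (simp add: c'_def)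
 have supp: "{n. c' n \<noteq> \<zero>} \<subseteq> A" by (auto simp: c'_def)
 have cM: "c n \<in> carrier M" for n using c(2) hM by blast
 hence "finsum M c A = finsum M c' A" by (intro finsum_cong') (auto simp: c'_def)
 hence mc': "m = gfinprod (add_monoid M) c' UNIV"
  using gfinprod_add_monoid[OF c(1) supp] c'h hM c(3) by metis
 show "\<exists>!c. (\<forall>n. c n \<in> h n) \<and> finite {n. c n \<noteq> \<zero>} \<and> m = gfinprod (add_monoid M) c UNIV"
 proof (rule ex1I[of _ c'], intro conjI allI c'h mc')
  show "finite {n. c' n \<noteq> \<zero>}" using supp c(1) finite_subset by blast
  fix d assume d: "(\<forall>n. d n \<in> h n) \<and> finite {n. d n \<noteq> \<zero>} \<and> m = gfinprod (add_monoid M) d UNIV"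
  define B where "B = A \<union> {n. d n \<noteq> \<zero>}"
  have B: "finite B" "{n. c' n \<noteq> \<zero>} \<subseteq> B" "{n. d n \<noteq> \<zero>} \<subseteq> B" using c(1) d supp by (auto simp: B_def)
  have dM: "d n \<in> carrier M" "c' n \<in> carrier M" for n using d c'h hM by blast+
  have s: "finsum M d B = m" "finsum M c' B = m"
   using gfinprod_add_monoid[OF B(1,3) dM(1)] gfinprod_add_monoid[OF B(1,2) dM(2)] d mc' by simp_all
  have "finsum M (\<lambda>n. d n \<ominus> c' n) B = finsum M d B \<oplus> finsum M (\<lambda>n. \<ominus> c' n) B"
   using dM unfolding minus_eq by (intro finsum_addf) auto
  moreover have "finsum M (\<lambda>n. \<ominus> c' n) B = \<ominus> finsum M c' B"
  proof -
   have "finsum M (\<lambda>n. \<ominus> c' n) B \<oplus> finsum M c' B = finsum M (\<lambda>n. \<ominus> c' n \<oplus> c' n) B"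
    using dM by (intro finsum_addf[symmetric]) auto
   also have "\<dots> = \<zero>" using dM by (simp add: l_neg)
   finally show ?thesis using dM by (intro minus_equality[symmetric]) auto
  qed
  ultimately have "finsum M (\<lambda>n. d n \<ominus> c' n) B = \<zero>" using s m by (simp add: r_neg)
  hence "d n \<ominus> c' n = \<zero>" if "n \<in> B" for n using un[OF B(1), of "\<lambda>n. d n \<ominus> c' n" n] mi d c'h that by simp
  hence "d n = c' n" if "n \<in> B" for n using that dM by (simp add: minus_eq_zero_iff)
  moreover have "d n = c' n" if "n \<notin> B" for n
  proof -
   have "d n = \<zero>" "c' n = \<zero>" using that B(2,3) by blast+
   thus ?thesis by simp
  qed
  ultimately show "d = c'" by blast
 qed
qed

lemma grading_carrier: "grading M h ==> a \<in> h n ==> a \<in> carrier M"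
 unfolding grading_def using subgroup.mem_carrier[of "h n" "add_monoid M" a] by simp

lemma grading_zero: "grading M h ==> \<zero> \<in> h n"
 unfolding grading_def using subgroup.one_closed[of "h n" "add_monoid M"] by simp

lemma grading_ex: assumes "grading M h" "m \<in> carrier M"
 obtains c A where "finite A" "\<And>n. c n \<in> h n" "m = finsum M c A"
proof -
 obtain c where c: "\<And>n. c n \<in> h n" "finite {n. c n \<noteq> \<zero>}" "m = gfinprod (add_monoid M) c UNIV"
  using assms unfolding grading_def by blast
 hence "m = finsum M c {n. c n \<noteq> \<zero>}"
  using gfinprod_add_monoid[OF c(2) subset_refl] grading_carrier[OF assms(1)] by metis
 with c(2,1) show ?thesis by (rule that)
qed

lemma grading_unique:
 assumes "grading M h" "finite A" "\<And>n. c n \<in> h n" "finsum M c A = \<zero>" "n \<in> A" shows "c n = \<zero>"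
proof -
 define c' where "c' n = (if n \<in> A then c n else \<zero>)" for n
 have c'h: "c' n \<in> h n" for n using assms(3) grading_zero[OF assms(1)] by (simp add: c'_def)
 have c'M: "c' n \<in> carrier M" for n using c'h grading_carrier[OF assms(1)] by blast
 have supp: "{n. c' n \<noteq> \<zero>} \<subseteq> A" by (auto simp: c'_def)
 have cM: "c n \<in> carrier M" for n using assms(3) grading_carrier[OF assms(1)] by blast
 hence "finsum M c A = finsum M c' A" by (intro finsum_cong') (auto simp: c'_def)
 hence 1: "\<zero> = gfinprod (add_monoid M) c' UNIV" using gfinprod_add_monoid[OF assms(2) supp c'M] assms(4) by simp
 have 2: "\<zero> = gfinprod (add_monoid M) (\<lambda>_. \<zero>) UNIV"
  by (subst gfinprod_add_monoid[of "{}"]) simp_all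
 have "\<exists>!c. (\<forall>n. c n \<in> h n) \<and> finite {n. c n \<noteq> \<zero>} \<and> \<zero> = gfinprod (add_monoid M) c UNIV"
  using assms(1) zero_closed unfolding grading_def by blast
 then obtain c0 where c0: "\<And>d. (\<forall>n. d n \<in> h n) \<and> finite {n. d n \<noteq> \<zero>} \<and> \<zero> = gfinprod (add_monoid M) d UNIV ==> d = c0"
  unfolding Ex1_def by blast
 have "c' = c0" by (rule c0) (use c'h 1 finite_subset[OF supp assms(2)] in blast)
 moreover have "(\<lambda>_. \<zero>) = c0" by (rule c0) (use grading_zero[OF assms(1)] 2 in simp)
 ultimately have "c' = (\<lambda>_. \<zero>)" by simp
 hence "c' n = \<zero>" by (rule fun_cong)
 thus ?thesis using assms(5) unfolding c'_def by simp
qed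

end

context add_map
begin

text \<open>The images of the components have distinct degrees, so they vanish separately. The shift
  \<open>d\<close> accommodates maps that involve multiplication by \<open>un x\<close>, which has
  the degree of \<delta>.\<close>

lemma grading_kernel:
 assumes h: "\<And>n a. a \<in> h n ==> a \<in> carrier A" and h': "grading B h'"
  and deg: "\<And>n a. a \<in> h n ==> f a \<in> h' (n + d)"
  and I: "finite I" "\<And>n. c n \<in> h n" "f (finsum A c I) = \<zero>\<^bsub>B\<^esub>" "n \<in> I"
 shows "f (c n) = \<zero>\<^bsub>B\<^esub>"
proof -
 have cA: "c k \<in> carrier A" for k using I(2) h by blast
 have "\<zero>\<^bsub>B\<^esub> = finsum B (\<lambda>n. f (c n)) I" using finsum[of c I] I(3) cA by auto
 also have "\<dots> = finsum B (\<lambda>k. f (c (k - d))) ((\<lambda>n. n + d) ` I)"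
  using cA by (subst B.add.finprod_reindex) (auto simp: inj_on_def)
 finally have "finsum B (\<lambda>k. f (c (k - d))) ((\<lambda>n. n + d) ` I) = \<zero>\<^bsub>B\<^esub>" ..
 moreover have "f (c (k - d)) \<in> h' k" for k using deg[OF I(2)[of "k - d"]] by simp
 ultimately have "f (c ((n + d) - d)) = \<zero>\<^bsub>B\<^esub>"
  using grading_unique[OF B.abelian_group_axioms h', of "(\<lambda>n. n + d) ` I" "\<lambda>k. f (c (k - d))" "n + d"] I(1,4)
  by blast
 thus ?thesis by simp
qed

lemma grading_image:
 assumes surj: "f ` carrier A = carrier B" and h: "grading A h"
  and ker: "\<And>c I n. finite I ==> (\<And>n. c n \<in> h n) ==> f (finsum A c I) = \<zero>\<^bsub>B\<^esub> ==> n \<in> I ==> f (c n) = \<zero>\<^bsub>B\<^esub>"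
 shows "grading B (\<lambda>n. f ` h n)"
proof (rule gradingI[OF B.abelian_group_axioms])
 note hA = grading_carrier[OF A.abelian_group_axioms h]
 fix n
 have sub: "subgroup (h n) (add_monoid A)" using h by (simp add: grading_def)
 show "subgroup (f ` h n) (add_monoid B)"
 proof (rule B.add.subgroupI)
  show "f ` h n \<subseteq> carrier B" using hA by auto
  show "f ` h n \<noteq> {}" using grading_zero[OF A.abelian_group_axioms h] by blast
  fix a assume "a \<in> f ` h n"
  then obtain b where b: "b \<in> h n" "a = f b" by blast
  have "\<ominus>\<^bsub>A\<^esub> b \<in> h n" using subgroup.m_inv_closed[OF sub b(1)] by (simp add: a_inv_def)
  hence "f (\<ominus>\<^bsub>A\<^esub> b) \<in> f ` h n" by blast
  thus "\<ominus>\<^bsub>B\<^esub> a \<in> f ` h n" using b hA minus by simp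
  fix a' assume "a' \<in> f ` h n"
  then obtain b' where b': "b' \<in> h n" "a' = f b'" by blast
  have "b \<oplus>\<^bsub>A\<^esub> b' \<in> h n" using subgroup.m_closed[OF sub b(1) b'(1)] by simp
  hence "f (b \<oplus>\<^bsub>A\<^esub> b') \<in> f ` h n" by blast
  moreover have "f (b \<oplus>\<^bsub>A\<^esub> b') = a \<oplus>\<^bsub>B\<^esub> a'" using b b' hA add by blast
  ultimately show "a \<oplus>\<^bsub>B\<^esub> a' \<in> f ` h n" by simp
 qed
next
 note hA = grading_carrier[OF A.abelian_group_axioms h]
 fix m assume "m \<in> carrier B"
 then obtain a where a: "a \<in> carrier A" "m = f a" using surj by blast
 obtain c I where c: "finite I" "\<And>n. c n \<in> h n" "a = finsum A c I"
  using grading_ex[OF A.abelian_group_axioms h a(1)] by blast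
 have cA: "c k \<in> carrier A" for k using c(2) hA by blast
 have "m = finsum B (\<lambda>i. f (c i)) I" unfolding a(2) c(3) by (rule finsum) (use cA in blast)
 moreover have "\<forall>n. f (c n) \<in> f ` h n" using c by blast
 ultimately show "\<exists>c I. finite I \<and> (\<forall>n. c n \<in> f ` h n) \<and> m = finsum B c I"
  using c(1) by (intro exI[of _ "\<lambda>n. f (c n)"] exI[of _ I]) simp
next
 note hA = grading_carrier[OF A.abelian_group_axioms h]
 fix c I n assume I: "finite I" "\<And>n. c n \<in> f ` h n" "finsum B c I = \<zero>\<^bsub>B\<^esub>" "n \<in> I"
 hence "\<forall>n. \<exists>b. b \<in> h n \<and> c n = f b" by blast
 then obtain b where b: "\<And>n. b n \<in> h n" "\<And>n. c n = f (b n)" by metis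
 have bA: "b k \<in> carrier A" for k using b(1) hA by blast
 have "f (finsum A b I) = finsum B c I" unfolding b(2) by (rule finsum) (use bA in blast)
 hence "f (finsum A b I) = \<zero>\<^bsub>B\<^esub>" using I(3) by simp
 thus "c n = \<zero>\<^bsub>B\<^esub>" using ker[OF I(1) b(1) _ I(4)] b(2) by simp
qed

text \<open>The component of degree \<open>n\<close> of any preimage works, since the other
  components land in other degrees. It is applied to a competing functor, whose grading is known a
  priori only to contain the image.\<close>

lemma homog_lift:
 assumes h: "grading A h" and h': "grading B h'" and deg: "\<And>n. f ` h n \<subseteq> h' n"
  and a: "a \<in> carrier A" "f a \<in> h' n"
 shows "\<exists>b\<in>h n. f b = f a"
proof -
 note hA = grading_carrier[OF A.abelian_group_axioms h]
 obtain c I where c: "finite I" "\<And>n. c n \<in> h n" "a = finsum A c I"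
  using grading_ex[OF A.abelian_group_axioms h a(1)] by blast
 define c' where "c' k = (if k \<in> I then c k else \<zero>\<^bsub>A\<^esub>)" for k
 have c'h: "c' k \<in> h k" for k using c grading_zero[OF A.abelian_group_axioms h] by (simp add: c'_def)
 have cA: "c k \<in> carrier A" "c' k \<in> carrier A" for k using c(2) c'h hA by blast+
 have "a = finsum A c' I" unfolding c(3) using cA by (intro A.finsum_cong') (auto simp: c'_def)
 also have "\<dots> = finsum A c' (insert n I)"
 proof (cases "n \<in> I")
  case False
  hence "c' n = \<zero>\<^bsub>A\<^esub>" by (simp add: c'_def)
  moreover have "finsum A c' (insert n I) = c' n \<oplus>\<^bsub>A\<^esub> finsum A c' I"
   using False c(1) c'h hA by (intro A.finsum_insert) blast+
  moreover have "finsum A c' I \<in> carrier A" using c'h hA by (intro A.finsum_closed) blast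
  ultimately show ?thesis by simp
 qed (simp add: insert_absorb)
 finally have a': "a = finsum A c' (insert n I)" .
 have c'A: "c' k \<in> carrier A" for k using c'h hA by blast
 have rest: "a = c' n \<oplus>\<^bsub>A\<^esub> finsum A c' (I - {n})"
  unfolding a' insert_Diff_single[symmetric, of n I] using c(1) c'A by (subst A.finsum_insert) auto
 have fr: "f (c' k) \<in> h' k" for k using c'h deg by blast
 note hB = grading_carrier[OF B.abelian_group_axioms h']
 have sub: "subgroup (h' n) (add_monoid B)" using h' by (simp add: grading_def)
 \<comment> \<open>A family of homogeneous elements with sum zero, obtained by moving
   \<open>f a\<close> into the component of degree \<open>n\<close>; independence then gives the
   claim.\<close>
 define e where "e k = (if k = n then f (c' n) \<ominus>\<^bsub>B\<^esub> f a else f (c' k))" for k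
 have eh: "e k \<in> h' k" for k
  using subgroup.m_closed[OF sub fr subgroup.m_inv_closed[OF sub a(2)]] fr
  by (simp add: e_def B.minus_eq a_inv_def)
 have fs: "finsum A c' (I - {n}) \<in> carrier A" using c'A by (intro A.finsum_closed) blast
 have "finsum B e (insert n (I - {n})) = e n \<oplus>\<^bsub>B\<^esub> finsum B e (I - {n})"
  using eh hB c(1) by (intro B.finsum_insert) blast+
 also have "finsum B e (I - {n}) = finsum B (\<lambda>k. f (c' k)) (I - {n})"
  using c'A by (intro B.finsum_cong') (auto simp: e_def)
 also have "\<dots> = f (finsum A c' (I - {n}))" using finsum[of c' "I - {n}"] c'A by simp
 also have "e n \<oplus>\<^bsub>B\<^esub> f (finsum A c' (I - {n})) = f (c' n \<oplus>\<^bsub>A\<^esub> finsum A c' (I - {n})) \<ominus>\<^bsub>B\<^esub> f a"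
  using fs c'A a by (simp add: e_def add B.minus_eq B.a_ac)
 also have "\<dots> = \<zero>\<^bsub>B\<^esub>" unfolding rest[symmetric] using a by (simp add: B.minus_eq B.r_neg)
 finally have "e n = \<zero>\<^bsub>B\<^esub>"
  using grading_unique[OF B.abelian_group_axioms h', of "insert n (I - {n})" e n] eh c(1) by simp
 hence "f (c' n) = f a" using c'A a by (simp add: e_def B.minus_eq_zero_iff)
 thus ?thesis using c'h by blast
qed

end

section \<open>Graded modules over the structure algebra\<close>

context T_base
begin

lemma is_zmoduleI:
 assumes "Module.module ZA M" "\<And>h. struct_grading D = Some h ==> grading M (homog M)"
  "\<And>h i j z m. struct_grading D = Some h ==> z \<in> h i ==> m \<in> homog M j ==> z \<odot>\<^bsub>M\<^esub> m \<in> homog M (i + j)"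
 shows "is_zmodule D M"
 using assms unfolding is_zmodule_def is_module_def by blast

text \<open>A module is determined by a surjection from another one, provided that the kernel is graded.\<close>

definition quotient_map where
 "quotient_map N C p \<longleftrightarrow> p ` carrier N = carrier C \<and> p \<zero>\<^bsub>N\<^esub> = \<zero>\<^bsub>C\<^esub> \<and>
   (\<forall>a\<in>carrier N. \<forall>b\<in>carrier N. p (a \<oplus>\<^bsub>N\<^esub> b) = p a \<oplus>\<^bsub>C\<^esub> p b) \<and>
   (\<forall>z\<in>Z. \<forall>a\<in>carrier N. p (z \<odot>\<^bsub>N\<^esub> a) = z \<odot>\<^bsub>C\<^esub> p a) \<and>
   (\<forall>h n. struct_grading D = Some h --> homog C n = p ` homog N n)"

lemma quotient_zmodule:
 assumes N: "is_zmodule D N" and p: "quotient_map N C p"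
  and ker: "\<And>h c I n. struct_grading D = Some h ==> finite I ==> (\<And>n. c n \<in> homog N n) ==>
   p (finsum N c I) = \<zero>\<^bsub>C\<^esub> ==> n \<in> I ==> p (c n) = \<zero>\<^bsub>C\<^esub>"
 shows "is_zmodule D C"
proof -
 interpret N: Module.module ZA N using N by (simp add: is_zmodule_def is_module_def)
 have surj: "carrier C = p ` carrier N" and z: "\<zero>\<^bsub>C\<^esub> = p \<zero>\<^bsub>N\<^esub>"
  and add: "\<And>a b. a \<in> carrier N ==> b \<in> carrier N ==> p a \<oplus>\<^bsub>C\<^esub> p b = p (a \<oplus>\<^bsub>N\<^esub> b)"
  and act: "\<And>z a. z \<in> Z ==> a \<in> carrier N ==> z \<odot>\<^bsub>C\<^esub> p a = p (z \<odot>\<^bsub>N\<^esub> a)"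
  using p unfolding quotient_map_def by auto
 have ab: "abelian_group C"
 proof (rule abelian_groupI)
  fix x assume x: "x \<in> carrier C"
  then obtain a where a: "a \<in> carrier N" "x = p a" using surj by auto
  have "p (\<ominus>\<^bsub>N\<^esub> a) \<oplus>\<^bsub>C\<^esub> x = \<zero>\<^bsub>C\<^esub>" "p (\<ominus>\<^bsub>N\<^esub> a) \<in> carrier C" using a surj by (simp_all add: add z N.l_neg)
  thus "\<exists>y\<in>carrier C. y \<oplus>\<^bsub>C\<^esub> x = \<zero>\<^bsub>C\<^esub>" by blast
 qed (auto simp: surj z add N.a_ac)
 have mod: "Module.module ZA C"
  by (rule moduleI) (auto simp: ab surj act add N.smult_l_distr N.smult_r_distr N.smult_assoc1 ZA.is_cring)
 interpret C: Module.module ZA C by (rule mod)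
 interpret p: add_map N C p by unfold_locales (auto simp: surj add)
 show ?thesis
 proof (rule is_zmoduleI[OF mod])
  fix h assume h: "struct_grading D = Some h"
  have hom: "homog C n = p ` homog N n" for n using p h unfolding quotient_map_def by simp
  have g: "grading N (homog N)" "\<And>i j z m. z \<in> h i ==> m \<in> homog N j ==> z \<odot>\<^bsub>N\<^esub> m \<in> homog N (i + j)"
   using N h by (simp_all add: is_zmodule_def is_module_def)
  have "homog C = (\<lambda>n. p ` homog N n)" using hom by blast
  moreover have "grading C (\<lambda>n. p ` homog N n)" by (rule p.grading_image[OF surj[symmetric] g(1)]) (rule ker[OF h])
  ultimately show "grading C (homog C)" by simp
  fix i j z m assume zm: "z \<in> h i" "m \<in> homog C j"
  then obtain a where a: "a \<in> homog N j" "m = p a" using hom by auto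
  have "z \<in> Z" using h zm by (auto simp: struct_grading_def)
  moreover have "a \<in> carrier N" using grading_carrier[OF N.abelian_group_axioms g(1) a(1)] .
  ultimately have "z \<odot>\<^bsub>C\<^esub> m = p (z \<odot>\<^bsub>N\<^esub> a)" using act a by simp
  thus "z \<odot>\<^bsub>C\<^esub> m \<in> homog C (i + j)" using g(2)[OF zm(1) a(1)] hom by simp
 qed
qed

lemma zhomD:
 assumes "f \<in> zhom D M N"
 shows "m \<in> carrier M ==> f m \<in> carrier N"
  "m \<in> carrier M ==> m' \<in> carrier M ==> f (m \<oplus>\<^bsub>M\<^esub> m') = f m \<oplus>\<^bsub>N\<^esub> f m'"
  "z \<in> Z ==> m \<in> carrier M ==> f (z \<odot>\<^bsub>M\<^esub> m) = z \<odot>\<^bsub>N\<^esub> f m"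
  "struct_grading D = Some h ==> m \<in> homog M n ==> f m \<in> homog N n"
  "f \<in> extensional (carrier M)"
 using assms unfolding zhom_def module_hom_def PiE_def by blast+

lemma zhomI:
 assumes "\<And>m. m \<in> carrier M ==> f m \<in> carrier N" "f \<in> extensional (carrier M)"
  "\<And>m n. m \<in> carrier M ==> n \<in> carrier M ==> f (m \<oplus>\<^bsub>M\<^esub> n) = f m \<oplus>\<^bsub>N\<^esub> f n"
  "\<And>z m. z \<in> Z ==> m \<in> carrier M ==> f (z \<odot>\<^bsub>M\<^esub> m) = z \<odot>\<^bsub>N\<^esub> f m"
  "\<And>h m n. struct_grading D = Some h ==> m \<in> homog M n ==> f m \<in> homog N n"
 shows "f \<in> zhom D M N"
 unfolding zhom_def module_hom_def PiE_def using assms by auto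

lemma zmod_intro: "is_zmodule D M ==> zmod D s M"
 by (intro zmod.intro T_base_axioms zmod_axioms.intro)

lemma tf_zmod_intro: "is_zmodule D M ==> root_torsion_free D M ==> tf_zmod D s M"
 by (intro tf_zmod.intro tf_zmod_axioms.intro zmod_intro)

lemma zmodule_module: "is_zmodule D M ==> Module.module ZA M"
 by (simp add: is_zmodule_def is_module_def)

lemma zhom_add_map: "is_zmodule D M ==> is_zmodule D N ==> f \<in> zhom D M N ==> add_map M N f"
 using zmodule_module[of M] zmodule_module[of N] zhomD(1,2)[of f M N]
 by (simp add: add_map_def add_map_axioms_def Module.module_def)

text \<open>The degree is that of \<delta>, twice the number of positive roots, hence the same for
  all orbits.\<close>

lemma un_homog:
 assumes "struct_grading D = Some h" "x \<in> orbs" shows "\<exists>d. \<forall>y\<in>orbs. un y \<in> h d"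
proof -
 obtain h0 where h0: "base_grading D = Some h0" "h = (\<lambda>n. {z \<in> Z. \<forall>x\<in>orbs. z x \<in> h0 n})"
  using assms by (auto simp: struct_grading_def)
 have gr: "graded_ring T h0" and cS0: "\<And>n. \<phi> ` sym_homog K E n \<subseteq> h0 n" using base_graded[OF h0(1)] by blast+
 have "finprod T cT A \<in> h0 (2 * int (card A))" if "finite A" "A \<subseteq> Rp" for A
  using that
 proof (induction A rule: finite_induct)
  case empty thus ?case using gr by (simp add: graded_ring_def)
 next
  case (insert a A)
  have "cT \<beta> \<in> carrier T" if "\<beta> \<in> insert a A" for \<beta> using that insert Rp_subset by auto
  hence "finprod T cT (insert a A) = cT a *\<^sub>T finprod T cT A" using insert by (intro T.finprod_insert) auto
  moreover have "cT a \<in> h0 2" using cS0[of 2] cS_homog[of a] insert Rp_subset unfolding cT_eq by blast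
  ultimately show ?case using insert gr by (simp add: graded_ring_def algebra_simps)
 qed
 hence "\<delta> \<in> h0 (2 * int (card Rp))" using finite_Rp by (simp add: \<delta>_prod)
 moreover have "0\<^sub>T \<in> h0 n" for n using gr grading_zero[OF T.abelian_group_axioms] by (simp add: graded_ring_def)
 ultimately have "un y \<in> h (2 * int (card Rp))" if "y \<in> orbs" for y using that unfolding h0(2) by (simp add: un_val)
 thus ?thesis by blast
qed

lemma cc_homog: assumes "struct_grading D = Some h" shows "cc \<in> h 2"
proof -
 obtain h0 where h0: "base_grading D = Some h0" "h = (\<lambda>n. {z \<in> Z. \<forall>x\<in>orbs. z x \<in> h0 n})"
  using assms by (auto simp: struct_grading_def)
 have cS0: "\<And>n. \<phi> ` sym_homog K E n \<subseteq> h0 n" using base_graded[OF h0(1)] by blast+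
 have "cT (croot x) \<in> h0 2" if "x \<in> orbs" for x using cS0[of 2] cS_homog croot_R[OF that] unfolding cT_eq by blast
 thus ?thesis using cc_Z unfolding h0(2) by (simp add: cc_def)
qed

lemma Z_homog:
 assumes "struct_grading D = Some h"
 shows "1\<^sub>Z \<in> h 0" "z \<in> h i ==> z \<in> Z" "z \<in> h i ==> w \<in> h j ==> z *\<^sub>Z w \<in> h (i + j)"
  "z \<in> h i ==> x \<in> orbs ==> dg (z x) \<in> h i"
  "z \<in> h i ==> w \<in> h i ==> z +\<^sub>Z w \<in> h i"
proof -
 obtain h0 where h0: "base_grading D = Some h0" "h = (\<lambda>n. {z \<in> Z. \<forall>x\<in>orbs. z x \<in> h0 n})"
  using assms by (auto simp: struct_grading_def)
 have gr: "graded_ring T h0" using base_graded[OF h0(1)] by blast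
 hence sub: "subgroup (h0 n) (add_monoid T)" for n by (simp add: graded_ring_def grading_def)
 show "1\<^sub>Z \<in> h 0" using gr ZA.one_closed by (simp add: h0(2) graded_ring_def ZA_simps)
 show z: "z \<in> h i ==> z \<in> Z" for i z by (simp add: h0(2))
 show "z \<in> h i ==> w \<in> h j ==> z *\<^sub>Z w \<in> h (i + j)"
  using gr ZA.m_closed[of z w] by (simp add: h0(2) graded_ring_def ZA_simps)
 show "z \<in> h i ==> x \<in> orbs ==> dg (z x) \<in> h i" by (simp add: h0(2) dg_val)
 show "z \<in> h i ==> w \<in> h i ==> z +\<^sub>Z w \<in> h i"
  using subgroup.m_closed[OF sub[of i]] ZA.a_closed[of z w] by (simp add: h0(2) ZA_simps)
qed

end

section \<open>The modules \<open>\<Z> \<otimes> M\<close> over the \<open>s\<close>-invariants\<close>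

lemma decomposable_add:
 assumes M: "abelian_group M" and sub: "\<And>n::int. subgroup (h n) (add_monoid M)"
  and x: "\<exists>c A. finite A \<and> (\<forall>n. c n \<in> h n) \<and> x = finsum M c A"
  and y: "\<exists>c A. finite A \<and> (\<forall>n. c n \<in> h n) \<and> y = finsum M c A"
 shows "\<exists>c A. finite A \<and> (\<forall>n. c n \<in> h n) \<and> x \<oplus>\<^bsub>M\<^esub> y = finsum M c A"
proof -
 interpret abelian_group M by (rule M)
 have hM: "c \<in> carrier M" if "c \<in> h n" for c n using subgroup.mem_carrier[OF sub that] by simp
 have z: "\<zero>\<^bsub>M\<^esub> \<in> h n" for n using subgroup.one_closed[OF sub, of n] by simp
 obtain c A d B where c: "finite A" "\<And>n. c n \<in> h n" "x = finsum M c A" and d: "finite B" "\<And>n. d n \<in> h n" "y = finsum M d B"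
  using x y by blast
 define c' where "c' n = (if n \<in> A then c n else \<zero>\<^bsub>M\<^esub>)" for n
 define d' where "d' n = (if n \<in> B then d n else \<zero>\<^bsub>M\<^esub>)" for n
 have h: "c' n \<in> h n" "d' n \<in> h n" for n using c d z by (simp_all add: c'_def d'_def)
 have M: "c n \<in> carrier M" "d n \<in> carrier M" "c' n \<in> carrier M" "d' n \<in> carrier M" for n using c d h hM by blast+
 have "x = finsum M c' (A \<union> B)" unfolding c(3)
  by (rule add.finprod_mono_neutral_cong_left) (use c d M in \<open>auto simp: c'_def\<close>)
 moreover have "y = finsum M d' (A \<union> B)" unfolding d(3)
  by (rule add.finprod_mono_neutral_cong_left) (use c d M in \<open>auto simp: d'_def\<close>)
 ultimately have "x \<oplus>\<^bsub>M\<^esub> y = finsum M (\<lambda>n. c' n \<oplus>\<^bsub>M\<^esub> d' n) (A \<union> B)"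
  using M by (simp add: finsum_addf Pi_def)
 moreover have "c' n \<oplus>\<^bsub>M\<^esub> d' n \<in> h n" for n using subgroup.m_closed[OF sub h] by simp
 ultimately show ?thesis using c(1) d(1) by (intro exI[of _ "\<lambda>n. c' n \<oplus>\<^bsub>M\<^esub> d' n"] exI[of _ "A \<union> B"]) simp
qed

lemma decomposable_homog:
 assumes M: "abelian_group M" and sub: "\<And>n::int. subgroup (h n) (add_monoid M)" and x: "x \<in> h k"
 shows "\<exists>c A. finite A \<and> (\<forall>n. c n \<in> h n) \<and> x = finsum M c A"
proof -
 interpret abelian_group M by (rule M)
 have z: "\<zero>\<^bsub>M\<^esub> \<in> h n" for n using subgroup.one_closed[OF sub, of n] by simp
 have "x \<in> carrier M" using subgroup.mem_carrier[OF sub x] by simp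
 hence "x = finsum M (\<lambda>n. if n = k then x else \<zero>\<^bsub>M\<^esub>) {k}" by (subst finsum_insert) auto
 thus ?thesis using x z by (intro exI[of _ "\<lambda>n. if n = k then x else \<zero>\<^bsub>M\<^esub>"] exI[of _ "{k}"]) simp
qed

lemma generate_image:
 assumes "group_hom G H f" "X \<subseteq> carrier G" "\<And>x. x \<in> X ==> f x \<in> K" "subgroup K H" "x \<in> generate G X"
 shows "f x \<in> K"
proof -
 interpret group_hom G H f by (rule assms(1))
 show ?thesis using assms(5)
 proof (induction rule: generate.induct)
  case one thus ?case using subgroup.one_closed[OF assms(4)] by simp
 next
  case (incl h) thus ?case by (rule assms(3))
 next
  case (inv h)
  hence "f (inv\<^bsub>G\<^esub> h) = inv\<^bsub>H\<^esub> f h" using assms(2) by (intro hom_inv) auto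
  thus ?case using subgroup.m_inv_closed[OF assms(4) assms(3)[OF inv]] by simp
 next
  case (eng a b)
  thus ?case using subgroup.m_closed[OF assms(4)] G.generate_in_carrier[OF assms(2)] by simp
 qed
qed

context T_base
begin

abbreviation "RM \<equiv> regular_module ZA"

lemma Zs_Z [simp]: "a \<in> Zs ==> a \<in> Z" by (simp add: Zs_iff)

lemma one_Zs [simp]: "1\<^sub>Z \<in> Zs"
 using ro_orbits ZA.one_closed by (simp add: Zs_iff ZA_simps)

lemma RM_action: "scalar_action (struct_inv D s) RM"
proof -
 interpret RM: Module.module ZA RM by (rule ZA.regular_module)
 show ?thesis by (intro scalar_action.intro scalar_action_axioms.intro RM.abelian_group_axioms) (simp add: regular_simps)
qed

text \<open>An \<open>s\<close>-invariant function acts on this sum over a pair of neighbouring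
  orbits as a scalar (\<open>Zs_uu\<close>). This makes the evaluations \<open>ph y\<close>
  compatible with the tensor product over the invariants.\<close>

definition uu where "uu y = un y +\<^sub>Z un (ro y)"

lemma uu_Z [simp]: "y \<in> orbs ==> uu y \<in> Z" by (simp add: uu_def ro_orbits)

lemma uu_val: "y \<in> orbs ==> w \<in> orbs ==> uu y w = (if w = y \<or> w = ro y then \<delta> else 0\<^sub>T)"
 using ro_neq[of y] by (auto simp: uu_def ZA_simps un_val ro_orbits)

lemma Zs_uu: assumes "a \<in> Zs" "y \<in> orbs" shows "a *\<^sub>Z uu y = dg (a y) *\<^sub>Z uu y"
proof -
 have "(a *\<^sub>Z uu y) w = (dg (a y) *\<^sub>Z uu y) w" if w: "w \<in> orbs" for w
 proof (cases "w = y \<or> w = ro y")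
  case True
  hence "a w = a y" using assms by (auto simp: Zs_iff)
  thus ?thesis using w by (simp add: ZA_simps(1) dg_val)
 next
  case False
  thus ?thesis using assms w by (simp add: ZA_simps(1) uu_val dg_val)
 qed
 thus ?thesis using assms by (intro Z_eqI) auto
qed

lemma un_uu: assumes "x \<in> orbs" "y \<in> orbs"
 shows "un x *\<^sub>Z uu y = (if x = y \<or> x = ro y then dg \<delta> *\<^sub>Z un x else 0\<^sub>Z)"
proof -
 have "(un x *\<^sub>Z uu y) w = (if x = y \<or> x = ro y then dg \<delta> *\<^sub>Z un x else 0\<^sub>Z) w" if "w \<in> orbs" for w
  using assms that by (auto simp: ZA_simps uu_val un_val dg_val)
 thus ?thesis using assms by (intro Z_eqI) auto
qed

end

section \<open>Normal form and evaluations\<close>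

context zmod
begin

sublocale E: tens "struct_inv D s" RM M
 by (intro tens.intro RM_action scalar_action.intro scalar_action_axioms.intro M.abelian_group_axioms) simp

abbreviation "EM \<equiv> eps_module D s M"

lemma RM_simps [simp]: "carrier RM = Z" "x \<oplus>\<^bsub>RM\<^esub> y = x +\<^sub>Z y" "\<zero>\<^bsub>RM\<^esub> = 0\<^sub>Z" "a \<odot>\<^bsub>RM\<^esub> x = a *\<^sub>Z x"
 by (simp_all add: regular_simps)

lemma EM_simps: "carrier EM = carrier E.G" "a \<oplus>\<^bsub>EM\<^esub> b = a \<otimes>\<^bsub>E.G\<^esub> b" "\<zero>\<^bsub>EM\<^esub> = \<one>\<^bsub>E.G\<^esub>"
 "z \<odot>\<^bsub>EM\<^esub> e = tensor_map (struct_inv D s) RM M (\<lambda>y. z *\<^sub>Z y) (\<lambda>m. m) e"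
 "homog EM n = generate E.G {E.te z m | z m. \<exists>h i. struct_grading D = Some h \<and> z \<in> h i \<and> m \<in> homog M (n - i)}"
 by (simp_all add: eps_module_def Let_def)

lemma eact_map: "z \<in> Z ==> tens_map (struct_inv D s) RM M RM M (\<lambda>y. z *\<^sub>Z y) (\<lambda>m. m)"
 by unfold_locales (auto simp: ZA.r_distr ZA.m_lcomm)

lemma smult_te [simp]: "z \<in> Z ==> w \<in> Z ==> m \<in> carrier M ==> z \<odot>\<^bsub>EM\<^esub> E.te w m = E.te (z *\<^sub>Z w) m"
 unfolding EM_simps using tens_map.tm_te[OF eact_map] by simp

lemma smult_hom: "z \<in> Z ==> (\<lambda>e. z \<odot>\<^bsub>EM\<^esub> e) \<in> hom E.G E.G"
 unfolding EM_simps using tens_map.tm_hom[OF eact_map] .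

lemma EM_abelian: "abelian_group EM"
 by (rule abelian_group_of_comm_group[OF E.G.comm_group_axioms]) (simp_all add: EM_simps(1-3))

lemma smult_closed: "z \<in> Z ==> e \<in> carrier E.G ==> z \<odot>\<^bsub>EM\<^esub> e \<in> carrier E.G"
 using smult_hom[of z] by (auto simp: hom_def)

lemma smult_add: "z \<in> Z ==> e \<in> carrier E.G ==> e' \<in> carrier E.G ==> z \<odot>\<^bsub>EM\<^esub> (e \<otimes>\<^bsub>E.G\<^esub> e') = (z \<odot>\<^bsub>EM\<^esub> e) \<otimes>\<^bsub>E.G\<^esub> (z \<odot>\<^bsub>EM\<^esub> e')"
 using smult_hom[of z] by (auto simp: hom_def)

lemma EM_module: "Module.module ZA EM"
proof (rule moduleI)
 show "cring ZA" by (rule ZA.is_cring)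
 show "abelian_group EM" by (rule EM_abelian)
 fix e assume ze: "e \<in> carrier EM"
 show "1\<^sub>Z \<odot>\<^bsub>EM\<^esub> e = e" using ze unfolding EM_simps(1)
 proof (induction rule: E.tensor_induct)
  case (mult x y) thus ?case by (simp add: smult_add)
 qed simp
next
 fix z e assume ze: "z \<in> Z" "e \<in> carrier EM"
 thus "z \<odot>\<^bsub>EM\<^esub> e \<in> carrier EM" using smult_closed by (simp add: EM_simps(1))
 fix w assume w: "w \<in> Z"
 show "(z +\<^sub>Z w) \<odot>\<^bsub>EM\<^esub> e = z \<odot>\<^bsub>EM\<^esub> e \<oplus>\<^bsub>EM\<^esub> w \<odot>\<^bsub>EM\<^esub> e" using ze(2) unfolding EM_simps(1,2)
 proof (induction rule: E.tensor_induct)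
  case (elt a m)
  thus ?case using ze(1) w E.te_add_left[of "z *\<^sub>Z a" "w *\<^sub>Z a" m] by (simp add: ZA.l_distr)
 next
  case (mult x y)
  thus ?case using ze(1) w smult_closed by (simp add: smult_add E.G.m_ac)
 qed
 show "(z *\<^sub>Z w) \<odot>\<^bsub>EM\<^esub> e = z \<odot>\<^bsub>EM\<^esub> (w \<odot>\<^bsub>EM\<^esub> e)" using ze(2) unfolding EM_simps(1,2)
 proof (induction rule: E.tensor_induct)
  case (elt a m)
  thus ?case using ze(1) w by (simp add: ZA.m_assoc)
 next
  case (mult x y)
  thus ?case using ze(1) w smult_closed by (simp add: smult_add)
 qed
 fix e' assume "e' \<in> carrier EM"
 thus "z \<odot>\<^bsub>EM\<^esub> (e \<oplus>\<^bsub>EM\<^esub> e') = z \<odot>\<^bsub>EM\<^esub> e \<oplus>\<^bsub>EM\<^esub> z \<odot>\<^bsub>EM\<^esub> e'" using ze smult_add by (simp add: EM_simps(1,2))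
qed

sublocale EM: Module.module ZA EM by (rule EM_module)

lemma te_EM [simp]: "z \<in> Z ==> m \<in> carrier M ==> E.te z m \<in> carrier EM" by (simp add: EM_simps(1))

lemma te_Zs: "a \<in> Zs ==> z \<in> Z ==> m \<in> carrier M ==> E.te (a *\<^sub>Z z) m = E.te z (a \<odot> m)"
 using E.te_smult[of a z m] by simp

text \<open>By \<open>Z_decomp\<close>, 1 and \<open>cc\<close> generate the structure algebra over
  the invariants, and the invariant coefficients move across the tensor sign.\<close>

lemma EM_normal:
 assumes "e \<in> carrier EM"
 shows "\<exists>m\<in>carrier M. \<exists>m'\<in>carrier M. e = E.te 1\<^sub>Z m \<oplus>\<^bsub>EM\<^esub> E.te cc m'"
 using assms unfolding EM_simps(1,2)
proof (induction rule: E.tensor_induct)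
 case (elt z m)
 then obtain a b where ab: "a \<in> Zs" "b \<in> Zs" "z = a +\<^sub>Z cc *\<^sub>Z b" using Z_decomp[of z] by auto
 have "E.te z m = E.te a m \<otimes>\<^bsub>E.G\<^esub> E.te (cc *\<^sub>Z b) m"
  unfolding ab(3) using E.te_add_left[of a "cc *\<^sub>Z b" m] ab elt by simp
 also have "E.te a m = E.te 1\<^sub>Z (a \<odot> m)" using te_Zs[of a "1\<^sub>Z" m] ab elt by simp
 also have "E.te (cc *\<^sub>Z b) m = E.te cc (b \<odot> m)" using te_Zs[of b cc m] ab elt by (simp add: ZA.m_comm)
 finally show ?case using ab elt by (intro bexI[of _ "a \<odot> m"] bexI[of _ "b \<odot> m"]) auto
next
 case (mult x y)
 obtain m m' where m: "m \<in> carrier M" "m' \<in> carrier M" "x = E.te 1\<^sub>Z m \<otimes>\<^bsub>E.G\<^esub> E.te cc m'" using mult by blast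
 obtain n n' where n: "n \<in> carrier M" "n' \<in> carrier M" "y = E.te 1\<^sub>Z n \<otimes>\<^bsub>E.G\<^esub> E.te cc n'" using mult by blast
 have "x \<otimes>\<^bsub>E.G\<^esub> y = (E.te 1\<^sub>Z m \<otimes>\<^bsub>E.G\<^esub> E.te 1\<^sub>Z n) \<otimes>\<^bsub>E.G\<^esub> (E.te cc m' \<otimes>\<^bsub>E.G\<^esub> E.te cc n')"
  unfolding m(3) n(3) using m(1,2) n(1,2) by (simp add: E.G.m_ac)
 also have "\<dots> = E.te 1\<^sub>Z (m \<oplus> n) \<otimes>\<^bsub>E.G\<^esub> E.te cc (m' \<oplus> n')"
  using m(1,2) n(1,2) by (simp add: E.te_add_right)
 finally show ?case using m(1,2) n(1,2) by (intro bexI[of _ "m \<oplus> n"] bexI[of _ "m' \<oplus> n'"]) auto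
qed

text \<open>The evaluations \<open>z \<otimes> m \<mapsto> z y (e\<^sub>y + e\<^bsub>ys\<^esub>) m\<close>, where \<open>e\<^sub>y\<close> is \<open>\<delta>\<close> at \<open>y\<close> and vanishes elsewhere, jointly
 detect zero in the tensor product if the module is torsion free.\<close>

definition ph where "ph y = (SOME \<phi>. \<phi> \<in> hom E.G (add_monoid M) \<and>
 (\<forall>z\<in>Z. \<forall>m\<in>carrier M. \<phi> (E.te z m) = dg (z y) \<odot> (uu y \<odot> m)))"

lemma ph: assumes y: "y \<in> orbs"
 shows "ph y \<in> hom E.G (add_monoid M)" "z \<in> Z ==> m \<in> carrier M ==> ph y (E.te z m) = dg (z y) \<odot> (uu y \<odot> m)"
proof -
 obtain \<phi> where "\<phi> \<in> hom E.G (add_monoid M)"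
  "\<And>z m. z \<in> carrier RM ==> m \<in> carrier M ==> \<phi> (E.te z m) = dg (z y) \<odot> (uu y \<odot> m)"
 proof (rule E.tensor_universal[of "add_monoid M" "\<lambda>z m. dg (z y) \<odot> (uu y \<odot> m)"])
  show "comm_group (add_monoid M)" by (rule M.a_comm_group)
  fix z m assume zm: "z \<in> carrier RM" "m \<in> carrier M"
  thus "dg (z y) \<odot> (uu y \<odot> m) \<in> carrier (add_monoid M)" using y by simp
  fix w assume "w \<in> carrier RM"
  thus "dg ((z \<oplus>\<^bsub>RM\<^esub> w) y) \<odot> (uu y \<odot> m) =
    (dg (z y) \<odot> (uu y \<odot> m)) \<otimes>\<^bsub>add_monoid M\<^esub> (dg (w y) \<odot> (uu y \<odot> m))"
  proof -
   have "(z \<oplus>\<^bsub>RM\<^esub> w) y = z y +\<^sub>T w y" using y by (simp add: ZA_simps(4))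
   thus ?thesis using y zm \<open>w \<in> carrier RM\<close> by (simp add: dg_ops M.smult_l_distr)
  qed
 next
  fix z m m' assume "z \<in> carrier RM" "m \<in> carrier M" "m' \<in> carrier M"
  thus "dg (z y) \<odot> (uu y \<odot> (m \<oplus> m')) =
    (dg (z y) \<odot> (uu y \<odot> m)) \<otimes>\<^bsub>add_monoid M\<^esub> (dg (z y) \<odot> (uu y \<odot> m'))"
   using y by (simp add: M.smult_r_distr)
 next
  fix a z m assume a: "a \<in> Zs" "z \<in> carrier RM" "m \<in> carrier M"
  hence aT: "a y \<in> carrier T" "z y \<in> carrier T" using y by simp_all
  have "(a \<odot>\<^bsub>RM\<^esub> z) y = z y *\<^sub>T a y" using y aT by (simp add: ZA_simps(1) T.m_comm)
  hence "dg ((a \<odot>\<^bsub>RM\<^esub> z) y) = dg (z y) *\<^sub>Z dg (a y)" using aT by (simp only: dg_ops(1))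
  hence "dg ((a \<odot>\<^bsub>RM\<^esub> z) y) \<odot> (uu y \<odot> m) = dg (z y) \<odot> ((dg (a y) *\<^sub>Z uu y) \<odot> m)"
   using y a aT by (simp add: M.smult_assoc1)
  also have "\<dots> = dg (z y) \<odot> (uu y \<odot> (a \<odot> m))"
   unfolding Zs_uu[OF a(1) y, symmetric] ZA.m_comm[OF Zs_Z[OF a(1)] uu_Z[OF y]] using a y by (simp add: M.smult_assoc1)
  finally show "dg ((a \<odot>\<^bsub>RM\<^esub> z) y) \<odot> (uu y \<odot> m) = dg (z y) \<odot> (uu y \<odot> (a \<odot> m))" .
 qed simp
 hence "\<exists>\<phi>. \<phi> \<in> hom E.G (add_monoid M) \<and>
   (\<forall>z\<in>Z. \<forall>m\<in>carrier M. \<phi> (E.te z m) = dg (z y) \<odot> (uu y \<odot> m))" by auto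
 from someI_ex[OF this] show "ph y \<in> hom E.G (add_monoid M)"
  "z \<in> Z ==> m \<in> carrier M ==> ph y (E.te z m) = dg (z y) \<odot> (uu y \<odot> m)" unfolding ph_def by blast+
qed

lemma ph_add_map: "y \<in> orbs ==> add_map EM M (ph y)"
 using ph(1)[of y] EM_abelian M.abelian_group_axioms
 by (auto simp: add_map_def add_map_axioms_def EM_simps(1,2) hom_def)

lemma ph_closed [simp]: "y \<in> orbs ==> e \<in> carrier EM ==> ph y e \<in> carrier M"
 by (rule add_map.closed[OF ph_add_map])

lemma ph_add: "y \<in> orbs ==> e \<in> carrier EM ==> e' \<in> carrier EM ==> ph y (e \<oplus>\<^bsub>EM\<^esub> e') = ph y e \<oplus> ph y e'"
 by (rule add_map.add[OF ph_add_map])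

lemma ph_zero [simp]: "y \<in> orbs ==> ph y \<zero>\<^bsub>EM\<^esub> = \<zero>"
 by (rule add_map.zero[OF ph_add_map])

lemma EM_induct [consumes 1, case_names elt add]:
 assumes "e \<in> carrier EM" "\<And>z m. z \<in> Z ==> m \<in> carrier M ==> PP (E.te z m)"
  "\<And>x y. x \<in> carrier EM ==> y \<in> carrier EM ==> PP x ==> PP y ==> PP (x \<oplus>\<^bsub>EM\<^esub> y)"
 shows "PP e"
 using assms(1) unfolding EM_simps(1)
proof (induction rule: E.tensor_induct)
 case (elt a b) thus ?case using assms(2) by simp
next
 case (mult x y) thus ?case using assms(3)[of x y] by (simp add: EM_simps(1,2))
qed

lemma ph_smult:
 assumes y: "y \<in> orbs" and z: "z \<in> Z" and e: "e \<in> carrier EM" shows "ph y (z \<odot>\<^bsub>EM\<^esub> e) = dg (z y) \<odot> ph y e"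
 using e
proof (induction rule: EM_induct)
 case (elt w m)
 hence zw: "z y \<in> carrier T" "w y \<in> carrier T" using y z by simp_all
 have "ph y (z \<odot>\<^bsub>EM\<^esub> E.te w m) = dg ((z *\<^sub>Z w) y) \<odot> (uu y \<odot> m)"
  using ph(2)[OF y, of "z *\<^sub>Z w" m] elt z by simp
 also have "(z *\<^sub>Z w) y = z y *\<^sub>T w y" using y by (simp add: ZA_simps(1))
 finally show ?case using elt y z zw by (simp add: ph(2) dg_ops M.smult_assoc1)
next
 case (add a b) thus ?case using y z by (simp add: EM.smult_r_distr ph_add M.smult_r_distr)
qed

text \<open>\<open>uu y\<close> is supported at \<open>y\<close> and \<open>ro y\<close>, so its
  product with any other \<open>un x\<close> is zero.\<close>

lemma un_ph:
 assumes x: "x \<in> orbs" "y \<in> orbs" "x \<noteq> y" "x \<noteq> ro y" and e: "e \<in> carrier EM" shows "un x \<odot> ph y e = \<zero>"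
 using e
proof (induction rule: EM_induct)
 case (elt z m)
 have zy: "dg (z y) \<in> Z" using elt x by simp
 have "un x \<odot> ph y (E.te z m) = (dg (z y) *\<^sub>Z (un x *\<^sub>Z uu y)) \<odot> m"
  using elt x zy by (simp add: ph(2) ZA.m_lcomm flip: M.smult_assoc1)
 thus ?case using un_uu[OF x(1,2)] x(3,4) elt zy by (simp add: M.smult_l_null)
next
 case (add a b) thus ?case using x by (simp add: ph_add M.smult_r_distr)
qed

end

context tf_zmod
begin

lemma uu_kernel:
 assumes y: "y \<in> orbs" and m: "m \<in> carrier M" "uu y \<odot> m = \<zero>" shows "un y \<odot> m = \<zero>"
proof -
 have "dg \<delta> \<odot> (un y \<odot> m) = un y \<odot> (uu y \<odot> m)"
  using un_uu[OF y y] y m(1) by (simp flip: M.smult_assoc1)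
 thus ?thesis using \<Delta>_kernel[OF \<delta>_\<Delta>, of "un y \<odot> m"] y m by (simp add: M.smult_r_null)
qed

lemma double_inj: assumes "m \<in> carrier M" "m \<oplus> m = \<zero>" shows "m = \<zero>"
proof -
 obtain h where h: "h \<in> carrier T" "h +\<^sub>T h = 1\<^sub>T" using half_T by blast
 have "m = dg (h +\<^sub>T h) \<odot> m" using h assms(1) by (simp add: dg_ops)
 also have "\<dots> = dg h \<odot> (m \<oplus> m)" using h(1) assms(1) by (simp add: dg_ops M.smult_l_distr M.smult_r_distr)
 finally show ?thesis using assms h by (simp add: M.smult_r_null)
qed

lemma root_inj: assumes "\<alpha> \<in> R" "m \<in> carrier M" "dg (cT \<alpha>) \<odot> m = \<zero>" shows "m = \<zero>"
proof (cases "\<alpha> \<in> Rp")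
 case True thus ?thesis using cT_inj assms by blast
next
 case False
 hence n: "- \<alpha> \<in> Rp" using Rp_cases assms(1) by blast
 have "cT (- \<alpha>) = \<ominus>\<^bsub>T\<^esub> cT \<alpha>" using assms(1) by (simp add: cT_eq cS_neg)
 hence "dg (cT (- \<alpha>)) = \<ominus>\<^bsub>ZA\<^esub> dg (cT \<alpha>)" using assms(1) neg_root[OF assms(1)]
  by (intro Z_eqI) (auto simp: ZA_minus dg_val)
 hence "dg (cT (- \<alpha>)) \<odot> m = \<zero>" using assms by (simp add: M.smult_l_minus)
 thus ?thesis using cT_inj[OF n] assms by blast
qed

text \<open>For the normal form with entries m and m', the evaluations at y and ys are the sum and
  the difference of two terms, one from m and one from c(y) m'. Adding them and cancelling 2 kills
  the first term; cancelling the wall coroot c(y) then kills the second.\<close>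

lemma ph_inj:
 assumes e: "e \<in> carrier EM" and z: "\<And>y. y \<in> orbs ==> ph y e = \<zero>" shows "e = \<zero>\<^bsub>EM\<^esub>"
proof -
 obtain m m' where m: "m \<in> carrier M" "m' \<in> carrier M" "e = E.te 1\<^sub>Z m \<oplus>\<^bsub>EM\<^esub> E.te cc m'" using EM_normal[OF e] by blast
 have *: "un y \<odot> m = \<zero> \<and> un y \<odot> m' = \<zero>" if y: "y \<in> orbs" for y
 proof -
  let ?u = "uu y \<odot> m" and ?v = "dg (cc y) \<odot> (uu y \<odot> m')"
  have ccy: "cc y \<in> carrier T" using y by simp
  have C: "?u \<in> carrier M" "?v \<in> carrier M" using m y by simp_all
  have ry: "ro y \<in> orbs" "ro (ro y) = y" using y ro_orbits ro_ro by auto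
  have uur: "uu (ro y) = uu y" using y ry by (simp add: uu_def ZA.a_comm)
  have one: "dg (1\<^sub>Z w) = 1\<^sub>Z" if "w \<in> orbs" for w using that by (simp add: ZA_simps dg_ops)
  have 1: "?u \<oplus> ?v = \<zero>" using z[OF y] unfolding m(3) using m y one[OF y] by (simp add: ph_add ph(2))
  have "dg (cc (ro y)) = \<ominus>\<^bsub>ZA\<^esub> dg (cc y)" using y ccy by (intro Z_eqI) (auto simp: ZA_minus dg_val cc_ro)
  hence 2: "?u \<oplus> \<ominus> ?v = \<zero>"
   using z[OF ry(1)] unfolding m(3) using m y ry(1) one[OF ry(1)] ccy by (simp add: ph_add ph(2) uur M.smult_l_minus)
  have "?u \<oplus> ?u = (?u \<oplus> ?v) \<oplus> (?u \<oplus> \<ominus> ?v)" using C by (simp add: M.a_ac M.r_neg M.r_neg1)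
  hence u: "?u = \<zero>" using 1 2 double_inj[OF C(1)] by simp
  hence "?v = \<zero>" using 1 C by simp
  hence "uu y \<odot> m' = \<zero>" using root_inj[OF croot_R[OF y], of "uu y \<odot> m'"] m y by (simp add: cc_def)
  thus ?thesis using u uu_kernel y m by blast
 qed
 have "m = \<zero>" "m' = \<zero>" using un_all_zero m * by blast+
 thus ?thesis unfolding m(3) using E.te_zero(2)[of "1\<^sub>Z"] E.te_zero(2)[of cc] by (simp add: EM_simps(2,3))
qed

lemma un_EM: assumes x: "x \<in> orbs" and e: "e \<in> carrier EM" shows "un x \<odot>\<^bsub>EM\<^esub> e = \<zero>\<^bsub>EM\<^esub> \<longleftrightarrow> ph x e = \<zero>"
proof
 assume "un x \<odot>\<^bsub>EM\<^esub> e = \<zero>\<^bsub>EM\<^esub>"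
 hence "dg (un x x) \<odot> ph x e = \<zero>" using ph_smult[OF x un_Z[OF x] e] x by simp
 thus "ph x e = \<zero>" using \<Delta>_kernel[OF \<delta>_\<Delta>] x e by (simp add: un_val)
next
 assume *: "ph x e = \<zero>"
 show "un x \<odot>\<^bsub>EM\<^esub> e = \<zero>\<^bsub>EM\<^esub>"
 proof (rule ph_inj)
  fix y assume y: "y \<in> orbs"
  thus "ph y (un x \<odot>\<^bsub>EM\<^esub> e) = \<zero>"
   using ph_smult[OF y un_Z[OF x] e] * e by (auto simp: un_val dg_ops M.smult_l_null M.smult_r_null)
 qed (use x e in simp)
qed

text \<open>By \<open>un_ph\<close>, only the parts at \<open>x\<close> and \<open>ro x\<close> of
  an evaluation can be nonzero.\<close>

lemma ph_zeroI:
 assumes "x \<in> orbs" "e \<in> carrier EM" "un x \<odot> ph x e = \<zero>" "un (ro x) \<odot> ph x e = \<zero>"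
 shows "ph x e = \<zero>"
 by (rule un_all_zero) (use assms un_ph in auto)

lemma EM_torsion_free: "root_torsion_free D EM"
 unfolding root_torsion_free_def
proof
 fix \<alpha> assume \<alpha>: "\<alpha> \<in> Rp"
 hence c: "cT \<alpha> \<in> carrier T" using Rp_subset by auto
 interpret add_map EM EM "\<lambda>m. dg (cT \<alpha>) \<odot>\<^bsub>EM\<^esub> m"
  using c by unfold_locales (auto simp: EM.smult_r_distr)
 show "inj_on (\<lambda>m. dg (cT \<alpha>) \<odot>\<^bsub>EM\<^esub> m) (carrier EM)"
 proof (rule inj_onI)
  fix e assume e: "e \<in> carrier EM" "dg (cT \<alpha>) \<odot>\<^bsub>EM\<^esub> e = \<zero>\<^bsub>EM\<^esub>"
  show "e = \<zero>\<^bsub>EM\<^esub>"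
  proof (rule ph_inj[OF e(1)])
   fix y assume y: "y \<in> orbs"
   have "dg (cT \<alpha>) \<odot> ph y e = \<zero>" using ph_smult[OF y dg_Z[OF c] e(1)] e(2) y by (simp add: dg_val)
   thus "ph y e = \<zero>" using cT_inj[OF \<alpha>] y e(1) by simp
  qed
 qed
qed

text \<open>Directness of the grading is not formal, since a tensor has many expressions. It is
  tested by the evaluations, which shift degrees by the degree of \<delta> and are jointly
  injective; decomposability follows from the normal form.\<close>

lemma EM_zmodule: "is_zmodule D EM"
proof (rule is_zmoduleI[OF EM_module])
 fix h assume h: "struct_grading D = Some h"
 note Zh = Z_homog[OF h]
 have gM: "grading M (homog M)" and actM: "\<And>i j z m. z \<in> h i ==> m \<in> homog M j ==> z \<odot> m \<in> homog M (i + j)"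
  using zm h by (auto simp: is_zmodule_def is_module_def)
 note hM = grading_carrier[OF M.abelian_group_axioms gM]
 define X where "X n = {E.te z m | z m. \<exists>h i. struct_grading D = Some h \<and> z \<in> h i \<and> m \<in> homog M (n - i)}" for n
 have XG: "X n \<subseteq> carrier E.G" for n unfolding X_def using h Zh(2) hM by auto
 have hX: "homog EM n = generate E.G (X n)" for n by (simp add: EM_simps(5) X_def)
 have XI: "E.te z m \<in> X (i + j)" if "z \<in> h i" "m \<in> homog M j" for z m i j
  unfolding X_def using h that by (intro CollectI exI[of _ z] exI[of _ m] conjI refl exI[of _ h] exI[of _ i]) simp_all
 have XE: "\<exists>z m i. e = E.te z m \<and> z \<in> h i \<and> m \<in> homog M (n - i)" if "e \<in> X n" for e n
  using that h unfolding X_def by auto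
 have XH: "e \<in> homog EM n" if "e \<in> X n" for e n using generate.incl[OF that] by (simp add: hX)
 have GE: "group_hom E.G (add_monoid M) (ph y)" if "y \<in> orbs" for y
  using ph(1)[OF that] M.a_group by (simp add: group_hom_def group_hom_axioms_def E.G.group_axioms)
 have minv: "m_inv (add_monoid EM) = m_inv E.G" by (rule ext) (simp add: m_inv_def EM_simps(1-3))
 have sub: "subgroup (homog EM n) (add_monoid EM)" for n
  using E.G.generate_is_subgroup[OF XG[of n]] unfolding hX subgroup_def minv by (simp add: EM_simps(1-3))
 have subG: "subgroup (homog EM n) E.G" for n
  using E.G.generate_is_subgroup[OF XG[of n]] by (simp add: hX)
 note hE = subgroup.mem_carrier[OF sub, simplified]
 { fix i j z e assume z: "z \<in> h i" and e: "e \<in> homog EM j"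
  have zZ: "z \<in> Z" using Zh(2) z .
  have "z \<odot>\<^bsub>EM\<^esub> e \<in> homog EM (i + j)"
  proof (rule generate_image[of E.G E.G "\<lambda>e. z \<odot>\<^bsub>EM\<^esub> e" "X j"])
   show "group_hom E.G E.G (\<lambda>e. z \<odot>\<^bsub>EM\<^esub> e)"
    using smult_hom[OF zZ] by (simp add: group_hom_def group_hom_axioms_def E.G.group_axioms)
   fix x assume "x \<in> X j"
   then obtain w m k where w: "x = E.te w m" "w \<in> h k" "m \<in> homog M (j - k)" using XE by blast
   hence "z \<odot>\<^bsub>EM\<^esub> x = E.te (z *\<^sub>Z w) m" using zZ Zh(2)[OF w(2)] hM by simp
   also have "\<dots> \<in> X ((i + k) + (j - k))" by (intro XI Zh(3) z w)
   finally show "z \<odot>\<^bsub>EM\<^esub> x \<in> homog EM (i + j)" using XH by simp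
  qed (use XG subG e hX in auto)
 } note act = this
 show "grading EM (homog EM)"
 proof (rule gradingI[OF EM_abelian sub])
  fix e assume "e \<in> carrier EM"
  then obtain m m' where m: "m \<in> carrier M" "m' \<in> carrier M" "e = E.te 1\<^sub>Z m \<oplus>\<^bsub>EM\<^esub> E.te cc m'" using EM_normal by blast
  let ?d = "\<lambda>e. \<exists>c A. finite A \<and> (\<forall>n. c n \<in> homog EM n) \<and> e = finsum EM c A"
  have d: "?d (E.te z m)" if z: "z \<in> h i" and m: "m \<in> carrier M" for z i m
  proof -
   have zZ: "z \<in> Z" using Zh(2) z .
   obtain c A where c: "finite A" "\<And>n. c n \<in> homog M n" "m = finsum M c A"
    using grading_ex[OF M.abelian_group_axioms gM m] by blast
   interpret t: add_map M EM "E.te z"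
    using zZ by unfold_locales (auto simp: E.te_add_right EM_simps(2))
   have cM: "c n \<in> carrier M" for n using c(2) hM by blast
   have "E.te z m = finsum EM (\<lambda>n. E.te z (c n)) A" unfolding c(3) by (rule t.finsum) (use cM in blast)
   moreover have "?d (finsum EM (\<lambda>n. E.te z (c n)) A)" using c(1)
   proof (induction A rule: finite_induct)
    case empty
    show ?case by (intro exI[of _ "\<lambda>_. \<zero>\<^bsub>EM\<^esub>"] exI[of _ "{}"]) (use subgroup.one_closed[OF sub] in simp)
   next
    case (insert n A)
    have "?d (E.te z (c n))" by (rule decomposable_homog[OF EM_abelian, of "homog EM"]) (rule sub, rule XH[OF XI[OF z c(2)[of n]]])
    moreover have "finsum EM (\<lambda>n. E.te z (c n)) (insert n A) = E.te z (c n) \<oplus>\<^bsub>EM\<^esub> finsum EM (\<lambda>n. E.te z (c n)) A"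
     using insert cM zZ by (intro EM.finsum_insert) auto
    ultimately show ?case by (simp only:) (rule decomposable_add[OF EM_abelian, of "homog EM", OF sub _ insert(3)])
   qed
   ultimately show ?thesis by simp
  qed
  show "?d e" unfolding m(3) by (intro decomposable_add[OF EM_abelian, of "homog EM", OF sub] d[OF Zh(1) m(1)] d[OF cc_homog[OF h] m(2)])
 next
  fix c A n assume c: "finite A" "\<And>n. c n \<in> homog EM n" "finsum EM c A = \<zero>\<^bsub>EM\<^esub>" "n \<in> A"
  show "c n = \<zero>\<^bsub>EM\<^esub>"
  proof (rule ph_inj)
   show "c n \<in> carrier EM" by (rule hE[OF c(2)])
   fix y assume y: "y \<in> orbs"
   obtain d where d: "\<And>x. x \<in> orbs ==> un x \<in> h d" using un_homog[OF h y] by blast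
   have uud: "uu y \<in> h d" unfolding uu_def by (intro Zh(5) d y ro_orbits)
   interpret p: add_map EM M "ph y" by (rule ph_add_map[OF y])
   show "ph y (c n) = \<zero>"
   proof (rule p.grading_kernel[of "homog EM" "homog M" d A c n])
    fix n e assume e: "e \<in> homog EM n"
    show "e \<in> carrier EM" by (rule hE[OF e])
    show "ph y e \<in> homog M (n + d)"
    proof (rule generate_image[OF GE[OF y] XG])
     fix x assume "x \<in> X n"
     then obtain w m k where w: "x = E.te w m" "w \<in> h k" "m \<in> homog M (n - k)" using XE by blast
     hence "ph y x = dg (w y) \<odot> (uu y \<odot> m)" using ph(2)[OF y] Zh(2)[OF w(2)] hM by simp
     also have "\<dots> \<in> homog M (k + (d + (n - k)))" by (intro actM Zh(4) w y uud)
     finally show "ph y x \<in> homog M (n + d)" by (simp add: add.commute)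
    qed (use gM e in \<open>simp_all add: grading_def hX\<close>)
   qed (use gM c y in auto)
  qed
 qed
 fix i j z e assume "z \<in> h i" "e \<in> homog EM j" thus "z \<odot>\<^bsub>EM\<^esub> e \<in> homog EM (i + j)" by (rule act)
qed

end

section \<open>Functoriality of the tensor product over the invariants\<close>

context T_base
begin

lemma eps_hom_map:
 assumes "is_zmodule D M" "is_zmodule D N" "f \<in> zhom D M N"
 shows "tens_map (struct_inv D s) RM M RM N (\<lambda>z. z) f"
proof -
 interpret M: zmod D s M by (rule zmod_intro[OF assms(1)])
 interpret N: zmod D s N by (rule zmod_intro[OF assms(2)])
 note f = zhomD(1-3)[OF assms(3)]
 show ?thesis by unfold_locales (use f in auto)
qed

lemma eps_hom_te:
 assumes "is_zmodule D M" "is_zmodule D N" "f \<in> zhom D M N" "z \<in> Z" "m \<in> carrier M"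
 shows "eps_hom D s M N f (tensor_elt (struct_inv D s) RM M z m) = tensor_elt (struct_inv D s) RM N z (f m)"
proof -
 interpret M: zmod D s M by (rule zmod_intro[OF assms(1)])
 show ?thesis using tens_map.tm_te[OF eps_hom_map[OF assms(1-3)], of z m] assms(4,5) by (simp add: eps_hom_def regular_simps)
qed

lemma eps_hom_add_map:
 assumes "is_zmodule D M" "is_zmodule D N" "f \<in> zhom D M N"
 shows "add_map (eps_module D s M) (eps_module D s N) (eps_hom D s M N f)"
proof -
 interpret M: zmod D s M by (rule zmod_intro[OF assms(1)])
 interpret N: zmod D s N by (rule zmod_intro[OF assms(2)])
 have "tensor_map (struct_inv D s) RM N (\<lambda>z. z) f \<in> hom M.E.G N.E.G" by (rule tens_map.tm_hom[OF eps_hom_map[OF assms]])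
 thus ?thesis by unfold_locales (auto simp: eps_hom_def M.EM_simps(1,2) N.EM_simps(1,2) hom_def)
qed

lemma eps_hom_zhom:
 assumes "is_zmodule D M" "is_zmodule D N" "f \<in> zhom D M N"
 shows "eps_hom D s M N f \<in> zhom D (eps_module D s M) (eps_module D s N)"
proof -
 interpret M: zmod D s M by (rule zmod_intro[OF assms(1)])
 interpret N: zmod D s N by (rule zmod_intro[OF assms(2)])
 interpret f: add_map "eps_module D s M" "eps_module D s N" "eps_hom D s M N f" by (rule eps_hom_add_map[OF assms])
 note te = eps_hom_te[OF assms] and fM = zhomD[OF assms(3)]
 show ?thesis
 proof (rule zhomI)
  fix z e assume z: "z \<in> Z" and e: "e \<in> carrier (eps_module D s M)"
  show "eps_hom D s M N f (z \<odot>\<^bsub>eps_module D s M\<^esub> e) = z \<odot>\<^bsub>eps_module D s N\<^esub> eps_hom D s M N f e"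
   using e
  proof (induction rule: M.EM_induct)
   case (elt w m) thus ?case using z te fM(1) by simp
  next
   case (add x y) thus ?case using z by (simp add: M.EM.smult_r_distr N.EM.smult_r_distr f.add)
  qed
 next
  fix h e n assume h: "struct_grading D = Some h" and e: "e \<in> homog (eps_module D s M) n"
  have gM: "grading M (homog M)" using assms(1) h by (auto simp: is_zmodule_def is_module_def)
  note hM = grading_carrier[OF M.M.abelian_group_axioms gM]
  have gN: "grading N (homog N)" using assms(2) h by (auto simp: is_zmodule_def is_module_def)
  note hN = grading_carrier[OF N.M.abelian_group_axioms gN]
  let ?X = "{M.E.te z m | z m. \<exists>h i. struct_grading D = Some h \<and> z \<in> h i \<and> m \<in> homog M (n - i)}"
  let ?Y = "{N.E.te z m | z m. \<exists>h i. struct_grading D = Some h \<and> z \<in> h i \<and> m \<in> homog N (n - i)}"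
  have Y: "?Y \<subseteq> carrier N.E.G" using Z_homog(2) hN by auto
  have X: "?X \<subseteq> carrier M.E.G" using Z_homog(2) hM by auto
  show "eps_hom D s M N f e \<in> homog (eps_module D s N) n"
  proof (rule generate_image[of M.E.G N.E.G _ ?X])
   show "group_hom M.E.G N.E.G (eps_hom D s M N f)"
    using f.closed f.add by (auto simp: group_hom_def group_hom_axioms_def M.E.G.group_axioms N.E.G.group_axioms hom_def
     M.EM_simps(1,2) N.EM_simps(1,2))
   show "subgroup (homog (eps_module D s N) n) N.E.G"
    unfolding N.EM_simps(5) by (rule N.E.G.generate_is_subgroup[OF Y])
   show "e \<in> generate M.E.G ?X" using e by (simp only: M.EM_simps(5))
   fix x assume "x \<in> ?X"
   then obtain z m h i where x: "x = M.E.te z m" "struct_grading D = Some h" "z \<in> h i" "m \<in> homog M (n - i)" by blast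
   have "eps_hom D s M N f x = N.E.te z (f m)" unfolding x(1) by (rule te) (use x Z_homog(2) hM in blast)+
   moreover have "f m \<in> homog N (n - i)" by (rule fM(4)[OF x(2,4)])
   ultimately have "eps_hom D s M N f x \<in> ?Y" using x by blast
   thus "eps_hom D s M N f x \<in> homog (eps_module D s N) n" unfolding N.EM_simps(5) by (rule generate.incl)
  qed (rule X)
 qed (use f.closed f.add in \<open>auto simp: eps_hom_def\<close>)
qed

lemma ph_eps_hom:
 assumes "is_zmodule D M" "is_zmodule D N" "f \<in> zhom D M N" and y: "y \<in> orbs" and e: "e \<in> carrier (eps_module D s M)"
 shows "zmod.ph D s N y (eps_hom D s M N f e) = f (zmod.ph D s M y e)"
proof -
 interpret M: zmod D s M by (rule zmod_intro[OF assms(1)])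
 interpret N: zmod D s N by (rule zmod_intro[OF assms(2)])
 interpret f: add_map "eps_module D s M" "eps_module D s N" "eps_hom D s M N f" by (rule eps_hom_add_map[OF assms(1-3)])
 note te = eps_hom_te[OF assms(1-3)] and fM = zhomD(1-3)[OF assms(3)]
 show ?thesis using e
 proof (induction rule: M.EM_induct)
  case (elt z m) thus ?case using y fM te by (simp add: M.ph(2) N.ph(2))
 next
  case (add a b) thus ?case using y fM by (simp add: f.add M.ph_add N.ph_add)
 qed
qed

text \<open>The composite enters as a third homomorphism \<open>h\<close>, so that restrictions,
  morphisms and the two ways around a square are all covered.\<close>

lemma eps_hom_comp:
 assumes M: "is_zmodule D M" "is_zmodule D N" "is_zmodule D L" and f: "f \<in> zhom D M N" "g \<in> zhom D N L" "h \<in> zhom D M L"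
  and eq: "\<And>m. m \<in> carrier M ==> g (f m) = h m" and e: "e \<in> carrier (eps_module D s M)"
 shows "eps_hom D s N L g (eps_hom D s M N f e) = eps_hom D s M L h e"
proof -
 interpret M: zmod D s M by (rule zmod_intro[OF M(1)])
 interpret f: add_map "eps_module D s M" "eps_module D s N" "eps_hom D s M N f" by (rule eps_hom_add_map[OF M(1,2) f(1)])
 interpret g: add_map "eps_module D s N" "eps_module D s L" "eps_hom D s N L g" by (rule eps_hom_add_map[OF M(2,3) f(2)])
 interpret h: add_map "eps_module D s M" "eps_module D s L" "eps_hom D s M L h" by (rule eps_hom_add_map[OF M(1,3) f(3)])
 show ?thesis using e
 proof (induction rule: M.EM_induct)
  case (elt z m)
  thus ?case using eps_hom_te[OF M(1,2) f(1)] eps_hom_te[OF M(2,3) f(2)] eps_hom_te[OF M(1,3) f(3)] eq zhomD(1)[OF f(1)] by simp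
 next
  case (add a b) thus ?case by (simp add: f.add g.add h.add)
 qed
qed

lemma eps_hom_id:
 assumes M: "is_zmodule D M" and f: "f \<in> zhom D M M" and eq: "\<And>m. m \<in> carrier M ==> f m = m"
  and e: "e \<in> carrier (eps_module D s M)"
 shows "eps_hom D s M M f e = e"
proof -
 interpret M: zmod D s M by (rule zmod_intro[OF M(1)])
 interpret f: add_map "eps_module D s M" "eps_module D s M" "eps_hom D s M M f" by (rule eps_hom_add_map[OF M M f])
 show ?thesis using e
 proof (induction rule: M.EM_induct)
  case (elt z m) thus ?case using eps_hom_te[OF M M f] eq by simp
 next
  case (add a b) thus ?case by (simp add: f.add)
 qed
qed

end

section \<open>Presheaves\<close>

context T_base
begin

abbreviation "ops \<equiv> opens D"
abbreviation "car M J \<equiv> carrier (sec M J)"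
abbreviation "zer M J \<equiv> \<zero>\<^bsub>sec M J\<^esub>"

lemma presheafD:
 assumes "M \<in> presheaves D" "J \<in> ops"
 shows "is_zmodule D (sec M J)" "J' \<in> ops ==> J' \<subseteq> J ==> res M J J' \<in> zhom D (sec M J) (sec M J')"
  "m \<in> car M J ==> res M J J m = m"
  "J' \<in> ops ==> J'' \<in> ops ==> J'' \<subseteq> J' ==> J' \<subseteq> J ==> m \<in> car M J ==>
    res M J' J'' (res M J J' m) = res M J J'' m"
proof -
 note M = assms(1)[unfolded presheaves_def mem_Collect_eq]
 show "is_zmodule D (sec M J)" using conjunct1[OF M] assms(2) by simp
 show "J' \<in> ops ==> J' \<subseteq> J ==> res M J J' \<in> zhom D (sec M J) (sec M J')"
  using conjunct1[OF conjunct2[OF M]] assms(2) by simp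
 show "m \<in> car M J ==> res M J J m = m" using conjunct1[OF conjunct2[OF conjunct2[OF M]]] assms(2) by simp
 show "J' \<in> ops ==> J'' \<in> ops ==> J'' \<subseteq> J' ==> J' \<subseteq> J ==> m \<in> car M J ==>
    res M J' J'' (res M J J' m) = res M J J'' m"
  using conjunct2[OF conjunct2[OF conjunct2[OF M]]] assms(2) by simp
qed

lemma presheaf_homD:
 assumes "f \<in> presheaf_hom D M N"
 shows "J \<in> ops ==> f J \<in> zhom D (sec M J) (sec N J)" "f \<in> extensional ops"
  "J \<in> ops ==> J' \<in> ops ==> J' \<subseteq> J ==> m \<in> car M J ==> res N J J' (f J m) = f J' (res M J J' m)"
proof -
 note f = assms[unfolded presheaf_hom_def mem_Collect_eq]
 show "J \<in> ops ==> f J \<in> zhom D (sec M J) (sec N J)" using conjunct1[OF conjunct2[OF f]] by simp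
 show "f \<in> extensional ops" by (rule conjunct1[OF f])
 show "J \<in> ops ==> J' \<in> ops ==> J' \<subseteq> J ==> m \<in> car M J ==> res N J J' (f J m) = f J' (res M J J' m)"
  using conjunct2[OF conjunct2[OF f]] by simp
qed

lemma presheaf_hom_eqI:
 assumes "f \<in> presheaf_hom D M N" "g \<in> presheaf_hom D M N"
  "\<And>J m. J \<in> ops ==> m \<in> car M J ==> f J m = g J m"
 shows "f = g"
proof (rule extensionalityI[OF presheaf_homD(2)[OF assms(1)] presheaf_homD(2)[OF assms(2)]])
 fix J assume J: "J \<in> ops"
 show "f J = g J"
  by (rule extensionalityI[OF zhomD(5)[OF presheaf_homD(1)[OF assms(1) J]] zhomD(5)[OF presheaf_homD(1)[OF assms(2) J]]])
    (rule assms(3)[OF J])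
qed

lemma presheaf_id_hom: "M \<in> presheaves D ==> presheaf_id D M \<in> presheaf_hom D M M"
 unfolding presheaf_hom_def presheaf_id_def
proof (intro CollectI conjI ballI impI)
 fix J assume M: "M \<in> presheaves D" and J: "J \<in> ops"
 interpret zmod D s "sec M J" by (rule zmod_intro[OF presheafD(1)[OF M J]])
 have hM: "m \<in> car M J" if "struct_grading D = Some h" "m \<in> homog (sec M J) n" for h m n
  using zm that grading_carrier[OF M.abelian_group_axioms, of "homog (sec M J)"] by (auto simp: is_zmodule_def is_module_def)
 show "(\<lambda>J\<in>ops. \<lambda>m\<in>car M J. m) J \<in> zhom D (sec M J) (sec M J)"
  using J hM by (intro zhomI) auto
 fix J' m assume "J' \<in> ops" "J' \<subseteq> J" and m: "m \<in> car M J"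
 moreover have "res M J J' m \<in> car M J'" using zhomD(1)[OF presheafD(2)[OF M J]] m \<open>J' \<in> ops\<close> \<open>J' \<subseteq> J\<close> by blast
 ultimately show "res M J J' ((\<lambda>J\<in>ops. \<lambda>m\<in>car M J. m) J m) = (\<lambda>J\<in>ops. \<lambda>m\<in>car M J. m) J' (res M J J' m)"
  using J by simp
qed auto

lemma presheaf_comp_hom:
 assumes M: "M \<in> presheaves D" "N \<in> presheaves D" and f: "f \<in> presheaf_hom D M N" "g \<in> presheaf_hom D N L"
 shows "presheaf_comp D M g f \<in> presheaf_hom D M L"
 unfolding presheaf_hom_def presheaf_comp_def
proof (intro CollectI conjI ballI impI)
 fix J assume J: "J \<in> ops"
 interpret zmod D s "sec M J" by (rule zmod_intro[OF presheafD(1)[OF M(1) J]])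
 note fJ = zhomD[OF presheaf_homD(1)[OF f(1) J]] and gJ = zhomD[OF presheaf_homD(1)[OF f(2) J]]
 have hM: "m \<in> car M J" if "struct_grading D = Some h" "m \<in> homog (sec M J) n" for h m n
  using zm that grading_carrier[OF M.abelian_group_axioms, of "homog (sec M J)"] by (auto simp: is_zmodule_def is_module_def)
 show "(\<lambda>J\<in>ops. \<lambda>m\<in>car M J. g J (f J m)) J \<in> zhom D (sec M J) (sec L J)"
  using J hM fJ gJ by (intro zhomI) auto
 fix J' m assume *: "J' \<in> ops" "J' \<subseteq> J" and m: "m \<in> car M J"
 moreover have "res M J J' m \<in> car M J'" using zhomD(1)[OF presheafD(2)[OF M(1) J]] m * by blast
 moreover have "res L J J' (g J (f J m)) = g J' (f J' (res M J J' m))"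
  using presheaf_homD(3)[OF f(2) J *] presheaf_homD(3)[OF f(1) J *] fJ(1) m by simp
 ultimately show "res L J J' ((\<lambda>J\<in>ops. \<lambda>m\<in>car M J. g J (f J m)) J m) =
   (\<lambda>J\<in>ops. \<lambda>m\<in>car M J. g J (f J m)) J' (res M J J' m)"
  using J by simp
qed auto

lemma un_un: assumes "x \<in> orbs" "y \<in> orbs"
 shows "un y *\<^sub>Z un x = (if y = x then dg \<delta> *\<^sub>Z un x else 0\<^sub>Z)"
proof -
 have "(un y *\<^sub>Z un x) w = (if y = x then dg \<delta> *\<^sub>Z un x else 0\<^sub>Z) w" if "w \<in> orbs" for w
  using assms that by (auto simp: ZA_simps un_val dg_val)
 thus ?thesis using assms by (intro Z_eqI) auto
qed

end

section \<open>Flabby torsion free presheaves and the support condition\<close>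

locale tfp = T_base D s for D :: "('v::euclidean_space, 'k, 't) base_data" and s +
 fixes N :: "('v, 't, 'm) presheaf"
 assumes N: "N \<in> presheaves D" and Ntf: "torsion_free_presheaf D N" and Nfl: "flabby D N"
begin

lemma sec_tf: "J \<in> ops ==> tf_zmod D s (sec N J)"
 using N Ntf by (intro tf_zmod_intro presheafD(1)) (auto simp: torsion_free_presheaf_def)

lemma sec_zm: "J \<in> ops ==> zmod D s (sec N J)"
 using N by (intro zmod_intro presheafD(1))

lemma res_zhom: "J \<in> ops ==> J' \<in> ops ==> J' \<subseteq> J ==> res N J J' \<in> zhom D (sec N J) (sec N J')"
 by (rule presheafD(2)[OF N])

lemma res_add_map: "J \<in> ops ==> J' \<in> ops ==> J' \<subseteq> J ==> add_map (sec N J) (sec N J') (res N J J')"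
 by (rule zhom_add_map[OF presheafD(1)[OF N] presheafD(1)[OF N] res_zhom])

lemma res_closed: "J \<in> ops ==> J' \<in> ops ==> J' \<subseteq> J ==> n \<in> car N J ==> res N J J' n \<in> car N J'"
 by (rule zhomD(1)[OF res_zhom])

lemma res_surj: assumes "J \<in> ops" "J' \<in> ops" "J' \<subseteq> J" "n \<in> car N J'"
 obtains m where "m \<in> car N J" "res N J J' m = n"
proof -
 have "res N J J' ` car N J = car N J'" using Nfl assms(1-3) unfolding flabby_def by blast
 hence "n \<in> res N J J' ` car N J" using assms(4) by simp
 thus ?thesis using that by blast
qed

text \<open>Surjectivity on stalks is automatic from flabbiness, and injectivity is a statement
  about the kernel of \<open>un x\<close>.\<close>

lemma support_bij_iff:
 assumes J: "J \<in> ops" and J': "J' \<in> ops" and sub: "J' \<subseteq> J" and x: "x \<in> orbs"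
 shows "bij_betw (gen_map D (sec N J') (res N J J')) (stalk D (sec N J) x) (stalk D (sec N J') x) \<longleftrightarrow>
  (\<forall>n\<in>car N J. un x \<odot>\<^bsub>sec N J'\<^esub> res N J J' n = zer N J' --> un x \<odot>\<^bsub>sec N J\<^esub> n = zer N J)"
  (is "?B \<longleftrightarrow> ?A")
proof -
 interpret M: tf_zmod D s "sec N J" by (rule sec_tf[OF J])
 interpret M': tf_zmod D s "sec N J'" by (rule sec_tf[OF J'])
 interpret r: add_map "sec N J" "sec N J'" "res N J J'" by (rule res_add_map[OF J J' sub])
 have g: "gen_map D (sec N J') (res N J J') (to_stalk D (sec N J) x m) = to_stalk D (sec N J') x (res N J J' m)"
  if "m \<in> car N J" for m
  by (rule gen_map_stalk[OF M.tf_zmod_axioms M'.tf_zmod_axioms res_zhom[OF J J' sub] x that])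
 show ?thesis
 proof
  assume B: ?B
  show ?A
  proof (intro ballI impI)
   fix n assume n: "n \<in> car N J" "un x \<odot>\<^bsub>sec N J'\<^esub> res N J J' n = zer N J'"
   hence "to_stalk D (sec N J') x (res N J J' n) = to_stalk D (sec N J') x (res N J J' (zer N J))"
    using x by (subst M'.stalk_eq_iff) (auto simp: M'.M.smult_r_null)
   hence "to_stalk D (sec N J) x n = to_stalk D (sec N J) x (zer N J)"
    using g[OF n(1)] g[OF M.M.zero_closed] bij_betw_imp_inj_on[OF B] n(1) M.M.zero_closed
    unfolding stalk_def inj_on_def by (metis imageI)
   thus "un x \<odot>\<^bsub>sec N J\<^esub> n = zer N J" using x n(1) by (simp add: M.stalk_eq_iff M.M.smult_r_null)
  qed
 next
  assume A: ?A
  show ?B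
   unfolding bij_betw_def
  proof
   show "inj_on (gen_map D (sec N J') (res N J J')) (stalk D (sec N J) x)"
   proof (rule inj_onI)
    fix X Y assume "X \<in> stalk D (sec N J) x" "Y \<in> stalk D (sec N J) x"
     and eq: "gen_map D (sec N J') (res N J J') X = gen_map D (sec N J') (res N J J') Y"
    then obtain m n where mn: "m \<in> car N J" "n \<in> car N J" "X = to_stalk D (sec N J) x m" "Y = to_stalk D (sec N J) x n"
     unfolding stalk_def by blast
    have "un x \<odot>\<^bsub>sec N J'\<^esub> res N J J' m = un x \<odot>\<^bsub>sec N J'\<^esub> res N J J' n"
     using eq mn(1,2) x unfolding mn(3,4) g[OF mn(1)] g[OF mn(2)] by (simp add: M'.stalk_eq_iff)
    hence "un x \<odot>\<^bsub>sec N J'\<^esub> res N J J' (m \<ominus>\<^bsub>sec N J\<^esub> n) = zer N J'"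
     using mn(1,2) x by (simp add: r.diff M'.M.minus_eq M'.M.smult_r_distr M'.M.smult_r_minus M'.M.r_neg)
    hence "un x \<odot>\<^bsub>sec N J\<^esub> (m \<ominus>\<^bsub>sec N J\<^esub> n) = zer N J" using A mn(1,2) by simp
    hence "un x \<odot>\<^bsub>sec N J\<^esub> m \<ominus>\<^bsub>sec N J\<^esub> un x \<odot>\<^bsub>sec N J\<^esub> n = zer N J"
     using mn(1,2) x by (simp add: M.M.minus_eq M.M.smult_r_distr M.M.smult_r_minus)
    hence "un x \<odot>\<^bsub>sec N J\<^esub> m = un x \<odot>\<^bsub>sec N J\<^esub> n" using mn(1,2) x by (simp add: M.M.minus_eq_zero_iff)
    thus "X = Y" unfolding mn(3,4) using mn(1,2) x by (simp add: M.stalk_eq_iff)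
   qed
   show "gen_map D (sec N J') (res N J J') ` stalk D (sec N J) x = stalk D (sec N J') x"
   proof
    show "gen_map D (sec N J') (res N J J') ` stalk D (sec N J) x \<subseteq> stalk D (sec N J') x"
     unfolding stalk_def using g r.closed by auto
    show "stalk D (sec N J') x \<subseteq> gen_map D (sec N J') (res N J J') ` stalk D (sec N J) x"
    proof
     fix Y assume "Y \<in> stalk D (sec N J') x"
     then obtain n where n: "n \<in> car N J'" "Y = to_stalk D (sec N J') x n" unfolding stalk_def by blast
     obtain m where m: "m \<in> car N J" "res N J J' m = n" by (rule res_surj[OF J J' sub n(1)])
     have "Y = gen_map D (sec N J') (res N J J') (to_stalk D (sec N J) x m)" unfolding g[OF m(1)] m(2) n(2) ..
     thus "Y \<in> gen_map D (sec N J') (res N J J') ` stalk D (sec N J) x" unfolding stalk_def using m(1) by blast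
    qed
   qed
  qed
 qed
qed

lemma support_iff:
 "support_condition D N \<longleftrightarrow> (\<forall>J\<in>ops. \<forall>x\<in>orbs. \<forall>n\<in>car N J.
   un x \<odot>\<^bsub>sec N (hl (J \<inter> x))\<^esub> res N J (hl (J \<inter> x)) n = zer N (hl (J \<inter> x)) --> un x \<odot>\<^bsub>sec N J\<^esub> n = zer N J)"
 unfolding support_condition_def Let_def using Ntf support_bij_iff hull_Int hull_Int_sub by (simp cong: ball_cong)

text \<open>The kernel of the map from \<open>N\<close> to \<open>N\<^sup>+\<close>.\<close>

definition vanish where
 "vanish J n \<longleftrightarrow> (\<forall>x\<in>orbs. un x \<odot>\<^bsub>sec N (hl (J \<inter> x))\<^esub> res N J (hl (J \<inter> x)) n = zer N (hl (J \<inter> x)))"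

end

text \<open>The presheaf \<open>N\<^sup>+\<close> together with the map from \<open>N\<close>, up to isomorphism.\<close>

locale plus_quotient = tfp D s N for D :: "('v::euclidean_space, 'k, 't) base_data" and s
  and N :: "('v, 't, 'm) presheaf" +
 fixes C :: "('v, 't, 'n) presheaf" and pr :: "'v set set \<Rightarrow> 'm \<Rightarrow> 'n"
 assumes quot: "J \<in> ops ==> quotient_map (sec N J) (sec C J) (pr J)"
  and kern: "J \<in> ops ==> n \<in> car N J ==> pr J n = zer C J \<longleftrightarrow> vanish J n"
  and res_pr: "J \<in> ops ==> J' \<in> ops ==> J' \<subseteq> J ==> n \<in> car N J ==> res C J J' (pr J n) = pr J' (res N J J' n)"
  and res_ext: "J \<in> ops ==> J' \<in> ops ==> J' \<subseteq> J ==> res C J J' \<in> extensional (car C J)"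
begin

lemma prD:
 assumes "J \<in> ops"
 shows "n \<in> car N J ==> pr J n \<in> car C J"
  "n \<in> car N J ==> m \<in> car N J ==> pr J (n \<oplus>\<^bsub>sec N J\<^esub> m) = pr J n \<oplus>\<^bsub>sec C J\<^esub> pr J m"
  "z \<in> Z ==> n \<in> car N J ==> pr J (z \<odot>\<^bsub>sec N J\<^esub> n) = z \<odot>\<^bsub>sec C J\<^esub> pr J n"
  "struct_grading D = Some h ==> homog (sec C J) i = pr J ` homog (sec N J) i" "pr J (zer N J) = zer C J"
 using quot[OF assms] unfolding quotient_map_def by auto

lemma pr_surj: assumes "J \<in> ops" "c \<in> car C J" obtains n where "n \<in> car N J" "c = pr J n"
proof -
 have "c \<in> pr J ` car N J" using quot[OF assms(1)] assms(2) unfolding quotient_map_def by blast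
 thus ?thesis using that by blast
qed

text \<open>The kernel is the common zero set of the maps "restrict, then apply
  \<open>un x\<close>", each of which shifts degrees by a constant; so it contains the homogeneous
  components of its elements.\<close>

lemma C_zm: assumes J: "J \<in> ops" shows "is_zmodule D (sec C J)"
proof (rule quotient_zmodule[OF presheafD(1)[OF N J] quot[OF J]])
 interpret J: zmod D s "sec N J" by (rule sec_zm[OF J])
 fix h c I n assume h: "struct_grading D = Some h" and I: "finite I" "\<And>n. c n \<in> homog (sec N J) n"
  "pr J (finsum (sec N J) c I) = zer C J" "n \<in> I"
 have g: "grading (sec N J) (homog (sec N J))" using J.zm h by (simp add: is_zmodule_def is_module_def)
 note hN = grading_carrier[OF J.M.abelian_group_axioms g]
 have cN: "c n \<in> car N J" for n using hN I(2) .
 have fs: "finsum (sec N J) c I \<in> car N J" using cN by (intro J.M.finsum_closed) blast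
 have "vanish J (c n)"
  unfolding vanish_def
 proof
  fix x assume x: "x \<in> orbs"
  let ?H = "hl (J \<inter> x)"
  have H: "?H \<in> ops" "?H \<subseteq> J" using hull_Int hull_Int_sub J by auto
  interpret H: zmod D s "sec N ?H" by (rule sec_zm[OF H(1)])
  interpret r: add_map "sec N J" "sec N ?H" "res N J ?H" by (rule res_add_map[OF J H])
  interpret ur: add_map "sec N J" "sec N ?H" "\<lambda>n. un x \<odot>\<^bsub>sec N ?H\<^esub> res N J ?H n"
   using x by unfold_locales (auto simp: r.add H.M.smult_r_distr)
  obtain d where d: "\<And>x. x \<in> orbs ==> un x \<in> h d" using un_homog[OF h x] by blast
  have gH: "grading (sec N ?H) (homog (sec N ?H))"
   "\<And>i j z m. z \<in> h i ==> m \<in> homog (sec N ?H) j ==> z \<odot>\<^bsub>sec N ?H\<^esub> m \<in> homog (sec N ?H) (i + j)"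
   using H.zm h by (simp_all add: is_zmodule_def is_module_def)
  show "un x \<odot>\<^bsub>sec N ?H\<^esub> res N J ?H (c n) = zer N ?H"
  proof (rule ur.grading_kernel[of "homog (sec N J)" "homog (sec N ?H)" d I c n])
   fix k a assume a: "a \<in> homog (sec N J) k"
   thus "a \<in> car N J" by (rule hN)
   have "un x \<odot>\<^bsub>sec N ?H\<^esub> res N J ?H a \<in> homog (sec N ?H) (d + k)"
    by (rule gH(2)[OF d[OF x] zhomD(4)[OF res_zhom[OF J H] h a]])
   thus "un x \<odot>\<^bsub>sec N ?H\<^esub> res N J ?H a \<in> homog (sec N ?H) (k + d)" by (simp add: add.commute)
  next
   show "un x \<odot>\<^bsub>sec N ?H\<^esub> res N J ?H (finsum (sec N J) c I) = zer N ?H"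
    using kern[OF J fs] I(3) x unfolding vanish_def by blast
  qed (use gH I in auto)
 qed
 thus "pr J (c n) = zer C J" using kern[OF J cN] by blast
qed

text \<open>Multiplication by \<open>un x\<close> turns all conditions in \<open>vanish\<close> into
  trivial ones, except the one at \<open>x\<close>, which is merely multiplied by \<delta>.\<close>

lemma un_pr:
 assumes J: "J \<in> ops" and x: "x \<in> orbs" and n: "n \<in> car N J"
 shows "un x \<odot>\<^bsub>sec C J\<^esub> pr J n = zer C J \<longleftrightarrow>
   un x \<odot>\<^bsub>sec N (hl (J \<inter> x))\<^esub> res N J (hl (J \<inter> x)) n = zer N (hl (J \<inter> x))"
proof -
 interpret J: zmod D s "sec N J" by (rule sec_zm[OF J])
 have "un x \<odot>\<^bsub>sec C J\<^esub> pr J n = zer C J \<longleftrightarrow> vanish J (un x \<odot>\<^bsub>sec N J\<^esub> n)"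
  using kern[OF J, of "un x \<odot>\<^bsub>sec N J\<^esub> n"] prD(3)[OF J un_Z[OF x] n] x n by simp
 also have "\<dots> \<longleftrightarrow> (\<forall>y\<in>orbs. y = x --> un y \<odot>\<^bsub>sec N (hl (J \<inter> y))\<^esub> res N J (hl (J \<inter> y)) n = zer N (hl (J \<inter> y)))"
  unfolding vanish_def
 proof (rule ball_cong[OF refl])
  fix y assume y: "y \<in> orbs"
  let ?H = "hl (J \<inter> y)"
  have H: "?H \<in> ops" "?H \<subseteq> J" using hull_Int hull_Int_sub J by auto
  interpret H: tf_zmod D s "sec N ?H" by (rule sec_tf[OF H(1)])
  have rn: "res N J ?H n \<in> car N ?H" by (rule res_closed[OF J H n])
  have "un y \<odot>\<^bsub>sec N ?H\<^esub> res N J ?H (un x \<odot>\<^bsub>sec N J\<^esub> n) = (un y *\<^sub>Z un x) \<odot>\<^bsub>sec N ?H\<^esub> res N J ?H n"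
   using zhomD(3)[OF res_zhom[OF J H] un_Z[OF x] n] x y rn by (simp add: H.M.smult_assoc1)
  also have "\<dots> = zer N ?H \<longleftrightarrow> (y = x --> un y \<odot>\<^bsub>sec N ?H\<^esub> res N J ?H n = zer N ?H)"
  proof (cases "y = x")
   case True
   have "(un y *\<^sub>Z un x) \<odot>\<^bsub>sec N ?H\<^esub> res N J ?H n = dg \<delta> \<odot>\<^bsub>sec N ?H\<^esub> (un y \<odot>\<^bsub>sec N ?H\<^esub> res N J ?H n)"
    using un_un[OF x y] True H.M.smult_assoc1[OF dg_Z[OF \<delta>_T] un_Z[OF y] rn] by simp
   moreover have "dg \<delta> \<odot>\<^bsub>sec N ?H\<^esub> (un y \<odot>\<^bsub>sec N ?H\<^esub> res N J ?H n) = zer N ?H \<longleftrightarrow> un y \<odot>\<^bsub>sec N ?H\<^esub> res N J ?H n = zer N ?H"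
    using H.\<Delta>_kernel[OF \<delta>_\<Delta>, of "un y \<odot>\<^bsub>sec N ?H\<^esub> res N J ?H n"] y rn by (auto simp: H.M.smult_r_null)
   ultimately show ?thesis using True by simp
  next
   case False
   thus ?thesis using un_un[OF x y] rn by (simp add: H.M.smult_l_null)
  qed
  finally show "un y \<odot>\<^bsub>sec N ?H\<^esub> res N J ?H (un x \<odot>\<^bsub>sec N J\<^esub> n) = zer N ?H \<longleftrightarrow>
   (y = x --> un y \<odot>\<^bsub>sec N ?H\<^esub> res N J ?H n = zer N ?H)" .
 qed
 finally show ?thesis using x by blast
qed

lemma C_zhom: assumes J: "J \<in> ops" "J' \<in> ops" "J' \<subseteq> J" shows "res C J J' \<in> zhom D (sec C J) (sec C J')"
proof (rule zhomI)
 note rD = zhomD[OF res_zhom[OF J]]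
 interpret J: zmod D s "sec N J" by (rule sec_zm[OF J(1)])
 fix c assume "c \<in> car C J"
 then obtain n where n: "n \<in> car N J" "c = pr J n" by (rule pr_surj[OF J(1)])
 show "res C J J' c \<in> car C J'" unfolding n(2) using res_pr[OF J n(1)] prD(1)[OF J(2)] rD(1)[OF n(1)] by simp
 { fix z assume z: "z \<in> Z"
  have "res C J J' (z \<odot>\<^bsub>sec C J\<^esub> c) = res C J J' (pr J (z \<odot>\<^bsub>sec N J\<^esub> n))" using prD(3)[OF J(1) z n(1)] n(2) by simp
  also have "\<dots> = z \<odot>\<^bsub>sec C J'\<^esub> res C J J' c"
   using res_pr[OF J] prD(3)[OF J(2) z] rD(1,3) n z by simp
  finally show "res C J J' (z \<odot>\<^bsub>sec C J\<^esub> c) = z \<odot>\<^bsub>sec C J'\<^esub> res C J J' c" . }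
 fix d assume "d \<in> car C J"
 then obtain m where m: "m \<in> car N J" "d = pr J m" by (rule pr_surj[OF J(1)])
 have "res C J J' (c \<oplus>\<^bsub>sec C J\<^esub> d) = res C J J' (pr J (n \<oplus>\<^bsub>sec N J\<^esub> m))" using prD(2)[OF J(1) n(1) m(1)] n(2) m(2) by simp
 also have "\<dots> = res C J J' c \<oplus>\<^bsub>sec C J'\<^esub> res C J J' d"
  using res_pr[OF J] prD(2)[OF J(2)] rD(1,2) n m by simp
 finally show "res C J J' (c \<oplus>\<^bsub>sec C J\<^esub> d) = res C J J' c \<oplus>\<^bsub>sec C J'\<^esub> res C J J' d" .
next
 interpret J: zmod D s "sec N J" by (rule sec_zm[OF J(1)])
 fix h c i assume h: "struct_grading D = Some h" and c: "c \<in> homog (sec C J) i"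
 then obtain n where n: "n \<in> homog (sec N J) i" "c = pr J n" using prD(4)[OF J(1) h] by blast
 have g: "grading (sec N J) (homog (sec N J))" using J.zm h by (simp add: is_zmodule_def is_module_def)
 have "n \<in> car N J" by (rule grading_carrier[OF J.M.abelian_group_axioms g n(1)])
 thus "res C J J' c \<in> homog (sec C J') i"
  using res_pr[OF J] prD(4)[OF J(2) h] zhomD(4)[OF res_zhom[OF J] h n(1)] n(2) by simp
qed (rule res_ext[OF J])

lemma C_presheaf: "C \<in> presheaves D"
 unfolding presheaves_def
proof (intro CollectI conjI ballI impI)
 fix J assume J: "J \<in> ops"
 show "is_zmodule D (sec C J)" by (rule C_zm[OF J])
 fix c assume "c \<in> car C J"
 then obtain n where n: "n \<in> car N J" "c = pr J n" by (rule pr_surj[OF J])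
 show "res C J J c = c" unfolding n(2) using res_pr[OF J J subset_refl n(1)] presheafD(3)[OF N J n(1)] by simp
 fix J' J'' assume *: "J' \<in> ops" "J'' \<in> ops" "J'' \<subseteq> J' \<and> J' \<subseteq> J"
 have "res N J J' n \<in> car N J'" using res_closed[OF J *(1) _ n(1)] * by blast
 thus "res C J' J'' (res C J J' c) = res C J J'' c"
  unfolding n(2) using * J n(1) res_pr[of J J' n] res_pr[of J' J'' "res N J J' n"] res_pr[of J J'' n]
   presheafD(4)[OF N J *(1,2) _ _ n(1)] by (metis subset_trans)
qed (rule C_zhom)

lemma C_torsion_free: "torsion_free_presheaf D C"
 unfolding torsion_free_presheaf_def root_torsion_free_def
proof (intro ballI)
 fix J \<alpha> assume J: "J \<in> ops" and \<alpha>: "\<alpha> \<in> Rp"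
 have a: "cT \<alpha> \<in> carrier T" using \<alpha> Rp_subset by auto
 interpret C: zmod D s "sec C J" by (rule zmod_intro[OF C_zm[OF J]])
 interpret J: zmod D s "sec N J" by (rule sec_zm[OF J])
 interpret add_map "sec C J" "sec C J" "\<lambda>c. dg (cT \<alpha>) \<odot>\<^bsub>sec C J\<^esub> c"
  using a by unfold_locales (auto simp: C.M.smult_r_distr)
 show "inj_on (\<lambda>c. dg (cT \<alpha>) \<odot>\<^bsub>sec C J\<^esub> c) (car C J)"
 proof (rule inj_onI)
  fix c assume c: "c \<in> car C J" "dg (cT \<alpha>) \<odot>\<^bsub>sec C J\<^esub> c = zer C J"
  obtain n where n: "n \<in> car N J" "c = pr J n" by (rule pr_surj[OF J c(1)])
  have v: "vanish J (dg (cT \<alpha>) \<odot>\<^bsub>sec N J\<^esub> n)"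
   using c(2) kern[OF J, of "dg (cT \<alpha>) \<odot>\<^bsub>sec N J\<^esub> n"] prD(3)[OF J dg_Z[OF a] n(1)] a n by simp
  have "vanish J n"
   unfolding vanish_def
  proof
   fix x assume x: "x \<in> orbs"
   let ?H = "hl (J \<inter> x)"
   have H: "?H \<in> ops" "?H \<subseteq> J" using hull_Int hull_Int_sub J by auto
   interpret H: tf_zmod D s "sec N ?H" by (rule sec_tf[OF H(1)])
   have rn: "res N J ?H n \<in> car N ?H" by (rule res_closed[OF J H n(1)])
   have "dg (cT \<alpha>) \<odot>\<^bsub>sec N ?H\<^esub> (un x \<odot>\<^bsub>sec N ?H\<^esub> res N J ?H n) = un x \<odot>\<^bsub>sec N ?H\<^esub> res N J ?H (dg (cT \<alpha>) \<odot>\<^bsub>sec N J\<^esub> n)"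
    using zhomD(3)[OF res_zhom[OF J H] dg_Z[OF a] n(1)] x a rn by (simp add: ZA.m_comm flip: H.M.smult_assoc1)
   also have "\<dots> = zer N ?H" using v x unfolding vanish_def by blast
   finally show "un x \<odot>\<^bsub>sec N ?H\<^esub> res N J ?H n = zer N ?H" using H.cT_inj[OF \<alpha>, of "un x \<odot>\<^bsub>sec N ?H\<^esub> res N J ?H n"] x rn by simp
  qed
  thus "c = zer C J" using kern[OF J n(1)] n(2) by simp
 qed
qed

lemma C_flabby: "flabby D C"
 unfolding flabby_def
proof (intro ballI impI)
 fix J J' assume J: "J \<in> ops" "J' \<in> ops" "J' \<subseteq> J"
 show "res C J J' ` car C J = car C J'"
 proof
  show "res C J J' ` car C J \<subseteq> car C J'" using zhomD(1)[OF C_zhom[OF J]] by blast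
  show "car C J' \<subseteq> res C J J' ` car C J"
  proof
   fix c assume "c \<in> car C J'"
   then obtain n where n: "n \<in> car N J'" "c = pr J' n" by (rule pr_surj[OF J(2)])
   obtain m where m: "m \<in> car N J" "res N J J' m = n" by (rule res_surj[OF J n(1)])
   have "c = res C J J' (pr J m)" using res_pr[OF J m(1)] m(2) n(2) by simp
   thus "c \<in> res C J J' ` car C J" using prD(1)[OF J(1) m(1)] by blast
  qed
 qed
qed

sublocale C: tfp D s C
 by (intro tfp.intro T_base_axioms tfp_axioms.intro C_presheaf C_torsion_free C_flabby)

text \<open>The hull of J \<inter> x meets \<open>x\<close> in the same alcoves as \<open>J\<close>,
  so by \<open>un_pr\<close> the conditions at \<open>x\<close> over \<open>J\<close> and over the
  hull coincide.\<close>

lemma C_support: "support_condition D C"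
 unfolding C.support_iff
proof (intro ballI impI)
 fix J x c assume J: "J \<in> ops" and x: "x \<in> orbs" and "c \<in> car C J"
  and z: "un x \<odot>\<^bsub>sec C (hl (J \<inter> x))\<^esub> res C J (hl (J \<inter> x)) c = zer C (hl (J \<inter> x))"
 then obtain n where n: "n \<in> car N J" "c = pr J n" using pr_surj[OF J] by metis
 let ?H = "hl (J \<inter> x)"
 have H: "?H \<in> ops" "?H \<subseteq> J" "hl (?H \<inter> x) = ?H" using hull_Int hull_Int_sub hull_Int_hull J by auto
 have rn: "res N J ?H n \<in> car N ?H" by (rule res_closed[OF J H(1,2) n(1)])
 have "un x \<odot>\<^bsub>sec N ?H\<^esub> res N ?H ?H (res N J ?H n) = zer N ?H"
  using un_pr[OF H(1) x rn] z res_pr[OF J H(1,2) n(1)] unfolding H(3) n(2) by simp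
 thus "un x \<odot>\<^bsub>sec C J\<^esub> c = zer C J"
  unfolding n(2) using un_pr[OF J x n(1)] presheafD(3)[OF N H(1) rn] by simp
qed

lemma pr_eq_iff:
 assumes J: "J \<in> ops" and n: "n \<in> car N J" "m \<in> car N J"
 shows "pr J n = pr J m \<longleftrightarrow> vanish J (n \<ominus>\<^bsub>sec N J\<^esub> m)"
proof -
 interpret J: zmod D s "sec N J" by (rule sec_zm[OF J])
 interpret C: zmod D s "sec C J" by (rule zmod_intro[OF C_zm[OF J]])
 interpret p: add_map "sec N J" "sec C J" "pr J" using prD(1,2)[OF J] by unfold_locales auto
 show ?thesis using p.diff_zero[OF n] kern[OF J, of "n \<ominus>\<^bsub>sec N J\<^esub> m"] n by simp
qed

end

context plus_quotient
begin

text \<open>All properties of \<open>g\<close> descend from \<open>f\<close> along the surjections.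
  It is used for the action of \<open>theta\<close> on morphisms and for the comparison \<eta> with
  a competing functor.\<close>

lemma induced_hom:
 assumes Q': "plus_quotient D s N' C' pr'" and f: "f \<in> presheaf_hom D N N'"
  and g: "g \<in> extensional ops" "\<And>J. J \<in> ops ==> g J \<in> extensional (car C J)"
  and gp: "\<And>J n. J \<in> ops ==> n \<in> car N J ==> g J (pr J n) = pr' J (f J n)"
 shows "g \<in> presheaf_hom D C C'"
proof -
 interpret Q': plus_quotient D s N' C' pr' by (rule Q')
 note fD = zhomD[OF presheaf_homD(1)[OF f]]
 have gh: "g J \<in> zhom D (sec C J) (sec C' J)" if J: "J \<in> ops" for J
 proof (rule zhomI)
  interpret J: zmod D s "sec N J" by (rule sec_zm[OF J])
  fix c assume "c \<in> car C J"
  then obtain n where n: "n \<in> car N J" "c = pr J n" by (rule pr_surj[OF J])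
  show "g J c \<in> car C' J" unfolding n(2) using gp[OF J n(1)] Q'.prD(1)[OF J fD(1)[OF J n(1)]] by simp
  { fix z assume z: "z \<in> Z"
   have "g J (z \<odot>\<^bsub>sec C J\<^esub> c) = g J (pr J (z \<odot>\<^bsub>sec N J\<^esub> n))" using prD(3)[OF J z n(1)] n(2) by simp
   also have "\<dots> = z \<odot>\<^bsub>sec C' J\<^esub> g J c"
    using gp[OF J] Q'.prD(3)[OF J z] fD(1,3)[OF J] n z by simp
   finally show "g J (z \<odot>\<^bsub>sec C J\<^esub> c) = z \<odot>\<^bsub>sec C' J\<^esub> g J c" . }
  fix d assume "d \<in> car C J"
  then obtain m where m: "m \<in> car N J" "d = pr J m" by (rule pr_surj[OF J])
  have "g J (c \<oplus>\<^bsub>sec C J\<^esub> d) = g J (pr J (n \<oplus>\<^bsub>sec N J\<^esub> m))" using prD(2)[OF J n(1) m(1)] n(2) m(2) by simp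
  also have "\<dots> = g J c \<oplus>\<^bsub>sec C' J\<^esub> g J d"
   using gp[OF J] Q'.prD(2)[OF J] fD(1,2)[OF J] n m by simp
  finally show "g J (c \<oplus>\<^bsub>sec C J\<^esub> d) = g J c \<oplus>\<^bsub>sec C' J\<^esub> g J d" .
 next
  interpret J: zmod D s "sec N J" by (rule sec_zm[OF J])
  fix h c i assume h: "struct_grading D = Some h" and c: "c \<in> homog (sec C J) i"
  then obtain n where n: "n \<in> homog (sec N J) i" "c = pr J n" using prD(4)[OF J h] by blast
  have g: "grading (sec N J) (homog (sec N J))" using J.zm h by (simp add: is_zmodule_def is_module_def)
  have "n \<in> car N J" by (rule grading_carrier[OF J.M.abelian_group_axioms g n(1)])
  thus "g J c \<in> homog (sec C' J) i"
   using gp[OF J] Q'.prD(4)[OF J h] fD(4)[OF J h n(1)] n(2) by simp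
 qed (rule g(2)[OF J])
 show ?thesis
  unfolding presheaf_hom_def
 proof (intro CollectI conjI ballI impI g(1) gh)
  fix J J' c assume J: "J \<in> ops" "J' \<in> ops" "J' \<subseteq> J" and "c \<in> car C J"
  then obtain n where n: "n \<in> car N J" "c = pr J n" using pr_surj[OF J(1)] by metis
  have "res C' J J' (g J c) = pr' J' (res N' J J' (f J n))"
   unfolding n(2) gp[OF J(1) n(1)] by (rule Q'.res_pr[OF J fD(1)[OF J(1) n(1)]])
  also have "\<dots> = g J' (res C J J' c)"
   unfolding n(2) res_pr[OF J n(1)] gp[OF J(2) res_closed[OF J n(1)]] presheaf_homD(3)[OF f J n(1)] ..
  finally show "res C' J J' (g J c) = g J' (res C J J' c)" .
 qed
qed

end

context tfp
begin

lemma to_plus_eq_iff: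
 assumes J: "J \<in> ops" and n: "n \<in> car N J" "m \<in> car N J"
 shows "to_plus D N J n = to_plus D N J m \<longleftrightarrow> vanish J (n \<ominus>\<^bsub>sec N J\<^esub> m)"
proof -
 have "to_plus D N J n = to_plus D N J m \<longleftrightarrow> (\<forall>x\<in>orbs. to_plus D N J n x = to_plus D N J m x)"
  unfolding to_plus_def by (auto simp: restrict_def fun_eq_iff)
 also have "\<dots> \<longleftrightarrow> vanish J (n \<ominus>\<^bsub>sec N J\<^esub> m)"
  unfolding vanish_def
 proof (rule ball_cong[OF refl])
  fix x assume x: "x \<in> orbs"
  let ?H = "hl (J \<inter> x)"
  have H: "?H \<in> ops" "?H \<subseteq> J" using hull_Int hull_Int_sub J by auto
  interpret H: tf_zmod D s "sec N ?H" by (rule sec_tf[OF H(1)])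
  interpret r: add_map "sec N J" "sec N ?H" "res N J ?H" by (rule res_add_map[OF J H])
  interpret ur: add_map "sec N J" "sec N ?H" "\<lambda>n. un x \<odot>\<^bsub>sec N ?H\<^esub> res N J ?H n"
   using x by unfold_locales (auto simp: r.add H.M.smult_r_distr)
  show "to_plus D N J n x = to_plus D N J m x \<longleftrightarrow> un x \<odot>\<^bsub>sec N ?H\<^esub> res N J ?H (n \<ominus>\<^bsub>sec N J\<^esub> m) = zer N ?H"
   unfolding ur.diff_zero[OF n] using x n by (simp add: to_plus_def Let_def H.stalk_eq_iff)
 qed
 finally show ?thesis .
qed

lemma plus_quot: assumes J: "J \<in> ops" shows "quotient_map (sec N J) (plus_sec D N J) (to_plus D N J)"
proof -
 have *: "hl (J \<inter> x) \<in> ops" "hl (J \<inter> x) \<subseteq> J" for x using hull_Int hull_Int_sub J by auto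
 interpret J: tf_zmod D s "sec N J" by (rule sec_tf[OF J])
 show ?thesis
  unfolding quotient_map_def
 proof (intro conjI ballI allI)
  show "to_plus D N J (zer N J) = \<zero>\<^bsub>plus_sec D N J\<^esub>"
   using add_map.zero[OF res_add_map[OF J *]] tf_zmod.to_stalk_zero[OF sec_tf[OF *(1)]]
   by (simp add: to_plus_def plus_sec_def Let_def cong: restrict_cong)
  fix a assume a: "a \<in> car N J"
  note ra = res_closed[OF J * a]
  { fix b assume b: "b \<in> car N J"
   show "to_plus D N J (a \<oplus>\<^bsub>sec N J\<^esub> b) = to_plus D N J a \<oplus>\<^bsub>plus_sec D N J\<^esub> to_plus D N J b"
    using add_map.add[OF res_add_map[OF J *] a b] tf_zmod.to_stalk_add[OF sec_tf[OF *(1)] _ ra res_closed[OF J * b]]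
    by (simp add: to_plus_def plus_sec_def Let_def cong: restrict_cong) }
  fix z assume z: "z \<in> Z"
  show "to_plus D N J (z \<odot>\<^bsub>sec N J\<^esub> a) = z \<odot>\<^bsub>plus_sec D N J\<^esub> to_plus D N J a"
   using zhomD(3)[OF res_zhom[OF J *] z a] tf_zmod.to_stalk_smult[OF sec_tf[OF *(1)] _ ra z]
   by (simp add: to_plus_def plus_sec_def Let_def cong: restrict_cong)
 qed (simp_all add: plus_sec_def)
qed

lemma plus_res:
 assumes J: "J \<in> ops" "J' \<in> ops" "J' \<subseteq> J" and n: "n \<in> car N J"
 shows "res (plus_presheaf D N) J J' (to_plus D N J n) = to_plus D N J' (res N J J' n)"
proof -
 have H: "hl (J \<inter> x) \<in> ops" "hl (J \<inter> x) \<subseteq> J" "hl (J' \<inter> x) \<in> ops" "hl (J' \<inter> x) \<subseteq> J'" "hl (J' \<inter> x) \<subseteq> hl (J \<inter> x)" for x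
  using hull_Int hull_Int_sub J hull_least[OF hull_Int[OF J(1), of x], of "J' \<inter> x"] hull_superset[of "J \<inter> x"] by blast+
 have "gen_map D (sec N (hl (J' \<inter> x))) (res N (hl (J \<inter> x)) (hl (J' \<inter> x))) (to_stalk D (sec N (hl (J \<inter> x))) x (res N J (hl (J \<inter> x)) n)) =
  to_stalk D (sec N (hl (J' \<inter> x))) x (res N J' (hl (J' \<inter> x)) (res N J J' n))" if x: "x \<in> orbs" for x
  using gen_map_stalk[OF sec_tf[OF H(1)] sec_tf[OF H(3)] res_zhom[OF H(1,3,5)] x res_closed[OF J(1) H(1,2) n]]
   presheafD(4)[OF N J(1) H(1,3,5,2) n] presheafD(4)[OF N J(1,2) H(3,4) J(3) n] by simp
 thus ?thesis using n by (simp add: plus_presheaf_def plus_sec_def to_plus_def Let_def cong: restrict_cong)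
qed

text \<open>The smallness assumption makes the function chosen by \<open>copy_fun\<close> injective,
  so that copying is a transport of structure.\<close>

lemma copy_plus_quotient:
 assumes small: "\<And>J. J \<in> ops ==> \<exists>f :: _ \<Rightarrow> 'n. inj_on f (carrier (plus_sec D N J))"
 shows "plus_quotient D s N (copy_presheaf (plus_presheaf D N) :: ('v, 't, 'n) presheaf)
  (\<lambda>J n. copy_fun (plus_sec D N J) (to_plus D N J n))"
proof -
 let ?P = "plus_sec D N"
 have inj: "inj_on (copy_fun (?P J) :: _ \<Rightarrow> 'n) (carrier (?P J))" if "J \<in> ops" for J
  using someI_ex[OF small[OF that]] unfolding copy_fun_def inj_on_def by simp
 have inv: "copy_inv (?P J) (copy_fun (?P J) u :: 'n) = u" if "J \<in> ops" "u \<in> carrier (?P J)" for J u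
  unfolding copy_inv_def by (rule inv_into_f_f[OF inj[OF that(1)] that(2)])
 have tp: "to_plus D N J n \<in> carrier (?P J)" if "n \<in> car N J" for J n using that by (simp add: plus_sec_def)
 show ?thesis
 proof (intro plus_quotient.intro plus_quotient_axioms.intro tfp_axioms)
  fix J assume J: "J \<in> ops"
  have q: "to_plus D N J ` car N J = carrier (?P J)" "to_plus D N J (zer N J) = \<zero>\<^bsub>?P J\<^esub>"
   "\<And>a b. a \<in> car N J ==> b \<in> car N J ==> to_plus D N J (a \<oplus>\<^bsub>sec N J\<^esub> b) = to_plus D N J a \<oplus>\<^bsub>?P J\<^esub> to_plus D N J b"
   "\<And>z a. z \<in> Z ==> a \<in> car N J ==> to_plus D N J (z \<odot>\<^bsub>sec N J\<^esub> a) = z \<odot>\<^bsub>?P J\<^esub> to_plus D N J a"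
   "\<And>n. homog (?P J) n = to_plus D N J ` homog (sec N J) n"
   using plus_quot[OF J] unfolding quotient_map_def by (blast, blast, blast, blast, simp add: plus_sec_def)
  interpret J: zmod D s "sec N J" by (rule sec_zm[OF J])
  show "quotient_map (sec N J) (sec (copy_presheaf (plus_presheaf D N) :: ('v, 't, 'n) presheaf) J)
    (\<lambda>n. copy_fun (?P J) (to_plus D N J n))"
   unfolding quotient_map_def copy_presheaf_def copy_module_def plus_presheaf_def
   using J inv tp by (auto simp: q(2-5) image_image simp flip: q(1))
  fix n assume n: "n \<in> car N J"
  have "copy_fun (?P J) (to_plus D N J n) = (copy_fun (?P J) (to_plus D N J (zer N J)) :: 'n) \<longleftrightarrow> to_plus D N J n = to_plus D N J (zer N J)"
   using inj_on_eq_iff[OF inj[OF J] tp[OF n] tp[OF J.M.zero_closed]] .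
  also have "\<dots> \<longleftrightarrow> vanish J n" using to_plus_eq_iff[OF J n J.M.zero_closed] J.M.minus_equality[of "(zer N J)" "(zer N J)"] n
   by (simp add: J.M.minus_eq)
  finally show "copy_fun (?P J) (to_plus D N J n) = zer (copy_presheaf (plus_presheaf D N) :: ('v, 't, 'n) presheaf) J \<longleftrightarrow> vanish J n"
   by (simp add: copy_presheaf_def copy_module_def plus_presheaf_def q(2))
  fix J' assume J': "J' \<in> ops" "J' \<subseteq> J"
  show "res (copy_presheaf (plus_presheaf D N) :: ('v, 't, 'n) presheaf) J J' (copy_fun (?P J) (to_plus D N J n)) =
   copy_fun (?P J') (to_plus D N J' (res N J J' n))"
   using plus_res[OF J J' n] inv[OF J tp[OF n]] tp[OF n]
   by (simp add: copy_presheaf_def copy_hom_def plus_presheaf_def)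
 next
  fix J J'
  show "res (copy_presheaf (plus_presheaf D N) :: ('v, 't, 'n) presheaf) J J' \<in>
    extensional (car (copy_presheaf (plus_presheaf D N) :: ('v, 't, 'n) presheaf) J)"
   by (simp add: copy_presheaf_def copy_hom_def copy_module_def)
 qed
qed

end

section \<open>Wall crossing\<close>

context T_base
begin

lemma eps_simps:
 "sec (fob (eps D s) M) J = eps_module D s (sec M (sh J))"
 "res (fob (eps D s) M) J J' = eps_hom D s (sec M (sh J)) (sec M (sh J')) (res M (sh J) (sh J'))"
 "J \<in> ops ==> fmor (eps D s) M N f J = eps_hom D s (sec M (sh J)) (sec N (sh J)) (f (sh J))"
 by (simp_all add: eps_def)

end

context tfp
begin

abbreviation "EP \<equiv> fob (eps D s) N"

lemma eps_presheaf: "EP \<in> presheaves D"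
 unfolding presheaves_def
proof (intro CollectI conjI ballI impI)
 fix J assume J: "J \<in> ops"
 have zJ: "is_zmodule D (sec N (sh J))" by (rule presheafD(1)[OF N sh_opens[OF J]])
 show "is_zmodule D (sec EP J)" unfolding eps_simps by (rule tf_zmod.EM_zmodule[OF sec_tf[OF sh_opens[OF J]]])
 fix e assume "e \<in> car EP J"
 hence e: "e \<in> carrier (eps_module D s (sec N (sh J)))" by (simp add: eps_simps)
 show "res EP J J e = e" unfolding eps_simps
  by (rule eps_hom_id[OF zJ res_zhom _ e]) (use presheafD(3)[OF N sh_opens[OF J]] sh_opens[OF J] in auto)
 fix J' J'' assume J': "J' \<in> ops" "J'' \<in> ops" "J'' \<subseteq> J' \<and> J' \<subseteq> J"
 have sub: "sh J'' \<subseteq> sh J'" "sh J' \<subseteq> sh J" "sh J'' \<subseteq> sh J" using J' sh_mono by blast+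
 show "res EP J' J'' (res EP J J' e) = res EP J J'' e" unfolding eps_simps
  by (rule eps_hom_comp[OF zJ presheafD(1)[OF N sh_opens[OF J'(1)]] presheafD(1)[OF N sh_opens[OF J'(2)]] _ _ _ _ e])
   (use res_zhom sh_opens J J'(1,2) sub presheafD(4)[OF N sh_opens[OF J] sh_opens[OF J'(1)] sh_opens[OF J'(2)] sub(1,2)] in auto)
next
 fix J J' assume J: "J \<in> ops" "J' \<in> ops" "J' \<subseteq> J"
 show "res EP J J' \<in> zhom D (sec EP J) (sec EP J')" unfolding eps_simps
  by (intro eps_hom_zhom presheafD(1)[OF N] res_zhom sh_opens J sh_mono)
qed

lemma eps_tf: "torsion_free_presheaf D EP"
 unfolding torsion_free_presheaf_def eps_simps using tf_zmod.EM_torsion_free[OF sec_tf[OF sh_opens]] by blast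

text \<open>In the normal form the two entries can be lifted separately, by flabbiness of
  \<open>N\<close>.\<close>

lemma eps_flabby: "flabby D EP"
 unfolding flabby_def
proof (intro ballI impI)
 fix J J' assume J: "J \<in> ops" "J' \<in> ops" "J' \<subseteq> J"
 have S: "sh J \<in> ops" "sh J' \<in> ops" "sh J' \<subseteq> sh J" using sh_opens J sh_mono by auto
 note zm = presheafD(1)[OF N S(1)] presheafD(1)[OF N S(2)] res_zhom[OF S]
 interpret M: zmod D s "sec N (sh J)" by (rule sec_zm[OF S(1)])
 interpret M': zmod D s "sec N (sh J')" by (rule sec_zm[OF S(2)])
 interpret f: add_map "eps_module D s (sec N (sh J))" "eps_module D s (sec N (sh J'))" "res EP J J'"
  unfolding eps_simps by (rule eps_hom_add_map[OF zm])
 show "res EP J J' ` car EP J = car EP J'" unfolding eps_simps(1)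
 proof
  show "res EP J J' ` carrier M.EM \<subseteq> carrier M'.EM" using f.closed by auto
  show "carrier M'.EM \<subseteq> res EP J J' ` carrier M.EM"
  proof
   fix e assume "e \<in> carrier M'.EM"
   then obtain m m' where m: "m \<in> car N (sh J')" "m' \<in> car N (sh J')"
    "e = M'.E.te 1\<^sub>Z m \<oplus>\<^bsub>M'.EM\<^esub> M'.E.te cc m'" using M'.EM_normal by blast
   obtain n where n: "n \<in> car N (sh J)" "res N (sh J) (sh J') n = m" by (rule res_surj[OF S m(1)])
   obtain n' where n': "n' \<in> car N (sh J)" "res N (sh J) (sh J') n' = m'" by (rule res_surj[OF S m(2)])
   have te: "res EP J J' (M.E.te z k) = M'.E.te z (res N (sh J) (sh J') k)" if "z \<in> Z" "k \<in> car N (sh J)" for z k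
    unfolding eps_simps by (rule eps_hom_te[OF zm that])
   have "e = res EP J J' (M.E.te 1\<^sub>Z n \<oplus>\<^bsub>M.EM\<^esub> M.E.te cc n')"
    using n n' m(3) te by (simp add: f.add)
   moreover have "M.E.te 1\<^sub>Z n \<oplus>\<^bsub>M.EM\<^esub> M.E.te cc n' \<in> carrier M.EM" using n n' by simp
   ultimately show "e \<in> res EP J J' ` carrier M.EM" by blast
  qed
 qed
qed

lemma eps_tfp: "tfp D s EP"
 by (intro tfp.intro T_base_axioms tfp_axioms.intro eps_presheaf eps_tf eps_flabby)

end

locale tfp_eps = tfp D s N + EP: tfp D s "fob (eps D s) N"
 for D :: "('v::euclidean_space, 'k, 't) base_data" and s and N :: "('v, 't, 'm) presheaf"
begin

abbreviation "evl J x \<equiv> zmod.ph D s (sec N (sh J)) x"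

lemma evl_closed: "J \<in> ops ==> x \<in> orbs ==> e \<in> car EP J ==> evl J x e \<in> car N (sh J)"
 unfolding eps_simps by (rule zmod.ph_closed[OF sec_zm[OF sh_opens]])

lemma evl_res:
 assumes "J \<in> ops" "J' \<in> ops" "J' \<subseteq> J" "x \<in> orbs" "e \<in> car EP J"
 shows "evl J' x (res EP J J' e) = res N (sh J) (sh J') (evl J x e)"
 using ph_eps_hom[OF presheafD(1)[OF N] presheafD(1)[OF N] res_zhom] assms sh_opens sh_mono unfolding eps_simps by simp

text \<open>By \<open>un_EM\<close>, being killed by \<open>un x\<close> means that the evaluation
  at \<open>x\<close> vanishes, and evaluations commute with restriction.\<close>

lemma eps_vanish:
 assumes J: "J \<in> ops" and e: "e \<in> car EP J"
 shows "EP.vanish J e \<longleftrightarrow> (\<forall>x\<in>orbs. res N (sh J) (sh (hl (J \<inter> x))) (evl J x e) = zer N (sh (hl (J \<inter> x))))"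
 unfolding EP.vanish_def
proof (rule ball_cong[OF refl])
 fix x assume x: "x \<in> orbs"
 let ?H = "hl (J \<inter> x)"
 have H: "?H \<in> ops" "?H \<subseteq> J" using hull_Int hull_Int_sub J by auto
 have "un x \<odot>\<^bsub>sec EP ?H\<^esub> res EP J ?H e = zer EP ?H \<longleftrightarrow> evl ?H x (res EP J ?H e) = zer N (sh ?H)"
  using tf_zmod.un_EM[OF sec_tf[OF sh_opens[OF H(1)]] x, of "res EP J ?H e"] EP.res_closed[OF J H e] unfolding eps_simps(1) .
 thus "un x \<odot>\<^bsub>sec EP ?H\<^esub> res EP J ?H e = zer EP ?H \<longleftrightarrow> res N (sh J) (sh ?H) (evl J x e) = zer N (sh ?H)"
  using evl_res[OF J H x e] by simp
qed

end

context tfp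
begin

text \<open>By the normal form a section is described by a pair of elements of \<open>'m\<close>,
  and an infinite type is equipotent to its square. Hence the universe is closed under wall
  crossing.\<close>

lemma eps_small:
 assumes inf: "infinite (UNIV :: 'm set)" and J: "J \<in> ops"
 shows "\<exists>f :: _ \<Rightarrow> 'm. inj_on f (carrier (plus_sec D EP J))"
proof -
 interpret M: zmod D s "sec N (sh J)" by (rule sec_zm[OF sh_opens[OF J]])
 define q where "q p = to_plus D EP J (M.E.te 1\<^sub>Z (fst p) \<oplus>\<^bsub>M.EM\<^esub> M.E.te cc (snd p))" for p
 have "\<exists>p. u = q p" if "u \<in> carrier (plus_sec D EP J)" for u
 proof -
  have "u \<in> to_plus D EP J ` carrier M.EM" using that by (simp add: plus_sec_def eps_simps(1))
  then obtain e where e: "e \<in> carrier M.EM" "u = to_plus D EP J e" by blast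
  then obtain m m' where "e = M.E.te 1\<^sub>Z m \<oplus>\<^bsub>M.EM\<^esub> M.E.te cc m'" using M.EM_normal by blast
  thus ?thesis using e(2) by (intro exI[of _ "(m, m')"]) (simp add: q_def)
 qed
 then obtain g where g: "\<And>u. u \<in> carrier (plus_sec D EP J) ==> u = q (g u)" by metis
 obtain h :: "'m \<times> 'm \<Rightarrow> 'm" where h: "bij_betw h (UNIV \<times> UNIV) UNIV"
  using card_of_Times_same_infinite[OF inf] card_of_ordIso by blast
 hence hi: "inj h" by (simp add: bij_betw_def)
 have "inj_on (\<lambda>u. h (g u)) (carrier (plus_sec D EP J))"
 proof (rule inj_onI)
  fix u v assume uv: "u \<in> carrier (plus_sec D EP J)" "v \<in> carrier (plus_sec D EP J)" "h (g u) = h (g v)"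
  hence "g u = g v" using hi injD by metis
  thus "u = v" using g[OF uv(1)] g[OF uv(2)] by simp
 qed
 thus ?thesis by blast
qed

lemma plus_map_to_plus:
 assumes "tfp D s N'" and f: "f \<in> presheaf_hom D N N'" and J: "J \<in> ops" and n: "n \<in> car N J"
 shows "plus_map D N N' f J (to_plus D N J n) = to_plus D N' J (f J n)"
proof -
 interpret N': tfp D s N' by (rule assms(1))
 have H: "hl (J \<inter> x) \<in> ops" "hl (J \<inter> x) \<subseteq> J" for x using hull_Int hull_Int_sub J by auto
 have "gen_map D (sec N' (hl (J \<inter> x))) (f (hl (J \<inter> x))) (to_stalk D (sec N (hl (J \<inter> x))) x (res N J (hl (J \<inter> x)) n)) =
  to_stalk D (sec N' (hl (J \<inter> x))) x (res N' J (hl (J \<inter> x)) (f J n))" if x: "x \<in> orbs" for x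
  using gen_map_stalk[OF sec_tf[OF H(1)] N'.sec_tf[OF H(1)] presheaf_homD(1)[OF f H(1)] x res_closed[OF J H n]]
   presheaf_homD(3)[OF f J H n] by simp
 thus ?thesis using J n by (simp add: plus_map_def plus_sec_def to_plus_def Let_def cong: restrict_cong)
qed

lemma eps_fmor_hom:
 assumes "tfp D s N'" and f: "f \<in> presheaf_hom D N N'"
 shows "fmor (eps D s) N N' f \<in> presheaf_hom D EP (fob (eps D s) N')"
 unfolding presheaf_hom_def
proof (intro CollectI conjI ballI impI)
 interpret N': tfp D s N' by (rule assms(1))
 note fh = presheaf_homD(1)[OF f]
 show "fmor (eps D s) N N' f \<in> extensional ops" by (simp add: eps_def)
 fix J assume J: "J \<in> ops"
 note S = sh_opens[OF J]
 show "fmor (eps D s) N N' f J \<in> zhom D (sec EP J) (sec (fob (eps D s) N') J)"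
  unfolding eps_simps(1) eps_simps(3)[OF J] by (intro eps_hom_zhom presheafD(1)[OF N] presheafD(1)[OF N'.N] S fh)
 fix J' e assume J': "J' \<in> ops" "J' \<subseteq> J" and e: "e \<in> car EP J"
 note S' = sh_opens[OF J'(1)] and sub = sh_mono[OF J'(2)]
 have e': "e \<in> carrier (eps_module D s (sec N (sh J)))" using e by (simp add: eps_simps)
 \<comment> \<open>The diagonal of the naturality square; both ways around are compared with
   it.\<close>
 define h where "h = (\<lambda>m\<in>car N (sh J). f (sh J') (res N (sh J) (sh J') m))"
 note zm = presheafD(1)[OF N S] presheafD(1)[OF N'.N S] presheafD(1)[OF N S'] presheafD(1)[OF N'.N S']
 interpret M: zmod D s "sec N (sh J)" by (rule sec_zm[OF S])
 have h: "h \<in> zhom D (sec N (sh J)) (sec N' (sh J'))"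
 proof -
  have hM: "m \<in> car N (sh J)" if "struct_grading D = Some h" "m \<in> homog (sec N (sh J)) n" for h m n
   using M.zm that grading_carrier[OF M.M.abelian_group_axioms, of "homog (sec N (sh J))"] by (auto simp: is_zmodule_def is_module_def)
  show ?thesis unfolding h_def
   using zhomD[OF res_zhom[OF S S' sub]] zhomD[OF fh[OF S']] hM by (intro zhomI) auto
 qed
 have "res (fob (eps D s) N') J J' (fmor (eps D s) N N' f J e) = eps_hom D s (sec N (sh J)) (sec N' (sh J')) h e"
  unfolding eps_simps(2) eps_simps(3)[OF J]
  by (rule eps_hom_comp[OF zm(1,2,4) fh[OF S] N'.res_zhom[OF S S' sub] h _ e'])
   (use presheaf_homD(3)[OF f S S' sub] in \<open>simp add: h_def\<close>)
 moreover have "fmor (eps D s) N N' f J' (res EP J J' e) = eps_hom D s (sec N (sh J)) (sec N' (sh J')) h e"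
  unfolding eps_simps(2) eps_simps(3)[OF J'(1)]
  by (rule eps_hom_comp[OF zm(1,3,4) res_zhom[OF S S' sub] fh[OF S'] h _ e']) (simp add: h_def)
 ultimately show "res (fob (eps D s) N') J J' (fmor (eps D s) N N' f J e) = fmor (eps D s) N N' f J' (res EP J J' e)" by simp
qed

end

lemma (in T_base) eps_functor_aux:
 assumes "tfp D s M" "tfp D s N" "tfp D s L" and f: "f \<in> presheaf_hom D M N" "g \<in> presheaf_hom D N L"
 shows "fmor (eps D s) M M (presheaf_id D M) = presheaf_id D (fob (eps D s) M)"
  "fmor (eps D s) M L (presheaf_comp D M g f) = presheaf_comp D (fob (eps D s) M) (fmor (eps D s) N L g) (fmor (eps D s) M N f)"
proof -
 interpret M: tfp D s M by (rule assms(1))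
 interpret N: tfp D s N by (rule assms(2))
 interpret L: tfp D s L by (rule assms(3))
 note id = presheaf_id_hom[OF M.N] and comp = presheaf_comp_hom[OF M.N N.N f]
 show "fmor (eps D s) M M (presheaf_id D M) = presheaf_id D (fob (eps D s) M)"
 proof (rule presheaf_hom_eqI[OF M.eps_fmor_hom[OF assms(1) id] presheaf_id_hom[OF M.eps_presheaf]])
  fix J e assume J: "J \<in> ops" and e: "e \<in> car M.EP J"
  have "presheaf_id D M (sh J) m = m" if "m \<in> car M (sh J)" for m
   using that sh_opens[OF J] by (simp add: presheaf_id_def)
  hence "fmor (eps D s) M M (presheaf_id D M) J e = e" unfolding eps_simps(3)[OF J]
   using eps_hom_id[OF presheafD(1)[OF M.N sh_opens[OF J]] presheaf_homD(1)[OF id sh_opens[OF J]]] e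
   by (simp add: eps_simps(1))
  thus "fmor (eps D s) M M (presheaf_id D M) J e = presheaf_id D (fob (eps D s) M) J e" using J e by (simp add: presheaf_id_def)
 qed
 show "fmor (eps D s) M L (presheaf_comp D M g f) = presheaf_comp D (fob (eps D s) M) (fmor (eps D s) N L g) (fmor (eps D s) M N f)"
 proof (rule presheaf_hom_eqI[OF M.eps_fmor_hom[OF assms(3) comp]
    presheaf_comp_hom[OF M.eps_presheaf N.eps_presheaf M.eps_fmor_hom[OF assms(2) f(1)] N.eps_fmor_hom[OF assms(3) f(2)]]])
  fix J e assume J: "J \<in> ops" and e: "e \<in> car M.EP J"
  note S = sh_opens[OF J]
  have "eps_hom D s (sec N (sh J)) (sec L (sh J)) (g (sh J)) (eps_hom D s (sec M (sh J)) (sec N (sh J)) (f (sh J)) e) =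
   eps_hom D s (sec M (sh J)) (sec L (sh J)) (presheaf_comp D M g f (sh J)) e"
   by (rule eps_hom_comp[OF presheafD(1)[OF M.N S] presheafD(1)[OF N.N S] presheafD(1)[OF L.N S]
      presheaf_homD(1)[OF f(1) S] presheaf_homD(1)[OF f(2) S] presheaf_homD(1)[OF comp S]])
     (use e S in \<open>simp_all add: presheaf_comp_def eps_simps\<close>)
  thus "fmor (eps D s) M L (presheaf_comp D M g f) J e =
   presheaf_comp D (fob (eps D s) M) (fmor (eps D s) N L g) (fmor (eps D s) M N f) J e"
   using J e by (simp add: presheaf_comp_def[of D M.EP] eps_simps(3))
 qed
qed

section \<open>Wall crossing applied to one object\<close>

locale wc_object = tfp_eps D s M for D :: "('v::euclidean_space, 'k, 't) base_data" and s
  and M :: "('v, 't, 'm) presheaf" +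
 assumes fin: "finitary D M" and supp: "support_condition D M" and inf: "infinite (UNIV :: 'm set)"
begin

text \<open>The support condition extends to every open set between the hull of J \<inter> x and
  \<open>J\<close>, because restriction to the hull factors through it.\<close>

lemma supp_zero:
 assumes J: "J \<in> ops" and x: "x \<in> orbs" and J': "J' \<in> ops" "J' \<subseteq> J" "J \<inter> x \<subseteq> J'"
  and n: "n \<in> car M J" and z: "un x \<odot>\<^bsub>sec M J'\<^esub> res M J J' n = zer M J'"
 shows "un x \<odot>\<^bsub>sec M J\<^esub> n = zer M J"
proof -
 let ?H = "hl (J \<inter> x)"
 have H: "?H \<in> ops" "?H \<subseteq> J'" using hull_Int[OF J] hull_least[OF J'(1,3)] by auto
 interpret add_map "sec M J'" "sec M ?H" "res M J' ?H" by (rule res_add_map[OF J'(1) H])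
 have "un x \<odot>\<^bsub>sec M ?H\<^esub> res M J ?H n = res M J' ?H (un x \<odot>\<^bsub>sec M J'\<^esub> res M J J' n)"
  using zhomD(3)[OF res_zhom[OF J'(1) H] un_Z[OF x] res_closed[OF J J'(1,2) n]] presheafD(4)[OF N J J'(1) H J'(2) n] by simp
 also have "\<dots> = zer M ?H" using z by simp
 finally show ?thesis using supp J x n unfolding support_iff by blast
qed

definition TT where "TT = (SOME \<T>. \<T> \<subseteq> alcoves D \<and> finite \<T> \<and>
 (\<forall>J\<in>ops. res M J (hl (J \<inter> \<T>)) \<in> ziso D (sec M J) (sec M (hl (J \<inter> \<T>)))))"

lemma TT: "TT \<subseteq> alcoves D" "finite TT" "J \<in> ops ==> res M J (hl (J \<inter> TT)) \<in> ziso D (sec M J) (sec M (hl (J \<inter> TT)))"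
proof -
 have "\<exists>\<T>. \<T> \<subseteq> alcoves D \<and> finite \<T> \<and> (\<forall>J\<in>ops. res M J (hl (J \<inter> \<T>)) \<in> ziso D (sec M J) (sec M (hl (J \<inter> \<T>))))"
  using fin unfolding finitary_def by (elim conjE exE) (intro exI conjI)
 from someI_ex[OF this] have *: "TT \<subseteq> alcoves D \<and> finite TT \<and> (\<forall>J\<in>ops. res M J (hl (J \<inter> TT)) \<in> ziso D (sec M J) (sec M (hl (J \<inter> TT))))"
  unfolding TT_def .
 show "TT \<subseteq> alcoves D" "finite TT" using * by simp_all
 show "J \<in> ops ==> res M J (hl (J \<inter> TT)) \<in> ziso D (sec M J) (sec M (hl (J \<inter> TT)))" using * by simp
qed

text \<open>Restriction to the hull of L \<inter> TT is injective, and over that hull the part at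
  \<open>y\<close> is detected on its intersection with \<open>y\<close>, which lies in
  \<open>L'\<close>.\<close>

lemma finitary_zero:
 assumes L: "L \<in> ops" "L' \<in> ops" "L' \<subseteq> L" and y: "y \<in> orbs" and c: "hl (L \<inter> TT) \<inter> y \<subseteq> L'"
  and n: "n \<in> car M L" and z: "res M L L' n = zer M L'"
 shows "un y \<odot>\<^bsub>sec M L\<^esub> n = zer M L"
proof -
 let ?H = "hl (L \<inter> TT)"
 let ?G = "hl (?H \<inter> y)"
 have H: "?H \<in> ops" "?H \<subseteq> L" using hull_Int[OF L(1)] hull_Int_sub[OF L(1)] by auto
 have G: "?G \<in> ops" "?G \<subseteq> ?H" "?G \<subseteq> L'" using hull_Int[OF H(1)] hull_Int_sub[OF H(1)] hull_least[OF L(2) c] by auto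
 interpret L: tf_zmod D s "sec M L" by (rule sec_tf[OF L(1)])
 interpret G: zmod D s "sec M ?G" by (rule sec_zm[OF G(1)])
 interpret r: add_map "sec M L" "sec M ?H" "res M L ?H" by (rule res_add_map[OF L(1) H])
 interpret r': add_map "sec M L'" "sec M ?G" "res M L' ?G" by (rule res_add_map[OF L(2) G(1,3)])
 have rn: "res M L ?H n \<in> car M ?H" by (rule res_closed[OF L(1) H n])
 have "res M ?H ?G (res M L ?H n) = res M L' ?G (res M L L' n)"
  using presheafD(4)[OF N L(1) H(1) G(1,2) H(2) n] presheafD(4)[OF N L(1,2) G(1,3) L(3) n] by simp
 hence "un y \<odot>\<^bsub>sec M ?G\<^esub> res M ?H ?G (res M L ?H n) = zer M ?G" using z y by (simp add: G.M.smult_r_null)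
 hence "un y \<odot>\<^bsub>sec M ?H\<^esub> res M L ?H n = zer M ?H"
  by (intro supp_zero[OF H(1) y G(1,2) _ rn]) (use hull_superset in auto)
 hence "res M L ?H (un y \<odot>\<^bsub>sec M L\<^esub> n) = res M L ?H (zer M L)"
  using zhomD(3)[OF res_zhom[OF L(1) H] un_Z[OF y] n] by simp
 moreover have "inj_on (res M L ?H) (car M L)"
  using TT(3)[OF L(1)] by (simp add: ziso_def module_iso_def bij_betw_def)
 ultimately show ?thesis using inj_onD[of "res M L ?H" "car M L" "un y \<odot>\<^bsub>sec M L\<^esub> n" "(zer M L)"] y n by simp
qed

abbreviation "TH \<equiv> (fob (theta D s) M :: ('v, 't, 'm) presheaf)"

definition pr :: "'v set set \<Rightarrow> _ \<Rightarrow> 'm" where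
 "pr J e = copy_fun (plus_sec D EP J) (to_plus D EP J e)"

lemma TH_eq: "TH = copy_presheaf (plus_presheaf D EP)" by (simp add: theta_def)

sublocale PQ: plus_quotient D s EP TH pr
 unfolding TH_eq pr_def[abs_def] by (rule EP.copy_plus_quotient) (rule eps_small[OF inf])

lemma rho_eq: "J \<in> ops ==> e \<in> car EP J ==> rho D s M J e = (pr J e :: 'm)"
 by (simp add: rho_def pr_def plus_unit_def)

lemma TH_empty: "car TH {} = {(zer TH {})}"
proof -
 interpret M: zmod D s "sec M {}" by (rule sec_zm[OF empty_opens])
 have M0: "car M {} = {(zer M {})}" using fin by (simp add: finitary_def)
 have "e = \<zero>\<^bsub>M.EM\<^esub>" if e: "e \<in> carrier M.EM" for e
 proof -
  obtain m m' where m: "m \<in> car M {}" "m' \<in> car M {}" "e = M.E.te 1\<^sub>Z m \<oplus>\<^bsub>M.EM\<^esub> M.E.te cc m'"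
   using M.EM_normal[OF e] by blast
  thus ?thesis using M0 M.E.te_zero(2)[of "1\<^sub>Z"] M.E.te_zero(2)[of cc] by (simp add: M.EM_simps(2,3))
 qed
 hence E0: "e = zer EP {}" if "e \<in> car EP {}" for e using that by (simp add: eps_simps sh_empty)
 show ?thesis
 proof (intro equalityI subsetI)
  fix c assume "c \<in> car TH {}"
  then obtain e where "e \<in> car EP {}" "c = pr {} e" by (rule PQ.pr_surj[OF empty_opens])
  hence "c = zer TH {}" using E0 PQ.prD(5)[OF empty_opens] by metis
  thus "c \<in> {(zer TH {})}" by simp
 next
  interpret C: zmod D s "sec TH {}" by (rule PQ.C.sec_zm[OF empty_opens])
  fix c assume "c \<in> {(zer TH {})}"
  thus "c \<in> car TH {}" by simp
 qed
qed

text \<open>An evaluation at \<open>x\<close> has parts at \<open>x\<close> and at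
  \<open>ro x\<close>; for each of them \<open>finitary_cover\<close> supplies the inclusion that
  \<open>finitary_zero\<close> asks for.\<close>

lemma eps_vanish_cover:
 assumes J: "J \<in> ops" and e: "e \<in> car EP J"
  and v: "EP.vanish (hl (J \<inter> (TT \<union> ra ` TT))) (res EP J (hl (J \<inter> (TT \<union> ra ` TT))) e)"
 shows "EP.vanish J e"
proof -
 let ?J' = "hl (J \<inter> (TT \<union> ra ` TT))"
 have J': "?J' \<in> ops" "?J' \<subseteq> J" using hull_Int hull_Int_sub J by auto
 have re: "res EP J ?J' e \<in> car EP ?J'" by (rule EP.res_closed[OF J J' e])
 show ?thesis unfolding eps_vanish[OF J e]
 proof
  fix x assume x: "x \<in> orbs"
  let ?H = "hl (J \<inter> x)" and ?H' = "hl (?J' \<inter> x)"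
  have H: "?H \<in> ops" "?H \<subseteq> J" using hull_Int hull_Int_sub J by auto
  have H': "?H' \<in> ops" "?H' \<subseteq> ?J'" "?H' \<subseteq> ?H"
   using hull_Int hull_Int_sub J'(1) hull_least[OF H(1), of "?J' \<inter> x"] hull_superset[of "J \<inter> x"] J'(2) by blast+
  note S = sh_opens[OF J] sh_opens[OF J'(1)] sh_opens[OF H(1)] sh_opens[OF H'(1)]
  have s1: "sh ?H \<subseteq> sh J" "sh ?H' \<subseteq> sh ?H" "sh ?H' \<subseteq> sh ?J'" "sh ?J' \<subseteq> sh J" using H H' J' sh_mono by auto
  note ee = evl_closed[OF J x e]
  have rH: "res EP J ?H e \<in> car EP ?H" by (rule EP.res_closed[OF J H e])
  let ?k = "evl ?H x (res EP J ?H e)"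
  have k: "?k = res M (sh J) (sh ?H) (evl J x e)" by (rule evl_res[OF J H x e])
  have kc: "?k \<in> car M (sh ?H)" by (rule evl_closed[OF H(1) x rH])
  have "res M (sh ?J') (sh ?H') (evl ?J' x (res EP J ?J' e)) = zer M (sh ?H')"
   using v x unfolding eps_vanish[OF J'(1) re] by blast
  hence "res M (sh ?H) (sh ?H') ?k = zer M (sh ?H')"
   unfolding k evl_res[OF J J' x e]
   using presheafD(4)[OF N S(1,2,4) s1(3,4) ee] presheafD(4)[OF N S(1,3,4) s1(2,1) ee] by simp
  note z = finitary_zero[OF S(3,4) s1(2) _ _ kc this]
  interpret Hm: tf_zmod D s "sec M (sh ?H)" by (rule sec_tf[OF S(3)])
  have "?k = zer M (sh ?H)"
  proof (rule Hm.ph_zeroI[OF x])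
   show "res EP J ?H e \<in> carrier Hm.EM" using rH by (simp add: eps_simps(1))
   show "un x \<odot>\<^bsub>sec M (sh ?H)\<^esub> ?k = zer M (sh ?H)" by (rule z[OF x finitary_cover(1)[OF J x TT(1)]])
   show "un (ro x) \<odot>\<^bsub>sec M (sh ?H)\<^esub> ?k = zer M (sh ?H)" by (rule z[OF ro_orbits[OF x] finitary_cover(2)[OF J x TT(1)]])
  qed
  thus "res M (sh J) (sh ?H) (evl J x e) = zer M (sh ?H)" by (simp only: k)
 qed
qed

text \<open>Surjectivity of the restrictions is flabbiness; injectivity is the covering argument,
  for which the finite set of \<open>M\<close> is enlarged by the neighbours of its alcoves.\<close>

lemma TH_finitary: "finitary D TH"
 unfolding finitary_def
proof (intro conjI TH_empty exI[of _ "TT \<union> ra ` TT"] ballI)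
 show "TT \<union> ra ` TT \<subseteq> alcoves D" using TT(1) ra_alcove by blast
 show "finite (TT \<union> ra ` TT)" using TT(2) by simp
 fix J assume J: "J \<in> ops"
 let ?J' = "hl (J \<inter> (TT \<union> ra ` TT))"
 have J': "?J' \<in> ops" "?J' \<subseteq> J" using hull_Int hull_Int_sub J by auto
 interpret r: add_map "sec TH J" "sec TH ?J'" "res TH J ?J'" by (rule PQ.C.res_add_map[OF J J'])
 have "inj_on (res TH J ?J') (car TH J)"
 proof (rule r.inj_onI)
  fix c assume c: "c \<in> car TH J" "res TH J ?J' c = zer TH ?J'"
  obtain e where e: "e \<in> car EP J" "c = pr J e" by (rule PQ.pr_surj[OF J c(1)])
  have "EP.vanish ?J' (res EP J ?J' e)"
   using c(2) PQ.res_pr[OF J J' e(1)] PQ.kern[OF J'(1) EP.res_closed[OF J J' e(1)]] e(2) by simp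
  thus "c = zer TH J" using eps_vanish_cover[OF J e(1)] PQ.kern[OF J e(1)] e(2) by simp
 qed
 moreover have "res TH J ?J' ` car TH J = car TH ?J'" using PQ.C_flabby J J' unfolding flabby_def by blast
 ultimately show "res TH J ?J' \<in> ziso D (sec TH J) (sec TH ?J')"
  using PQ.C_zhom[OF J J'] unfolding ziso_def module_iso_def zhom_def bij_betw_def by simp
qed

lemma TH_P_T: "TH \<in> P_T D"
 unfolding P_T_def using PQ.C_presheaf PQ.C_flabby TH_finitary PQ.C_torsion_free PQ.C_support by simp

lemma rho_hom: "rho D s M \<in> presheaf_hom D EP TH"
 unfolding presheaf_hom_def
proof (intro CollectI conjI ballI impI)
 show "rho D s M \<in> extensional ops" by (simp add: rho_def)
 fix J assume J: "J \<in> ops"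
 interpret E: zmod D s "sec EP J" by (rule EP.sec_zm[OF J])
 have hM: "e \<in> car EP J" if "struct_grading D = Some h" "e \<in> homog (sec EP J) n" for h e n
  using E.zm that grading_carrier[OF E.M.abelian_group_axioms, of "homog (sec EP J)"] by (auto simp: is_zmodule_def is_module_def)
 show "rho D s M J \<in> zhom D (sec EP J) (sec TH J)"
 proof (rule zhomI)
  show "rho D s M J \<in> extensional (car EP J)" using J by (simp add: rho_def)
  fix e assume e: "e \<in> car EP J"
  show "rho D s M J e \<in> car TH J" using PQ.prD(1)[OF J e] by (simp add: rho_eq J e)
  { fix z assume "z \<in> Z" thus "rho D s M J (z \<odot>\<^bsub>sec EP J\<^esub> e) = z \<odot>\<^bsub>sec TH J\<^esub> rho D s M J e"
    using PQ.prD(3)[OF J _ e] by (simp add: rho_eq J e) }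
  fix e' assume e': "e' \<in> car EP J"
  show "rho D s M J (e \<oplus>\<^bsub>sec EP J\<^esub> e') = rho D s M J e \<oplus>\<^bsub>sec TH J\<^esub> rho D s M J e'"
   using PQ.prD(2)[OF J e e'] by (simp add: rho_eq J e e')
 next
  fix h e n assume h: "struct_grading D = Some h" and "e \<in> homog (sec EP J) n"
  thus "rho D s M J e \<in> homog (sec TH J) n" using hM PQ.prD(4)[OF J h] by (simp add: rho_eq J)
 qed
 fix J' e assume J': "J' \<in> ops" "J' \<subseteq> J" and e: "e \<in> car EP J"
 show "res TH J J' (rho D s M J e) = rho D s M J' (res EP J J' e)"
  using PQ.res_pr[OF J J' e] EP.res_closed[OF J J' e] by (simp add: rho_eq J J' e)
qed

lemma rho_iso:
 assumes J: "J \<in> ops" and inv: "ra ` J = J" shows "rho D s M J \<in> ziso D (sec EP J) (sec TH J)"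
proof -
 have rz: "rho D s M J \<in> zhom D (sec EP J) (sec TH J)" by (rule presheaf_homD(1)[OF rho_hom J])
 interpret r: add_map "sec EP J" "sec TH J" "rho D s M J"
  by (rule zhom_add_map[OF presheafD(1)[OF eps_presheaf J] PQ.C_zm[OF J] rz])
 have shJ: "sh J = J" by (rule sh_invariant[OF inv])
 interpret Jm: tf_zmod D s "sec M (sh J)" by (rule sec_tf[OF sh_opens[OF J]])
 have "inj_on (rho D s M J) (car EP J)"
 proof (rule r.inj_onI)
  fix e assume e: "e \<in> car EP J" and "rho D s M J e = zer TH J"
  hence v: "EP.vanish J e" using PQ.kern[OF J e] by (simp add: rho_eq J)
  have eE: "e \<in> carrier Jm.EM" using e by (simp add: eps_simps(1))
  have "e = \<zero>\<^bsub>Jm.EM\<^esub>"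
  proof (rule Jm.ph_inj[OF eE])
   fix x assume x: "x \<in> orbs"
   let ?K = "sh (hl (J \<inter> x))"
   have H: "hl (J \<inter> x) \<in> ops" "hl (J \<inter> x) \<subseteq> J" using hull_Int hull_Int_sub J by auto
   have K: "?K \<in> ops" "?K \<subseteq> sh J" using sh_opens[OF H(1)] sh_mono[OF H(2)] by auto
   interpret Km: zmod D s "sec M ?K" by (rule sec_zm[OF K(1)])
   have z: "res M (sh J) ?K (evl J x e) = zer M ?K" using v x unfolding eps_vanish[OF J e] by blast
   have c: "sh J \<inter> x \<subseteq> ?K" using hull_superset[of "J \<inter> x"] sh_superset[of "hl (J \<inter> x)"] unfolding shJ by blast
   \<comment> \<open>For \<open>ro x\<close> the covering comes from the invariance of
     \<open>J\<close>: the neighbour of \<open>B\<close> lies in J \<inter> x.\<close>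
   have c': "sh J \<inter> ro x \<subseteq> ?K"
   proof
    fix B assume B: "B \<in> sh J \<inter> ro x"
    hence BJ: "B \<in> J" unfolding shJ by blast
    have Ba: "B \<in> alcoves D" using opens_alcoves J BJ by blast
    have "ra B \<in> ra ` J" by (rule imageI[OF BJ])
    hence "ra B \<in> J" unfolding inv .
    moreover have "ra B \<in> x" using ra_in_ro[of B "ro x"] B ro_ro[OF x] by simp
    ultimately have "ra B \<in> J \<inter> x" by (rule IntI)
    hence "ra B \<in> hl (J \<inter> x)" by (rule subsetD[OF hull_superset])
    hence "ra (ra B) \<in> ?K" unfolding sharp_def by (intro UnI2 imageI)
    thus "B \<in> ?K" using ra_ra[OF Ba] by simp
   qed
   have *: "un y \<odot>\<^bsub>sec M (sh J)\<^esub> evl J x e = zer M (sh J)" if "y \<in> orbs" "sh J \<inter> y \<subseteq> ?K" for y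
    by (rule supp_zero[OF sh_opens[OF J] that(1) K that(2) evl_closed[OF J x e]])
     (use z that(1) in \<open>simp add: Km.M.smult_r_null\<close>)
   show "evl J x e = zer M (sh J)"
    by (rule Jm.ph_zeroI[OF x eE *[OF x c] *[OF ro_orbits[OF x] c']])
  qed
  thus "e = zer EP J" by (simp add: eps_simps(1))
 qed
 moreover have "rho D s M J ` car EP J = car TH J"
 proof
  show "rho D s M J ` car EP J \<subseteq> car TH J" using r.closed by blast
  show "car TH J \<subseteq> rho D s M J ` car EP J"
  proof
   fix c assume "c \<in> car TH J"
   then obtain e where "e \<in> car EP J" "c = pr J e" by (rule PQ.pr_surj[OF J])
   thus "c \<in> rho D s M J ` car EP J" using rho_eq[OF J] by (metis imageI)
  qed
 qed
 ultimately show ?thesis using rz unfolding ziso_def module_iso_def zhom_def bij_betw_def by simp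
qed

lemma theta_fmor:
 assumes "wc_object D s M'" and f: "f \<in> presheaf_hom D M M'"
 shows "fmor (theta D s) M M' f \<in> presheaf_hom D TH (fob (theta D s) M')"
  "J \<in> ops ==> e \<in> car EP J ==>
    fmor (theta D s) M M' f J (pr J e) = (wc_object.pr D s M' J (fmor (eps D s) M M' f J e) :: 'm)"
proof -
 interpret M': wc_object D s M' by (rule assms(1))
 note fe = eps_fmor_hom[OF M'.tfp_axioms f]
 have carr: "car TH J = copy_fun (plus_sec D EP J) ` carrier (plus_sec D EP J)" for J
  by (simp add: TH_eq copy_presheaf_def copy_module_def plus_presheaf_def)
 have *: "fmor (theta D s) M M' f J (pr J e) = M'.pr J (fmor (eps D s) M M' f J e)"
  if J: "J \<in> ops" and e: "e \<in> car EP J" for J e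
 proof -
  have tp: "to_plus D EP J e \<in> carrier (plus_sec D EP J)" using e by (simp add: plus_sec_def)
  have "inj_on (copy_fun (plus_sec D EP J) :: _ \<Rightarrow> 'm) (carrier (plus_sec D EP J))"
   using someI_ex[OF eps_small[OF inf J]] unfolding copy_fun_def inj_on_def by simp
  hence "copy_inv (plus_sec D EP J) (pr J e) = to_plus D EP J e"
   unfolding pr_def copy_inv_def by (rule inv_into_f_f) (rule tp)
  moreover have "pr J e \<in> copy_fun (plus_sec D EP J) ` carrier (plus_sec D EP J)" unfolding pr_def using tp by blast
  ultimately show ?thesis using J EP.plus_map_to_plus[OF M'.EP.tfp_axioms fe J e]
   by (simp add: theta_def copy_hom_def M'.pr_def)
 qed
 thus "J \<in> ops ==> e \<in> car EP J ==> fmor (theta D s) M M' f J (pr J e) = M'.pr J (fmor (eps D s) M M' f J e)" .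
 show "fmor (theta D s) M M' f \<in> presheaf_hom D TH (fob (theta D s) M')"
 proof (rule PQ.induced_hom[OF M'.PQ.plus_quotient_axioms fe])
  show "fmor (theta D s) M M' f \<in> extensional ops" by (simp add: theta_def)
  fix J assume J: "J \<in> ops"
  show "fmor (theta D s) M M' f J \<in> extensional (car TH J)"
   unfolding carr using J by (simp add: theta_def copy_hom_def)
  fix e assume "e \<in> car EP J"
  thus "fmor (theta D s) M M' f J (pr J e) = M'.pr J (fmor (eps D s) M M' f J e)" by (rule *[OF J])
 qed
qed

end

section \<open>Uniqueness\<close>

lemma (in tfp) eps_sh:
 assumes J: "J \<in> ops"
 shows "sec EP (sh J) = sec EP J" "e \<in> car EP J ==> res EP (sh J) J e = e"
proof -
 show "sec EP (sh J) = sec EP J" by (simp only: eps_simps sh_sh[OF J])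
 assume e: "e \<in> car EP J"
 show "res EP (sh J) J e = e" unfolding eps_simps sh_sh[OF J]
  by (rule eps_hom_id[OF presheafD(1)[OF N sh_opens[OF J]] res_zhom])
   (use e presheafD(3)[OF N sh_opens[OF J]] sh_opens[OF J] in \<open>simp_all add: eps_simps(1)\<close>)
qed

lemma (in T_base) is_functor_mono: "is_functor D Q1 F ==> Q1 \<subseteq> Q2 ==> is_functor D Q2 F"
 unfolding is_functor_def by blast

lemma (in T_base) P_T_presheaves: "P_T D \<subseteq> presheaves D"
 unfolding P_T_def by blast

lemma (in T_base) P_T_tfp: "M \<in> P_T D ==> tfp D s M"
 by (intro tfp.intro T_base_axioms tfp_axioms.intro) (simp_all add: P_T_def)

lemma (in T_base) P_T_wc_object:
 fixes M :: "('v, 't, 'm) presheaf"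
 assumes inf: "infinite (UNIV :: 'm set)" and M: "M \<in> P_T D" shows "wc_object D s M"
 by (intro wc_object.intro tfp_eps.intro wc_object_axioms.intro P_T_tfp[OF M] tfp.eps_tfp[OF P_T_tfp[OF M]] inf)
  (use M in \<open>simp_all add: P_T_def\<close>)

lemma (in T_base) eps_functor: "is_functor D (presheaves D) (eps D s)"
 unfolding is_functor_def
 using tfp.eps_presheaf[OF P_T_tfp] tfp.eps_fmor_hom[OF P_T_tfp P_T_tfp] eps_functor_aux[OF P_T_tfp P_T_tfp P_T_tfp]
  presheaf_id_hom P_T_presheaves
 by (intro conjI ballI) blast+

text \<open>The parameter \<open>U\<close> names the universe \<open>'m\<close>, so that the locale
  can be interpreted at the type of modules under consideration.\<close>

locale theta_functor = T_base D s for D :: "('v::euclidean_space, 'k, 't) base_data" and s +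
 fixes U :: "'m itself"
 assumes inf: "infinite (UNIV :: 'm set)"
begin

abbreviation "TF \<equiv> (theta D s :: ('v, 't, 'm, 'm) presheaf_functor)"
abbreviation "EF \<equiv> (eps D s :: ('v, 't, 'm, ('v, 't, 'm) eps_elt) presheaf_functor)"
abbreviation "PO \<equiv> (P_T D :: ('v, 't, 'm) presheaf set)"
abbreviation "pr \<equiv> (wc_object.pr D s :: ('v, 't, 'm) presheaf \<Rightarrow> _)"

lemma wc: "M \<in> PO ==> wc_object D s M"
 by (rule P_T_wc_object[OF inf])

lemma theta_is_functor: "is_functor D PO TF"
 unfolding is_functor_def
proof (intro conjI ballI)
 fix M assume M: "M \<in> PO"
 interpret M: wc_object D s M by (rule wc[OF M])
 note id = presheaf_id_hom[OF M.N]
 show "fob TF M \<in> PO" by (rule M.TH_P_T)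
 show "fmor TF M M (presheaf_id D M) = presheaf_id D (fob TF M)"
 proof (rule presheaf_hom_eqI[OF M.theta_fmor(1)[OF M.wc_object_axioms id] presheaf_id_hom[OF M.PQ.C_presheaf]])
  fix J c assume J: "J \<in> ops" and c: "c \<in> car M.TH J"
  obtain e where e: "e \<in> car M.EP J" "c = M.pr J e" by (rule M.PQ.pr_surj[OF J c])
  have "fmor (eps D s) M M (presheaf_id D M) J e = e"
   using eps_functor_aux(1)[OF M.tfp_axioms M.tfp_axioms M.tfp_axioms id id] J e(1) by (simp add: presheaf_id_def)
  thus "fmor TF M M (presheaf_id D M) J c = presheaf_id D M.TH J c"
   using M.theta_fmor(2)[OF M.wc_object_axioms id J e(1)] e J c by (simp add: presheaf_id_def)
 qed
 fix N assume N: "N \<in> PO"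
 interpret N: wc_object D s N by (rule wc[OF N])
 fix f assume f: "f \<in> presheaf_hom D M N"
 show "fmor TF M N f \<in> presheaf_hom D (fob TF M) (fob TF N)" by (rule M.theta_fmor(1)[OF N.wc_object_axioms f])
next
 fix M N L f g assume M: "M \<in> PO" and N: "N \<in> PO" and L: "L \<in> PO"
  and f: "f \<in> presheaf_hom D M N" and g: "g \<in> presheaf_hom D N L"
 interpret M: wc_object D s M by (rule wc[OF M])
 interpret N: wc_object D s N by (rule wc[OF N])
 interpret L: wc_object D s L by (rule wc[OF L])
 note comp = presheaf_comp_hom[OF M.N N.N f g]
 note tf = M.theta_fmor[OF N.wc_object_axioms f] and tg = N.theta_fmor[OF L.wc_object_axioms g]
  and tc = M.theta_fmor[OF L.wc_object_axioms comp]
 show "fmor TF M L (presheaf_comp D M g f) = presheaf_comp D (fob TF M) (fmor TF N L g) (fmor TF M N f)"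
 proof (rule presheaf_hom_eqI[OF tc(1) presheaf_comp_hom[OF M.PQ.C_presheaf N.PQ.C_presheaf tf(1) tg(1)]])
  fix J c assume J: "J \<in> ops" and c: "c \<in> car M.TH J"
  obtain e where e: "e \<in> car M.EP J" "c = M.pr J e" by (rule M.PQ.pr_surj[OF J c])
  have fe: "fmor (eps D s) M N f J e \<in> car N.EP J"
   by (rule zhomD(1)[OF presheaf_homD(1)[OF M.eps_fmor_hom[OF N.tfp_axioms f] J] e(1)])
  have "fmor (eps D s) M L (presheaf_comp D M g f) J e = fmor (eps D s) N L g J (fmor (eps D s) M N f J e)"
   using eps_functor_aux(2)[OF M.tfp_axioms N.tfp_axioms L.tfp_axioms f g] J e(1) by (simp add: presheaf_comp_def)
  thus "fmor TF M L (presheaf_comp D M g f) J c = presheaf_comp D M.TH (fmor TF N L g) (fmor TF M N f) J c"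
   using tf(2)[OF J e(1)] tg(2)[OF J fe] tc(2)[OF J e(1)] e c J by (simp add: presheaf_comp_def)
 qed
qed

lemma rho_natural: "natural_transformation D EF TF (rho D s)"
 unfolding natural_transformation_def
proof (intro conjI ballI eps_functor is_functor_mono[OF theta_is_functor P_T_presheaves])
 fix M assume M: "M \<in> PO"
 interpret M: wc_object D s M by (rule wc[OF M])
 show "rho D s M \<in> presheaf_hom D M.EP M.TH" by (rule M.rho_hom)
 fix N f assume N: "N \<in> PO" and f: "f \<in> presheaf_hom D M N"
 interpret N: wc_object D s N by (rule wc[OF N])
 note tf = M.theta_fmor[OF N.wc_object_axioms f] and fe = M.eps_fmor_hom[OF N.tfp_axioms f]
 show "presheaf_comp D M.EP (fmor TF M N f) (rho D s M) = presheaf_comp D M.EP (rho D s N) (fmor EF M N f)"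
 proof (rule presheaf_hom_eqI[OF presheaf_comp_hom[OF M.eps_presheaf M.PQ.C_presheaf M.rho_hom tf(1)]
    presheaf_comp_hom[OF M.eps_presheaf N.eps_presheaf fe N.rho_hom]])
  fix J e assume J: "J \<in> ops" and e: "e \<in> car M.EP J"
  have "fmor (eps D s) M N f J e \<in> car N.EP J" by (rule zhomD(1)[OF presheaf_homD(1)[OF fe J] e])
  thus "presheaf_comp D M.EP (fmor TF M N f) (rho D s M) J e = presheaf_comp D M.EP (rho D s N) (fmor EF M N f) J e"
   using J e tf(2)[OF J e] by (simp add: presheaf_comp_def M.rho_eq N.rho_eq)
 qed
qed

lemma rho_iso_on_invariants: "iso_on_invariants D s TF (rho D s)"
 unfolding iso_on_invariants_def using wc_object.rho_iso[OF wc] by blast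

end

section \<open>A competing functor\<close>

locale theta_unique = theta_functor D s U for D :: "('v::euclidean_space, 'k, 't) base_data" and s and U :: "'m itself" +
 fixes F :: "('v, 't, 'm, 'm) presheaf_functor" and \<rho> :: "('v, 't, 'm, ('v, 't, 'm) eps_elt, 'm) transformation"
 assumes F: "is_functor D (P_T D) F" and \<rho>: "natural_transformation D (eps D s) F \<rho>" and iso: "iso_on_invariants D s F \<rho>"
begin

lemma F_PO: "M \<in> PO ==> fob F M \<in> PO"
 using F unfolding is_functor_def by simp

lemma \<rho>_hom: "M \<in> PO ==> \<rho> M \<in> presheaf_hom D (fob EF M) (fob F M)"
 using \<rho> unfolding natural_transformation_def by simp

lemma \<rho>_bij: "M \<in> PO ==> J \<in> ops ==> bij_betw (\<rho> M (sh J)) (car (fob EF M) (sh J)) (car (fob F M) (sh J))"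
 using iso ra_sh[of J] sh_opens[of J] unfolding iso_on_invariants_def ziso_def module_iso_def by simp

text \<open>Once the values of a competing functor are recognized as quotients of the same presheaf
  with the same kernel, they must agree with \<open>theta\<close>. The kernel is computed from the
  support condition that the competing values satisfy as objects of the category.\<close>

lemma F_quotient: assumes M: "M \<in> PO" shows "plus_quotient D s (fob EF M) (fob F M) (\<rho> M)"
proof -
 interpret M: wc_object D s M by (rule wc[OF M])
 interpret FM: wc_object D s "fob F M" by (rule wc[OF F_PO[OF M]])
 let ?r = "\<rho> M"
 note rz = presheaf_homD(1)[OF \<rho>_hom[OF M]] and rr = presheaf_homD(3)[OF \<rho>_hom[OF M]]
 have add: "add_map (sec M.EP J) (sec (fob F M) J) (?r J)" if J: "J \<in> ops" for J
  by (rule zhom_add_map[OF presheafD(1)[OF M.eps_presheaf J] presheafD(1)[OF FM.N J] rz[OF J]])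
 have surj: "?r J ` car M.EP J = car (fob F M) J" if J: "J \<in> ops" for J
 proof
  show "?r J ` car M.EP J \<subseteq> car (fob F M) J" using zhomD(1)[OF rz[OF J]] by blast
  show "car (fob F M) J \<subseteq> ?r J ` car M.EP J"
  proof
   fix c assume c: "c \<in> car (fob F M) J"
   note S = sh_opens[OF J] sh_superset[of J]
   obtain b where b: "b \<in> car (fob F M) (sh J)" "res (fob F M) (sh J) J b = c"
    by (rule FM.res_surj[OF S(1) J S(2) c])
   have "b \<in> ?r (sh J) ` car M.EP (sh J)" using \<rho>_bij[OF M J] b(1) unfolding bij_betw_def by simp
   then obtain e where e: "e \<in> car M.EP (sh J)" "b = ?r (sh J) e" by blast
   have e': "e \<in> car M.EP J" using e(1) unfolding M.eps_sh(1)[OF J] .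
   have "c = ?r J e" using rr[OF S(1) J S(2) e(1)] b(2) e(2) M.eps_sh(2)[OF J e'] by simp
   thus "c \<in> ?r J ` car M.EP J" using e' by blast
  qed
 qed
 show ?thesis
 proof (intro plus_quotient.intro plus_quotient_axioms.intro M.EP.tfp_axioms)
  fix J assume J: "J \<in> ops"
  interpret r: add_map "sec M.EP J" "sec (fob F M) J" "?r J" by (rule add[OF J])
  interpret EJ: zmod D s "sec M.EP J" by (rule M.EP.sec_zm[OF J])
  interpret FJ: tf_zmod D s "sec (fob F M) J" by (rule FM.sec_tf[OF J])
  \<comment> \<open>Degree 0 gives one inclusion; surjectivity and \<open>homog_lift\<close> show
    that the grading is no larger than the image.\<close>
  have homog_eq: "homog (sec (fob F M) J) n = ?r J ` homog (sec M.EP J) n" if "struct_grading D = Some h" for h n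
  proof -
   have gE: "grading (sec M.EP J) (homog (sec M.EP J))" using EJ.zm that by (simp add: is_zmodule_def is_module_def)
   have gF: "grading (sec (fob F M) J) (homog (sec (fob F M) J))" using FJ.zm that by (simp add: is_zmodule_def is_module_def)
   have deg: "?r J ` homog (sec M.EP J) k \<subseteq> homog (sec (fob F M) J) k" for k using zhomD(4)[OF rz[OF J] that] by blast
   have "c \<in> ?r J ` homog (sec M.EP J) n" if c: "c \<in> homog (sec (fob F M) J) n" for c
   proof -
    have "c \<in> ?r J ` car M.EP J" using surj[OF J] grading_carrier[OF r.B.abelian_group_axioms gF c] by simp
    then obtain e where e: "e \<in> car M.EP J" "c = ?r J e" by blast
    obtain b where "b \<in> homog (sec M.EP J) n" "?r J b = ?r J e"
     using r.homog_lift[OF gE gF deg e(1)] c e(2) by blast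
    thus ?thesis using e(2) by (metis imageI)
   qed
   thus ?thesis using deg by blast
  qed
  show "quotient_map (sec M.EP J) (sec (fob F M) J) (?r J)"
   unfolding quotient_map_def using surj[OF J] r.zero r.add zhomD(3)[OF rz[OF J]] homog_eq by simp
  fix e assume e: "e \<in> car M.EP J"
  show "?r J e = zer (fob F M) J \<longleftrightarrow> M.EP.vanish J e"
  proof
   assume v: "M.EP.vanish J e"
   show "?r J e = zer (fob F M) J"
   \<comment> \<open>A section is zero once every \<open>un x\<close> kills it, and by the support
     condition this can be tested over the hull of J \<inter> x.\<close>
   proof (rule FJ.un_all_zero)
    show "?r J e \<in> car (fob F M) J" using e by simp
    fix x assume x: "x \<in> orbs"
    let ?H = "hl (J \<inter> x)"
    have H: "?H \<in> ops" "?H \<subseteq> J" using hull_Int hull_Int_sub J by auto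
    interpret rH: add_map "sec M.EP ?H" "sec (fob F M) ?H" "?r ?H" by (rule add[OF H(1)])
    have "un x \<odot>\<^bsub>sec (fob F M) ?H\<^esub> res (fob F M) J ?H (?r J e) = ?r ?H (un x \<odot>\<^bsub>sec M.EP ?H\<^esub> res M.EP J ?H e)"
     using rr[OF J H e] zhomD(3)[OF rz[OF H(1)] un_Z[OF x] M.EP.res_closed[OF J H e]] by simp
    also have "\<dots> = zer (fob F M) ?H" using v x unfolding M.EP.vanish_def by simp
    finally show "un x \<odot>\<^bsub>sec (fob F M) J\<^esub> ?r J e = zer (fob F M) J"
     by (rule FM.supp_zero[OF J x H hull_superset, rotated]) (use e in simp)
   qed
  next
   assume z: "?r J e = zer (fob F M) J"
   show "M.EP.vanish J e"
    unfolding M.EP.vanish_def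
   proof
    fix x assume x: "x \<in> orbs"
    let ?H = "hl (J \<inter> x)"
    have H: "?H \<in> ops" "?H \<subseteq> J" using hull_Int hull_Int_sub J by auto
    note S = sh_opens[OF H(1)] sh_superset[of ?H]
    let ?e = "res M.EP J ?H e"
    have e1: "?e \<in> car M.EP ?H" by (rule M.EP.res_closed[OF J H e])
    have e2: "?e \<in> car M.EP (sh ?H)" using e1 unfolding M.eps_sh(1)[OF H(1)] .
    interpret rS: add_map "sec M.EP (sh ?H)" "sec (fob F M) (sh ?H)" "?r (sh ?H)" by (rule add[OF S(1)])
    interpret rF: add_map "sec (fob F M) J" "sec (fob F M) ?H" "res (fob F M) J ?H" by (rule FM.res_add_map[OF J H])
    interpret FH: zmod D s "sec (fob F M) ?H" by (rule FM.sec_zm[OF H(1)])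
    interpret ES: zmod D s "sec M.EP (sh ?H)" by (rule M.EP.sec_zm[OF S(1)])
    \<comment> \<open>The restriction of \<open>e\<close> is regarded as a section over
      \<open>sh ?H\<close>, where \<rho> is bijective. Its image vanishes over \<open>?H\<close>;
      since \<open>sh ?H\<close> contains no further alcoves of \<open>x\<close>, the support
      condition carries the vanishing at \<open>x\<close> up to \<open>sh ?H\<close>.\<close>
    have "res (fob F M) (sh ?H) ?H (?r (sh ?H) ?e) = ?r ?H ?e"
     using rr[OF S(1) H(1) S(2) e2] M.eps_sh(2)[OF H(1) e1] by simp
    also have "\<dots> = zer (fob F M) ?H" using rr[OF J H e] z by simp
    finally have "un x \<odot>\<^bsub>sec (fob F M) ?H\<^esub> res (fob F M) (sh ?H) ?H (?r (sh ?H) ?e) = zer (fob F M) ?H"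
     using x by (simp add: FH.M.smult_r_null)
    moreover have "sh ?H \<inter> x \<subseteq> ?H" unfolding sh_hull_Int[OF J x] by (rule hull_superset)
    ultimately have "un x \<odot>\<^bsub>sec (fob F M) (sh ?H)\<^esub> ?r (sh ?H) ?e = zer (fob F M) (sh ?H)"
     using FM.supp_zero[OF S(1) x H(1) S(2) _ rS.closed[OF e2]] by blast
    hence "?r (sh ?H) (un x \<odot>\<^bsub>sec M.EP (sh ?H)\<^esub> ?e) = ?r (sh ?H) (zer M.EP (sh ?H))"
     using zhomD(3)[OF rz[OF S(1)] un_Z[OF x] e2] by simp
    hence "un x \<odot>\<^bsub>sec M.EP (sh ?H)\<^esub> ?e = zer M.EP (sh ?H)"
     using inj_onD[OF bij_betw_imp_inj_on[OF \<rho>_bij[OF M H(1)]]] x e2 by simp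
    thus "un x \<odot>\<^bsub>sec M.EP ?H\<^esub> ?e = zer M.EP ?H" unfolding M.eps_sh(1)[OF H(1)] .
   qed
  qed
  fix J' assume "J' \<in> ops" "J' \<subseteq> J"
  thus "res (fob F M) J J' (?r J e) = ?r J' (res M.EP J J' e)" using rr[OF J _ _ e] by simp
 next
  fix J J' assume "J \<in> ops" "J' \<in> ops" "J' \<subseteq> J"
  thus "res (fob F M) J J' \<in> extensional (car (fob F M) J)" by (rule zhomD(5)[OF FM.res_zhom])
 qed
qed

text \<open>Sends a section to the class of any preimage under \<rho>; the choice is immaterial
  because both surjections have kernel \<open>vanish\<close>.\<close>

definition \<eta> where "\<eta> M = (\<lambda>J\<in>ops. \<lambda>c\<in>car (fob F M) J. pr M J (SOME e. e \<in> car (fob EF M) J \<and> \<rho> M J e = c))"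

lemma \<eta>_\<rho>:
 assumes M: "M \<in> PO" and J: "J \<in> ops" and e: "e \<in> car (fob EF M) J"
 shows "\<eta> M J (\<rho> M J e) = pr M J e"
proof -
 interpret M: wc_object D s M by (rule wc[OF M])
 interpret Q: plus_quotient D s M.EP "fob F M" "\<rho> M" by (rule F_quotient[OF M])
 let ?e = "SOME e'. e' \<in> car (fob EF M) J \<and> \<rho> M J e' = \<rho> M J e"
 have "?e \<in> car (fob EF M) J \<and> \<rho> M J ?e = \<rho> M J e" by (rule someI_ex) (use e in blast)
 hence "M.pr J ?e = M.pr J e"
  using Q.pr_eq_iff[OF J _ e] M.PQ.pr_eq_iff[OF J _ e] by blast
 thus ?thesis using J Q.prD(1)[OF J e] by (simp add: \<eta>_def)
qed

lemma \<eta>_hom: assumes M: "M \<in> PO" shows "\<eta> M \<in> presheaf_hom D (fob F M) (fob TF M)"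
proof -
 interpret M: wc_object D s M by (rule wc[OF M])
 interpret Q: plus_quotient D s M.EP "fob F M" "\<rho> M" by (rule F_quotient[OF M])
 show ?thesis
 proof (rule Q.induced_hom[OF M.PQ.plus_quotient_axioms presheaf_id_hom[OF M.eps_presheaf]])
  show "\<eta> M \<in> extensional ops" by (simp add: \<eta>_def)
  fix J assume J: "J \<in> ops"
  show "\<eta> M J \<in> extensional (car (fob F M) J)" using J by (simp add: \<eta>_def)
  fix e assume e: "e \<in> car M.EP J"
  show "\<eta> M J (\<rho> M J e) = M.pr J (presheaf_id D M.EP J e)" using \<eta>_\<rho>[OF M J e] J e by (simp add: presheaf_id_def)
 qed
qed

lemma \<eta>_iso: assumes M: "M \<in> PO" and J: "J \<in> ops" shows "\<eta> M J \<in> ziso D (sec (fob F M) J) (sec (fob TF M) J)"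
proof -
 interpret M: wc_object D s M by (rule wc[OF M])
 interpret Q: plus_quotient D s M.EP "fob F M" "\<rho> M" by (rule F_quotient[OF M])
 have hz: "\<eta> M J \<in> zhom D (sec (fob F M) J) (sec M.TH J)" by (rule presheaf_homD(1)[OF \<eta>_hom[OF M] J])
 interpret h: add_map "sec (fob F M) J" "sec M.TH J" "\<eta> M J" by (rule zhom_add_map[OF Q.C_zm[OF J] M.PQ.C_zm[OF J] hz])
 have "inj_on (\<eta> M J) (car (fob F M) J)"
 proof (rule h.inj_onI)
  fix c assume c: "c \<in> car (fob F M) J" "\<eta> M J c = zer M.TH J"
  obtain e where e: "e \<in> car M.EP J" "c = \<rho> M J e" by (rule Q.pr_surj[OF J c(1)])
  thus "c = zer (fob F M) J" using c(2) \<eta>_\<rho>[OF M J e(1)] M.PQ.kern[OF J e(1)] Q.kern[OF J e(1)] by simp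
 qed
 moreover have "\<eta> M J ` car (fob F M) J = car M.TH J"
 proof
  show "\<eta> M J ` car (fob F M) J \<subseteq> car M.TH J" using h.closed by blast
  show "car M.TH J \<subseteq> \<eta> M J ` car (fob F M) J"
  proof
   fix c assume "c \<in> car M.TH J"
   then obtain e where e: "e \<in> car M.EP J" "c = M.pr J e" by (rule M.PQ.pr_surj[OF J])
   have "c = \<eta> M J (\<rho> M J e)" using \<eta>_\<rho>[OF M J e(1)] e(2) by simp
   thus "c \<in> \<eta> M J ` car (fob F M) J" using Q.prD(1)[OF J e(1)] by blast
  qed
 qed
 ultimately show ?thesis using hz unfolding ziso_def module_iso_def zhom_def bij_betw_def by simp
qed

text \<open>Every section is an image under \<rho>, and on such images the square reduces to the
  naturality of \<rho> and to \<open>theta_fmor\<close>.\<close>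

lemma \<eta>_natural: "natural_transformation D F TF \<eta>"
 unfolding natural_transformation_def
proof (intro conjI ballI is_functor_mono[OF theta_is_functor P_T_presheaves] is_functor_mono[OF F P_T_presheaves] \<eta>_hom)
 fix M N f assume M: "M \<in> PO" and N: "N \<in> PO" and f: "f \<in> presheaf_hom D M N"
 interpret M: wc_object D s M by (rule wc[OF M])
 interpret N: wc_object D s N by (rule wc[OF N])
 interpret Q: plus_quotient D s M.EP "fob F M" "\<rho> M" by (rule F_quotient[OF M])
 interpret QN: plus_quotient D s N.EP "fob F N" "\<rho> N" by (rule F_quotient[OF N])
 note tf = M.theta_fmor[OF N.wc_object_axioms f] and fe = M.eps_fmor_hom[OF N.tfp_axioms f]
 have Ff: "fmor F M N f \<in> presheaf_hom D (fob F M) (fob F N)" using F M N f unfolding is_functor_def by simp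
 have nat: "presheaf_comp D M.EP (fmor F M N f) (\<rho> M) = presheaf_comp D M.EP (\<rho> N) (fmor EF M N f)"
  using \<rho> M N f unfolding natural_transformation_def by simp
 show "presheaf_comp D (fob F M) (fmor TF M N f) (\<eta> M) = presheaf_comp D (fob F M) (\<eta> N) (fmor F M N f)"
 proof (rule presheaf_hom_eqI[OF presheaf_comp_hom[OF Q.C_presheaf M.PQ.C_presheaf \<eta>_hom[OF M] tf(1)]
    presheaf_comp_hom[OF Q.C_presheaf QN.C_presheaf Ff \<eta>_hom[OF N]]])
  fix J c assume J: "J \<in> ops" and c: "c \<in> car (fob F M) J"
  obtain e where e: "e \<in> car M.EP J" "c = \<rho> M J e" by (rule Q.pr_surj[OF J c])
  have fee: "fmor EF M N f J e \<in> car N.EP J" by (rule zhomD(1)[OF presheaf_homD(1)[OF fe J] e(1)])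
  have "presheaf_comp D M.EP (fmor F M N f) (\<rho> M) J e = presheaf_comp D M.EP (\<rho> N) (fmor EF M N f) J e" by (simp only: nat)
  hence "fmor F M N f J c = \<rho> N J (fmor EF M N f J e)" using J e by (simp add: presheaf_comp_def)
  thus "presheaf_comp D (fob F M) (fmor TF M N f) (\<eta> M) J c = presheaf_comp D (fob F M) (\<eta> N) (fmor F M N f) J c"
   using J c e tf(2)[OF J e(1)] \<eta>_\<rho>[OF M J e(1)] \<eta>_\<rho>[OF N J fee] by (simp add: presheaf_comp_def)
 qed
qed

lemma F_isomorphic: "isomorphic_functors D F TF"
 unfolding isomorphic_functors_def using \<eta>_natural \<eta>_iso by blast

end

theorem theorem7p1:
  fixes D :: "('v::euclidean_space, 'k, 't) base_data" and s :: "'v \<Rightarrow> 'v"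
  assumes "root_system D" and "reduced_root_system D" and "irreducible_root_system D"
    and "positive_system D"
    and "field (ground D)" and "gkm D"
    and "universe TYPE('m) (base D)" and "base_ring TYPE('m) D"
    and "s \<in> simple_affine_refls D"
  shows "is_functor D (P_T D) (theta D s :: ('v, 't, 'm, 'm) presheaf_functor) \<and>
    natural_transformation D (eps D s) (theta D s :: ('v, 't, 'm, 'm) presheaf_functor) (rho D s) \<and>
    iso_on_invariants D s (theta D s :: ('v, 't, 'm, 'm) presheaf_functor) (rho D s) \<and>
    (\<forall>F :: ('v, 't, 'm, 'm) presheaf_functor.
       is_functor D (P_T D) F \<and>
       (\<exists>\<rho>. natural_transformation D (eps D s) F \<rho> \<and> iso_on_invariants D s F \<rho>) \<longrightarrow>
       isomorphic_functors D F (theta D s))"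
proof -
  have T: "T_base D s"
    by (intro T_base.intro ring_base.intro wall_base.intro wall_datum.intro root_datum.intro
        wall_datum_axioms.intro ring_base_axioms.intro T_base_axioms.intro)
      (use assms in \<open>simp_all add: base_ring_def\<close>)
  interpret theta_functor D s "TYPE('m)"
    by (intro theta_functor.intro T theta_functor_axioms.intro) (use assms(7) in \<open>simp add: universe_def\<close>)
  have "isomorphic_functors D F TF"
    if "is_functor D (P_T D) F" "natural_transformation D (eps D s) F \<rho>" "iso_on_invariants D s F \<rho>"
    for F :: "('v, 't, 'm, 'm) presheaf_functor" and \<rho>
  proof -
    interpret theta_unique D s "TYPE('m)" F \<rho>
      by (intro theta_unique.intro theta_functor_axioms theta_unique_axioms.intro that)
    show ?thesis by (rule F_isomorphic)
  qed
  then show ?thesis using theta_is_functor rho_natural rho_iso_on_invariants by blast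
qed

end
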